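(* Let $n\ge 1$ and let $k$ be a field whose characteristic does not divide the order of the hyperoctahedral group $\mathcal B_n$. Let $k\mathcal F$ be the face semigroup algebra of the reflection arrangement of $\mathcal B_n$ in $\mathbb R^n$ and $(k\mathcal F)^{\mathcal B_n}$ its $\mathcal B_n$-invariant subalgebra. The quiver of $(k\mathcal F)^{\mathcal B_n}$ contains one vertex $\nu_p$ for each integer partition $p$ of each of $0,1,\ldots,n$, and $m_{p,q}$ arrows from $\nu_p$ to $\nu_q$, where $$m_{p,q}=\begin{cases}2,&\text{if } q \text{ is obtained by adding } 3 \text{ distinct parts of } p,\\ 1,&\text{if } q \text{ is obtained by adding } 3 \text{ parts of } p,\ (\text{exactly})\ 2 \text{ of which are distinct},\\ 1,&\text{if } q \text{ is obtained by deleting } 2 \text{ distinct parts of } p,\\ 0,&\text{otherwise.}\end{cases}$$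
   Context: The Coxeter group $\mathcal B_n$ of type $B$ and rank $n$ is the finite group of orthogonal transformations of $\mathbb R^n$ generated by the reflections in the hyperplanes $\{v_i=0\}$, $\{v_i=v_j\}$, $\{v_i=-v_j\}$ ($i\ne j$ in $\{1,\dots,n\}$); this set of hyperplanes is its reflection arrangement $\mathcal A$. Face semigroup algebra. For each $H\in\mathcal A$ let $H^+,H^-$ be the two open half spaces determined by $H$ (labels fixed arbitrarily) and $H^0=H$. A face is a non-empty intersection $x=\bigcap_{H\in\mathcal A}H^{\sigma_H(x)}$ with $\sigma_H(x)\in\{+,0,-\}$. The set $\mathcal F$ of faces is a semigroup with identity: $xy$ is the face with $\sigma_H(xy)=\sigma_H(x)$ if $\sigma_H(x)\ne 0$ and $\sigma_H(xy)=\sigma_H(y)$ if $\sigma_H(x)=0$. $k\mathcal F$ is its semigroup algebra over $k$. The group acts on $\mathcal F$, hence by algebra automorphisms on $k\mathcal F$, and $(k\mathcal F)^{\mathcal B_n}$ is the subalgebra of elements fixed by all of $\mathcal B_n$. Integer partitions. An integer partition of $m$ is a collection (multiset) of positive integers summing to $m$ (the empty partition is the only partition of $0$). "Adding 3 parts $p_1,p_2,p_3$ of $p$" means replacing these three parts of $p$ by the single part $p_1+p_2+p_3$. "Distinct" refers to values: three distinct parts have pairwise different values; three parts, two of which are distinct, means $p_1\ne p_2=p_3$ for some ordering; deleting two distinct parts means removing from $p$ two parts $p_1\neq p_2$. Quivers. A finite dimensional $k$-algebra $A$ is split basic if $A/\operatorname{rad}(A)$ is isomorphic to a direct product of copies of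 $k$; the algebra $(k\mathcal F)^{\mathcal B_n}$ is split basic. The quiver of a split basic algebra $A$ is the directed graph defined from any complete system of primitive orthogonal idempotents $\{e_v:v\in\mathcal V\}$ (pairwise orthogonal primitive idempotents summing to $1$): it has one vertex $v$ for each $e_v$, and the number of arrows from $x$ to $y$ is $\dim_k e_y\big(\operatorname{rad}(A)/\operatorname{rad}^2(A)\big)e_x$. It does not depend on the chosen system, up to isomorphism of directed graphs. *)

theory Defs
  imports
    "HOL-Analysis.Analysis"
    "HOL-Algebra.Algebra"
    "HOL-Algebra.Algebraic_Closure_Type"
    "Jordan_Normal_Form.Missing_VectorSpace"
    "Graph_Theory.Digraph_Isomorphism"
begin

text \<open>
  A unital associative algebra over a field \<open>K\<close> is carried by the record type \<open>module\<close> of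
  HOL-Algebra, which extends \<open>ring\<close> by a scalar multiplication. (The locale \<open>algebra\<close> of
  HOL-Algebra is not usable here, since it only covers commutative algebras.)
\<close>

section \<open>Finite dimensional algebras and their quivers\<close>

locale fin_dim_algebra = vectorspace K A + alg?: ring A for K and A (structure) +
  assumes smult_mult_left:
      "\<lbrakk>c \<in> carrier K; x \<in> carrier A; y \<in> carrier A\<rbrakk> \<Longrightarrow> (c \<odot> x) \<otimes> y = c \<odot> (x \<otimes> y)"
    and smult_mult_right:
      "\<lbrakk>c \<in> carrier K; x \<in> carrier A; y \<in> carrier A\<rbrakk> \<Longrightarrow> x \<otimes> (c \<odot> y) = c \<odot> (x \<otimes> y)"
    and finite_dimensional: "vectorspace.fin_dim K A"

definition left_ideal :: "'a set \<Rightarrow> ('a, 'm) ring_scheme \<Rightarrow> bool" where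
  "left_ideal I R \<longleftrightarrow>
     additive_subgroup I R \<and> (\<forall>a\<in>carrier R. \<forall>x\<in>I. a \<otimes>\<^bsub>R\<^esub> x \<in> I)"

definition maximal_left_ideal :: "'a set \<Rightarrow> ('a, 'm) ring_scheme \<Rightarrow> bool" where
  "maximal_left_ideal I R \<longleftrightarrow>
     left_ideal I R \<and> I \<noteq> carrier R \<and>
     (\<forall>J. left_ideal J R \<and> I \<subseteq> J \<longrightarrow> J = I \<or> J = carrier R)"

definition jacobson_radical :: "('a, 'm) ring_scheme \<Rightarrow> 'a set" where
  "jacobson_radical R = carrier R \<inter> \<Inter> {I. maximal_left_ideal I R}"

definition quotient_algebra ::
    "('k, 'a, 'm) module_scheme \<Rightarrow> 'a set \<Rightarrow> ('k, 'a set) module" where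
  "quotient_algebra A I =
     ring.extend (A Quot I) \<lparr> module.smult = (\<lambda>c S. \<Union>x\<in>S. I +>\<^bsub>A\<^esub> (c \<odot>\<^bsub>A\<^esub> x)) \<rparr>"

definition product_algebra :: "('k, 'm) ring_scheme \<Rightarrow> nat \<Rightarrow> ('k, nat \<Rightarrow> 'k) module" where
  "product_algebra K m =
     \<lparr> carrier = {..<m} \<rightarrow>\<^sub>E carrier K,
       monoid.mult = (\<lambda>f g. \<lambda>i\<in>{..<m}. f i \<otimes>\<^bsub>K\<^esub> g i),
       one = (\<lambda>i\<in>{..<m}. \<one>\<^bsub>K\<^esub>),
       ring.zero = (\<lambda>i\<in>{..<m}. \<zero>\<^bsub>K\<^esub>),
       add = (\<lambda>f g. \<lambda>i\<in>{..<m}. f i \<oplus>\<^bsub>K\<^esub> g i),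
       module.smult = (\<lambda>c f. \<lambda>i\<in>{..<m}. c \<otimes>\<^bsub>K\<^esub> f i) \<rparr>"

definition algebra_iso ::
    "('k, 'l) ring_scheme \<Rightarrow> ('k, 'a, 'm) module_scheme \<Rightarrow> ('k, 'b, 'n) module_scheme
      \<Rightarrow> ('a \<Rightarrow> 'b) set" where
  "algebra_iso K A B =
     {h \<in> ring_iso A B.
        \<forall>c\<in>carrier K. \<forall>x\<in>carrier A. h (c \<odot>\<^bsub>A\<^esub> x) = c \<odot>\<^bsub>B\<^esub> h x}"

definition split_basic :: "('k, 'l) ring_scheme \<Rightarrow> ('k, 'a, 'm) module_scheme \<Rightarrow> bool" where
  "split_basic K A \<longleftrightarrow>
     fin_dim_algebra K A \<and>
     (\<exists>m. algebra_iso K (quotient_algebra A (jacobson_radical A)) (product_algebra K m) \<noteq> {})"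

definition idempotent_elem :: "('a, 'm) ring_scheme \<Rightarrow> 'a \<Rightarrow> bool" where
  "idempotent_elem R e \<longleftrightarrow> e \<in> carrier R \<and> e \<otimes>\<^bsub>R\<^esub> e = e"

definition primitive_idempotent :: "('a, 'm) ring_scheme \<Rightarrow> 'a \<Rightarrow> bool" where
  "primitive_idempotent R e \<longleftrightarrow>
     idempotent_elem R e \<and> e \<noteq> \<zero>\<^bsub>R\<^esub> \<and>
     (\<forall>f g. idempotent_elem R f \<and> idempotent_elem R g \<and>
        f \<otimes>\<^bsub>R\<^esub> g = \<zero>\<^bsub>R\<^esub> \<and> g \<otimes>\<^bsub>R\<^esub> f = \<zero>\<^bsub>R\<^esub> \<and> e = f \<oplus>\<^bsub>R\<^esub> g
        \<longrightarrow> f = \<zero>\<^bsub>R\<^esub> \<or> g = \<zero>\<^bsub>R\<^esub>)"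

definition complete_idempotent_system :: "('a, 'm) ring_scheme \<Rightarrow> 'a set \<Rightarrow> bool" where
  "complete_idempotent_system R E \<longleftrightarrow>
     finite E \<and> (\<forall>e\<in>E. primitive_idempotent R e) \<and>
     (\<forall>e\<in>E. \<forall>f\<in>E. e \<noteq> f \<longrightarrow> e \<otimes>\<^bsub>R\<^esub> f = \<zero>\<^bsub>R\<^esub>) \<and>
     (\<Oplus>\<^bsub>R\<^esub>e\<in>E. e) = \<one>\<^bsub>R\<^esub>"

abbreviation radical_square :: "('a, 'm) ring_scheme \<Rightarrow> 'a set" where
  "radical_square R \<equiv> ideal_prod R (jacobson_radical R) (jacobson_radical R)"

text \<open>
  The subspace \<open>y (rad A / rad\<^sup>2 A) x\<close> of \<open>A / rad\<^sup>2 A\<close>; the elements \<open>x\<close> and \<open>y\<close> of \<open>A\<close> act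
  through their classes modulo \<open>rad\<^sup>2 A\<close>.
\<close>

definition arrow_space :: "('k, 'a, 'm) module_scheme \<Rightarrow> 'a \<Rightarrow> 'a \<Rightarrow> 'a set set" where
  "arrow_space A x y =
     (let J = radical_square A; B = quotient_algebra A J in
      {(J +>\<^bsub>A\<^esub> y) \<otimes>\<^bsub>B\<^esub> (J +>\<^bsub>A\<^esub> r) \<otimes>\<^bsub>B\<^esub> (J +>\<^bsub>A\<^esub> x) | r. r \<in> jacobson_radical A})"

definition arrow_number ::
    "('k, 'l) ring_scheme \<Rightarrow> ('k, 'a, 'm) module_scheme \<Rightarrow> 'a \<Rightarrow> 'a \<Rightarrow> nat" where
  "arrow_number K A x y =
     vectorspace.dim K
       (quotient_algebra A (radical_square A) \<lparr> carrier := arrow_space A x y \<rparr>)"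

text \<open>A directed multigraph is given by its vertices and, for \<open>x\<close> and \<open>y\<close>, the number \<open>N x y\<close> of
  arrows from \<open>x\<close> to \<open>y\<close>; these arrows are named \<open>(x, y, 0), \<dots>, (x, y, N x y - 1)\<close>.\<close>

definition multigraph ::
    "'v set \<Rightarrow> ('v \<Rightarrow> 'v \<Rightarrow> nat) \<Rightarrow> ('v, 'v \<times> 'v \<times> nat) pre_digraph" where
  "multigraph V N =
     \<lparr> verts = V,
       arcs = {(x, y, i). x \<in> V \<and> y \<in> V \<and> i < N x y},
       tail = (\<lambda>(x, y, i). x),
       head = (\<lambda>(x, y, i). y) \<rparr>"

text \<open>
  \<open>Q\<close> is the quiver of \<open>A\<close>, up to isomorphism of directed graphs. The quiver is only defined for
  split basic algebras, so this is part of the definition; it is computed from any complete system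
  of primitive orthogonal idempotents, hence the quantification over all systems.
\<close>

definition is_quiver_of ::
    "('v, 'w) pre_digraph \<Rightarrow> ('k, 'l) ring_scheme \<Rightarrow> ('k, 'a, 'm) module_scheme \<Rightarrow> bool" where
  "is_quiver_of Q K A \<longleftrightarrow>
     split_basic K A \<and>
     (\<exists>E. complete_idempotent_system A E) \<and>
     (\<forall>E. complete_idempotent_system A E \<longrightarrow>
        digraph_iso (multigraph E (arrow_number K A)) Q)"


section \<open>The face semigroup of a hyperplane arrangement\<close>

datatype sign = Pos | Zero | Neg

fun side :: "'v::real_inner \<Rightarrow> sign \<Rightarrow> 'v set" where
  "side a Pos = {v. a \<bullet> v > 0}"
| "side a Zero = {v. a \<bullet> v = 0}"
| "side a Neg = {v. a \<bullet> v < 0}"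

text \<open>
  A choice, for each hyperplane \<open>H\<close>, of a normal vector \<open>\<eta> H\<close>. This amounts to labelling the two
  open half spaces of \<open>H\<close>: \<open>H\<^sup>\<sigma>\<close> is \<open>side (\<eta> H) \<sigma>\<close>, and every labelling arises in this way.
\<close>

definition labelling :: "'v::real_inner set set \<Rightarrow> ('v set \<Rightarrow> 'v) \<Rightarrow> bool" where
  "labelling \<A> \<eta> \<longleftrightarrow> (\<forall>H\<in>\<A>. \<eta> H \<noteq> 0 \<and> H = {v. \<eta> H \<bullet> v = 0})"

definition face_of_signs ::
    "'v::real_inner set set \<Rightarrow> ('v set \<Rightarrow> 'v) \<Rightarrow> ('v set \<Rightarrow> sign) \<Rightarrow> 'v set" where
  "face_of_signs \<A> \<eta> \<sigma> = (\<Inter>H\<in>\<A>. side (\<eta> H) (\<sigma> H))"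

definition faces :: "'v::real_inner set set \<Rightarrow> ('v set \<Rightarrow> 'v) \<Rightarrow> 'v set set" where
  "faces \<A> \<eta> = {x. x \<noteq> {} \<and> (\<exists>\<sigma>. x = face_of_signs \<A> \<eta> \<sigma>)}"

definition face_sign :: "('v::real_inner set \<Rightarrow> 'v) \<Rightarrow> 'v set \<Rightarrow> 'v set \<Rightarrow> sign" where
  "face_sign \<eta> x H = (THE s. x \<subseteq> side (\<eta> H) s)"

definition face_mult ::
    "'v::real_inner set set \<Rightarrow> ('v set \<Rightarrow> 'v) \<Rightarrow> 'v set \<Rightarrow> 'v set \<Rightarrow> 'v set" where
  "face_mult \<A> \<eta> x y =
     face_of_signs \<A> \<eta>
       (\<lambda>H. if face_sign \<eta> x H \<noteq> Zero then face_sign \<eta> x H else face_sign \<eta> y H)"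

definition face_semigroup ::
    "'v::real_inner set set \<Rightarrow> ('v set \<Rightarrow> 'v) \<Rightarrow> 'v set monoid" where
  "face_semigroup \<A> \<eta> =
     \<lparr> carrier = faces \<A> \<eta>, monoid.mult = face_mult \<A> \<eta>, one = face_of_signs \<A> \<eta> (\<lambda>_. Zero) \<rparr>"


section \<open>Semigroup algebras\<close>

definition supp :: "('s \<Rightarrow> 'k::zero) \<Rightarrow> 's set" where
  "supp f = {x. f x \<noteq> 0}"

text \<open>The algebra of formal linear combinations of elements of a semigroup \<open>M\<close> with identity,
  encoded by their coefficient functions.\<close>

definition semigroup_algebra ::
    "('s, 'm) monoid_scheme \<Rightarrow> ('k::field, 's \<Rightarrow> 'k) module" where
  "semigroup_algebra M =
     \<lparr> carrier = {f. finite (supp f) \<and> supp f \<subseteq> carrier M},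
       monoid.mult = (\<lambda>f g z. \<Sum>(x, y) \<in> {(x, y) \<in> supp f \<times> supp g. x \<otimes>\<^bsub>M\<^esub> y = z}. f x * g y),
       one = (\<lambda>x. if x = \<one>\<^bsub>M\<^esub> then 1 else 0),
       ring.zero = (\<lambda>_. 0),
       add = (\<lambda>f g x. f x + g x),
       module.smult = (\<lambda>c f x. c * f x) \<rparr>"

text \<open>For a bijection \<open>w\<close>, the vimage \<open>w -` x\<close> is the image of \<open>x\<close> under the inverse of \<open>w\<close>; so
  the following is the linear extension of \<open>x \<mapsto> w ` x\<close>.\<close>

definition face_action :: "('v \<Rightarrow> 'v) \<Rightarrow> ('v set \<Rightarrow> 'k) \<Rightarrow> ('v set \<Rightarrow> 'k)" where
  "face_action w f = (\<lambda>x. f (w -` x))"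


section \<open>The hyperoctahedral group\<close>

definition B_arrangement :: "(real ^ 'n) set set" where
  "B_arrangement =
     {{v. v $ i = 0} | i. True} \<union>
     {{v. v $ i = v $ j} | i j. i \<noteq> j} \<union>
     {{v. v $ i = - (v $ j)} | i j. i \<noteq> j}"

definition reflection :: "'v::real_inner \<Rightarrow> 'v \<Rightarrow> 'v" where
  "reflection a v = v - (2 * (a \<bullet> v) / (a \<bullet> a)) *\<^sub>R a"

definition hyperoctahedral_group :: "(real ^ 'n \<Rightarrow> real ^ 'n) set" where
  "hyperoctahedral_group =
     generate (BijGroup UNIV) {reflection a | a. a \<noteq> 0 \<and> {v. a \<bullet> v = 0} \<in> B_arrangement}"

definition B_face_algebra ::
    "((real ^ 'n) set \<Rightarrow> real ^ 'n) \<Rightarrow> ('k::field, (real ^ 'n) set \<Rightarrow> 'k) module" where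
  "B_face_algebra \<eta> = semigroup_algebra (face_semigroup B_arrangement \<eta>)"

definition B_invariant_algebra ::
    "((real ^ 'n) set \<Rightarrow> real ^ 'n) \<Rightarrow> ('k::field, (real ^ 'n) set \<Rightarrow> 'k) module" where
  "B_invariant_algebra \<eta> =
     B_face_algebra \<eta> \<lparr> carrier :=
       {f \<in> carrier (B_face_algebra \<eta>). \<forall>w\<in>hyperoctahedral_group. face_action w f = f} \<rparr>"


section \<open>Integer partitions\<close>

definition integer_partitions :: "nat \<Rightarrow> nat multiset set" where
  "integer_partitions m = {p. 0 \<notin># p \<and> sum_mset p = m}"

definition adds_three_parts :: "nat multiset \<Rightarrow> nat multiset \<Rightarrow> nat \<Rightarrow> nat \<Rightarrow> nat \<Rightarrow> bool" where
  "adds_three_parts p q a b c \<longleftrightarrow>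
     {#a, b, c#} \<subseteq># p \<and> q = p - {#a, b, c#} + {#a + b + c#}"

definition deletes_two_parts :: "nat multiset \<Rightarrow> nat multiset \<Rightarrow> nat \<Rightarrow> nat \<Rightarrow> bool" where
  "deletes_two_parts p q a b \<longleftrightarrow> {#a, b#} \<subseteq># p \<and> q = p - {#a, b#}"

definition partition_arrows :: "nat multiset \<Rightarrow> nat multiset \<Rightarrow> nat" where
  "partition_arrows p q =
     (if \<exists>a b c. a \<noteq> b \<and> a \<noteq> c \<and> b \<noteq> c \<and> adds_three_parts p q a b c then 2
      else if \<exists>a b. a \<noteq> b \<and> adds_three_parts p q a b b then 1
      else if \<exists>a b. a \<noteq> b \<and> deletes_two_parts p q a b then 1
      else 0)"

definition partition_quiver ::
    "nat \<Rightarrow> (nat multiset, nat multiset \<times> nat multiset \<times> nat) pre_digraph" where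
  "partition_quiver n = multigraph (\<Union>m\<le>n. integer_partitions m) partition_arrows"

end

theory Submission
  imports Defs "HOL-Library.Poly_Mapping" "HOL-Combinatorics.Combinatorics"
begin

text \<open>
 A face is encoded by an integer vector \<open>f\<close> on the coordinates: only the signs of the \<open>f i\<close> and the
 order of the \<open>\<bar>f i\<bar>\<close> matter, and the product of \<open>f\<close> and \<open>g\<close> is the face of \<open>K f + g\<close> for large \<open>K\<close>.
 The orbit of a face is determined by its type, the list of the sizes of its nonzero levels in
 increasing order of absolute value, so an invariant is a function \<open>a\<close> on words, i.e. lists of
 positive integers with sum at most \<open>n\<close>.

 A word \<open>w\<close> is also a chamber of the arrangement of rank \<open>length w\<close> whose coordinates carry the letters
 of \<open>w\<close> as weights. Hence the invariants act on the functions \<open>\<phi>\<close> on the words of a fixed content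
 \<open>\<mu>\<close> by \<open>(\<phi> a) w = (\<Sum>f. a (type f) * \<phi> (type (f w)))\<close>. The constant functions yield one character for
 every partition \<open>\<mu>\<close>. These characters are different, and their common kernel \<open>J\<close> is nilpotent, since
 multiplication by an element of \<open>J\<close> raises the support in the face order. So \<open>J\<close> is the radical and
 the partitions are the vertices.

 Let \<open>e\<close> be the primitive idempotent of \<open>\<mu>\<close>. The action on words of content \<open>\<mu>\<close> is faithful on \<open>A e\<close>,
 so a linear form on \<open>A e\<close> is given by a function \<open>\<phi>\<close> on these words. If it kills \<open>J\<^sup>2 e\<close>, products of
 differences of orbit sums give two families of relations: they express how \<open>\<phi>\<close> changes when two
 adjacent letters are exchanged. Their solutions are, up to constants, the sums over \<open>T \<subseteq> \<mu>\<close> with two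
 or three elements of functions counting the occurrences of \<open>T\<close> as a subword (the order of the letters being
 disregarded) with a weight \<open>g\<close> that depends only on the last letter. Conversely such a function is
 multiplied by an invariant, modulo constants, with the character of the partition obtained from \<open>\<mu>\<close> by
 deleting \<open>T\<close> if it has two elements, and by adding up its three parts otherwise, and therefore it
 kills \<open>J\<^sup>2 e\<close>. As \<open>g\<close> matters only modulo constants, each \<open>T\<close> contributes one arrow less than it has
 distinct elements.
\<close>

section \<open>Dimension and quotients by coordinates\<close>

text \<open>The delicate point is to isolate single brackets in the second family of relations. Such
  a relation only controls a sum over all places where the letter p + q + r occurs in a word, and
  these places have different neighbours. The triples are therefore treated by decreasing sum: if d
  = p + q + r, every triple that contains d has a larger sum, so exchanging d with a neighbour is
  already understood, all copies of d can be gathered at one place, and the sum becomes a multiple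
  of one bracket. The multiple is the number of copies, at most the number of letters. The other
  scalars to be inverted count chambers of a given type: a power of 2 for the signs times the
  factorials of the multiplicities of the letters. This is where the characteristic enters. The ring
  theory is kept apart from the combinatorics. It asks for separating characters with a nil common
  kernel and, for each pair of vertices, for functionals that vanish on products of two radical
  elements, possess dual elements, and detect whether y r x is a sum of such products.\<close>

lemma field_K: "field (ring_of_type_algebra :: 'k::field ring)" ..

lemma K_simps [simp]:
 "carrier (ring_of_type_algebra :: 'k::field ring) = UNIV"
 "x \<otimes>\<^bsub>(ring_of_type_algebra :: 'k ring)\<^esub> y = x * y"
 "x \<oplus>\<^bsub>(ring_of_type_algebra :: 'k ring)\<^esub> y = x + y"
 "\<one>\<^bsub>(ring_of_type_algebra :: 'k ring)\<^esub> = 1"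
 "\<zero>\<^bsub>(ring_of_type_algebra :: 'k ring)\<^esub> = 0"
 by (simp_all add: ring_of_type_algebra_def)

text \<open>All vector space axioms are pulled back along the injection \<open>h\<close> into
  functions with support in \<open>I\<close>, so a record with plain operations becomes a space of
  dimension \<open>card I\<close> at once. It serves the algebra itself and the space of arrows
  between two vertices.\<close>

locale coordinates =
 fixes V :: "('k::field, 'a, 'm) module_scheme" and I :: "'i set" and h :: "'a \<Rightarrow> 'i \<Rightarrow> 'k"
 assumes finI: "finite I"
  and h_bij: "bij_betw h (carrier V) {g. \<forall>i. i \<notin> I \<longrightarrow> g i = 0}"
  and zero_closed: "\<zero>\<^bsub>V\<^esub> \<in> carrier V"
  and add_closed: "\<And>x y. x \<in> carrier V \<Longrightarrow> y \<in> carrier V \<Longrightarrow> x \<oplus>\<^bsub>V\<^esub> y \<in> carrier V"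
  and smult_closed: "\<And>c x. x \<in> carrier V \<Longrightarrow> c \<odot>\<^bsub>V\<^esub> x \<in> carrier V"
  and h_zero: "h \<zero>\<^bsub>V\<^esub> i = 0"
  and h_add: "\<And>x y. x \<in> carrier V \<Longrightarrow> y \<in> carrier V \<Longrightarrow> h (x \<oplus>\<^bsub>V\<^esub> y) i = h x i + h y i"
  and h_smult: "\<And>c x. x \<in> carrier V \<Longrightarrow> h (c \<odot>\<^bsub>V\<^esub> x) i = c * h x i"
begin

abbreviation K :: "'k ring" where "K \<equiv> ring_of_type_algebra"

lemma h_eqI: "x \<in> carrier V \<Longrightarrow> y \<in> carrier V \<Longrightarrow> (\<And>i. h x i = h y i) \<Longrightarrow> x = y"
 using h_bij by (auto simp: bij_betw_def inj_on_def fun_eq_iff)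

lemma h_outside: "x \<in> carrier V \<Longrightarrow> i \<notin> I \<Longrightarrow> h x i = 0"
 using h_bij by (auto simp: bij_betw_def)

lemma h_surj:
 assumes "\<And>i. i \<notin> I \<Longrightarrow> g i = 0"
 obtains x where "x \<in> carrier V" "h x = g"
proof -
 have "g \<in> h ` carrier V" using h_bij assms by (simp add: bij_betw_def)
 then show thesis using that by blast
qed

lemma abelian_group_V: "abelian_group V"
proof (rule abelian_groupI)
 fix x assume x: "x \<in> carrier V"
 have "(\<And>i. i \<notin> I \<Longrightarrow> - h x i = 0)" using h_outside[OF x] by simp
 then obtain y where y: "y \<in> carrier V" "h y = (\<lambda>i. - h x i)" by (rule h_surj)
 have "y \<oplus>\<^bsub>V\<^esub> x = \<zero>\<^bsub>V\<^esub>"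
  by (rule h_eqI) (simp_all add: x y add_closed zero_closed h_zero h_add)
 then show "\<exists>y\<in>carrier V. y \<oplus>\<^bsub>V\<^esub> x = \<zero>\<^bsub>V\<^esub>" using y(1) by blast
next
 fix x y z assume "x \<in> carrier V" "y \<in> carrier V" "z \<in> carrier V"
 then show "x \<oplus>\<^bsub>V\<^esub> y \<oplus>\<^bsub>V\<^esub> z = x \<oplus>\<^bsub>V\<^esub> (y \<oplus>\<^bsub>V\<^esub> z)"
  by (intro h_eqI) (simp_all add: add_closed h_add)
next
 fix x y assume "x \<in> carrier V" "y \<in> carrier V"
 then show "x \<oplus>\<^bsub>V\<^esub> y = y \<oplus>\<^bsub>V\<^esub> x" by (intro h_eqI) (simp_all add: add_closed h_add)
next
 fix x assume "x \<in> carrier V"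
 then show "\<zero>\<^bsub>V\<^esub> \<oplus>\<^bsub>V\<^esub> x = x" by (intro h_eqI) (simp_all add: add_closed zero_closed h_zero h_add)
qed (simp_all add: add_closed zero_closed)

lemma vectorspace_V: "vectorspace K V"
proof -
 have "module K V"
 proof (rule moduleI)
  show "cring K" by (rule cring_from_type_algebra)
  show "abelian_group V" by (rule abelian_group_V)
 qed (auto intro!: h_eqI simp: smult_closed add_closed h_smult h_add algebra_simps)
 then show ?thesis unfolding vectorspace_def using field_K by blast
qed

sublocale vs: vectorspace K V by (rule vectorspace_V)

lemma h_finsum: "finite B \<Longrightarrow> f \<in> B \<rightarrow> carrier V \<Longrightarrow> h (finsum V f B) i = (\<Sum>b\<in>B. h (f b) i)"
proof (induction B rule: finite_induct)
 case empty
 show ?case by (simp add: h_zero)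
next
 case (insert b B)
 have "f \<in> B \<rightarrow> carrier V" "f b \<in> carrier V" using insert.prems by auto
 then show ?case using insert by (simp add: h_add vs.finsum_closed)
qed

lemma h_lincomb: "finite B \<Longrightarrow> B \<subseteq> carrier V \<Longrightarrow> h (vs.lincomb a B) i = (\<Sum>b\<in>B. a b * h b i)"
 unfolding vs.lincomb_def
 by (subst h_finsum) (auto intro!: smult_closed sum.cong simp: h_smult subset_iff)

definition unit_vector :: "'i \<Rightarrow> 'a" where
 "unit_vector j = (THE x. x \<in> carrier V \<and> h x = (\<lambda>i. if i = j then 1 else 0))"

lemma unit_vector:
 assumes "j \<in> I"
 shows "unit_vector j \<in> carrier V" "h (unit_vector j) i = (if i = j then 1 else 0)"
proof -
 have "\<And>i. i \<notin> I \<Longrightarrow> (if i = j then 1 else 0) = (0::'k)" using assms by auto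
 then obtain x where x: "x \<in> carrier V" "h x = (\<lambda>i. if i = j then 1 else 0)" by (rule h_surj)
 have "unit_vector j = x" unfolding unit_vector_def
  by (rule the_equality) (use x in \<open>auto intro!: h_eqI\<close>)
 then show "unit_vector j \<in> carrier V" "h (unit_vector j) i = (if i = j then 1 else 0)" using x by simp_all
qed

lemma inj_unit_vector: "inj_on unit_vector I"
proof (rule inj_onI)
 fix i j assume ij: "i \<in> I" "j \<in> I" "unit_vector i = unit_vector j"
 then show "i = j" using unit_vector(2)[OF ij(1), of i] unit_vector(2)[OF ij(2), of i]
  by (auto split: if_splits)
qed

lemma basis_unit_vectors: "vs.basis (unit_vector ` I)"
proof -
 let ?B = "unit_vector ` I"
 have B: "finite ?B" "?B \<subseteq> carrier V" using finI unit_vector(1) by auto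
 have comb: "h (vs.lincomb a ?B) i = (if i \<in> I then a (unit_vector i) else 0)" for a i
 proof -
  have "h (vs.lincomb a ?B) i = (\<Sum>j\<in>I. a (unit_vector j) * h (unit_vector j) i)"
   unfolding h_lincomb[OF B] by (simp add: sum.reindex inj_unit_vector)
  also have "\<dots> = (\<Sum>j\<in>I. if j = i then a (unit_vector i) else 0)"
   by (rule sum.cong) (simp_all add: unit_vector(2))
  finally show ?thesis by (simp add: finI)
 qed
 have ind: "vs.lin_indpt ?B"
 proof (rule vs.finite_lin_indpt2[OF B])
  fix a assume "vs.lincomb a ?B = \<zero>\<^bsub>V\<^esub>"
  then have z: "(if i \<in> I then a (unit_vector i) else 0) = 0" for i using comb[of a i] by (simp add: h_zero)
  show "\<forall>v\<in>?B. a v = \<zero>\<^bsub>K\<^esub>"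
  proof (intro ballI)
   fix v assume "v \<in> ?B"
   then obtain i where "v = unit_vector i" "i \<in> I" by blast
   then show "a v = \<zero>\<^bsub>K\<^esub>" using z[of i] by simp
  qed
 qed
 have gen: "x \<in> vs.span ?B" if x: "x \<in> carrier V" for x
 proof -
  have out: "h x i = 0" if "i \<notin> I" for i by (rule h_outside[OF x that])
  define a where "a v = h x (the_inv_into I unit_vector v)" for v
  have "a (unit_vector i) = h x i" if "i \<in> I" for i
   by (simp add: a_def the_inv_into_f_f[OF inj_unit_vector that])
  then have "x = vs.lincomb a ?B"
   by (intro h_eqI x vs.lincomb_closed B(2)) (simp_all add: comb out)
  then show ?thesis unfolding vs.finite_span[OF B] by auto
 qed
 have "vs.span ?B = carrier V"
  by (rule equalityI[OF vs.span_is_subset2[OF B(2)] subsetI[OF gen]])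
 then show ?thesis unfolding vs.basis_def by (intro conjI ind B(2))
qed

lemma fin_dim_V: "vs.fin_dim"
 using basis_unit_vectors unfolding vs.fin_dim_def vs.basis_def
 by (elim conjE, intro exI[of _ "unit_vector ` I"] conjI finite_imageI finI)

lemma dim_V: "vs.dim = card I"
 using vs.dim_basis[OF _ basis_unit_vectors] finI by (simp add: card_image inj_unit_vector)

end

section \<open>Rings with separating characters\<close>

lemma power_mult_commuting: "x * y = y * x \<Longrightarrow> (x * y) ^ n = x ^ n * (y :: 'r::monoid_mult) ^ n"
proof (induction n)
 case (Suc n)
 have "x * y * (x ^ n * y ^ n) = x * (y * x ^ n) * y ^ n" by (simp only: mult.assoc)
 also have "y * x ^ n = x ^ n * y" by (rule power_commuting_commutes[OF Suc.prems, symmetric])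
 finally show ?case using Suc by (simp add: mult.assoc)
qed simp

text \<open>The polynomial 3 t^2 - 2 t^3 fixes 0 and 1 and has derivative 0 there, so it replaces an
  approximate idempotent by one whose defect is divisible by the square of the old defect. Its
  coefficients, and those of the cofactor 4 (t^2 - t) - 3, are written out as repeated sums.\<close>

lemma lifting_step:
 fixes a :: "'r::ring_1"
 defines "b \<equiv> a * a + a * a + a * a - (a * a * a + a * a * a)"
 shows "b * b - b = (a * a - a) * (a * a - a) *
  ((a * a - a) + (a * a - a) + (a * a - a) + (a * a - a) - 1 - 1 - 1)"
 unfolding b_def by (simp add: algebra_simps)

text \<open>Modulo the common kernel of the characters, \<open>S\<close> embeds into a product of
  copies of the field, and this kernel consists of nilpotent elements. Separation is asked for pairs
  of characters, which is what the triangular character table of the face algebra provides.\<close>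

locale split_ring =
 fixes S :: "'r::ring_1 set" and P :: "'p set" and ch :: "'p \<Rightarrow> 'r \<Rightarrow> 'k::field"
 assumes S_1: "1 \<in> S" and S_add: "\<And>a b. a \<in> S \<Longrightarrow> b \<in> S \<Longrightarrow> a + b \<in> S"
  and S_diff: "\<And>a b. a \<in> S \<Longrightarrow> b \<in> S \<Longrightarrow> a - b \<in> S"
  and S_mult: "\<And>a b. a \<in> S \<Longrightarrow> b \<in> S \<Longrightarrow> a * b \<in> S"
  and finP: "finite P" and P_nonempty: "P \<noteq> {}"
  and ch_add: "\<And>p a b. p \<in> P \<Longrightarrow> a \<in> S \<Longrightarrow> b \<in> S \<Longrightarrow> ch p (a + b) = ch p a + ch p b"
  and ch_mult: "\<And>p a b. p \<in> P \<Longrightarrow> a \<in> S \<Longrightarrow> b \<in> S \<Longrightarrow> ch p (a * b) = ch p a * ch p b"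
  and ch_1: "\<And>p. p \<in> P \<Longrightarrow> ch p 1 = 1"
  and separate: "\<And>p q. p \<in> P \<Longrightarrow> q \<in> P \<Longrightarrow> p \<noteq> q \<Longrightarrow> \<exists>z\<in>S. ch p z = 1 \<and> ch q z = 0"
  and nilpotent: "\<And>a. a \<in> S \<Longrightarrow> (\<And>p. p \<in> P \<Longrightarrow> ch p a = 0) \<Longrightarrow> \<exists>N. a ^ N = 0"
begin

definition J :: "'r set" where
 "J = {a \<in> S. \<forall>p\<in>P. ch p a = 0}"

lemma S_0: "0 \<in> S"
 using S_diff[OF S_1 S_1] by simp

lemma ch_diff:
 assumes "p \<in> P" "a \<in> S" "b \<in> S"
 shows "ch p (a - b) = ch p a - ch p b"
 using ch_add[OF assms(1) S_diff[OF assms(2,3)] assms(3)] by (simp add: algebra_simps)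

lemma ch_0: "p \<in> P \<Longrightarrow> ch p 0 = 0"
 using ch_diff[of p 1 1] S_1 by simp

lemma J_mult: "a \<in> S \<Longrightarrow> b \<in> J \<Longrightarrow> a * b \<in> J" "b \<in> J \<Longrightarrow> a \<in> S \<Longrightarrow> b * a \<in> J"
 by (simp_all add: J_def S_mult ch_mult)

lemma J_subset: "J \<subseteq> S" by (auto simp: J_def)

lemma J_nilpotent: "a \<in> J \<Longrightarrow> \<exists>N. a ^ N = 0"
 using nilpotent unfolding J_def by blast

text \<open>The product of the elements that separate \<open>p\<close> from each of the other
  indices has character value 1 at \<open>p\<close> and 0 elsewhere.\<close>

lemma character_delta:
 assumes "p \<in> P"
 obtains x where "x \<in> S" "\<And>q. q \<in> P \<Longrightarrow> ch q x = (if q = p then 1 else 0)"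
proof -
 have "\<exists>x\<in>S. ch p x = 1 \<and> (\<forall>q\<in>Q. ch q x = 0)" if "Q \<subseteq> P - {p}" for Q
 proof -
  have "finite Q" using that finP by (meson finite_Diff finite_subset)
  then show ?thesis using that
  proof (induction Q rule: finite_induct)
   case empty
   show ?case using S_1 ch_1[OF assms] by blast
  next
   case (insert q Q)
   then obtain x where x: "x \<in> S" "ch p x = 1" "\<forall>q\<in>Q. ch q x = 0" by blast
   have qP: "q \<in> P" "p \<noteq> q" using insert.prems by auto
   obtain z where z: "z \<in> S" "ch p z = 1" "ch q z = 0" using separate[OF assms qP] by blast
   have "ch r (x * z) = 0" if "r \<in> insert q Q" for r
   proof (cases "r = q")
    case True
    then show ?thesis using ch_mult[OF qP(1) x(1) z(1)] z(3) by simp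
   next
    case False
    then have "r \<in> Q" "r \<in> P" using that insert.prems by auto
    then show ?thesis using ch_mult[OF \<open>r \<in> P\<close> x(1) z(1)] x(3) by simp
   qed
   moreover have "ch p (x * z) = 1" using ch_mult[OF assms x(1) z(1)] x(2) z(2) by simp
   ultimately show ?case using S_mult[OF x(1) z(1)] by blast
  qed
 qed
 from this[OF subset_refl] obtain x where "x \<in> S" "ch p x = 1" "\<forall>q\<in>P - {p}. ch q x = 0" by blast
 then show thesis using that[of x] by auto
qed

section \<open>Lifting idempotents modulo the kernel of the characters\<close>

lemma ch_idempotent:
 assumes "p \<in> P" "e \<in> S" "e * e = e"
 shows "ch p e = 0 \<or> ch p e = 1"
 using ch_mult[OF assms(1,2,2)] assms(3) by simp

text \<open>A nonzero idempotent is not nilpotent, so some character does not vanish on it, and on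
  idempotents characters take only the values 0 and 1.\<close>

lemma idempotent_character:
 assumes "e \<in> S" "e * e = e" "e \<noteq> 0"
 obtains p where "p \<in> P" "ch p e = 1"
proof (cases "e \<in> J")
 case True
 then obtain N where "e ^ N = 0" using J_nilpotent by blast
 moreover have "e ^ Suc n = e" for n by (induction n) (simp_all add: assms(2))
 ultimately have "e = 0" by (metis mult_zero_right power_Suc)
 then show thesis using assms(3) by simp
next
 case False
 then obtain p where "p \<in> P" "ch p e \<noteq> 0" using assms(1) by (auto simp: J_def)
 then show thesis using that ch_idempotent[OF _ assms(1,2)] by blast
qed

text \<open>Each application of 3 t^2 - 2 t^3 squares the defect a^2 - a up to a commuting factor,
  hence k applications remove a defect whose 2^k-th power is 0. The polynomial has no constant term,
  so the equations with \<open>e\<close> persist and the result stays in the corner of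
  \<open>e\<close>; the character values 0 and 1 are fixed points.\<close>

lemma lift_idempotent_power:
 assumes "a \<in> S" "e * a = a" "a * e = a" "\<And>p. p \<in> P \<Longrightarrow> ch p a = 0 \<or> ch p a = 1"
  and "(a * a - a) ^ (2 ^ k) = 0"
 shows "\<exists>f\<in>S. f * f = f \<and> e * f = f \<and> f * e = f \<and> (\<forall>p\<in>P. ch p f = ch p a)"
 using assms
proof (induction k arbitrary: a)
 case 0
 then have "a * a = a" by simp
 then show ?case using "0.prems" by blast
next
 case (Suc k)
 define b where "b = a * a + a * a + a * a - (a * a * a + a * a * a)"
 define d where "d = a * a - a"
 define c where "c = d + d + d + d - 1 - 1 - 1"
 note aS = Suc.prems(1)
 have aa: "a * a \<in> S" and aaa: "a * a * a \<in> S" using aS by (simp_all add: S_mult)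
 have bS: "b \<in> S" unfolding b_def by (intro S_diff S_add aa aaa)
 have "e * (a * x) = a * x" for x using Suc.prems(2) by (simp add: mult.assoc[symmetric])
 then have eb: "e * b = b" unfolding b_def by (simp add: distrib_left right_diff_distrib mult.assoc)
 have be: "b * e = b" unfolding b_def by (simp add: distrib_right left_diff_distrib mult.assoc Suc.prems(3))
 have chb: "ch p b = ch p a" if p: "p \<in> P" for p
 proof -
  have "ch p b = ch p a * ch p a + ch p a * ch p a + ch p a * ch p a
    - (ch p a * ch p a * ch p a + ch p a * ch p a * ch p a)"
   unfolding b_def by (simp only: ch_diff ch_add ch_mult p S_add S_mult aS)
  then show ?thesis using Suc.prems(4)[OF p] by auto
 qed
 have bb: "b * b - b = d * d * c" unfolding b_def c_def d_def by (rule lifting_step)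
 have dc: "d * c = c * d" unfolding c_def
  by (simp only: distrib_left distrib_right left_diff_distrib right_diff_distrib mult_1_left mult_1_right)
 have "d * d * c = d * (c * d)" unfolding mult.assoc dc ..
 also have "\<dots> = c * (d * d)" unfolding mult.assoc[symmetric] dc ..
 finally have "(d * d * c) ^ (2 ^ k) = (d * d) ^ (2 ^ k) * c ^ (2 ^ k)" by (rule power_mult_commuting)
 also have "(d * d) ^ (2 ^ k) = d ^ (2 ^ Suc k)"
  by (simp add: power2_eq_square[symmetric] power_mult[symmetric])
 also have "\<dots> = 0" unfolding d_def by (rule Suc.prems(5))
 finally have "(b * b - b) ^ (2 ^ k) = 0" unfolding bb by simp
 from Suc.IH[OF bS eb be _ this] chb Suc.prems(4) show ?case by simp
qed

lemma lift_idempotent: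
 assumes "a \<in> S" "e * a = a" "a * e = a" "\<And>p. p \<in> P \<Longrightarrow> ch p a = 0 \<or> ch p a = 1"
 obtains f where "f \<in> S" "f * f = f" "e * f = f" "f * e = f" "\<And>p. p \<in> P \<Longrightarrow> ch p f = ch p a"
proof -
 have "ch p (a * a - a) = 0" if "p \<in> P" for p
  using assms(4)[OF that] that by (auto simp: ch_diff ch_mult S_mult assms(1))
 then have "a * a - a \<in> J" by (simp add: J_def S_diff S_mult assms(1))
 then obtain N where N: "(a * a - a) ^ N = 0" using J_nilpotent by blast
 \<comment> \<open>A vanishing power stays zero when its exponent grows, so the exponent may be
   taken to be a power of 2.\<close>
 have "2 ^ N = N + (2 ^ N - N :: nat)" using less_exp[of N] by simp
 then have "(a * a - a) ^ (2 ^ N) = 0" by (metis N mult_zero_left power_add)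
 then show thesis using lift_idempotent_power[OF assms] that by blast
qed

section \<open>Complete systems of primitive idempotents\<close>

definition primitive :: "'r \<Rightarrow> bool" where
 "primitive e \<longleftrightarrow> e \<in> S \<and> e * e = e \<and> e \<noteq> 0 \<and>
  (\<forall>f g. f \<in> S \<and> f * f = f \<and> g \<in> S \<and> g * g = g \<and> f * g = 0 \<and> g * f = 0 \<and> e = f + g \<longrightarrow> f = 0 \<or> g = 0)"

definition orthogonal_system :: "'r set \<Rightarrow> bool" where
 "orthogonal_system E \<longleftrightarrow> finite E \<and> E \<subseteq> S \<and> (\<forall>e\<in>E. e * e = e \<and> e \<noteq> 0) \<and>
  (\<forall>e\<in>E. \<forall>f\<in>E. e \<noteq> f \<longrightarrow> e * f = 0) \<and> \<Sum>E = 1"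

lemma orthogonal_systemD:
 assumes "orthogonal_system E"
 shows "finite E" "\<Sum>E = 1"
  and "\<And>e. e \<in> E \<Longrightarrow> e \<in> S" "\<And>e. e \<in> E \<Longrightarrow> e * e = e" "\<And>e. e \<in> E \<Longrightarrow> e \<noteq> 0"
  and "\<And>e f. e \<in> E \<Longrightarrow> f \<in> E \<Longrightarrow> e \<noteq> f \<Longrightarrow> e * f = 0"
proof -
 note D' = assms[unfolded orthogonal_system_def]
 note D = conjunct1[OF D'] conjunct1[OF conjunct2[OF D']] conjunct1[OF conjunct2[OF conjunct2[OF D']]]
  conjunct1[OF conjunct2[OF conjunct2[OF conjunct2[OF D']]]] conjunct2[OF conjunct2[OF conjunct2[OF conjunct2[OF D']]]]
 show "finite E" "\<Sum>E = 1" by (fact D)+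
 show "e \<in> S" if "e \<in> E" for e by (rule subsetD[OF D(2) that])
 show "e * e = e" "e \<noteq> 0" if "e \<in> E" for e using bspec[OF D(3) that] by simp_all
 show "e * f = 0" if "e \<in> E" "f \<in> E" "e \<noteq> f" for e f
  using bspec[OF bspec[OF D(4) that(1)] that(2)] that(3) by (rule mp)
qed

text \<open>Two orthogonal idempotents cannot share a character with value 1, since their product 0
  would then have value 1.\<close>

lemma orthogonal_system_card:
 assumes "orthogonal_system E"
 shows "card E \<le> card P"
proof -
 have "\<forall>e\<in>E. \<exists>p. p \<in> P \<and> ch p e = 1"
 proof
  fix e assume "e \<in> E"
  then have "e \<in> S" "e * e = e" "e \<noteq> 0" using orthogonal_systemD[OF assms] by simp_all
  then show "\<exists>p. p \<in> P \<and> ch p e = 1" using idempotent_character by blast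
 qed
 then obtain p where p: "\<And>e. e \<in> E \<Longrightarrow> p e \<in> P \<and> ch (p e) e = 1" by metis
 have "inj_on p E"
 proof (rule inj_onI, rule ccontr)
  fix e f assume ef: "e \<in> E" "f \<in> E" "p e = p f" "e \<noteq> f"
  then have *: "e * f = 0" "e \<in> S" "f \<in> S" using orthogonal_systemD[OF assms] by simp_all
  have "ch (p e) (e * f) = 1" using ch_mult[of "p e" e f] p[OF ef(1)] p[OF ef(2)] ef(3) * by simp
  then show False using *(1) ch_0[of "p e"] p[OF ef(1)] by simp
 qed
 then show ?thesis using p finP by (intro card_inj_on_le[of p]) auto
qed

text \<open>From e = f + g with f and g orthogonal follows ef = f = fe, so both parts inherit from
  \<open>e\<close> the orthogonality to the remaining members.\<close>

lemma split_system:
 assumes E: "orthogonal_system E" and e: "e \<in> E"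
  and fg: "f \<in> S" "f * f = f" "g \<in> S" "g * g = g" "f * g = 0" "g * f = 0" "e = f + g" "f \<noteq> 0" "g \<noteq> 0"
 shows "\<exists>E'. orthogonal_system E' \<and> card E' = Suc (card E)"
proof -
 let ?R = "E - {e}"
 let ?E' = "insert f (insert g ?R)"
 have fin: "finite E" and orth: "\<And>u v. u \<in> E \<Longrightarrow> v \<in> E \<Longrightarrow> u \<noteq> v \<Longrightarrow> u * v = 0"
  and idem: "\<And>u. u \<in> E \<Longrightarrow> u \<in> S \<and> u * u = u \<and> u \<noteq> 0" and one: "\<Sum>E = 1"
  using orthogonal_systemD[OF E] by simp_all
 have ef: "e * f = f" "f * e = f" "e * g = g" "g * e = g"
  unfolding fg(7) by (simp_all only: distrib_left distrib_right fg(2,4,5,6) add_0_left add_0_right)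
 have uf: "u * f = 0" "f * u = 0" "u * g = 0" "g * u = 0" if "u \<in> ?R" for u
 proof -
  have ue: "u * e = 0" "e * u = 0" using that e orth by auto
  show "u * f = 0" using ue(1) ef(1) by (metis mult.assoc mult_zero_left)
  show "u * g = 0" using ue(1) ef(3) by (metis mult.assoc mult_zero_left)
  show "f * u = 0" using ue(2) ef(2) by (metis mult.assoc mult_zero_right)
  show "g * u = 0" using ue(2) ef(4) by (metis mult.assoc mult_zero_right)
 qed
 have fR: "f \<notin> ?R" using uf(1)[of f] fg by auto
 have gR: "g \<notin> ?R" using uf(3)[of g] fg by auto
 have neq: "f \<noteq> g" using fg by auto
 have card: "card ?E' = Suc (card E)"
  using fin e fR gR neq card_Suc_Diff1[OF fin e] by simp
 have "\<Sum>?E' = f + (g + \<Sum>?R)" using fin fR gR neq by simp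
 also have "\<dots> = e + \<Sum>?R" unfolding fg(7) by (simp only: add.assoc)
 also have "\<dots> = 1" using sum.remove[OF fin e, of "\<lambda>x. x"] one by simp
 finally have sum: "\<Sum>?E' = 1" .
 have "u * v = 0" if "u \<in> ?E'" "v \<in> ?E'" "u \<noteq> v" for u v
  using that uf[of u] uf[of v] orth[of u v] fg(5,6) by auto
 moreover have "u \<in> S \<and> u * u = u \<and> u \<noteq> 0" if "u \<in> ?E'" for u
  using that idem[of u] fg by auto
 ultimately have "orthogonal_system ?E'"
  unfolding orthogonal_system_def using fin sum by blast
 then show ?thesis using card by blast
qed

text \<open>A system with the largest number of members exists because \<open>card P\<close> bounds
  this number; a member that decomposes could be split to give a larger system.\<close>

lemma primitive_system_exists:
 obtains E where "orthogonal_system E" "\<And>e. e \<in> E \<Longrightarrow> primitive e"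
proof -
 obtain p where p: "p \<in> P" using P_nonempty by blast
 have "1 \<noteq> (0 :: 'r)" using ch_1[OF p] ch_0[OF p] by auto
 then have "orthogonal_system {1}" using S_1 by (simp add: orthogonal_system_def)
 from ex_has_greatest_nat[of orthogonal_system _ card "Suc (card P)", OF this]
 obtain E where E: "orthogonal_system E" "\<And>E'. orthogonal_system E' \<Longrightarrow> card E' \<le> card E"
  using orthogonal_system_card less_Suc_eq_le by blast
 have "primitive e" if e: "e \<in> E" for e
 proof -
  have "f = 0 \<or> g = 0"
   if fg: "f \<in> S" "f * f = f" "g \<in> S" "g * g = g" "f * g = 0" "g * f = 0" "e = f + g" for f g
  proof (rule ccontr)
   assume no: "\<not> (f = 0 \<or> g = 0)"
   have "\<exists>E'. orthogonal_system E' \<and> card E' = Suc (card E)"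
    by (rule split_system[OF E(1) e fg]) (use no in simp_all)
   then obtain E' where "orthogonal_system E'" "card E' = Suc (card E)" by (elim exE conjE)
   then show False using E(2)[of E'] by simp
  qed
  then have "\<forall>f g. f \<in> S \<and> f * f = f \<and> g \<in> S \<and> g * g = g \<and> f * g = 0 \<and> g * f = 0 \<and> e = f + g \<longrightarrow> f = 0 \<or> g = 0"
   by (intro allI impI) (elim conjE, assumption)
  then show ?thesis unfolding primitive_def by (intro conjI orthogonal_systemD(3-5)[OF E(1) e])
 qed
 then show thesis using that E(1) by blast
qed

text \<open>If a character has value 1 at \<open>e\<close>, let x be the element with value 1 at
  this character and 0 at the others. The corner element e x e lifts to a nonzero idempotent f below
  \<open>e\<close>, primitivity leaves no room for e - f, and so \<open>e\<close> has the character
  values of f.\<close>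

lemma primitive_character:
 assumes "primitive e"
 obtains p where "p \<in> P" "\<And>q. q \<in> P \<Longrightarrow> ch q e = (if q = p then 1 else 0)"
proof -
 have e: "e \<in> S" "e * e = e" "e \<noteq> 0" using assms by (simp_all add: primitive_def)
 obtain p where p: "p \<in> P" "ch p e = 1" using idempotent_character[OF e] .
 obtain x where x: "x \<in> S" "\<And>q. q \<in> P \<Longrightarrow> ch q x = (if q = p then 1 else 0)"
  using character_delta[OF p(1)] by blast
 have exe: "ch q (e * x * e) = (if q = p then 1 else 0)" if "q \<in> P" for q
  using that p(2) by (simp add: ch_mult S_mult e x)
 obtain f where f: "f \<in> S" "f * f = f" "e * f = f" "f * e = f" "\<And>q. q \<in> P \<Longrightarrow> ch q f = ch q (e * x * e)"
 proof (rule lift_idempotent[of "e * x * e" e])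
  show "e * x * e \<in> S" by (simp add: S_mult e x)
  show "e * (e * x * e) = e * x * e" "e * x * e * e = e * x * e"
   using e(2) by (simp_all add: mult.assoc) (simp_all add: mult.assoc[symmetric])
 qed (use exe in auto)
 let ?g = "e - f"
 have g: "?g \<in> S" "?g * ?g = ?g" "f * ?g = 0" "?g * f = 0" "e = f + ?g"
  using f e by (simp_all add: S_diff left_diff_distrib right_diff_distrib)
 have "f \<noteq> 0" using f(5)[OF p(1)] exe[OF p(1)] ch_0[OF p(1)] by auto
 then have "?g = 0" using assms f(1,2) g unfolding primitive_def by blast
 then have "ch q e = (if q = p then 1 else 0)" if "q \<in> P" for q
  using f(5)[OF that] exe[OF that] by simp
 then show thesis using that p(1) by blast
qed

definition label :: "'r \<Rightarrow> 'p" where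
 "label e = (THE p. p \<in> P \<and> ch p e = 1)"

lemma label:
 assumes "primitive e"
 shows "label e \<in> P" "q \<in> P \<Longrightarrow> ch q e = (if q = label e then 1 else 0)"
proof -
 obtain p where p: "p \<in> P" "\<And>q. q \<in> P \<Longrightarrow> ch q e = (if q = p then 1 else 0)"
  using primitive_character[OF assms] by blast
 have "label e = p" unfolding label_def
  by (rule the_equality) (use p in \<open>auto split: if_splits\<close>)
 then show "label e \<in> P" "q \<in> P \<Longrightarrow> ch q e = (if q = label e then 1 else 0)" using p by simp_all
qed

text \<open>Injectivity is the orthogonality argument again. If some \<open>p\<close> were no label,
  the character at \<open>p\<close> would vanish on every member and thus on their sum 1.\<close>

lemma label_bij:
 assumes fin: "finite E" and prim: "\<And>e. e \<in> E \<Longrightarrow> primitive e"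
  and orth: "\<And>e f. e \<in> E \<Longrightarrow> f \<in> E \<Longrightarrow> e \<noteq> f \<Longrightarrow> e * f = 0" and one: "\<Sum>E = 1"
 shows "bij_betw label E P"
proof -
 have ES: "e \<in> S" if "e \<in> E" for e using prim[OF that] by (simp add: primitive_def)
 have inj: "inj_on label E"
 proof (rule inj_onI, rule ccontr)
  fix e f assume ef: "e \<in> E" "f \<in> E" "label e = label f" "e \<noteq> f"
  note le = label[OF prim[OF ef(1)]] and lf = label[OF prim[OF ef(2)]]
  have "ch (label e) (e * f) = 1"
   using ch_mult[OF le(1) ES[OF ef(1)] ES[OF ef(2)]] le lf ef(3) by simp
  then show False using orth[OF ef(1,2,4)] ch_0[OF le(1)] by simp
 qed
 have "p \<in> label ` E" if p: "p \<in> P" for p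
 proof (rule ccontr)
  assume no: "p \<notin> label ` E"
  have "ch p (\<Sum>F) = 0 \<and> \<Sum>F \<in> S" if "F \<subseteq> E" for F
  proof -
   have "finite F" using that fin by (rule finite_subset)
   then show ?thesis using that
   proof (induction F rule: finite_induct)
    case (insert e F)
    then have e: "e \<in> E" "p \<noteq> label e" using no by auto
    have "ch p e = 0" using label(2)[OF prim[OF e(1)] p] e(2) by simp
    then show ?case using insert ES[OF e(1)] by (simp add: ch_add[OF p] S_add)
   qed (simp add: ch_0[OF p] S_0)
  qed
  then have "ch p 1 = 0" using one by (metis subset_refl)
  then show False using ch_1[OF p] by simp
 qed
 then have "label ` E = P" using label(1)[OF prim] by auto
 then show ?thesis using inj by (simp add: bij_betw_def)
qed

end

section \<open>The quiver of an algebra with separating characters\<close>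

lemma multigraph_iso:
 assumes bij: "bij_betw \<theta> E V" and N: "\<And>x y. x \<in> E \<Longrightarrow> y \<in> E \<Longrightarrow> M x y = N (\<theta> x) (\<theta> y)"
 shows "digraph_iso (multigraph E M) (multigraph V N)"
proof -
 let ?G = "multigraph E M" and ?H = "multigraph V N"
 let ?f = "\<lparr>iso_verts = \<theta>, iso_arcs = (\<lambda>(x, y, i). (\<theta> x, \<theta> y, i)), iso_head = head ?H, iso_tail = tail ?H\<rparr>"
 have inj: "\<theta> x = \<theta> y \<longleftrightarrow> x = y" if "x \<in> E" "y \<in> E" for x y
  using bij that by (auto simp: bij_betw_def inj_on_def)
 have img: "\<theta> ` E = V" using bij by (simp add: bij_betw_def)
 have "pre_digraph.digraph_isomorphism ?G ?f"
  unfolding pre_digraph.digraph_isomorphism_def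
 proof (intro conjI)
  show "wf_digraph ?G" by unfold_locales (auto simp: multigraph_def)
  show "inj_on (iso_verts ?f) (verts ?G)" using bij by (simp add: multigraph_def bij_betw_def)
  show "inj_on (iso_arcs ?f) (arcs ?G)"
   by (rule inj_onI) (auto simp: multigraph_def inj)
 qed (auto simp: multigraph_def)
 moreover have "?H = app_iso ?f ?G"
 proof (rule pre_digraph.equality)
  show "arcs ?H = arcs (app_iso ?f ?G)"
  proof (rule equalityI; rule subsetI)
   fix a assume "a \<in> arcs ?H"
   then obtain p q i where a: "a = (p, q, i)" "p \<in> V" "q \<in> V" "i < N p q" by (auto simp: multigraph_def)
   then obtain x y where xy: "x \<in> E" "y \<in> E" "p = \<theta> x" "q = \<theta> y" using img by blast
   then have "(x, y, i) \<in> arcs ?G" using a N[OF xy(1,2)] by (simp add: multigraph_def)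
   then show "a \<in> arcs (app_iso ?f ?G)" unfolding arcs_app_iso by (rule rev_image_eqI) (simp add: a xy)
  next
   fix a assume "a \<in> arcs (app_iso ?f ?G)"
   then obtain x y i where a: "a = (\<theta> x, \<theta> y, i)" "x \<in> E" "y \<in> E" "i < M x y" by (auto simp: multigraph_def)
   then show "a \<in> arcs ?H" using img N[of x y] by (auto simp: multigraph_def)
  qed
  show "verts ?H = verts (app_iso ?f ?G)" using img by (simp add: multigraph_def)
 qed (simp_all add: multigraph_def)
 ultimately show ?thesis unfolding digraph_iso_def by blast
qed

text \<open>\<open>A\<close> is a record algebra and \<open>S\<close> its isomorphic image in a type
  class ring, where identities are easier to compute. The map \<open>h\<close> carries the ring
  structure, \<open>sc\<close> corresponds to the scalars, and \<open>co\<close> supplies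
  coordinates and hence the dimension.\<close>

locale split_model = split_ring S P ch
 for S :: "'r::ring_1 set" and P :: "'p set" and ch :: "'p \<Rightarrow> 'r \<Rightarrow> 'k::field" +
 fixes A :: "('k, 'a, 'm) module_scheme" (structure) and h :: "'a \<Rightarrow> 'r"
  and sc :: "'k \<Rightarrow> 'r \<Rightarrow> 'r" and I :: "'i set" and co :: "'r \<Rightarrow> 'i \<Rightarrow> 'k"
 assumes h_bij: "bij_betw h (carrier A) S"
  and closed: "\<zero> \<in> carrier A" "\<one> \<in> carrier A"
   "\<And>x y. x \<in> carrier A \<Longrightarrow> y \<in> carrier A \<Longrightarrow> x \<oplus> y \<in> carrier A"
   "\<And>x y. x \<in> carrier A \<Longrightarrow> y \<in> carrier A \<Longrightarrow> x \<otimes> y \<in> carrier A"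
   "\<And>c x. x \<in> carrier A \<Longrightarrow> c \<odot> x \<in> carrier A"
  and h_zero: "h \<zero> = 0" and h_one: "h \<one> = 1"
  and h_add: "\<And>x y. x \<in> carrier A \<Longrightarrow> y \<in> carrier A \<Longrightarrow> h (x \<oplus> y) = h x + h y"
  and h_mult: "\<And>x y. x \<in> carrier A \<Longrightarrow> y \<in> carrier A \<Longrightarrow> h (x \<otimes> y) = h x * h y"
  and h_smult: "\<And>c x. x \<in> carrier A \<Longrightarrow> h (c \<odot> x) = sc c (h x)"
  and sc_mult_left: "\<And>c a b. sc c a * b = sc c (a * b)"
  and sc_mult_right: "\<And>c a b. a * sc c b = sc c (a * b)"
  and ch_sc: "\<And>p c a. p \<in> P \<Longrightarrow> a \<in> S \<Longrightarrow> ch p (sc c a) = c * ch p a"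
  and finI: "finite I" and co_bij: "bij_betw co S {g. \<forall>i. i \<notin> I \<longrightarrow> g i = 0}"
  and co_zero: "co 0 i = 0"
  and co_add: "\<And>a b. a \<in> S \<Longrightarrow> b \<in> S \<Longrightarrow> co (a + b) i = co a i + co b i"
  and co_sc: "\<And>c a. a \<in> S \<Longrightarrow> co (sc c a) i = c * co a i"
begin

abbreviation KK :: "'k ring" where "KK \<equiv> ring_of_type_algebra"

lemma coordinates_A: "coordinates A I (\<lambda>x. co (h x))"
proof
 show "bij_betw (\<lambda>x. co (h x)) (carrier A) {g. \<forall>i. i \<notin> I \<longrightarrow> g i = 0}"
  using bij_betw_trans[OF h_bij co_bij] by (simp add: comp_def)
 have hS: "h x \<in> S" if "x \<in> carrier A" for x using h_bij that by (auto simp: bij_betw_def)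
 then show "co (h (x \<oplus> y)) i = co (h x) i + co (h y) i" if "x \<in> carrier A" "y \<in> carrier A" for x y i
  using that by (simp add: h_add co_add)
 show "co (h (c \<odot> x)) i = c * co (h x) i" if "x \<in> carrier A" for c x i
  using that by (simp add: h_smult co_sc hS)
qed (simp_all add: finI closed h_zero co_zero)

lemma h_S: "x \<in> carrier A \<Longrightarrow> h x \<in> S"
 using h_bij by (auto simp: bij_betw_def)

lemma h_inj: "x \<in> carrier A \<Longrightarrow> y \<in> carrier A \<Longrightarrow> h x = h y \<Longrightarrow> x = y"
 using h_bij by (auto simp: bij_betw_def inj_on_def)

lemma h_surj:
 assumes "s \<in> S"
 obtains x where "x \<in> carrier A" "h x = s"
proof -
 have "s \<in> h ` carrier A" using h_bij assms by (simp add: bij_betw_def)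
 then show thesis using that by blast
qed

lemma ring_A: "ring A"
proof (rule ringI)
 show "abelian_group A" by (rule coordinates.abelian_group_V[OF coordinates_A])
 show "monoid A"
  by (rule monoidI) (auto intro!: h_inj simp: closed h_mult h_one mult.assoc)
qed (auto intro!: h_inj simp: closed h_mult h_add distrib_left distrib_right)

sublocale R: ring A by (rule ring_A)

lemma h_uminus: "x \<in> carrier A \<Longrightarrow> h (\<ominus> x) = - h x"
 using h_add[of "\<ominus> x" x] by (simp add: h_zero R.l_neg eq_neg_iff_add_eq_0)

lemma h_minus: "x \<in> carrier A \<Longrightarrow> y \<in> carrier A \<Longrightarrow> h (x \<ominus> y) = h x - h y"
 by (simp add: a_minus_def h_add h_uminus)

lemma h_finsum: "finite E \<Longrightarrow> f \<in> E \<rightarrow> carrier A \<Longrightarrow> h (finsum A f E) = (\<Sum>e\<in>E. h (f e))"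
proof (induction E rule: finite_induct)
 case (insert b B)
 have "f \<in> B \<rightarrow> carrier A" "f b \<in> carrier A" using insert.prems by auto
 then show ?case using insert by (simp add: h_add)
qed (simp add: h_zero)

text \<open>Scalars act through multiples of the unit, which makes all left ideals closed under
  scalar multiplication.\<close>

lemma smult_eq_mult: "x \<in> carrier A \<Longrightarrow> c \<odot> x = (c \<odot> \<one>) \<otimes> x"
 by (rule h_inj) (simp_all add: closed h_smult h_mult h_one sc_mult_left)

lemma fin_dim_algebra_A: "fin_dim_algebra KK A"
proof (rule fin_dim_algebra.intro)
 show "vectorspace KK A" by (rule coordinates.vectorspace_V[OF coordinates_A])
 show "ring A" by (rule ring_A)
 show "fin_dim_algebra_axioms KK A"
  by unfold_locales
   (auto intro!: h_inj simp: closed h_smult h_mult sc_mult_left sc_mult_right coordinates.fin_dim_V[OF coordinates_A])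
qed

lemma additive_subgroup_pullback:
 assumes "0 \<in> T" "\<And>a b. a \<in> T \<Longrightarrow> b \<in> T \<Longrightarrow> a - b \<in> T"
 shows "additive_subgroup {x \<in> carrier A. h x \<in> T} A"
proof (rule additive_subgroupI)
 have neg: "- a \<in> T" if "a \<in> T" for a using assms(2)[OF assms(1) that] by simp
 have add: "a + b \<in> T" if "a \<in> T" "b \<in> T" for a b using assms(2)[OF that(1) neg[OF that(2)]] by simp
 show "subgroup {x \<in> carrier A. h x \<in> T} (add_monoid A)"
 proof (rule R.add.subgroupI)
  show "{x \<in> carrier A. h x \<in> T} \<noteq> {}" using closed(1) h_zero assms(1) by auto
 qed (auto simp: h_uminus h_add neg add)
qed

text \<open>The kernel has codimension one: given b outside it, every a differs from a scalar
  multiple of b by an element of the kernel.\<close>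

lemma kernel_maximal:
 assumes p: "p \<in> P"
 shows "maximal_left_ideal {x \<in> carrier A. ch p (h x) = 0} A" (is "maximal_left_ideal ?M A")
proof -
 have eq: "?M = {x \<in> carrier A. h x \<in> {a \<in> S. ch p a = 0}}" using h_S by auto
 have "additive_subgroup ?M A" unfolding eq
  by (rule additive_subgroup_pullback) (auto simp: S_0 S_diff ch_0 ch_diff p)
 then have M: "left_ideal ?M A"
  unfolding left_ideal_def by (auto simp: h_mult ch_mult p h_S)
 have "\<one> \<notin> ?M" by (simp add: h_one ch_1 p)
 then have ne: "?M \<noteq> carrier A" using closed(2) by blast
 have "L = ?M \<or> L = carrier A" if L: "left_ideal L A" "?M \<subseteq> L" for L
 proof (rule disjCI)
  assume "L \<noteq> carrier A"
  show "L = ?M"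
  proof (rule ccontr)
   assume "L \<noteq> ?M"
   have sub: "additive_subgroup L A" and mult: "\<And>a x. a \<in> carrier A \<Longrightarrow> x \<in> L \<Longrightarrow> a \<otimes> x \<in> L"
    using L(1) by (simp_all add: left_ideal_def)
   interpret L: additive_subgroup L A by (rule sub)
   obtain b where b: "b \<in> L" "b \<notin> ?M" using \<open>L \<noteq> ?M\<close> L(2) by blast
   have bc: "b \<in> carrier A" using b(1) L.a_subset by blast
   have nz: "ch p (h b) \<noteq> 0" using b(2) bc by simp
   have "a \<in> L" if a: "a \<in> carrier A" for a
   proof -
    define u where "u = (ch p (h a) / ch p (h b)) \<odot> b"
    have u: "u \<in> carrier A" by (simp add: u_def closed bc)
    have "u \<in> L" unfolding u_def smult_eq_mult[OF bc] by (rule mult) (simp_all add: closed b)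
    moreover have "a \<ominus> u \<in> ?M"
     using nz a u bc p by (simp add: h_minus ch_diff h_S) (simp add: u_def h_smult ch_sc h_S)
    then have "a \<ominus> u \<in> L" using L(2) by blast
    ultimately have "(a \<ominus> u) \<oplus> u \<in> L" by simp
    moreover have "(a \<ominus> u) \<oplus> u = a" using a u by (intro h_inj) (simp_all add: h_add h_minus)
    ultimately show ?thesis by simp
   qed
   then show False using \<open>L \<noteq> carrier A\<close> L.a_subset by blast
  qed
 qed
 then show ?thesis unfolding maximal_left_ideal_def using M ne by blast
qed

lemma geometric_sum: "(\<Sum>k<N. t ^ k) * (1 - t) = 1 - (t :: 'r) ^ N"
proof (induction N)
 case (Suc N)
 have "(\<Sum>k<Suc N. t ^ k) * (1 - t) = (\<Sum>k<N. t ^ k) * (1 - t) + (t ^ N - t ^ N * t)"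
  by (simp only: sum.lessThan_Suc distrib_right right_diff_distrib[of "t ^ N"] mult_1_right)
 also have "\<dots> = 1 - t ^ Suc N" unfolding Suc.IH power_Suc2 by simp
 finally show ?case .
qed simp

text \<open>If \<open>a\<close> were outside \<open>M\<close>, then M + A a would be everything, so
  1 = i + b a with i in \<open>M\<close>. Since b a lies in the nil kernel, a geometric series gives
  a left inverse of i = 1 - b a, which puts 1 into \<open>M\<close>.\<close>

lemma radical_in_maximal:
 assumes a: "a \<in> carrier A" "h a \<in> J" and M: "maximal_left_ideal M A"
 shows "a \<in> M"
proof (rule ccontr)
 assume "a \<notin> M"
 have sub: "additive_subgroup M A" and mult: "\<And>a x. a \<in> carrier A \<Longrightarrow> x \<in> M \<Longrightarrow> a \<otimes> x \<in> M"
  and ne: "M \<noteq> carrier A" and max: "\<And>L. left_ideal L A \<Longrightarrow> M \<subseteq> L \<Longrightarrow> L = M \<or> L = carrier A"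
  using M by (simp_all add: maximal_left_ideal_def left_ideal_def)
 interpret M: additive_subgroup M A by (rule sub)
 have Mc: "i \<in> carrier A" if "i \<in> M" for i using that M.a_subset by blast
 define L where "L = {i \<oplus> b \<otimes> a | i b. i \<in> M \<and> b \<in> carrier A}"
 have L_I: "x \<in> L" if "i \<in> M" "b \<in> carrier A" "x = i \<oplus> b \<otimes> a" for x i b
  using that unfolding L_def by blast
 have "left_ideal L A"
  unfolding left_ideal_def
 proof (intro conjI ballI)
  show "additive_subgroup L A"
  proof (rule additive_subgroupI, rule R.add.subgroupI)
   show "L \<subseteq> carrier A" unfolding L_def using Mc a(1) by auto
   show "L \<noteq> {}" using L_I[OF M.zero_closed closed(1)] by blast
   fix x assume "x \<in> L"
   then obtain i b where x: "x = i \<oplus> b \<otimes> a" "i \<in> M" "b \<in> carrier A" unfolding L_def by blast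
   have "\<ominus> x = (\<ominus> i) \<oplus> (\<ominus> b) \<otimes> a"
    unfolding x(1) using Mc[OF x(2)] x(3) a(1) by (intro h_inj) (simp_all add: h_add h_mult h_uminus)
   then show "\<ominus> x \<in> L" using x by (intro L_I[of "\<ominus> i" "\<ominus> b"]) simp_all
   fix y assume "y \<in> L"
   then obtain j c where y: "y = j \<oplus> c \<otimes> a" "j \<in> M" "c \<in> carrier A" unfolding L_def by blast
   have "x \<oplus> y = (i \<oplus> j) \<oplus> (b \<oplus> c) \<otimes> a"
    unfolding x(1) y(1) using Mc[OF x(2)] Mc[OF y(2)] x(3) y(3) a(1)
    by (intro h_inj) (simp_all add: h_add h_mult distrib_right)
   then show "x \<oplus> y \<in> L" using x y by (intro L_I[of "i \<oplus> j" "b \<oplus> c"]) simp_all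
  qed
  fix c x assume c: "c \<in> carrier A" and "x \<in> L"
  then obtain i b where x: "x = i \<oplus> b \<otimes> a" "i \<in> M" "b \<in> carrier A" unfolding L_def by blast
  have "c \<otimes> x = c \<otimes> i \<oplus> (c \<otimes> b) \<otimes> a"
   unfolding x(1) using Mc[OF x(2)] x(3) a(1) c by (intro h_inj) (simp_all add: h_add h_mult distrib_left mult.assoc)
  then show "c \<otimes> x \<in> L" using mult[OF c x(2)] c x(3) by (intro L_I[of "c \<otimes> i" "c \<otimes> b"]) simp_all
 qed
 moreover have "M \<subseteq> L"
 proof
  fix i assume i: "i \<in> M"
  have "i = i \<oplus> \<zero> \<otimes> a" using Mc[OF i] a(1) by simp
  then show "i \<in> L" using i by (intro L_I[of i \<zero>]) simp_all
 qed
 moreover have "a \<in> L" using a(1) by (intro L_I[of \<zero> \<one>]) simp_all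
 ultimately have "L = carrier A" using max \<open>a \<notin> M\<close> by blast
 then have "\<one> \<in> L" using closed(2) by simp
 then obtain i b where ib: "\<one> = i \<oplus> b \<otimes> a" "i \<in> M" "b \<in> carrier A" unfolding L_def by blast
 define t where "t = h b * h a"
 have t: "t \<in> J" unfolding t_def by (rule J_mult(1)[OF h_S[OF ib(3)] a(2)])
 obtain N where N: "t ^ N = 0" using J_nilpotent[OF t] by blast
 have "1 = h i + t" using arg_cong[OF ib(1), of h] Mc[OF ib(2)] ib(3) a(1) by (simp add: h_one h_add h_mult t_def)
 then have hi: "h i = 1 - t" by (simp add: algebra_simps)
 have pow: "t ^ k \<in> S" for k using t J_subset by (induction k) (auto simp: S_1 S_mult)
 have "(\<Sum>k<N. t ^ k) \<in> S" by (induction N) (simp_all add: S_0 S_add pow)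
 then obtain c where c: "c \<in> carrier A" "h c = (\<Sum>k<N. t ^ k)" by (rule h_surj)
 have "h (c \<otimes> i) = 1" using c Mc[OF ib(2)] N by (simp add: h_mult hi geometric_sum)
 then have "c \<otimes> i = \<one>" using c(1) Mc[OF ib(2)] by (intro h_inj) (simp_all add: h_one)
 then have one: "\<one> \<in> M" using mult[OF c(1) ib(2)] by simp
 have "x \<in> M" if "x \<in> carrier A" for x using mult[OF that one] that by simp
 then show False using ne M.a_subset by blast
qed

lemma jacobson_radical_A: "jacobson_radical A = {x \<in> carrier A. h x \<in> J}"
proof (rule equalityI; rule subsetI)
 fix a assume a: "a \<in> jacobson_radical A"
 then have ac: "a \<in> carrier A" by (simp add: jacobson_radical_def)
 have "ch p (h a) = 0" if p: "p \<in> P" for p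
 proof -
  have "a \<in> {x \<in> carrier A. ch p (h x) = 0}" using a kernel_maximal[OF p] unfolding jacobson_radical_def by blast
  then show ?thesis by simp
 qed
 then show "a \<in> {x \<in> carrier A. h x \<in> J}" using ac by (simp add: J_def h_S)
next
 fix a assume "a \<in> {x \<in> carrier A. h x \<in> J}"
 then show "a \<in> jacobson_radical A" unfolding jacobson_radical_def using radical_in_maximal by blast
qed

lemma primitive_A: "primitive_idempotent A e \<longleftrightarrow> e \<in> carrier A \<and> primitive (h e)"
proof
 assume e: "primitive_idempotent A e"
 then have ec: "e \<in> carrier A" "e \<otimes> e = e" "e \<noteq> \<zero>" by (auto simp: primitive_idempotent_def idempotent_elem_def)
 have "h e * h e = h e" using arg_cong[OF ec(2), of h] ec(1) by (simp add: h_mult)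
 moreover have "h e \<noteq> 0" using ec h_inj[OF ec(1) closed(1)] by (auto simp: h_zero)
 moreover have "f = 0 \<or> g = 0"
  if fg: "f \<in> S" "f * f = f" "g \<in> S" "g * g = g" "f * g = 0" "g * f = 0" "h e = f + g" for f g
 proof -
  obtain f' where f': "f' \<in> carrier A" "h f' = f" using h_surj[OF fg(1)] .
  obtain g' where g': "g' \<in> carrier A" "h g' = g" using h_surj[OF fg(3)] .
  have "f' \<otimes> f' = f'" "g' \<otimes> g' = g'" "f' \<otimes> g' = \<zero>" "g' \<otimes> f' = \<zero>" "e = f' \<oplus> g'"
   using f' g' fg ec(1) by (auto intro!: h_inj simp: h_mult h_add h_zero)
  then have "f' = \<zero> \<or> g' = \<zero>" using e f'(1) g'(1) unfolding primitive_idempotent_def idempotent_elem_def by blast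
  then show ?thesis using f'(2) g'(2) h_zero by auto
 qed
 ultimately show "e \<in> carrier A \<and> primitive (h e)" unfolding primitive_def using ec(1) h_S by blast
next
 assume e: "e \<in> carrier A \<and> primitive (h e)"
 then have ec: "e \<in> carrier A" "h e * h e = h e" "h e \<noteq> 0" by (auto simp: primitive_def)
 have "e \<otimes> e = e" using ec by (intro h_inj) (simp_all add: h_mult)
 moreover have "e \<noteq> \<zero>" using ec(3) h_zero by auto
 moreover have "f = \<zero> \<or> g = \<zero>"
  if fg: "f \<in> carrier A" "f \<otimes> f = f" "g \<in> carrier A" "g \<otimes> g = g" "f \<otimes> g = \<zero>" "g \<otimes> f = \<zero>" "e = f \<oplus> g" for f g
 proof -
  have "h f * h f = h f" "h g * h g = h g" "h f * h g = 0" "h g * h f = 0" "h e = h f + h g"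
   using fg by (simp_all add: h_add h_zero flip: h_mult)
  then have "h f = 0 \<or> h g = 0" using e h_S[OF fg(1)] h_S[OF fg(3)] unfolding primitive_def by blast
  then show ?thesis using h_inj[OF fg(1) closed(1)] h_inj[OF fg(3) closed(1)] h_zero by auto
 qed
 ultimately show "primitive_idempotent A e"
  unfolding primitive_idempotent_def idempotent_elem_def using ec(1) by blast
qed

lemma system_label_bij:
 assumes "complete_idempotent_system A E"
 shows "bij_betw (\<lambda>e. label (h e)) E P"
proof -
 have E: "finite E" "\<And>e. e \<in> E \<Longrightarrow> e \<in> carrier A \<and> primitive (h e)"
  "\<And>e f. e \<in> E \<Longrightarrow> f \<in> E \<Longrightarrow> e \<noteq> f \<Longrightarrow> e \<otimes> f = \<zero>" "(\<Oplus>e\<in>E. e) = \<one>"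
  using assms by (simp_all add: complete_idempotent_system_def primitive_A)
 have inj: "inj_on h E" using E(2) h_inj by (intro inj_onI) blast
 have "bij_betw label (h ` E) P"
 proof (rule label_bij)
  show "finite (h ` E)" using E(1) by simp
  show "primitive e" if "e \<in> h ` E" for e using that E(2) by auto
  show "e * f = 0" if ef: "e \<in> h ` E" "f \<in> h ` E" "e \<noteq> f" for e f
  proof -
   obtain e' f' where e': "e' \<in> E" "e = h e'" "f' \<in> E" "f = h f'" using ef by blast
   then have "e' \<otimes> f' = \<zero>" using E(3) ef(3) by blast
   then show ?thesis using e' E(2) by (metis h_mult h_zero)
  qed
  have "(\<Sum>e\<in>E. h e) = h \<one>" unfolding E(4)[symmetric] by (rule h_finsum[symmetric]) (use E in auto)
  then show "\<Sum>(h ` E) = 1" by (simp add: sum.reindex[OF inj] h_one)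
 qed
 from bij_betw_trans[OF inj_on_imp_bij_betw[OF inj] this] show ?thesis by (simp add: comp_def)
qed

lemma system_exists: "\<exists>E. complete_idempotent_system A E"
proof -
 obtain E' where E': "orthogonal_system E'" "\<And>e. e \<in> E' \<Longrightarrow> primitive e" using primitive_system_exists by blast
 note O = orthogonal_systemD[OF E'(1)]
 define E where "E = {x \<in> carrier A. h x \<in> E'}"
 have inj: "inj_on h E" unfolding E_def by (rule inj_onI) (auto intro: h_inj)
 have img: "h ` E = E'"
 proof (rule equalityI; rule subsetI)
  fix e assume e: "e \<in> E'"
  obtain x where "x \<in> carrier A" "h x = e" using h_surj[OF O(3)[OF e]] .
  then show "e \<in> h ` E" using e by (intro rev_image_eqI[of x]) (simp_all add: E_def)
 qed (auto simp: E_def)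
 have fin: "finite E" using O(1) by (rule inj_on_finite[OF inj, rotated]) (simp add: img)
 have "(\<Oplus>e\<in>E. e) = \<one>"
 proof (rule h_inj)
  have "h (\<Oplus>e\<in>E. e) = (\<Sum>e\<in>E. h e)" by (rule h_finsum[OF fin]) (auto simp: E_def)
  also have "\<dots> = \<Sum>E'" unfolding img[symmetric] by (simp add: sum.reindex[OF inj])
  finally show "h (\<Oplus>e\<in>E. e) = h \<one>" by (simp add: O(2) h_one)
  show "(\<Oplus>e\<in>E. e) \<in> carrier A" by (rule R.finsum_closed) (auto simp: E_def)
 qed (simp add: closed)
 moreover have "\<forall>e\<in>E. primitive_idempotent A e" by (auto simp: E_def primitive_A E'(2))
 moreover have "e \<otimes> f = \<zero>" if "e \<in> E" "f \<in> E" "e \<noteq> f" for e f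
 proof (rule h_inj)
  have "h e \<noteq> h f" using inj that by (auto simp: inj_on_def)
  then show "h (e \<otimes> f) = h \<zero>" using that O(6)[of "h e" "h f"] by (simp add: E_def h_mult h_zero)
 qed (use that in \<open>simp_all add: E_def closed\<close>)
 ultimately show ?thesis unfolding complete_idempotent_system_def using fin by blast
qed

end

context split_model
begin

section \<open>Quotient algebras and the split basic property\<close>

lemma quotient_simps [simp]:
 "carrier (quotient_algebra A M) = a_rcosets M"
 "Z \<otimes>\<^bsub>quotient_algebra A M\<^esub> Y = rcoset_mult A M Z Y"
 "Z \<oplus>\<^bsub>quotient_algebra A M\<^esub> Y = set_add A Z Y"
 "\<zero>\<^bsub>quotient_algebra A M\<^esub> = M"
 "\<one>\<^bsub>quotient_algebra A M\<^esub> = M +> \<one>"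
 "c \<odot>\<^bsub>quotient_algebra A M\<^esub> Z = (\<Union>x\<in>Z. M +> (c \<odot> x))"
 by (simp_all add: quotient_algebra_def ring.extend_def FactRing_def)

lemma coset_elem:
 assumes M: "ideal M A" and a: "a \<in> carrier A" and z: "z \<in> M +> a"
 shows "z \<in> carrier A" "z \<ominus> a \<in> M"
proof -
 interpret M: ideal M A by (rule M)
 obtain i where i: "i \<in> M" "z = i \<oplus> a" using z unfolding a_r_coset_def' by blast
 have ic: "i \<in> carrier A" using i(1) M.a_subset by blast
 show "z \<in> carrier A" using i(2) ic a by simp
 have "z \<ominus> a = i" unfolding i(2) using ic a by (intro h_inj) (simp_all add: h_minus h_add)
 then show "z \<ominus> a \<in> M" using i(1) by simp
qed

lemma coset_eq:
 assumes "ideal M A" "a \<in> carrier A" "b \<in> carrier A"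
 shows "M +> a = M +> b \<longleftrightarrow> a \<ominus> b \<in> M"
 using R.quotient_eq_iff_same_a_r_cos[OF assms] by blast

text \<open>Maps out of a quotient are defined below on a representative picked by
  \<open>SOME\<close>; this removes the choice whenever the map is constant on the coset.\<close>

lemma coset_rep:
 assumes M: "ideal M A" and a: "a \<in> carrier A"
  and f: "\<And>z. z \<in> carrier A \<Longrightarrow> z \<ominus> a \<in> M \<Longrightarrow> f z = f a"
 shows "f (SOME z. z \<in> M +> a) = f a"
proof -
 interpret M: ideal M A by (rule M)
 have "a \<in> M +> a" using a by (rule M.a_rcos_self)
 then have "(SOME z. z \<in> M +> a) \<in> M +> a" by (rule someI)
 then show ?thesis using coset_elem[OF M a] f by blast
qed

lemma coset_ops:
 assumes M: "ideal M A" and a: "a \<in> carrier A" and b: "b \<in> carrier A"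
 shows "set_add A (M +> a) (M +> b) = M +> (a \<oplus> b)" "rcoset_mult A M (M +> a) (M +> b) = M +> (a \<otimes> b)"
  "(\<Union>x\<in>M +> a. M +> (c \<odot> x)) = M +> (c \<odot> a)"
proof -
 interpret M: ideal M A by (rule M)
 show "set_add A (M +> a) (M +> b) = M +> (a \<oplus> b)" by (rule M.a_rcos_sum[OF a b])
 show "rcoset_mult A M (M +> a) (M +> b) = M +> (a \<otimes> b)" by (rule M.rcoset_mult_add[OF a b])
 have "M +> (c \<odot> x) = M +> (c \<odot> a)" if "x \<in> M +> a" for x
 proof -
  note x = coset_elem[OF M a that]
  have "c \<odot> x \<ominus> c \<odot> a = (c \<odot> \<one>) \<otimes> (x \<ominus> a)"
   using x(1) a by (intro h_inj) (simp_all add: closed smult_eq_mult[of x] smult_eq_mult[of a] h_minus h_mult right_diff_distrib)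
  moreover have "\<dots> \<in> M" by (rule M.I_l_closed[OF x(2)]) (simp add: closed)
  ultimately show ?thesis using x(1) a by (simp add: coset_eq[OF M] closed)
 qed
 moreover have "a \<in> M +> a" using a by (rule M.a_rcos_self)
 ultimately show "(\<Union>x\<in>M +> a. M +> (c \<odot> x)) = M +> (c \<odot> a)" by blast
qed

lemma coset_closed: "ideal M A \<Longrightarrow> a \<in> carrier A \<Longrightarrow> M +> a \<in> a_rcosets M"
 using R.a_rcosetsI ideal.axioms(1) additive_subgroup.a_subset by blast

lemma cosetE:
 assumes "Z \<in> a_rcosets M"
 obtains a where "a \<in> carrier A" "Z = M +> a"
 using assms unfolding A_RCOSETS_def' by blast

abbreviation rad :: "'a set" where "rad \<equiv> jacobson_radical A"

lemma J_0: "0 \<in> J" by (simp add: J_def S_0 ch_0)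

lemma J_diff: "a \<in> J \<Longrightarrow> b \<in> J \<Longrightarrow> a - b \<in> J" by (simp add: J_def S_diff ch_diff)

lemma rad_ideal: "ideal rad A"
proof (rule idealI)
 show "subgroup rad (add_monoid A)"
  unfolding jacobson_radical_A using additive_subgroup_pullback[of J] J_0 J_diff
  by (blast intro: additive_subgroup.a_subgroup)
qed (auto simp: jacobson_radical_A ring_A closed h_mult J_mult h_S)

lemma characters_onto: "\<exists>x\<in>S. \<forall>p\<in>P. ch p x = g p"
proof -
 \<comment> \<open>Stability of \<open>S\<close> under scalars is read off from the record algebra
   through \<open>h\<close>.\<close>
 have scS: "sc c a \<in> S" if a: "a \<in> S" for c a
 proof -
  obtain x where "x \<in> carrier A" "h x = a" using h_surj[OF a] .
  then show ?thesis using h_smult[of x c] h_S[OF closed(5)[of x c]] by simp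
 qed
 have "\<exists>x\<in>S. \<forall>p\<in>P. ch p x = (if p \<in> Q then g p else 0)" if "Q \<subseteq> P" for Q
 proof -
  have "finite Q" using that finP by (rule finite_subset)
  then show ?thesis using that
  proof (induction Q rule: finite_induct)
   case empty
   show ?case using S_0 ch_0 by auto
  next
   case (insert q Q)
   then obtain x where x: "x \<in> S" "\<forall>p\<in>P. ch p x = (if p \<in> Q then g p else 0)" by blast
   have q: "q \<in> P" using insert.prems by simp
   obtain z where z: "z \<in> S" "\<And>p. p \<in> P \<Longrightarrow> ch p z = (if p = q then 1 else 0)" using character_delta[OF q] by blast
   have "ch p (x + sc (g q) z) = (if p \<in> insert q Q then g p else 0)" if "p \<in> P" for p
    using that x z insert.hyps(2) by (auto simp: ch_add ch_sc scS)
   then show ?case using S_add[OF x(1) scS[OF z(1)]] by blast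
  qed
 qed
 from this[OF subset_refl] show ?thesis by simp
qed

text \<open>Evaluating all characters on a representative identifies the quotient by the radical
  with a product of copies of the field. The factors are numbered by an arbitrary enumeration
  \<open>en\<close> of \<open>P\<close>.\<close>

lemma split_basic_A: "split_basic KK A"
proof -
 let ?m = "card P"
 let ?B = "quotient_algebra A rad" and ?C = "product_algebra KK ?m"
 obtain en where en: "bij_betw en {..<?m} P" using ex_bij_betw_nat_finite[OF finP] by (auto simp: atLeast0LessThan)
 have enP: "en i \<in> P" if "i < ?m" for i using en that by (auto simp: bij_betw_def)
 have Pen: "\<exists>i<?m. p = en i" if "p \<in> P" for p using en that by (auto simp: bij_betw_def)
 define \<phi> where "\<phi> Z = (\<lambda>i\<in>{..<?m}. ch (en i) (h (SOME z. z \<in> Z)))" for Z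
 have val: "\<phi> (rad +> a) = (\<lambda>i\<in>{..<?m}. ch (en i) (h a))" if a: "a \<in> carrier A" for a
  unfolding \<phi>_def
 proof (rule restrict_ext)
  fix i assume "i \<in> {..<?m}"
  then have p: "en i \<in> P" using enP by simp
  show "ch (en i) (h (SOME z. z \<in> rad +> a)) = ch (en i) (h a)"
  proof (rule coset_rep[OF rad_ideal a, where f = "\<lambda>z. ch (en i) (h z)"])
   fix z assume z: "z \<in> carrier A" "z \<ominus> a \<in> rad"
   then have "ch (en i) (h z - h a) = 0" using p a by (simp add: jacobson_radical_A h_minus J_def)
   then show "ch (en i) (h z) = ch (en i) (h a)" using p z(1) a by (simp add: ch_diff h_S)
  qed
 qed
 have "\<phi> \<in> algebra_iso KK ?B ?C"
  unfolding algebra_iso_def ring_iso_def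
 proof (intro CollectI conjI ballI)
  show "\<phi> \<in> ring_hom ?B ?C"
  proof (rule ring_hom_memI)
   fix Z assume "Z \<in> carrier ?B"
   then obtain a where a: "a \<in> carrier A" "Z = rad +> a" by (auto elim: cosetE)
   show "\<phi> Z \<in> carrier ?C" unfolding a(2) val[OF a(1)] by (simp add: product_algebra_def)
   fix Y assume "Y \<in> carrier ?B"
   then obtain b where b: "b \<in> carrier A" "Y = rad +> b" by (auto elim: cosetE)
   show "\<phi> (Z \<otimes>\<^bsub>?B\<^esub> Y) = \<phi> Z \<otimes>\<^bsub>?C\<^esub> \<phi> Y"
    using a(1) b(1) by (auto simp: a(2) b(2) coset_ops[OF rad_ideal] val product_algebra_def closed h_mult ch_mult h_S enP)
   show "\<phi> (Z \<oplus>\<^bsub>?B\<^esub> Y) = \<phi> Z \<oplus>\<^bsub>?C\<^esub> \<phi> Y"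
    using a(1) b(1) by (auto simp: a(2) b(2) coset_ops[OF rad_ideal] val product_algebra_def closed h_add ch_add h_S enP)
  next
   show "\<phi> \<one>\<^bsub>?B\<^esub> = \<one>\<^bsub>?C\<^esub>" by (auto simp: val product_algebra_def closed h_one ch_1 enP)
  qed
  show "bij_betw \<phi> (carrier ?B) (carrier ?C)"
  proof (rule bij_betw_imageI, rule inj_onI, rule_tac [2] equalityI, rule_tac [2] subsetI, rule_tac [3] subsetI)
   fix Z Y assume ZY: "Z \<in> carrier ?B" "Y \<in> carrier ?B" "\<phi> Z = \<phi> Y"
   obtain a where a: "a \<in> carrier A" "Z = rad +> a" using ZY(1) by (auto elim: cosetE)
   obtain b where b: "b \<in> carrier A" "Y = rad +> b" using ZY(2) by (auto elim: cosetE)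
   have "ch p (h a) = ch p (h b)" if pP: "p \<in> P" for p
   proof -
    obtain i where i: "i < ?m" "p = en i" using Pen[OF pP] by blast
    have "\<phi> Z i = \<phi> Y i" using ZY(3) by simp
    then show ?thesis using i by (simp add: a b val)
   qed
   then have "a \<ominus> b \<in> rad" using a(1) b(1) by (simp add: jacobson_radical_A J_def h_minus h_S S_diff ch_diff)
   then show "Z = Y" by (simp add: a b coset_eq[OF rad_ideal])
  next
   fix g assume "g \<in> \<phi> ` carrier ?B"
   then obtain a where "a \<in> carrier A" "g = \<phi> (rad +> a)" by (auto elim: cosetE)
   then show "g \<in> carrier ?C" by (simp add: val product_algebra_def)
  next
   fix g assume "g \<in> carrier ?C"
   then have g: "g \<in> extensional {..<?m}" by (simp add: product_algebra_def PiE_def)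
   from characters_onto[of "\<lambda>p. g (the_inv_into {..<?m} en p)"]
   obtain s where s: "s \<in> S" "\<forall>p\<in>P. ch p s = g (the_inv_into {..<?m} en p)" ..
   obtain a where a: "a \<in> carrier A" "h a = s" using h_surj[OF s(1)] .
   have "\<phi> (rad +> a) = g"
   proof
    fix i
    show "\<phi> (rad +> a) i = g i"
    proof (cases "i < ?m")
     case True
     have "the_inv_into {..<?m} en (en i) = i"
      by (rule the_inv_into_f_f[OF bij_betw_imp_inj_on[OF en]]) (simp add: True)
     then show ?thesis using bspec[OF s(2) enP[OF True]] True by (simp add: val[OF a(1)] a(2))
    next
     case False
     then show ?thesis using extensional_arb[OF g, of i] by (simp add: val[OF a(1)])
    qed
   qed
   then show "g \<in> \<phi> ` carrier ?B" using coset_closed[OF rad_ideal a(1)] by (intro rev_image_eqI[of "rad +> a"]) simp_all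
  qed
  fix c Z assume "Z \<in> carrier ?B"
  then obtain a where a: "a \<in> carrier A" "Z = rad +> a" by (auto elim: cosetE)
  show "\<phi> (c \<odot>\<^bsub>?B\<^esub> Z) = c \<odot>\<^bsub>?C\<^esub> \<phi> Z"
   using a(1) by (auto simp: a(2) coset_ops[OF rad_ideal] val product_algebra_def closed h_smult ch_sc h_S enP)
 qed
 then show ?thesis unfolding split_basic_def using fin_dim_algebra_A by blast
qed

lemma square_ideal: "ideal (radical_square A) A"
 by (rule R.ideal_prod_is_ideal[OF rad_ideal rad_ideal])

lemma square_subset: "s \<in> radical_square A \<Longrightarrow> s \<in> carrier A"
 using additive_subgroup.a_subset[OF ideal.axioms(1)[OF square_ideal]] by blast

lemma arrow_space_A:
 assumes "e \<in> carrier A" "f \<in> carrier A"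
 shows "arrow_space A e f = {radical_square A +> (f \<otimes> r \<otimes> e) | r. r \<in> rad}"
proof -
 let ?M = "radical_square A"
 have eq: "rcoset_mult A ?M (rcoset_mult A ?M (?M +> f) (?M +> r)) (?M +> e) = ?M +> (f \<otimes> r \<otimes> e)" if "r \<in> rad" for r
 proof -
  have "r \<in> carrier A" using that by (simp add: jacobson_radical_A)
  then show ?thesis using assms by (simp add: coset_ops[OF square_ideal] closed)
 qed
 show ?thesis
  unfolding arrow_space_def Let_def quotient_simps
 proof (intro Collect_cong ex_cong1)
  fix Z r
  show "Z = rcoset_mult A ?M (rcoset_mult A ?M (?M +> f) (?M +> r)) (?M +> e) \<and> r \<in> rad
    \<longleftrightarrow> Z = ?M +> (f \<otimes> r \<otimes> e) \<and> r \<in> rad"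
   using eq[of r] by (cases "r \<in> rad") simp_all
 qed
qed

end

text \<open>For a source idempotent x and a target y with label q, the functionals
  \<open>d x q v\<close> with \<open>v\<close> in \<open>V (label x) q\<close> are to be coordinates
  on y (J / J^2) x. By \<open>d_left\<close> they vanish on J^2, by \<open>d_dual\<close> they are
  independent, and by \<open>d_upper\<close> they are jointly injective. The last condition is
  phrased with an arbitrary additively closed \<open>Q\<close> that contains all products of two
  elements of \<open>J\<close>, so that it fits the ideal product of the record ring and the linear
  span in the concrete ring alike.\<close>

locale quiver_model = split_model S P ch A h sc I co
 for S :: "'r::ring_1 set" and P :: "'p set" and ch :: "'p \<Rightarrow> 'r \<Rightarrow> 'k::field"
  and A :: "('k, 'a, 'm) module_scheme" (structure) and h :: "'a \<Rightarrow> 'r"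
  and sc :: "'k \<Rightarrow> 'r \<Rightarrow> 'r" and I :: "'i set" and co :: "'r \<Rightarrow> 'i \<Rightarrow> 'k" +
 fixes V :: "'p \<Rightarrow> 'p \<Rightarrow> 'v set" and d :: "'r \<Rightarrow> 'p \<Rightarrow> 'v \<Rightarrow> 'r \<Rightarrow> 'k"
 assumes V_finite: "finite (V p q)"
  and d_add: "\<And>x q v a b. d x q v (a + b) = d x q v a + d x q v b"
  and d_sc: "\<And>x q v c a. d x q v (sc c a) = c * d x q v a"
  and d_left: "\<And>x q v a r. primitive x \<Longrightarrow> q \<in> P \<Longrightarrow> v \<in> V (label x) q \<Longrightarrow> a \<in> S \<Longrightarrow> r \<in> J \<Longrightarrow>
    d x q v (a * r) = ch q a * d x q v r"
  and d_right: "\<And>x q v r. primitive x \<Longrightarrow> d x q v (r * x) = d x q v r"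
  and d_dual: "\<And>x q v. primitive x \<Longrightarrow> q \<in> P \<Longrightarrow> v \<in> V (label x) q \<Longrightarrow>
    \<exists>r\<in>J. \<forall>v'\<in>V (label x) q. d x q v' r = (if v' = v then 1 else 0)"
  and d_upper: "\<And>x y r Q. primitive x \<Longrightarrow> primitive y \<Longrightarrow> r \<in> J \<Longrightarrow>
    (\<And>v. v \<in> V (label x) (label y) \<Longrightarrow> d x (label y) v r = 0) \<Longrightarrow> 0 \<in> Q \<Longrightarrow>
    (\<And>a b. a \<in> Q \<Longrightarrow> b \<in> Q \<Longrightarrow> a + b \<in> Q) \<Longrightarrow> (\<And>a b. a \<in> J \<Longrightarrow> b \<in> J \<Longrightarrow> a * b \<in> Q) \<Longrightarrow> y * r * x \<in> Q"
begin

lemma d_zero: "d x q v 0 = 0"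
 by (metis add_0_right add_left_cancel d_add)

lemma d_diff: "d x q v (a - b) = d x q v a - d x q v b"
 using d_add[of x q v "a - b" b] by simp

lemma d_square:
 assumes "primitive x" "q \<in> P" "v \<in> V (label x) q" "s \<in> radical_square A"
 shows "d x q v (h s) = 0"
 using assms(4)
proof (induction rule: ideal_prod.induct)
 case (prod i j)
 then have ij: "i \<in> carrier A" "h i \<in> J" "j \<in> carrier A" "h j \<in> J" by (simp_all add: jacobson_radical_A)
 have "ch q (h i) = 0" using ij(2) assms(2) by (simp add: J_def)
 then show ?case using d_left[OF assms(1-3) h_S[OF ij(1)] ij(4)] by (simp add: h_mult ij)
next
 case (sum s1 s2)
 then show ?case by (simp add: h_add square_subset d_add)
qed

text \<open>The class of f r e is sent to the values of the functionals at r. The outer factors may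
  be dropped: f acts by its character value 1 at its own label, and e is absorbed by
  \<open>d_right\<close>.\<close>

lemma arrow_number_A:
 assumes e: "e \<in> carrier A" "primitive (h e)" and f: "f \<in> carrier A" "primitive (h f)"
 shows "arrow_number KK A e f = card (V (label (h e)) (label (h f)))"
proof -
 let ?M = "radical_square A" and ?x = "h e" and ?q = "label (h f)"
 let ?V = "V (label ?x) ?q"
 let ?B = "quotient_algebra A ?M\<lparr>carrier := arrow_space A e f\<rparr>"
 define H where "H Z v = (if v \<in> ?V then d ?x ?q v (h (SOME z. z \<in> Z)) else 0)" for Z v
 have q: "?q \<in> P" by (rule label(1)[OF f(2)])
 have radc: "r \<in> carrier A" "h r \<in> J" if "r \<in> rad" for r using that by (simp_all add: jacobson_radical_A)
 have fre: "f \<otimes> r \<otimes> e \<in> carrier A" if "r \<in> rad" for r using that e f by (simp add: radc closed)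
 have val: "H (?M +> (f \<otimes> r \<otimes> e)) v = (if v \<in> ?V then d ?x ?q v (h r) else 0)" if r: "r \<in> rad" for r v
 proof (cases "v \<in> ?V")
  case True
  have "d ?x ?q v (h (SOME z. z \<in> ?M +> (f \<otimes> r \<otimes> e))) = d ?x ?q v (h (f \<otimes> r \<otimes> e))"
  proof (rule coset_rep[OF square_ideal fre[OF r], where f = "\<lambda>z. d ?x ?q v (h z)"])
   fix z assume z: "z \<in> carrier A" "z \<ominus> f \<otimes> r \<otimes> e \<in> ?M"
   have "d ?x ?q v (h (z \<ominus> f \<otimes> r \<otimes> e)) = 0" by (rule d_square[OF e(2) q True z(2)])
   then show "d ?x ?q v (h z) = d ?x ?q v (h (f \<otimes> r \<otimes> e))"
    using z(1) fre[OF r] by (simp add: h_minus d_diff)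
  qed
  also have "\<dots> = d ?x ?q v (h f * (h r * ?x))" using e f r by (simp add: h_mult radc closed mult.assoc)
  also have "\<dots> = d ?x ?q v (h r * ?x)"
   using d_left[OF e(2) q True h_S[OF f(1)] J_mult(2)[OF radc(2)[OF r] h_S[OF e(1)]]] label(2)[OF f(2) q] by simp
  also have "\<dots> = d ?x ?q v (h r)" by (rule d_right[OF e(2)])
  finally show ?thesis using True by (simp add: H_def)
 qed (simp add: H_def)
 note sp = arrow_space_A[OF e(1) f(1)]
 have elim: "\<exists>r. r \<in> rad \<and> Z = ?M +> (f \<otimes> r \<otimes> e)" if "Z \<in> carrier ?B" for Z using that by (auto simp: sp)
 have intro: "?M +> (f \<otimes> r \<otimes> e) \<in> carrier ?B" if "r \<in> rad" for r using that by (auto simp: sp)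
 interpret rad: ideal rad A by (rule rad_ideal)
 have rad0: "\<zero> \<in> rad" by simp
 interpret sq: ideal ?M A by (rule square_ideal)
 have zero: "?M = ?M +> (f \<otimes> \<zero> \<otimes> e)"
 proof -
  have "?M +> \<zero> = ?M" by (rule R.a_coset_add_zero[OF sq.a_subset])
  then show ?thesis using e f by simp
 qed
 have add: "set_add A (?M +> (f \<otimes> r \<otimes> e)) (?M +> (f \<otimes> r' \<otimes> e)) = ?M +> (f \<otimes> (r \<oplus> r') \<otimes> e)"
  if "r \<in> rad" "r' \<in> rad" for r r'
 proof -
  have "f \<otimes> r \<otimes> e \<oplus> f \<otimes> r' \<otimes> e = f \<otimes> (r \<oplus> r') \<otimes> e"
   using that e f by (intro h_inj) (simp_all add: radc h_mult h_add distrib_left distrib_right)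
  then show ?thesis using that fre by (simp add: coset_ops[OF square_ideal])
 qed
 have smult: "(\<Union>x\<in>?M +> (f \<otimes> r \<otimes> e). ?M +> (c \<odot> x)) = ?M +> (f \<otimes> (c \<odot> r) \<otimes> e)" if "r \<in> rad" for c r
 proof -
  have "c \<odot> (f \<otimes> r \<otimes> e) = f \<otimes> (c \<odot> r) \<otimes> e"
   using that e f by (intro h_inj) (simp_all add: radc closed h_mult h_smult sc_mult_left sc_mult_right)
  then show ?thesis using coset_ops(3)[OF square_ideal fre[OF that] fre[OF that], of c] by (simp only:)
 qed
 have smult_rad: "c \<odot> r \<in> rad" if "r \<in> rad" for c r
  using that rad.I_l_closed[OF that, of "c \<odot> \<one>"] by (simp add: radc closed flip: smult_eq_mult)
 have inj: "Z = Y" if ZY: "Z \<in> carrier ?B" "Y \<in> carrier ?B" "H Z = H Y" for Z Y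
 proof -
  obtain r where r: "r \<in> rad" "Z = ?M +> (f \<otimes> r \<otimes> e)" using elim[OF ZY(1)] by blast
  obtain s where s: "s \<in> rad" "Y = ?M +> (f \<otimes> s \<otimes> e)" using elim[OF ZY(2)] by blast
  have "d ?x ?q v (h r - h s) = 0" if "v \<in> ?V" for v
  proof -
   have "H Z v = H Y v" using ZY(3) by simp
   then show ?thesis using that by (simp add: r s val d_diff)
  qed
  moreover have "h r - h s \<in> J" using r s by (simp add: radc J_diff)
  \<comment> \<open>Here \<open>d_upper\<close> is applied with \<open>Q\<close> the image of the
    square of the radical under \<open>h\<close>.\<close>
  ultimately have "h f * (h r - h s) * h e \<in> h ` ?M"
  proof (intro d_upper[OF e(2) f(2)])
   show "0 \<in> h ` ?M" by (rule rev_image_eqI[OF sq.zero_closed]) (simp add: h_zero)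
   show "a + b \<in> h ` ?M" if ab: "a \<in> h ` ?M" "b \<in> h ` ?M" for a b
   proof -
    obtain a' where a': "a = h a'" "a' \<in> ?M" using ab(1) by (rule imageE)
    obtain b' where b': "b = h b'" "b' \<in> ?M" using ab(2) by (rule imageE)
    have "a' \<oplus> b' \<in> ?M" by (rule ideal_prod.sum[OF a'(2) b'(2)])
    then show ?thesis
     by (rule rev_image_eqI) (simp add: a'(1) b'(1) h_add square_subset[OF a'(2)] square_subset[OF b'(2)])
   qed
   show "a * b \<in> h ` ?M" if ab: "a \<in> J" "b \<in> J" for a b
   proof -
    obtain a' where a': "a' \<in> carrier A" "h a' = a" using h_surj[OF subsetD[OF J_subset ab(1)]] .
    obtain b' where b': "b' \<in> carrier A" "h b' = b" using h_surj[OF subsetD[OF J_subset ab(2)]] .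
    have "a' \<in> rad" "b' \<in> rad" unfolding jacobson_radical_A by (simp_all add: a' b' ab)
    then have "a' \<otimes> b' \<in> ?M" by (rule ideal_prod.prod)
    then show ?thesis by (rule rev_image_eqI) (simp add: h_mult a' b')
   qed
  qed
  then obtain t where t': "h f * (h r - h s) * h e = h t" "t \<in> ?M" by (rule imageE)
  note t = t'(2) t'(1)[symmetric]
  have "f \<otimes> r \<otimes> e \<ominus> f \<otimes> s \<otimes> e = t"
   by (intro h_inj) (simp_all add: t(2) radc[OF r(1)] radc[OF s(1)] e(1) f(1) square_subset[OF t(1)]
    h_minus h_mult left_diff_distrib right_diff_distrib)
  then show ?thesis using t(1) fre[OF r(1)] fre[OF s(1)] by (simp add: r(2) s(2) coset_eq[OF square_ideal])
 qed
 have surj: "\<exists>Z\<in>carrier ?B. H Z = g" if g: "\<And>v. v \<notin> ?V \<Longrightarrow> g v = 0" for g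
 proof -
  have "\<exists>r\<in>J. \<forall>v\<in>?V. d ?x ?q v r = (if v \<in> W then g v else 0)" if "W \<subseteq> ?V" for W
  proof -
   have "finite W" using that V_finite by (rule finite_subset)
   then show ?thesis using that
   proof (induction W rule: finite_induct)
    case empty
    show ?case using J_0 d_zero by auto
   next
    case (insert w W)
    have WV: "W \<subseteq> ?V" and w: "w \<in> ?V" using insert.prems by simp_all
    from insert.IH[OF WV] obtain r where r: "r \<in> J" "\<forall>v\<in>?V. d ?x ?q v r = (if v \<in> W then g v else 0)" ..
    from d_dual[OF e(2) q w] obtain u where u: "u \<in> J" "\<forall>v\<in>?V. d ?x ?q v u = (if v = w then 1 else 0)" ..
    obtain u' where u': "u' \<in> carrier A" "h u' = u" using h_surj[OF subsetD[OF J_subset u(1)]] .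
    have "u' \<in> rad" unfolding jacobson_radical_A by (simp add: u' u(1))
    then have "g w \<odot> u' \<in> rad" by (rule smult_rad)
    then have scJ: "sc (g w) u \<in> J" using radc(2)[of "g w \<odot> u'"] by (simp add: h_smult u')
    have "r + sc (g w) u \<in> J" using J_diff[OF r(1) J_diff[OF J_0 scJ]] by simp
    moreover have "\<forall>v\<in>?V. d ?x ?q v (r + sc (g w) u) = (if v \<in> insert w W then g v else 0)"
    proof
     fix v assume v: "v \<in> ?V"
     show "d ?x ?q v (r + sc (g w) u) = (if v \<in> insert w W then g v else 0)"
      unfolding d_add d_sc bspec[OF r(2) v] bspec[OF u(2) v] using insert.hyps(2) by auto
    qed
    ultimately show ?case by (rule bexI[rotated])
   qed
  qed
  from this[OF subset_refl] obtain r
   where r: "r \<in> J" "\<forall>v\<in>?V. d ?x ?q v r = (if v \<in> ?V then g v else 0)" ..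
  obtain r' where r': "r' \<in> carrier A" "h r' = r" using h_surj[OF subsetD[OF J_subset r(1)]] .
  have rr: "r' \<in> rad" unfolding jacobson_radical_A by (simp add: r' r(1))
  have "H (?M +> (f \<otimes> r' \<otimes> e)) = g"
  proof
   fix v
   show "H (?M +> (f \<otimes> r' \<otimes> e)) v = g v"
    unfolding val[OF rr] r'(2) using g[of v] bspec[OF r(2), of v] by simp
  qed
  then show ?thesis by (rule bexI[OF _ intro[OF rr]])
 qed
 have out: "H Z v = 0" if "v \<notin> ?V" for Z v using that by (simp add: H_def)
 have "coordinates ?B ?V H"
 proof
  show "finite ?V" by (rule V_finite)
  show "bij_betw H (carrier ?B) {g. \<forall>v. v \<notin> ?V \<longrightarrow> g v = 0}"
  proof (rule bij_betw_imageI, rule inj_onI, rule_tac [2] equalityI, rule_tac [2] subsetI, rule_tac [3] subsetI)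
   fix g :: "'v \<Rightarrow> 'k" assume "g \<in> {g. \<forall>v. v \<notin> ?V \<longrightarrow> g v = 0}"
   then have "\<exists>Z\<in>carrier ?B. H Z = g" by (intro surj) simp
   then obtain Z where Z: "Z \<in> carrier ?B" "H Z = g" ..
   show "g \<in> H ` carrier ?B" unfolding Z(2)[symmetric] by (rule imageI[OF Z(1)])
  next
   fix g assume "g \<in> H ` carrier ?B"
   then show "g \<in> {g. \<forall>v. v \<notin> ?V \<longrightarrow> g v = 0}" by (auto simp: out)
  qed (rule inj)
  show "\<zero>\<^bsub>?B\<^esub> \<in> carrier ?B" using intro[OF rad0] unfolding zero[symmetric] by simp
  show "H \<zero>\<^bsub>?B\<^esub> v = 0" for v
   using val[OF rad0, of v] unfolding zero[symmetric] by (simp add: h_zero d_zero)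
  show "c \<odot>\<^bsub>?B\<^esub> Z \<in> carrier ?B" if Z: "Z \<in> carrier ?B" for c Z
  proof -
   from elim[OF Z] obtain r where r: "r \<in> rad" "Z = ?M +> (f \<otimes> r \<otimes> e)" by (elim exE conjE)
   show ?thesis using intro[OF smult_rad[OF r(1)], of c] unfolding smult[OF r(1), symmetric] by (simp add: r(2))
  qed
  show "H (c \<odot>\<^bsub>?B\<^esub> Z) v = c * H Z v" if Z: "Z \<in> carrier ?B" for c Z v
  proof -
   from elim[OF Z] obtain r where r: "r \<in> rad" "Z = ?M +> (f \<otimes> r \<otimes> e)" by (elim exE conjE)
   have "c \<odot>\<^bsub>?B\<^esub> Z = ?M +> (f \<otimes> (c \<odot> r) \<otimes> e)" unfolding smult[OF r(1), symmetric] by (simp add: r(2))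
   then show ?thesis
    using val[OF smult_rad[OF r(1)], of c v] val[OF r(1), of v] by (simp add: r(2) h_smult radc[OF r(1)] d_sc)
  qed
  fix Z Y assume ZY: "Z \<in> carrier ?B" "Y \<in> carrier ?B"
  from elim[OF ZY(1)] obtain r where r: "r \<in> rad" "Z = ?M +> (f \<otimes> r \<otimes> e)" by (elim exE conjE)
  from elim[OF ZY(2)] obtain s where s: "s \<in> rad" "Y = ?M +> (f \<otimes> s \<otimes> e)" by (elim exE conjE)
  have rs: "r \<oplus> s \<in> rad" using r(1) s(1) by simp
  have sum: "Z \<oplus>\<^bsub>?B\<^esub> Y = ?M +> (f \<otimes> (r \<oplus> s) \<otimes> e)" unfolding add[OF r(1) s(1), symmetric] by (simp add: r(2) s(2))
  show "Z \<oplus>\<^bsub>?B\<^esub> Y \<in> carrier ?B" unfolding sum by (rule intro[OF rs])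
  show "H (Z \<oplus>\<^bsub>?B\<^esub> Y) v = H Z v + H Y v" for v
   unfolding sum unfolding val[OF rs] r(2) s(2) val[OF r(1)] val[OF s(1)]
   by (simp add: h_add radc[OF r(1)] radc[OF s(1)] d_add)
 qed
 from coordinates.dim_V[OF this] show ?thesis unfolding arrow_number_def .
qed

theorem is_quiver: "is_quiver_of (multigraph P (\<lambda>p q. card (V p q))) KK A"
 unfolding is_quiver_of_def
proof (intro conjI allI impI split_basic_A system_exists)
 fix E assume E: "complete_idempotent_system A E"
 have prim: "e \<in> carrier A" "primitive (h e)" if "e \<in> E" for e
  using E that by (simp_all add: complete_idempotent_system_def primitive_A)
 show "digraph_iso (multigraph E (arrow_number KK A)) (multigraph P (\<lambda>p q. card (V p q)))"
  by (rule multigraph_iso[OF system_label_bij[OF E]]) (rule arrow_number_A[OF prim prim])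
qed

end

section \<open>Normal forms of faces\<close>

abbreviation abs_less :: "('i \<Rightarrow> 'a::linordered_idom) \<Rightarrow> 'i \<Rightarrow> 'i \<Rightarrow> bool" where
 "abs_less f \<equiv> \<lambda>x y. \<bar>f x\<bar> < \<bar>f y\<bar>"

abbreviation nabs :: "('i \<Rightarrow> int) \<Rightarrow> 'i \<Rightarrow> nat" where
 "nabs f \<equiv> \<lambda>i. nat \<bar>f i\<bar>"

abbreviation upto_row :: "'i set \<Rightarrow> ('i \<Rightarrow> 'a::linordered_idom) \<Rightarrow> 'i \<Rightarrow> 'i set" where
 "upto_row I f i \<equiv> {j\<in>I. f j \<noteq> 0 \<and> \<bar>f j\<bar> \<le> \<bar>f i\<bar>}"

text \<open>These data determine the signs of f i, of f i - f j and of f i + f j, so this is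
  equality of faces of the arrangement. The two value types may differ, which later allows a real
  vector to be compared with its integer code.\<close>

definition same_face ::
  "'i set \<Rightarrow> ('i \<Rightarrow> 'a::linordered_idom) \<Rightarrow> ('i \<Rightarrow> 'b::linordered_idom) \<Rightarrow> bool" where
 "same_face I f g \<longleftrightarrow>
  (\<forall>i\<in>I. (0 < f i \<longleftrightarrow> 0 < g i) \<and> (f i < 0 \<longleftrightarrow> g i < 0)) \<and>
  (\<forall>i\<in>I. \<forall>j\<in>I. \<bar>f i\<bar> \<le> \<bar>f j\<bar> \<longleftrightarrow> \<bar>g i\<bar> \<le> \<bar>g j\<bar>)"

definition lclass :: "'i set \<Rightarrow> ('i \<Rightarrow> 'a::linordered_idom) \<Rightarrow> 'i \<Rightarrow> 'i set" where
 "lclass I f j = {l\<in>I. \<bar>f l\<bar> = \<bar>f j\<bar>}"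

text \<open>The number of the level of \<open>i\<close> when the nonzero levels are counted from 1
  by increasing absolute value; coordinates with value 0 get rank 0.\<close>

definition rk :: "'i set \<Rightarrow> ('i \<Rightarrow> 'a::linordered_idom) \<Rightarrow> 'i \<Rightarrow> nat" where
 "rk I f i = card (lclass I f ` upto_row I f i)"

definition lev :: "'i set \<Rightarrow> ('i \<Rightarrow> 'a::linordered_idom) \<Rightarrow> nat" where
 "lev I f = card (lclass I f ` {j\<in>I. f j \<noteq> 0})"

definition nrm :: "'i set \<Rightarrow> ('i \<Rightarrow> 'a::linordered_idom) \<Rightarrow> 'i \<Rightarrow> int" where
 "nrm I f i =
  (if i \<in> I then if 0 < f i then int (rk I f i) else if f i < 0 then - int (rk I f i) else 0
   else 0)"

text \<open>With all weights 1 this is the type of a face of the arrangement. With the letters of a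
  word as weights it is the coarser word in which the letters of each level are added up and those
  on the zero level are dropped.\<close>

definition ftyp :: "'i set \<Rightarrow> ('i \<Rightarrow> nat) \<Rightarrow> ('i \<Rightarrow> 'a::linordered_idom) \<Rightarrow> nat list" where
 "ftyp I wt f = map (\<lambda>l. \<Sum>i\<in>{i\<in>I. rk I f i = l}. wt i) [1..<Suc (lev I f)]"

definition NF :: "'i set \<Rightarrow> ('i \<Rightarrow> int) set" where
 "NF I = {f. nrm I f = f}"

lemma same_faceD:
 assumes "same_face I f g" "i \<in> I" "j \<in> I"
 shows "0 < f i \<longleftrightarrow> 0 < g i" "f i < 0 \<longleftrightarrow> g i < 0" "f i = 0 \<longleftrightarrow> g i = 0"
  "\<bar>f i\<bar> \<le> \<bar>f j\<bar> \<longleftrightarrow> \<bar>g i\<bar> \<le> \<bar>g j\<bar>" "abs_less f i j \<longleftrightarrow> abs_less g i j"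
  "\<bar>f i\<bar> = \<bar>f j\<bar> \<longleftrightarrow> \<bar>g i\<bar> = \<bar>g j\<bar>"
proof -
 have *: "0 < f i \<longleftrightarrow> 0 < g i" "f i < 0 \<longleftrightarrow> g i < 0"
  "\<bar>f i\<bar> \<le> \<bar>f j\<bar> \<longleftrightarrow> \<bar>g i\<bar> \<le> \<bar>g j\<bar>" "\<bar>f j\<bar> \<le> \<bar>f i\<bar> \<longleftrightarrow> \<bar>g j\<bar> \<le> \<bar>g i\<bar>"
  using assms(1)[unfolded same_face_def] assms(2,3) by auto
 show "0 < f i \<longleftrightarrow> 0 < g i" "f i < 0 \<longleftrightarrow> g i < 0" "\<bar>f i\<bar> \<le> \<bar>f j\<bar> \<longleftrightarrow> \<bar>g i\<bar> \<le> \<bar>g j\<bar>"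
  by fact+
 show "f i = 0 \<longleftrightarrow> g i = 0" using *(1,2) by (metis linorder_neqE_linordered_idom less_irrefl)
 show "abs_less f i j \<longleftrightarrow> abs_less g i j" using *(4) by (simp only: not_le[symmetric])
 show "\<bar>f i\<bar> = \<bar>f j\<bar> \<longleftrightarrow> \<bar>g i\<bar> = \<bar>g j\<bar>" using *(3,4) by (metis order_antisym_conv order_refl)
qed

lemma same_face_refl: "same_face I f f"
 by (simp add: same_face_def)

lemma same_face_sym: "same_face I f g \<Longrightarrow> same_face I g f"
 by (simp add: same_face_def)

lemma same_face_trans: "same_face I f g \<Longrightarrow> same_face I g h \<Longrightarrow> same_face I f h"
 by (simp add: same_face_def)

lemma lclass_same_face: "same_face I f g \<Longrightarrow> j \<in> I \<Longrightarrow> lclass I f j = lclass I g j"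
 unfolding lclass_def by (auto dest: same_faceD)

lemma rk_same_face: "same_face I f g \<Longrightarrow> i \<in> I \<Longrightarrow> rk I f i = rk I g i"
 unfolding rk_def
 by (intro arg_cong[where f = card] image_cong) (auto simp: lclass_same_face dest: same_faceD)

lemma lev_same_face: "same_face I f g \<Longrightarrow> lev I f = lev I g"
 unfolding lev_def
 by (intro arg_cong[where f = card] image_cong) (auto simp: lclass_same_face dest: same_faceD)

lemma nrm_same_face: "same_face I f g \<Longrightarrow> nrm I f = nrm I g"
 by (auto simp: nrm_def fun_eq_iff rk_same_face dest: same_faceD)

lemma ftyp_same_face: "same_face I f g \<Longrightarrow> ftyp I wt f = ftyp I wt g"
 unfolding ftyp_def
 by (auto simp: lev_same_face rk_same_face intro!: sum.cong)

lemma lclass_eq_iff: "i \<in> I \<Longrightarrow> j \<in> I \<Longrightarrow> lclass I f i = lclass I f j \<longleftrightarrow> \<bar>f i\<bar> = \<bar>f j\<bar>"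
 unfolding lclass_def by auto

lemma rk_mono:
 assumes "finite I" "\<bar>f i\<bar> \<le> \<bar>f j\<bar>"
 shows "rk I f i \<le> rk I f j"
 unfolding rk_def using assms by (intro card_mono image_mono) auto

lemma rk_strict_mono:
 assumes "finite I" "i \<in> I" "j \<in> I" "abs_less f i j"
 shows "rk I f i < rk I f j"
 unfolding rk_def
proof (rule psubset_card_mono)
 show "finite (lclass I f ` upto_row I f j)" using assms by simp
 have "f j \<noteq> 0" using assms by auto
 then have "lclass I f j \<in> lclass I f ` upto_row I f j" using assms by auto
 moreover have "lclass I f j \<notin> lclass I f ` upto_row I f i"
  using assms by (auto simp: lclass_eq_iff)
 ultimately show "lclass I f ` upto_row I f i
   \<subset> lclass I f ` upto_row I f j"
  using assms(4) by (intro psubsetI) (fastforce, blast)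
qed

lemma rk_le_iff:
 assumes "finite I" "i \<in> I" "j \<in> I"
 shows "rk I f i \<le> rk I f j \<longleftrightarrow> \<bar>f i\<bar> \<le> \<bar>f j\<bar>"
 using rk_mono[OF assms(1)] rk_strict_mono[OF assms(1)] assms by (metis not_le)

lemma rk_eq_iff:
 assumes "finite I" "i \<in> I" "j \<in> I"
 shows "rk I f i = rk I f j \<longleftrightarrow> \<bar>f i\<bar> = \<bar>f j\<bar>"
 using rk_le_iff[OF assms, of f] rk_le_iff[OF assms(1,3,2), of f] by auto

lemma rk_eq_0_iff:
 assumes "finite I" "i \<in> I"
 shows "rk I f i = 0 \<longleftrightarrow> f i = 0"
proof -
 have "rk I f i = 0 \<longleftrightarrow> upto_row I f i = {}"
  unfolding rk_def using assms(1) by (subst card_0_eq) auto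
 also have "\<dots> \<longleftrightarrow> f i = 0"
 proof
  assume "upto_row I f i = {}"
  then show "f i = 0" using assms(2) by blast
 qed simp
 finally show ?thesis .
qed

lemma rk_le_lev:
 assumes "finite I"
 shows "rk I f i \<le> lev I f"
 unfolding rk_def lev_def using assms by (intro card_mono image_mono) auto

text \<open>Ranks are constant on level classes and tell them apart, so exactly
  \<open>lev I f\<close> nonzero ranks occur; as they all lie in \<open>{1..lev I f}\<close>, they
  exhaust it.\<close>

lemma rk_image:
 assumes "finite I"
 shows "rk I f ` {i\<in>I. f i \<noteq> 0} = {1..lev I f}"
proof -
 let ?Z = "{i\<in>I. f i \<noteq> 0}"
 have "\<exists>g. rk I f ` ?Z = g ` (lclass I f ` ?Z) \<and> inj_on g (lclass I f ` ?Z)"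
 proof (intro exI conjI)
  let ?g = "\<lambda>c. rk I f (SOME i. i \<in> c)"
  have eq: "?g (lclass I f i) = rk I f i" if i: "i \<in> I" for i
  proof -
   have "i \<in> lclass I f i" using i by (simp add: lclass_def)
   then have "(SOME l. l \<in> lclass I f i) \<in> lclass I f i" by (rule someI)
   then have "(SOME l. l \<in> lclass I f i) \<in> I" "\<bar>f (SOME l. l \<in> lclass I f i)\<bar> = \<bar>f i\<bar>"
    unfolding lclass_def by blast+
   then show ?thesis using i by (simp only: rk_eq_iff[OF assms])
  qed
  show "rk I f ` ?Z = ?g ` (lclass I f ` ?Z)"
   unfolding image_image by (rule image_cong) (simp_all add: eq)
  show "inj_on ?g (lclass I f ` ?Z)"
  proof (rule inj_onI)
   fix x y assume "x \<in> lclass I f ` ?Z" "y \<in> lclass I f ` ?Z" "?g x = ?g y"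
   then obtain i j where "i \<in> I" "j \<in> I" "x = lclass I f i" "y = lclass I f j" "?g x = ?g y" by auto
   moreover from this have "rk I f i = rk I f j" using eq by metis
   ultimately show "x = y" by (simp add: lclass_eq_iff rk_eq_iff[OF assms])
  qed
 qed
 then obtain g where "rk I f ` ?Z = g ` (lclass I f ` ?Z)" "inj_on g (lclass I f ` ?Z)" by blast
 then have card: "card (rk I f ` ?Z) = lev I f"
  unfolding lev_def by (simp only: card_image)
 have sub: "rk I f ` ?Z \<subseteq> {1..lev I f}"
 proof
  fix r assume "r \<in> rk I f ` ?Z"
  then obtain i where i: "i \<in> I" "f i \<noteq> 0" "r = rk I f i" by blast
  then have "rk I f i \<noteq> 0" using rk_eq_0_iff[OF assms] by blast
  then show "r \<in> {1..lev I f}" using i rk_le_lev[OF assms, of f i] by simp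
 qed
 show ?thesis
 proof (rule card_subset_eq)
  show "card (rk I f ` ?Z) = card {1..lev I f}" using card by simp
 qed (use sub in auto)
qed

lemma sgn_nrm:
 assumes "finite I" "i \<in> I"
 shows "0 < nrm I f i \<longleftrightarrow> 0 < f i" "nrm I f i < 0 \<longleftrightarrow> f i < 0"
  and abs_nrm: "\<bar>nrm I f i\<bar> = int (rk I f i)"
proof -
 consider "f i = 0" | "0 < f i" | "f i < 0" by (rule linorder_cases)
 then have "(0 < nrm I f i \<longleftrightarrow> 0 < f i) \<and> (nrm I f i < 0 \<longleftrightarrow> f i < 0)
   \<and> \<bar>nrm I f i\<bar> = int (rk I f i)"
 proof cases
  case 1
  then have "rk I f i = 0" using rk_eq_0_iff[OF assms] by blast
  with 1 show ?thesis by (simp add: nrm_def)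
 next
  case 2
  then have "0 < rk I f i" using rk_eq_0_iff[OF assms] by (metis gr0I less_irrefl)
  with 2 show ?thesis using assms(2) by (simp add: nrm_def)
 next
  case 3
  then have "0 < rk I f i" using rk_eq_0_iff[OF assms] by (metis gr0I less_irrefl)
  with 3 show ?thesis using assms(2) by (simp add: nrm_def)
 qed
 then show "0 < nrm I f i \<longleftrightarrow> 0 < f i" "nrm I f i < 0 \<longleftrightarrow> f i < 0"
  "\<bar>nrm I f i\<bar> = int (rk I f i)" by blast+
qed

lemma same_face_nrm: "finite I \<Longrightarrow> same_face I f (nrm I f)"
 by (simp add: same_face_def sgn_nrm abs_nrm rk_le_iff)

lemma nrm_nrm: "finite I \<Longrightarrow> nrm I (nrm I f) = nrm I f"
 by (metis nrm_same_face same_face_nrm)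

lemma nrm_in_NF: "finite I \<Longrightarrow> nrm I f \<in> NF I"
 by (simp add: NF_def nrm_nrm)

lemma ftyp_nrm: "finite I \<Longrightarrow> ftyp I wt (nrm I f) = ftyp I wt f"
 by (metis ftyp_same_face same_face_nrm)

lemma NF_eqI: "f \<in> NF I \<Longrightarrow> g \<in> NF I \<Longrightarrow> same_face I f g \<Longrightarrow> f = g"
 by (metis (mono_tags) NF_def mem_Collect_eq nrm_same_face)

lemma NF_abs: "finite I \<Longrightarrow> f \<in> NF I \<Longrightarrow> i \<in> I \<Longrightarrow> \<bar>f i\<bar> = int (rk I f i)"
 by (metis (mono_tags) NF_def abs_nrm mem_Collect_eq)

lemma NF_outside: "f \<in> NF I \<Longrightarrow> i \<notin> I \<Longrightarrow> f i = 0"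
 by (metis (mono_tags) NF_def nrm_def mem_Collect_eq)

text \<open>The usable criterion for normal forms: when the nonzero absolute values fill an initial
  segment without gaps, counting the levels up to that of \<open>i\<close> just returns the absolute
  value.\<close>

lemma NF_I:
 assumes fin: "finite I" and out: "\<And>i. i \<notin> I \<Longrightarrow> f i = 0"
  and im: "nabs f ` {i\<in>I. f i \<noteq> 0} = {1..k}"
 shows "f \<in> NF I" "lev I f = k" "\<And>i. i \<in> I \<Longrightarrow> rk I f i = nat \<bar>f i\<bar>"
proof -
 have cl: "lclass I f i = {l\<in>I. nat \<bar>f l\<bar> = nat \<bar>f i\<bar>}" for i
  unfolding lclass_def by (simp only: eq_nat_nat_iff abs_ge_zero)
 have bij: "card (lclass I f ` S) = card (nabs f ` S)" if "S \<subseteq> I" for S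
 proof -
  have "lclass I f ` S = (\<lambda>v. {l\<in>I. nat \<bar>f l\<bar> = v}) ` (nabs f ` S)"
   unfolding image_image cl ..
  moreover have "inj_on (\<lambda>v. {l\<in>I. nat \<bar>f l\<bar> = v}) (nabs f ` S)"
  proof (rule inj_onI)
   fix v w assume v: "v \<in> nabs f ` S" and eq: "{l\<in>I. nat \<bar>f l\<bar> = v} = {l\<in>I. nat \<bar>f l\<bar> = w}"
   from v obtain i where "i \<in> S" "v = nat \<bar>f i\<bar>" by blast
   then have "i \<in> {l\<in>I. nat \<bar>f l\<bar> = v}" using that by auto
   moreover from this have "i \<in> {l\<in>I. nat \<bar>f l\<bar> = w}" unfolding eq .
   ultimately show "v = w" by simp
  qed
  ultimately show ?thesis by (simp add: card_image)
 qed
 show lev: "lev I f = k" unfolding lev_def by (subst bij) (auto simp: im)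
 show rk: "rk I f i = nat \<bar>f i\<bar>" if "i \<in> I" for i
 proof -
  have "nabs f ` upto_row I f i = {1..nat \<bar>f i\<bar>}"
  proof (intro equalityI subsetI)
   fix v assume "v \<in> {1..nat \<bar>f i\<bar>}"
   moreover from this have "f i \<noteq> 0" by auto
   then have "nat \<bar>f i\<bar> \<in> nabs f ` {j \<in> I. f j \<noteq> 0}" using that by blast
   then have "nat \<bar>f i\<bar> \<le> k" unfolding im by simp
   ultimately have "v \<in> nabs f ` {j \<in> I. f j \<noteq> 0}" unfolding im by simp
   then obtain j where "j \<in> I" "f j \<noteq> 0" "v = nat \<bar>f j\<bar>" by blast
   moreover from this have "\<bar>f j\<bar> \<le> \<bar>f i\<bar>" using \<open>v \<in> {1..nat \<bar>f i\<bar>}\<close> by (simp add: nat_le_eq_zle)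
   ultimately show "v \<in> nabs f ` upto_row I f i" by blast
  next
   fix v assume "v \<in> nabs f ` upto_row I f i"
   then obtain j where "f j \<noteq> 0" "\<bar>f j\<bar> \<le> \<bar>f i\<bar>" "v = nat \<bar>f j\<bar>" by blast
   then show "v \<in> {1..nat \<bar>f i\<bar>}" by (simp add: nat_mono Suc_le_eq)
  qed
  moreover have "upto_row I f i \<subseteq> I" by blast
  ultimately show ?thesis unfolding rk_def by (simp only: bij card_atLeastAtMost diff_Suc_1 One_nat_def Suc_diff_1)
 qed
 have "nrm I f i = f i" for i
  using out[of i] rk[of i] by (simp add: nrm_def)
 then show "f \<in> NF I" by (simp add: NF_def fun_eq_iff)
qed

lemma NF_image:
 assumes "finite I" "f \<in> NF I"
 shows "nabs f ` {i\<in>I. f i \<noteq> 0} = {1..lev I f}"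
proof -
 have "nabs f ` {i\<in>I. f i \<noteq> 0} = rk I f ` {i\<in>I. f i \<noteq> 0}"
  by (rule image_cong) (simp_all add: NF_abs[OF assms])
 then show ?thesis by (simp add: rk_image[OF assms(1)])
qed

lemma lev_le_card:
 assumes "finite I"
 shows "lev I f \<le> card I"
proof -
 have "lev I f \<le> card {j \<in> I. f j \<noteq> 0}"
  unfolding lev_def by (rule card_image_le) (simp add: assms)
 also have "\<dots> \<le> card I" by (rule card_mono) (auto simp: assms)
 finally show ?thesis .
qed

lemma finite_NF:
 assumes "finite I"
 shows "finite (NF I)"
proof -
 have "f i \<in> {- int (card I)..int (card I)}" if "f \<in> NF I" "i \<in> I" for f i
 proof -
  have "rk I f i \<le> card I"
   using rk_le_lev[OF assms] lev_le_card[OF assms] by (rule order_trans)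
  then have "\<bar>f i\<bar> \<le> int (card I)" using NF_abs[OF assms that] by simp
  then show ?thesis by (auto simp: abs_le_iff)
 qed
 then have "NF I \<subseteq> {f. \<forall>i. (i \<in> I \<longrightarrow> f i \<in> {- int (card I)..int (card I)}) \<and> (i \<notin> I \<longrightarrow> f i = 0)}"
  using NF_outside by (intro subsetI CollectI conjI allI impI)
 moreover have "finite {f. \<forall>i. (i \<in> I \<longrightarrow> f i \<in> {- int (card I)..int (card I)}) \<and> (i \<notin> I \<longrightarrow> f i = (0::int))}"
  by (rule finite_set_of_finite_funs) (simp_all add: assms)
 ultimately show ?thesis by (rule finite_subset)
qed

lemma length_ftyp [simp]: "length (ftyp I wt f) = lev I f"
 by (simp add: ftyp_def)

lemma nth_ftyp: "l < lev I f \<Longrightarrow> ftyp I wt f ! l = (\<Sum>i\<in>{i\<in>I. rk I f i = Suc l}. wt i)"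
 by (simp add: ftyp_def del: upt_Suc)

lemma ftyp_pos:
 assumes "finite I" "\<And>i. i \<in> I \<Longrightarrow> 0 < wt i"
 shows "0 \<notin> set (ftyp I wt f)"
proof
 assume "0 \<in> set (ftyp I wt f)"
 then obtain l where l: "l < lev I f" "ftyp I wt f ! l = 0" by (auto simp: in_set_conv_nth)
 then have "Suc l \<in> rk I f ` {i\<in>I. f i \<noteq> 0}" by (simp add: rk_image[OF assms(1)])
 then obtain i where "i \<in> I" "rk I f i = Suc l" by auto
 then have "(\<Sum>i\<in>{i\<in>I. rk I f i = Suc l}. wt i) > 0"
  using assms by (intro sum_pos2[of _ i]) auto
 then show False using l by (simp add: nth_ftyp)
qed

lemma sum_list_ftyp:
 assumes "finite I"
 shows "sum_list (ftyp I wt f) = (\<Sum>i\<in>{i\<in>I. f i \<noteq> 0}. wt i)"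
proof -
 have "sum_list (ftyp I wt f) = (\<Sum>l\<in>{1..lev I f}. \<Sum>i\<in>{i\<in>I. rk I f i = l}. wt i)"
  unfolding ftyp_def by (simp add: sum_list_distinct_conv_sum_set atLeastLessThanSuc_atLeastAtMost del: upt_Suc)
 also have "\<dots> = (\<Sum>l\<in>{1..lev I f}. \<Sum>i\<in>{i\<in>{i\<in>I. f i \<noteq> 0}. rk I f i = l}. wt i)"
 proof (rule sum.cong)
  fix l assume "l \<in> {1..lev I f}"
  then have "l \<noteq> 0" by simp
  then have "{i\<in>I. rk I f i = l} = {i\<in>{i\<in>I. f i \<noteq> 0}. rk I f i = l}"
   by (auto simp: rk_eq_0_iff[OF assms, symmetric])
  then show "(\<Sum>i\<in>{i\<in>I. rk I f i = l}. wt i) = (\<Sum>i\<in>{i\<in>{i\<in>I. f i \<noteq> 0}. rk I f i = l}. wt i)"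
   by (rule sum.cong) simp
 qed simp
 also have "\<dots> = (\<Sum>i\<in>{i\<in>I. f i \<noteq> 0}. wt i)"
  by (rule sum.group) (use assms rk_image[OF assms, of f] in simp_all)
 finally show ?thesis .
qed

section \<open>The product of faces\<close>

text \<open>For K larger than 2 |g i| the absolute value of K f i + g i is K |f i| +
  \<open>tie f g i\<close>. Thus g decides the order within a level of f, with reversed sign on the
  negative coordinates and by absolute value on the zero level.\<close>

definition tie :: "('i \<Rightarrow> int) \<Rightarrow> ('i \<Rightarrow> int) \<Rightarrow> 'i \<Rightarrow> int" where
 "tie f g i = (if f i = 0 then \<bar>g i\<bar> else sgn (f i) * g i)"

text \<open>The factor exceeds twice every |g j|, because two entries of g compete with each other
  when two coordinates are compared; g then acts as a small perturbation of f.\<close>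

definition comb :: "'i set \<Rightarrow> ('i \<Rightarrow> int) \<Rightarrow> ('i \<Rightarrow> int) \<Rightarrow> 'i \<Rightarrow> int" where
 "comb I f g i = (2 * (\<Sum>j\<in>I. \<bar>g j\<bar>) + 1) * f i + g i"

lemma abs_tie: "\<bar>tie f g i\<bar> = \<bar>g i\<bar>"
 by (simp add: tie_def abs_mult)

lemma lex_int:
 fixes a b h h' K :: int
 assumes "2 * \<bar>h\<bar> < K" "2 * \<bar>h'\<bar> < K"
 shows "K * a + h \<le> K * b + h' \<longleftrightarrow> a < b \<or> a = b \<and> h \<le> h'"
proof -
 have less: "K * x + y < K * x' + y'" if "x < x'" "2 * \<bar>y\<bar> < K" "2 * \<bar>y'\<bar> < K" for x x' y y' :: int
 proof -
  have "K * (x + 1) \<le> K * x'" using that by (intro mult_left_mono) auto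
  moreover have "y < K + y'" using that(2,3) by arith
  ultimately show ?thesis by (simp add: distrib_left)
 qed
 consider "a < b" | "a = b" | "b < a" by (rule linorder_cases)
 then show ?thesis
 proof cases
  case 1 with less[OF 1 assms] show ?thesis by simp
 next
  case 2 then show ?thesis by simp
 next
  case 3 with less[OF 3 assms(2,1)] show ?thesis by simp
 qed
qed

lemma comb_gen:
 fixes K :: int
 assumes "2 * \<bar>g i\<bar> < K"
 shows "0 < K * f i + g i \<longleftrightarrow> 0 < f i \<or> f i = 0 \<and> 0 < g i"
  and "K * f i + g i < 0 \<longleftrightarrow> f i < 0 \<or> f i = 0 \<and> g i < 0"
  and "\<bar>K * f i + g i\<bar> = K * \<bar>f i\<bar> + tie f g i"
proof -
 have *: "0 < K * x + y" if "0 < x" "2 * \<bar>y\<bar> < K" for x y :: int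
 proof -
  have "K * 1 \<le> K * x" using that by (intro mult_left_mono) auto
  then show ?thesis using that(2) by arith
 qed
 consider "f i = 0" | "0 < f i" | "f i < 0" by (rule linorder_cases)
 then have "(0 < K * f i + g i \<longleftrightarrow> 0 < f i \<or> f i = 0 \<and> 0 < g i) \<and>
  (K * f i + g i < 0 \<longleftrightarrow> f i < 0 \<or> f i = 0 \<and> g i < 0) \<and>
  \<bar>K * f i + g i\<bar> = K * \<bar>f i\<bar> + tie f g i"
 proof cases
  case 1 then show ?thesis by (simp add: tie_def)
 next
  case 2
  with *[OF 2 assms] show ?thesis by (simp add: tie_def)
 next
  case 3
  with *[of "- f i" "- g i"] assms have "K * f i + g i < 0" by simp
  with 3 show ?thesis by (simp add: tie_def)
 qed
 then show "0 < K * f i + g i \<longleftrightarrow> 0 < f i \<or> f i = 0 \<and> 0 < g i"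
  "K * f i + g i < 0 \<longleftrightarrow> f i < 0 \<or> f i = 0 \<and> g i < 0"
  "\<bar>K * f i + g i\<bar> = K * \<bar>f i\<bar> + tie f g i" by blast+
qed

lemma abs_comb_gen_le:
 fixes K :: int
 assumes "2 * \<bar>g i\<bar> < K" "2 * \<bar>g j\<bar> < K"
 shows "\<bar>K * f i + g i\<bar> \<le> \<bar>K * f j + g j\<bar> \<longleftrightarrow>
  abs_less f i j \<or> \<bar>f i\<bar> = \<bar>f j\<bar> \<and> tie f g i \<le> tie f g j"
 unfolding comb_gen(3)[where f=f and g=g and i=i, OF assms(1)]
  comb_gen(3)[where f=f and g=g and i=j, OF assms(2)]
 by (rule lex_int) (simp_all add: abs_tie assms)

text \<open>The right hand side mentions only signs and comparisons of absolute values, which are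
  the data preserved by \<open>same_face\<close>.\<close>

lemma signed_le_iff:
 fixes x y s t :: int
 assumes "s = 1 \<or> s = -1" "t = 1 \<or> t = -1"
 shows "s * x \<le> t * y \<longleftrightarrow>
  0 < s * x \<and> 0 < t * y \<and> \<bar>x\<bar> \<le> \<bar>y\<bar> \<or>
  s * x < 0 \<and> (0 \<le> t * y \<or> \<bar>y\<bar> \<le> \<bar>x\<bar>) \<or>
  \<not> 0 < s * x \<and> \<not> s * x < 0 \<and> 0 \<le> t * y"
 using assms by (elim disjE; hypsubst; simp only: mult_1 mult_minus1; arith)

lemma same_face_signed_le:
 fixes g g' :: "'i \<Rightarrow> int"
 assumes "same_face I g g'" "i \<in> I" "j \<in> I" "s = 1 \<or> s = -1" "t = 1 \<or> t = -1"
 shows "s * g i \<le> t * g j \<longleftrightarrow> s * g' i \<le> t * g' j"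
proof -
 have "0 < s * g i \<longleftrightarrow> 0 < s * g' i" "s * g i < 0 \<longleftrightarrow> s * g' i < 0"
  using assms(4) same_faceD(1,2)[OF assms(1,2,2)] by auto
 moreover have "0 < t * g j \<longleftrightarrow> 0 < t * g' j" "0 \<le> t * g j \<longleftrightarrow> 0 \<le> t * g' j"
  using assms(5) same_faceD(1,2)[OF assms(1,3,3)] by (auto simp: not_less[symmetric])
 ultimately show ?thesis
  unfolding signed_le_iff[OF assms(4,5)]
  by (simp only: same_faceD(4)[OF assms(1-3)] same_faceD(4)[OF assms(1,3,2)])
qed

lemma tie_same_face:
 assumes "same_face I f f'" "same_face I g g'" "i \<in> I" "j \<in> I" "\<bar>f i\<bar> = \<bar>f j\<bar>"
 shows "tie f g i \<le> tie f g j \<longleftrightarrow> tie f' g' i \<le> tie f' g' j"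
proof (cases "f i = 0")
 case True
 then have "f j = 0" using assms(5) by simp
 moreover from True this have "f' i = 0" "f' j = 0"
  using same_faceD(3)[OF assms(1,3,3)] same_faceD(3)[OF assms(1,4,4)] by blast+
 ultimately show ?thesis using True same_faceD(4)[OF assms(2,3,4)] by (simp add: tie_def)
next
 case False
 then have fj: "f j \<noteq> 0" using assms(5) by simp
 have f'i: "f' i \<noteq> 0" and f'j: "f' j \<noteq> 0"
  using False fj same_faceD(3)[OF assms(1,3,3)] same_faceD(3)[OF assms(1,4,4)] by blast+
 have si: "sgn (f' i) = sgn (f i)" and sj: "sgn (f' j) = sgn (f j)"
  using same_faceD(1,2)[OF assms(1,3,3)] same_faceD(1,2)[OF assms(1,4,4)] False fj f'i f'j
  by (simp_all add: sgn_if)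
 have "sgn (f i) = 1 \<or> sgn (f i) = -1" "sgn (f j) = 1 \<or> sgn (f j) = -1"
  using False fj by (auto simp: sgn_if)
 from same_face_signed_le[OF assms(2-4) this] show ?thesis
  using False fj f'i f'j by (simp add: tie_def si sj)
qed

text \<open>Signs and comparisons of K f + g are lexicographic as soon as K dominates g, so neither
  the representatives nor the particular K matter. The freedom in K is what reduces the semigroup
  identities below to bounds on constants.\<close>

lemma comb_same:
 fixes K K' :: int
 assumes f: "same_face I f f'" and g: "same_face I g g'"
  and K: "\<And>i. i \<in> I \<Longrightarrow> 2 * \<bar>g i\<bar> < K" and K': "\<And>i. i \<in> I \<Longrightarrow> 2 * \<bar>g' i\<bar> < K'"
 shows "same_face I (\<lambda>i. K * f i + g i) (\<lambda>i. K' * f' i + g' i)"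
 unfolding same_face_def
proof (intro conjI ballI)
 fix i assume i: "i \<in> I"
 show "(0 < K * f i + g i) = (0 < K' * f' i + g' i)"
  "(K * f i + g i < 0) = (K' * f' i + g' i < 0)"
  unfolding comb_gen(1,2)[where f=f and g=g and i=i, OF K[OF i]]
   comb_gen(1,2)[where f=f' and g=g' and i=i, OF K'[OF i]]
  by (simp_all only: same_faceD(1-3)[OF f i i] same_faceD(1-3)[OF g i i])
 fix j assume j: "j \<in> I"
 show "(\<bar>K * f i + g i\<bar> \<le> \<bar>K * f j + g j\<bar>) = (\<bar>K' * f' i + g' i\<bar> \<le> \<bar>K' * f' j + g' j\<bar>)"
  unfolding abs_comb_gen_le[where f=f and g=g, OF K[OF i] K[OF j]]
   abs_comb_gen_le[where f=f' and g=g', OF K'[OF i] K'[OF j]]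
  using tie_same_face[OF f g i j] same_faceD(5,6)[OF f i j] by blast
qed

lemma comb_bound: "finite I \<Longrightarrow> i \<in> I \<Longrightarrow> 2 * \<bar>g i\<bar> < 2 * (\<Sum>j\<in>I. \<bar>g j\<bar>) + (1::int)"
 using member_le_sum[of i I "\<lambda>j. \<bar>g j\<bar>"] by simp

lemma comb_sign:
 assumes "finite I" "i \<in> I"
 shows "0 < comb I f g i \<longleftrightarrow> 0 < f i \<or> f i = 0 \<and> 0 < g i"
  and "comb I f g i < 0 \<longleftrightarrow> f i < 0 \<or> f i = 0 \<and> g i < 0"
 unfolding comb_def
 by (rule comb_gen(1)[where f=f and g=g and i=i, OF comb_bound[where g=g, OF assms]],
   rule comb_gen(2)[where f=f and g=g and i=i, OF comb_bound[where g=g, OF assms]])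

lemma comb_eq_0:
 assumes "finite I" "i \<in> I"
 shows "comb I f g i = 0 \<longleftrightarrow> f i = 0 \<and> g i = 0"
 using comb_sign[OF assms, of f g] by (smt (verit))

lemma abs_comb_le:
 assumes "finite I" "i \<in> I" "j \<in> I"
 shows "\<bar>comb I f g i\<bar> \<le> \<bar>comb I f g j\<bar> \<longleftrightarrow>
  abs_less f i j \<or> \<bar>f i\<bar> = \<bar>f j\<bar> \<and> tie f g i \<le> tie f g j"
 unfolding comb_def by (rule abs_comb_gen_le; rule comb_bound) (fact assms)+

lemma abs_comb_less:
 assumes "finite I" "i \<in> I" "j \<in> I"
 shows "\<bar>comb I f g i\<bar> < \<bar>comb I f g j\<bar> \<longleftrightarrow>
  abs_less f i j \<or> \<bar>f i\<bar> = \<bar>f j\<bar> \<and> tie f g i < tie f g j"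
 using abs_comb_le[OF assms(1,3,2), of f g] by linarith

lemma abs_comb_eq:
 assumes "finite I" "i \<in> I" "j \<in> I"
 shows "\<bar>comb I f g i\<bar> = \<bar>comb I f g j\<bar> \<longleftrightarrow> \<bar>f i\<bar> = \<bar>f j\<bar> \<and> tie f g i = tie f g j"
 unfolding order_eq_iff abs_comb_le[OF assms] abs_comb_le[OF assms(1,3,2)] by auto

lemma comb_same_face:
 assumes "finite I" "same_face I f f'" "same_face I g g'"
 shows "same_face I (comb I f g) (comb I f' g')"
 unfolding comb_def using assms by (intro comb_same comb_bound)

text \<open>Both sides are f times a large constant plus the same perturbation
  \<open>comb I g h\<close>; it remains to check that the product of the two nested constants
  dominates this perturbation.\<close>

lemma comb_assoc:
 assumes "finite I"
 shows "same_face I (comb I (comb I f g) h) (comb I f (comb I g h))"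
proof -
 define Sg Sh where "Sg = (\<Sum>j\<in>I. \<bar>g j\<bar>)" and "Sh = (\<Sum>j\<in>I. \<bar>h j\<bar>)"
 have eq: "comb I (comb I f g) h = (\<lambda>i. ((2 * Sh + 1) * (2 * Sg + 1)) * f i + comb I g h i)"
  unfolding comb_def Sg_def[symmetric] Sh_def[symmetric] by (rule ext) (simp add: algebra_simps)
 have "2 * \<bar>comb I g h i\<bar> < (2 * Sh + 1) * (2 * Sg + 1)" if i: "i \<in> I" for i
 proof -
  have g: "\<bar>g i\<bar> \<le> Sg" and h: "\<bar>h i\<bar> \<le> Sh"
   using member_le_sum[of i I "\<lambda>j. \<bar>g j\<bar>"] member_le_sum[of i I "\<lambda>j. \<bar>h j\<bar>"] i assms
   by (simp_all add: Sg_def Sh_def)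
  have Sh: "0 \<le> 2 * Sh + 1" using h by linarith
  have "\<bar>comb I g h i\<bar> \<le> \<bar>(2 * Sh + 1) * g i\<bar> + \<bar>h i\<bar>"
   unfolding comb_def Sh_def[symmetric] by (rule abs_triangle_ineq)
  also have "\<dots> \<le> (2 * Sh + 1) * Sg + Sh"
   using mult_left_mono[OF g Sh] h by (simp only: abs_mult abs_of_nonneg[OF Sh] add_mono)
  finally show ?thesis by (simp add: algebra_simps)
 qed
 then have "same_face I (\<lambda>i. ((2 * Sh + 1) * (2 * Sg + 1)) * f i + comb I g h i) (comb I f (comb I g h))"
  unfolding comb_def[of I f "comb I g h"]
  by (intro comb_same same_face_refl comb_bound assms)
 then show ?thesis unfolding eq .
qed

lemma same_face_scale:
 fixes K :: int
 assumes "0 < K"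
 shows "same_face I f (\<lambda>i. K * f i)"
 unfolding same_face_def using assms by (simp add: abs_mult zero_less_mult_iff mult_less_0_iff)

lemma comb_idem:
 shows "same_face I (comb I f f) f"
proof -
 have "comb I f f = (\<lambda>i. (2 * (\<Sum>j\<in>I. \<bar>f j\<bar>) + 2) * f i)"
  by (rule ext) (simp add: comb_def algebra_simps)
 moreover have "0 \<le> (\<Sum>j\<in>I. \<bar>f j\<bar>)" by (simp add: sum_nonneg)
 then have "same_face I f (\<lambda>i. (2 * (\<Sum>j\<in>I. \<bar>f j\<bar>) + 2) * f i)"
  by (intro same_face_scale) linarith
 ultimately show ?thesis by (simp add: same_face_sym)
qed

text \<open>This is the left regular law of face semigroups. After collecting terms the left side is
  a constant times f plus a positive multiple of g, and rescaling g does not change its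
  face.\<close>

lemma comb_regular:
 assumes "finite I"
 shows "same_face I (comb I (comb I f g) f) (comb I f g)"
proof -
 define K1 K2 where "K1 = 2 * (\<Sum>j\<in>I. \<bar>g j\<bar>) + 1" and "K2 = 2 * (\<Sum>j\<in>I. \<bar>f j\<bar>) + 1"
 have K2: "0 < K2" unfolding K2_def by (simp add: sum_nonneg add_nonneg_pos)
 have eq: "comb I (comb I f g) f = (\<lambda>i. (K2 * K1 + 1) * f i + K2 * g i)"
  unfolding comb_def K1_def[symmetric] K2_def[symmetric] by (rule ext) (simp add: algebra_simps)
 have "2 * \<bar>K2 * g i\<bar> < K2 * K1 + 1" if "i \<in> I" for i
 proof -
  have "2 * \<bar>g i\<bar> \<le> K1" using comb_bound[OF assms that, of g] by (simp add: K1_def)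
  then have "K2 * (2 * \<bar>g i\<bar>) \<le> K2 * K1" using K2 by (intro mult_left_mono) simp_all
  moreover have "2 * \<bar>K2 * g i\<bar> = K2 * (2 * \<bar>g i\<bar>)" using K2 by (simp add: abs_mult)
  ultimately show ?thesis by linarith
 qed
 then have "same_face I (\<lambda>i. (K2 * K1 + 1) * f i + K2 * g i) (comb I f g)"
  unfolding comb_def[of I f g]
  by (intro comb_same same_face_refl comb_bound assms same_face_sym[OF same_face_scale] K2)
 then show ?thesis unfolding eq .
qed

lemma comb_zero_right [simp]: "comb I f (\<lambda>_. 0) = f"
 by (rule ext) (simp add: comb_def)

lemma comb_zero_left [simp]: "comb I (\<lambda>_. 0) g = g"
 by (rule ext) (simp add: comb_def)

text \<open>Every hyperplane that contains c must contain f, that is, f lies in the linear span of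
  c: it vanishes on the zero level of c and is constant on each other level once the signs of c are
  removed.\<close>

lemma comb_fix_iff:
 assumes "finite I"
 shows "same_face I (comb I c f) c \<longleftrightarrow>
  (\<forall>i\<in>I. c i = 0 \<longrightarrow> f i = 0) \<and> (\<forall>i\<in>I. \<forall>j\<in>I. \<bar>c i\<bar> = \<bar>c j\<bar> \<longrightarrow> tie c f i = tie c f j)"
 (is "?l \<longleftrightarrow> ?r")
proof
 assume l: ?l
 show ?r
 proof (intro conjI ballI impI)
  fix i assume "i \<in> I" "c i = 0"
  then show "f i = 0" using same_faceD(3)[OF l, of i i] comb_eq_0[OF assms, of i c f] by blast
 next
  fix i j assume "i \<in> I" "j \<in> I" "\<bar>c i\<bar> = \<bar>c j\<bar>"
  then show "tie c f i = tie c f j"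
   using same_faceD(6)[OF l, of i j] abs_comb_eq[OF assms, of i j c f] by blast
 qed
next
 assume r: ?r
 show ?l
  unfolding same_face_def
 proof (intro conjI ballI)
  fix i assume i: "i \<in> I"
  show "(0 < comb I c f i) = (0 < c i)" "(comb I c f i < 0) = (c i < 0)"
   unfolding comb_sign[OF assms i] using r i by auto
  fix j assume j: "j \<in> I"
  show "(\<bar>comb I c f i\<bar> \<le> \<bar>comb I c f j\<bar>) = (\<bar>c i\<bar> \<le> \<bar>c j\<bar>)"
  proof -
   have "\<bar>c i\<bar> = \<bar>c j\<bar> \<Longrightarrow> tie c f i = tie c f j" using r i j by blast
   then show ?thesis unfolding abs_comb_le[OF assms i j] by linarith
  qed
 qed
qed

section \<open>Flats of the arrangement as arrangements of smaller rank\<close>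

definition pull :: "('j \<Rightarrow> 'i option) \<Rightarrow> ('i \<Rightarrow> 'a::zero) \<Rightarrow> 'j \<Rightarrow> 'a" where
 "pull \<pi> h j = (case \<pi> j of None \<Rightarrow> 0 | Some i \<Rightarrow> h i)"

text \<open>A partial map onto \<open>I\<close> describes a flat of the arrangement on
  \<open>J\<close>: coordinates in one fibre are identified, and those without image are set to
  zero. By \<open>pull\<close> the arrangement of smaller rank on \<open>I\<close> is embedded as
  this flat.\<close>

locale regroup =
 fixes J :: "'j set" and I :: "'i set" and \<pi> :: "'j \<Rightarrow> 'i option"
 assumes fin: "finite J"
  and into: "\<And>j i. \<pi> j = Some i \<Longrightarrow> j \<in> J \<and> i \<in> I"
  and onto: "\<And>i. i \<in> I \<Longrightarrow> \<exists>j. \<pi> j = Some i"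
begin

lemma finI: "finite I"
proof (rule finite_subset)
 show "I \<subseteq> (\<lambda>j. the (\<pi> j)) ` J"
 proof
  fix i assume "i \<in> I"
  then obtain j where j: "\<pi> j = Some i" using onto by meson
  then show "i \<in> (\<lambda>j. the (\<pi> j)) ` J" using into[OF j] by (intro image_eqI[of _ _ j]) simp_all
 qed
qed (simp add: fin)

lemma pull_Some: "\<pi> j = Some i \<Longrightarrow> pull \<pi> h j = h i"
 by (simp add: pull_def)

lemma pull_None: "\<pi> j = None \<Longrightarrow> pull \<pi> h j = 0"
 by (simp add: pull_def)

lemma pull_nonzero:
 assumes "pull \<pi> h j \<noteq> 0"
 obtains i where "\<pi> j = Some i" "pull \<pi> h j = h i"
proof (cases "\<pi> j")
 case None
 then show thesis using assms by (simp add: pull_def)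
next
 case (Some i)
 then show thesis by (intro that[of i]) (simp_all add: pull_def)
qed

lemma same_face_pull:
 assumes "same_face I h h'"
 shows "same_face J (pull \<pi> h) (pull \<pi> h')"
 unfolding same_face_def
proof (intro conjI ballI)
 fix j
 show "(0 < pull \<pi> h j) = (0 < pull \<pi> h' j)" "(pull \<pi> h j < 0) = (pull \<pi> h' j < 0)"
 proof (atomize (full), cases "\<pi> j")
  case None
  then show "(0 < pull \<pi> h j) = (0 < pull \<pi> h' j) \<and> (pull \<pi> h j < 0) = (pull \<pi> h' j < 0)"
   by (simp add: pull_def)
 next
  case (Some i)
  then have "i \<in> I" using into by blast
  then show "(0 < pull \<pi> h j) = (0 < pull \<pi> h' j) \<and> (pull \<pi> h j < 0) = (pull \<pi> h' j < 0)"
   using Some same_faceD(1,2)[OF assms, of i i] by (simp add: pull_def)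
 qed
 fix l
 show "(\<bar>pull \<pi> h j\<bar> \<le> \<bar>pull \<pi> h l\<bar>) = (\<bar>pull \<pi> h' j\<bar> \<le> \<bar>pull \<pi> h' l\<bar>)"
 proof (cases "\<pi> j")
  case None then show ?thesis by (simp add: pull_def)
 next
  case (Some i)
  then have i: "i \<in> I" using into by blast
  show ?thesis
  proof (cases "\<pi> l")
   case None
   have "h i = 0 \<longleftrightarrow> h' i = 0" by (rule same_faceD(3)[OF assms i i])
   then show ?thesis using Some None by (simp add: pull_def)
  next
   case (Some i')
   then have "i' \<in> I" using into by blast
   then show ?thesis using Some \<open>\<pi> j = Some i\<close> same_faceD(4)[OF assms i, of i']
    by (simp add: pull_def)
  qed
 qed
qed

lemma pull_image:
 "nabs (pull \<pi> f) ` {j\<in>J. pull \<pi> f j \<noteq> 0} = nabs f ` {i\<in>I. f i \<noteq> (0::int)}"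
proof (intro equalityI subsetI)
 fix v assume "v \<in> nabs (pull \<pi> f) ` {j\<in>J. pull \<pi> f j \<noteq> 0}"
 then obtain j where "pull \<pi> f j \<noteq> 0" "v = nat \<bar>pull \<pi> f j\<bar>" by blast
 moreover from this obtain i where "\<pi> j = Some i" "pull \<pi> f j = f i" by (elim pull_nonzero)
 ultimately show "v \<in> nabs f ` {i\<in>I. f i \<noteq> 0}"
  using into[of j i] by (intro image_eqI[of _ _ i]) simp_all
next
 fix v assume "v \<in> nabs f ` {i\<in>I. f i \<noteq> 0}"
 then obtain i where i: "i \<in> I" "f i \<noteq> 0" "v = nat \<bar>f i\<bar>" by blast
 then obtain j where "\<pi> j = Some i" using onto by meson
 then show "v \<in> nabs (pull \<pi> f) ` {j\<in>J. pull \<pi> f j \<noteq> 0}"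
  using i into[of j i] by (intro image_eqI[of _ _ j]) (simp_all add: pull_Some)
qed

lemma pull_outside: "j \<notin> J \<Longrightarrow> pull \<pi> f j = 0"
proof (cases "\<pi> j")
 case (Some i)
 then show "j \<notin> J \<Longrightarrow> pull \<pi> f j = 0" using into[OF Some] by simp
qed (simp add: pull_def)

lemma pull_NF:
 assumes "f \<in> NF I"
 shows "pull \<pi> f \<in> NF J" "lev J (pull \<pi> f) = lev I f"
  "\<And>j. j \<in> J \<Longrightarrow> rk J (pull \<pi> f) j = nat \<bar>pull \<pi> f j\<bar>"
proof -
 have "nabs (pull \<pi> f) ` {j\<in>J. pull \<pi> f j \<noteq> 0} = {1..lev I f}"
  using NF_image[OF finI assms] by (simp only: pull_image)
 note NF_I[where f="pull \<pi> f", OF fin pull_outside this]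
 then show "pull \<pi> f \<in> NF J" "lev J (pull \<pi> f) = lev I f"
  "\<And>j. j \<in> J \<Longrightarrow> rk J (pull \<pi> f) j = nat \<bar>pull \<pi> f j\<bar>" by blast+
qed

lemma pull_NF_rev:
 assumes "pull \<pi> f \<in> NF J" "\<And>i. i \<notin> I \<Longrightarrow> f i = 0"
 shows "f \<in> NF I"
proof (rule NF_I(1)[where f=f])
 show "nabs f ` {i\<in>I. f i \<noteq> 0} = {1..lev J (pull \<pi> f)}"
  using NF_image[OF fin assms(1)] by (simp only: pull_image)
qed (fact finI, fact assms(2))

lemma inj_pull: "inj_on (pull \<pi>) (NF I :: ('i \<Rightarrow> int) set)"
proof (rule inj_onI, rule ext)
 fix f g :: "'i \<Rightarrow> int" and i
 assume *: "f \<in> NF I" "g \<in> NF I" "pull \<pi> f = pull \<pi> g"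
 show "f i = g i"
 proof (cases "i \<in> I")
  case True
  then obtain j where "\<pi> j = Some i" using onto by meson
  then show ?thesis using fun_cong[OF *(3), of j] by (simp add: pull_Some)
 next
  case False then show ?thesis using *(1,2) by (simp add: NF_outside)
 qed
qed

text \<open>Identified coordinates share a level, so the weight of a level is unchanged if each
  coordinate in \<open>I\<close> carries the total weight of its fibre.\<close>

lemma ftyp_pull:
 assumes wt: "\<And>i. i \<in> I \<Longrightarrow> wt' i = (\<Sum>j\<in>{j\<in>J. \<pi> j = Some i}. wt j)"
 shows "ftyp J wt (pull \<pi> h) = ftyp I wt' h"
proof -
 define f where "f = nrm I h"
 have f: "f \<in> NF I" unfolding f_def by (rule nrm_in_NF[OF finI])
 have "ftyp J wt (pull \<pi> h) = ftyp J wt (pull \<pi> f)"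
  unfolding f_def by (rule ftyp_same_face[OF same_face_pull[OF same_face_nrm[OF finI]]])
 also have "\<dots> = ftyp I wt' f"
 proof (rule nth_equalityI)
  show "length (ftyp J wt (pull \<pi> f)) = length (ftyp I wt' f)" by (simp add: pull_NF[OF f])
  fix l assume "l < length (ftyp J wt (pull \<pi> f))"
  then have l: "l < lev J (pull \<pi> f)" "l < lev I f" by (simp_all add: pull_NF[OF f])
  have rkI: "rk I f i = nat \<bar>f i\<bar>" if "i \<in> I" for i using NF_abs[OF finI f that] by simp
  have "{j\<in>J. rk J (pull \<pi> f) j = Suc l} = (\<Union>i\<in>{i\<in>I. rk I f i = Suc l}. {j\<in>J. \<pi> j = Some i})"
  proof (intro equalityI subsetI)
   fix j assume "j \<in> {j\<in>J. rk J (pull \<pi> f) j = Suc l}"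
   then have j: "j \<in> J" "nat \<bar>pull \<pi> f j\<bar> = Suc l" using pull_NF(3)[OF f, of j] by simp_all
   then have "pull \<pi> f j \<noteq> 0" by auto
   then obtain i where "\<pi> j = Some i" "pull \<pi> f j = f i" by (rule pull_nonzero)
   then show "j \<in> (\<Union>i\<in>{i\<in>I. rk I f i = Suc l}. {j\<in>J. \<pi> j = Some i})"
    using j rkI[of i] into[of j i] by simp
  next
   fix j assume "j \<in> (\<Union>i\<in>{i\<in>I. rk I f i = Suc l}. {j\<in>J. \<pi> j = Some i})"
   then obtain i where "i \<in> I" "rk I f i = Suc l" "j \<in> J" "\<pi> j = Some i" by blast
   then show "j \<in> {j\<in>J. rk J (pull \<pi> f) j = Suc l}" using rkI[of i] pull_NF(3)[OF f, of j] by (simp add: pull_Some)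
  qed
  then have "ftyp J wt (pull \<pi> f) ! l = (\<Sum>j\<in>(\<Union>i\<in>{i\<in>I. rk I f i = Suc l}. {j\<in>J. \<pi> j = Some i}). wt j)"
   by (simp only: nth_ftyp[OF l(1)])
  also have "\<dots> = (\<Sum>i\<in>{i\<in>I. rk I f i = Suc l}. \<Sum>j\<in>{j\<in>J. \<pi> j = Some i}. wt j)"
   by (rule sum.UNION_disjoint) (auto simp: fin finI)
  also have "\<dots> = (\<Sum>i\<in>{i\<in>I. rk I f i = Suc l}. wt' i)" by (rule sum.cong) (simp_all add: wt)
  finally show "ftyp J wt (pull \<pi> f) ! l = ftyp I wt' f ! l" by (simp only: nth_ftyp[OF l(2)])
 qed
 also have "\<dots> = ftyp I wt' h" unfolding f_def by (rule ftyp_nrm[OF finI])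
 finally show ?thesis .
qed

lemma comb_pull:
 "same_face J (comb J (pull \<pi> f) (pull \<pi> g)) (pull \<pi> (comb I f g))"
proof -
 \<comment> \<open>The constant built from sums over \<open>J\<close> is exchanged for the one built
   from sums over \<open>I\<close>, which dominates the pulled back vector as well.\<close>
 have "same_face J (comb J (pull \<pi> f) (pull \<pi> g))
  (\<lambda>j. (2 * (\<Sum>i\<in>I. \<bar>g i\<bar>) + 1) * pull \<pi> f j + pull \<pi> g j)"
  unfolding comb_def[of J]
 proof (intro comb_same same_face_refl comb_bound fin)
  fix j assume "j \<in> J"
  have "0 \<le> (\<Sum>i\<in>I. \<bar>g i\<bar>)" by (simp add: sum_nonneg)
  then show "2 * \<bar>pull \<pi> g j\<bar> < 2 * (\<Sum>i\<in>I. \<bar>g i\<bar>) + 1"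
   using comb_bound[OF finI, of _ g] into by (cases "\<pi> j") (simp_all add: pull_def)
 qed
 also have "(\<lambda>j. (2 * (\<Sum>i\<in>I. \<bar>g i\<bar>) + 1) * pull \<pi> f j + pull \<pi> g j) = pull \<pi> (comb I f g)"
 proof
  fix j show "(2 * (\<Sum>i\<in>I. \<bar>g i\<bar>) + 1) * pull \<pi> f j + pull \<pi> g j = pull \<pi> (comb I f g) j"
   by (cases "\<pi> j") (simp_all add: pull_def comb_def)
 qed
 finally show ?thesis .
qed

text \<open>The values of c are positive and distinct, so the nonzero levels of
  \<open>pull \<pi> c\<close> are exactly the fibres. The faces in its linear span are therefore
  those of the flat, i.e. the vectors pulled back from \<open>I\<close>.\<close>

lemma NF_below:
 assumes c: "\<And>i. i \<in> I \<Longrightarrow> 0 < c i" and inj: "inj_on c I"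
 shows "{F\<in>NF J. same_face J (comb J (pull \<pi> c) F) (pull \<pi> c)} = pull \<pi> ` NF I"
proof (intro equalityI subsetI)
 fix F assume "F \<in> {F\<in>NF J. same_face J (comb J (pull \<pi> c) F) (pull \<pi> c)}"
 then have F: "F \<in> NF J" and fixd: "same_face J (comb J (pull \<pi> c) F) (pull \<pi> c)" by simp_all
 define f where "f i = (if i \<in> I then F (SOME j. \<pi> j = Some i) else 0)" for i
 have eq: "pull \<pi> f = F"
 proof
  fix j
  show "pull \<pi> f j = F j"
  proof (cases "\<pi> j")
   case None
   then have "pull \<pi> c j = 0" by (rule pull_None)
   then have "F j = 0" using fixd[unfolded comb_fix_iff[OF fin]] NF_outside[OF F, of j] by blast
   then show ?thesis using None by (simp add: pull_None)
  next
   case (Some i)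
   define l where "l = (SOME j. \<pi> j = Some i)"
   have l: "\<pi> l = Some i" unfolding l_def using Some by (rule someI)
   have ij: "i \<in> I" "j \<in> J" "l \<in> J" using into[OF Some] into[OF l] by simp_all
   have "\<bar>pull \<pi> c j\<bar> = \<bar>pull \<pi> c l\<bar>" using Some l by (simp add: pull_Some)
   then have "tie (pull \<pi> c) F j = tie (pull \<pi> c) F l"
    using fixd[unfolded comb_fix_iff[OF fin]] ij by blast
   then have "F j = F l" using c[OF ij(1)] Some l by (simp add: tie_def pull_Some)
   then show ?thesis using Some ij by (simp add: pull_Some f_def l_def)
  qed
 qed
 have "f \<in> NF I"
 proof (rule pull_NF_rev)
  show "pull \<pi> f \<in> NF J" unfolding eq by (rule F)
 qed (simp add: f_def)
 then show "F \<in> pull \<pi> ` NF I" using eq by blast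
next
 fix F assume "F \<in> pull \<pi> ` NF I"
 then obtain f where f: "f \<in> NF I" "F = pull \<pi> f" by blast
 have zero: "\<pi> j = None" if "pull \<pi> c j = 0" for j
 proof (cases "\<pi> j")
  case (Some i)
  then show ?thesis using that c[of i] into[of j i] by (simp add: pull_Some)
 qed simp
 have "same_face J (comb J (pull \<pi> c) F) (pull \<pi> c)"
  unfolding comb_fix_iff[OF fin]
 proof (intro conjI ballI impI)
  fix j assume "pull \<pi> c j = 0"
  then have "\<pi> j = None" using zero by blast
  then show "F j = 0" by (simp add: f pull_None)
 next
  fix j l assume *: "\<bar>pull \<pi> c j\<bar> = \<bar>pull \<pi> c l\<bar>"
  have "\<pi> j = \<pi> l"
  proof (cases "\<pi> j")
   case None
   then show ?thesis using * zero[of l] by (simp add: pull_None)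
  next
   case (Some i)
   then have i: "i \<in> I" using into by blast
   then have "pull \<pi> c l \<noteq> 0" using * c[OF i] Some by (simp add: pull_Some)
   then obtain i' where i': "\<pi> l = Some i'" by (rule pull_nonzero)
   then have "i' \<in> I" using into by blast
   then have "c i = c i'" using * c i Some i' by (simp add: pull_Some abs_of_pos)
   then show ?thesis using Some i' i \<open>i' \<in> I\<close> inj_onD[OF inj] by simp
  qed
  then show "tie (pull \<pi> c) F j = tie (pull \<pi> c) F l" by (simp add: tie_def pull_def f)
 qed
 then show "F \<in> {F\<in>NF J. same_face J (comb J (pull \<pi> c) F) (pull \<pi> c)}" using f pull_NF(1) by simp
qed

end

section \<open>Chambers and faces of full support\<close>

definition generic :: "'i set \<Rightarrow> ('i \<Rightarrow> 'a::linordered_idom) \<Rightarrow> bool" where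
 "generic I z \<longleftrightarrow> (\<forall>i\<in>I. z i \<noteq> 0) \<and> inj_on (\<lambda>i. \<bar>z i\<bar>) I"

definition ordering :: "'i set \<Rightarrow> ('i \<Rightarrow> 'a::linordered_idom) \<Rightarrow> 'i list \<Rightarrow> bool" where
 "ordering I z ps \<longleftrightarrow> set ps = I \<and> (\<forall>p\<in>I. z p \<noteq> 0) \<and> sorted_wrt (abs_less z) ps"

lemma ordering_distinct: "ordering I z ps \<Longrightarrow> distinct ps"
proof -
 assume "ordering I z ps"
 then have "sorted_wrt (abs_less z) ps" by (simp add: ordering_def)
 then show "distinct ps" by (induction ps) auto
qed

text \<open>All levels are singletons, so the ranks along the ordered list increase strictly and
  have the values 1 to \<open>lev I z\<close>; such a list is determined by its set of
  entries.\<close>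

lemma ftyp_ordering:
 assumes "ordering I z ps"
 shows "ftyp I wt z = map wt ps" "lev I z = length ps"
  "\<And>k. k < length ps \<Longrightarrow> rk I z (ps ! k) = Suc k"
proof -
 have I: "set ps = I" and nz: "\<And>p. p \<in> I \<Longrightarrow> z p \<noteq> 0"
  and so: "sorted_wrt (abs_less z) ps" using assms by (simp_all add: ordering_def)
 have fin: "finite I" unfolding I[symmetric] by simp
 have so': "sorted_wrt (<) (map (rk I z) ps)"
  unfolding sorted_wrt_map
 proof (rule sorted_wrt_mono_rel[OF _ so])
  fix x y assume "x \<in> set ps" "y \<in> set ps" "abs_less z x y"
  then show "rk I z x < rk I z y" using rk_strict_mono[OF fin] I by simp
 qed
 have "{i\<in>I. z i \<noteq> 0} = I" using nz by blast
 then have "set (map (rk I z) ps) = {1..lev I z}" using rk_image[OF fin, of z] I by simp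
 also have "\<dots> = set [1..<Suc (lev I z)]" by auto
 finally have eq: "map (rk I z) ps = [1..<Suc (lev I z)]"
  using so' by (intro strict_sorted_equal) (simp_all del: upt_Suc)
 have len: "lev I z = length ps" using arg_cong[OF eq, of length] by simp
 show "lev I z = length ps" by (rule len)
 show rk: "rk I z (ps ! k) = Suc k" if "k < length ps" for k
  using arg_cong[OF eq, of "\<lambda>xs. xs ! k"] that len by (simp del: upt_Suc)
 show "ftyp I wt z = map wt ps"
 proof (rule nth_equalityI)
  show "length (ftyp I wt z) = length (map wt ps)" by (simp add: len)
  fix k assume "k < length (ftyp I wt z)"
  then have k: "k < lev I z" "k < length ps" by (simp_all add: len)
  have "{i\<in>I. rk I z i = Suc k} = {ps ! k}"
  proof (intro equalityI subsetI)
   fix i assume "i \<in> {i\<in>I. rk I z i = Suc k}"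
   then obtain l where l: "l < length ps" "i = ps ! l" "rk I z i = Suc k"
    unfolding I[symmetric] by (auto simp: in_set_conv_nth)
   then show "i \<in> {ps ! k}" using rk[OF l(1)] by simp
  next
   fix i assume "i \<in> {ps ! k}"
   then show "i \<in> {i\<in>I. rk I z i = Suc k}" using rk[OF k(2)] nth_mem[OF k(2)] I by simp
  qed
  then show "ftyp I wt z ! k = map wt ps ! k" using k by (simp add: nth_ftyp)
 qed
qed

lemma ordering_exists:
 assumes "finite I" "generic I z"
 obtains ps where "ordering I z ps"
proof -
 obtain xs where xs: "set xs = I" "distinct xs" using finite_distinct_list[OF assms(1)] by blast
 define ps where "ps = sort_key (\<lambda>p. \<bar>z p\<bar>) xs"
 have "distinct (map (\<lambda>p. \<bar>z p\<bar>) ps)"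
  using assms(2) xs by (simp add: ps_def distinct_map generic_def)
 moreover have "sorted (map (\<lambda>p. \<bar>z p\<bar>) ps)" unfolding ps_def by (rule sorted_sort_key)
 ultimately have "sorted_wrt (<) (map (\<lambda>p. \<bar>z p\<bar>) ps)" by (simp add: strict_sorted_iff)
 then have "ordering I z ps"
  using assms(2) xs by (simp add: ordering_def sorted_wrt_map generic_def ps_def)
 then show thesis by (rule that)
qed

lemma ordering_cong:
 assumes "ordering I z ps" "\<And>p. p \<in> I \<Longrightarrow> z' p \<noteq> 0"
  and "\<And>p q. p \<in> I \<Longrightarrow> q \<in> I \<Longrightarrow> abs_less z p q \<Longrightarrow> abs_less z' p q"
 shows "ordering I z' ps"
 unfolding ordering_def
proof (intro conjI)
 have I: "set ps = I" and so: "sorted_wrt (abs_less z) ps"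
  using assms(1) by (simp_all add: ordering_def)
 show "set ps = I" by fact
 show "\<forall>p\<in>I. z' p \<noteq> 0" using assms(2) by blast
 show "sorted_wrt (abs_less z') ps"
  by (rule sorted_wrt_mono_rel[OF _ so]) (use assms(3) I in blast)
qed

text \<open>One implication between the comparisons is enough, since the coordinates of z are
  totally ordered by absolute value: an ordering for z is also one for \<open>z'\<close>.\<close>

lemma ftyp_order_cong:
 assumes "finite I" "generic I z" "\<And>p. p \<in> I \<Longrightarrow> z' p \<noteq> 0"
  and "\<And>p q. p \<in> I \<Longrightarrow> q \<in> I \<Longrightarrow> abs_less z p q \<Longrightarrow> abs_less z' p q"
 shows "ftyp I wt z' = ftyp I wt z"
proof -
 obtain ps where ps: "ordering I z ps" by (rule ordering_exists[OF assms(1,2)])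
 have "ordering I z' ps" by (rule ordering_cong[OF ps assms(3,4)])
 then show ?thesis using ftyp_ordering(1)[OF ps] ftyp_ordering(1) by metis
qed

text \<open>Chambers are represented by positive vectors, as sign changes do not alter
  types.\<close>

definition chamber :: "'i set \<Rightarrow> ('i \<Rightarrow> int) \<Rightarrow> bool" where
 "chamber I c \<longleftrightarrow> (\<forall>i\<in>I. 0 < c i) \<and> inj_on c I"

lemma generic_comb:
 assumes "finite I" "chamber I c"
 shows "generic I (comb I f c)"
 unfolding generic_def
proof (intro conjI ballI inj_onI)
 fix i assume "i \<in> I"
 then show "comb I f c i \<noteq> 0" using comb_eq_0[OF assms(1)] assms(2) by (force simp: chamber_def)
next
 fix i j assume ij: "i \<in> I" "j \<in> I" "\<bar>comb I f c i\<bar> = \<bar>comb I f c j\<bar>"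
 then have "tie f c i = tie f c j" using abs_comb_eq[OF assms(1) ij(1,2)] by blast
 then have "\<bar>c i\<bar> = \<bar>c j\<bar>" by (metis abs_tie)
 moreover have "0 < c i" "0 < c j" using assms(2) ij by (simp_all add: chamber_def)
 ultimately have "c i = c j" by simp
 then show "i = j" using assms(2) ij by (simp add: chamber_def inj_on_def)
qed

lemma generic_chamber:
 assumes "chamber I c"
 shows "generic I c"
 unfolding generic_def
proof (intro conjI ballI inj_onI)
 fix i assume "i \<in> I"
 then show "c i \<noteq> 0" using assms by (force simp: chamber_def)
next
 fix i j assume ij: "i \<in> I" "j \<in> I" "\<bar>c i\<bar> = \<bar>c j\<bar>"
 moreover have "0 < c i" "0 < c j" using assms ij by (simp_all add: chamber_def)
 ultimately have "c i = c j" by simp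
 then show "i = j" using assms ij by (simp add: chamber_def inj_on_def)
qed

lemma full_level_generic:
 assumes "finite I" "f \<in> NF I" "lev I f = card I"
 shows "generic I f"
proof -
 let ?g = "\<lambda>i. nat \<bar>f i\<bar>"
 have im: "?g ` {i\<in>I. f i \<noteq> 0} = {1..card I}" using NF_image[OF assms(1,2)] assms(3) by simp
 have "card {i\<in>I. f i \<noteq> 0} \<ge> card (?g ` {i\<in>I. f i \<noteq> 0})"
  by (rule card_image_le) (simp add: assms(1))
 then have ge: "card {i\<in>I. f i \<noteq> 0} \<ge> card I" unfolding im by simp
 then have eqI: "{i\<in>I. f i \<noteq> 0} = I" by (intro card_seteq assms(1)) auto
 have "card (?g ` I) = card I" using im unfolding eqI by simp
 then have "inj_on ?g I" by (rule eq_card_imp_inj_on[OF assms(1)])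
 then have "inj_on (\<lambda>i. \<bar>f i\<bar>) I" by (auto simp: inj_on_def)
 then show ?thesis using eqI by (auto simp: generic_def)
qed

text \<open>A face without ties leaves nothing for the second factor to decide.\<close>

lemma ftyp_comb_full:
 assumes "finite I" "generic I f" "chamber I c"
 shows "ftyp I wt (comb I f c) = ftyp I wt f"
proof (rule ftyp_order_cong[OF assms(1,2)])
 fix p assume "p \<in> I"
 then show "comb I f c p \<noteq> 0" using generic_comb[OF assms(1,3)] by (simp add: generic_def)
next
 fix p q assume "p \<in> I" "q \<in> I" "abs_less f p q"
 then show "\<bar>comb I f c p\<bar> < \<bar>comb I f c q\<bar>" by (simp add: abs_comb_less[OF assms(1)])
qed

definition pos :: "'a list \<Rightarrow> 'a \<Rightarrow> nat" where
 "pos ps p = (THE k. k < length ps \<and> ps ! k = p)"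

lemma pos_nth: "distinct ps \<Longrightarrow> k < length ps \<Longrightarrow> pos ps (ps ! k) = k"
 unfolding pos_def by (rule the_equality) (auto simp: nth_eq_iff_index_eq)

lemma pos_less:
 assumes "distinct ps" "p \<in> set ps"
 shows "pos ps p < length ps" "ps ! pos ps p = p"
 using assms pos_nth[OF assms(1)] by (auto simp: in_set_conv_nth)

text \<open>A chamber is encoded by an ordering of the coordinates and the set of its negative
  coordinates. Positions start at 0 and levels at 1, hence the \<open>Suc\<close>.\<close>

definition sgnface :: "'i list \<Rightarrow> 'i set \<Rightarrow> 'i \<Rightarrow> int" where
 "sgnface ps S p =
  (if p \<in> set ps then (if p \<in> S then -1 else 1) * int (Suc (pos ps p)) else 0)"

lemma abs_sgnface: "p \<in> set ps \<Longrightarrow> \<bar>sgnface ps S p\<bar> = int (Suc (pos ps p))"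
 by (simp add: sgnface_def abs_mult)

lemma ordering_sgnface:
 assumes "distinct ps"
 shows "ordering (set ps) (sgnface ps S) ps"
 unfolding ordering_def
proof (intro conjI ballI)
 fix p assume "p \<in> set ps"
 then show "sgnface ps S p \<noteq> 0" using abs_sgnface[of p ps S] by auto
next
 show "sorted_wrt (\<lambda>p q. \<bar>sgnface ps S p\<bar> < \<bar>sgnface ps S q\<bar>) ps"
  unfolding sorted_wrt_iff_nth_less
 proof (intro allI impI)
  fix i j assume ij: "i < j" "j < length ps"
  then show "\<bar>sgnface ps S (ps ! i)\<bar> < \<bar>sgnface ps S (ps ! j)\<bar>"
   by (simp add: abs_sgnface pos_nth[OF assms])
 qed
qed simp

lemma sgnface_NF:
 assumes "distinct ps"
 shows "sgnface ps S \<in> NF (set ps)"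
proof (rule NF_I(1))
 show "nabs (sgnface ps S) ` {i \<in> set ps. sgnface ps S i \<noteq> 0} = {1..length ps}"
 proof (intro equalityI subsetI)
  fix v assume "v \<in> nabs (sgnface ps S) ` {i \<in> set ps. sgnface ps S i \<noteq> 0}"
  then obtain p where p: "p \<in> set ps" "v = nat \<bar>sgnface ps S p\<bar>" by blast
  then show "v \<in> {1..length ps}" using pos_less(1)[OF assms p(1)] by (simp add: abs_sgnface Suc_le_eq)
 next
  fix v assume v: "v \<in> {1..length ps}"
  then have k: "v - 1 < length ps" by auto
  have "nat \<bar>sgnface ps S (ps ! (v - 1))\<bar> = v"
   using v k by (simp add: abs_sgnface pos_nth[OF assms])
  moreover have "sgnface ps S (ps ! (v - 1)) \<noteq> 0"
   using ordering_sgnface[OF assms, of S] nth_mem[OF k] by (simp add: ordering_def)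
  ultimately show "v \<in> nabs (sgnface ps S) ` {i \<in> set ps. sgnface ps S i \<noteq> 0}"
   using nth_mem[OF k] by (intro image_eqI[of _ _ "ps ! (v - 1)"]) simp_all
 qed
qed (simp_all add: sgnface_def)

lemma ftyp_sgnface: "distinct ps \<Longrightarrow> ftyp (set ps) wt (sgnface ps S) = map wt ps"
 by (rule ftyp_ordering(1)[OF ordering_sgnface])

lemma sgnface_bij:
 assumes "finite I"
 shows "bij_betw (\<lambda>(ps, S). sgnface ps S) ({ps. distinct ps \<and> set ps = I} \<times> Pow I)
  {f\<in>NF I. lev I f = card I}"
 unfolding bij_betw_def
proof (intro conjI inj_onI equalityI subsetI)
 fix x y assume x: "x \<in> {ps. distinct ps \<and> set ps = I} \<times> Pow I"
  and y: "y \<in> {ps. distinct ps \<and> set ps = I} \<times> Pow I"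
  and eq: "(case x of (ps, S) \<Rightarrow> sgnface ps S) = (case y of (ps, S) \<Rightarrow> sgnface ps S)"
 obtain ps S qs T where xy: "x = (ps, S)" "y = (qs, T)" by (metis surj_pair)
 have ps: "distinct ps" "set ps = I" "S \<subseteq> I" and qs: "distinct qs" "set qs = I" "T \<subseteq> I"
  using x y xy by auto
 have e: "sgnface ps S p = sgnface qs T p" for p using eq xy by simp
 have len: "length ps = length qs" using ps qs distinct_card by metis
 have "ps = qs"
 proof (rule nth_equalityI[OF len])
  fix k assume k: "k < length ps"
  then have m: "ps ! k \<in> set ps" "ps ! k \<in> set qs" using ps qs by auto
  have "int (Suc (pos ps (ps ! k))) = int (Suc (pos qs (ps ! k)))"
   using abs_sgnface[OF m(1), of S] abs_sgnface[OF m(2), of T] e by simp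
  then have "pos qs (ps ! k) = k" using pos_nth[OF ps(1) k] by simp
  then show "ps ! k = qs ! k" using pos_less(2)[OF qs(1) m(2)] by simp
 qed
 moreover have "S = T"
 proof -
  have "p \<in> S \<longleftrightarrow> p \<in> T" if "p \<in> I" for p
   using e[of p] that ps qs \<open>ps = qs\<close> by (auto simp: sgnface_def split: if_splits)
  then show ?thesis using ps qs by blast
 qed
 ultimately show "x = y" by (simp add: xy)
next
 fix f assume "f \<in> (\<lambda>(ps, S). sgnface ps S) ` ({ps. distinct ps \<and> set ps = I} \<times> Pow I)"
 then obtain ps S where *: "distinct ps" "set ps = I" "f = sgnface ps S" by auto
 have "lev I f = length ps" using ftyp_ordering(2)[OF ordering_sgnface[OF *(1)], of S] * by simp
 also have "\<dots> = card I" using distinct_card * by metis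
 finally show "f \<in> {f\<in>NF I. lev I f = card I}" using sgnface_NF[OF *(1), of S] * by simp
next
 fix f assume "f \<in> {f\<in>NF I. lev I f = card I}"
 then have f: "f \<in> NF I" "lev I f = card I" by simp_all
 obtain ps where ps: "ordering I f ps"
  by (rule ordering_exists[OF assms full_level_generic[OF assms f]])
 have d: "distinct ps" "set ps = I" using ordering_distinct[OF ps] ps by (simp_all add: ordering_def)
 have "f = sgnface ps {p\<in>I. f p < 0}"
 proof
  fix p show "f p = sgnface ps {p\<in>I. f p < 0} p"
  proof (cases "p \<in> I")
   case True
   then have p: "p \<in> set ps" using d by simp
   have "rk I f p = Suc (pos ps p)"
    using ftyp_ordering(3)[OF ps pos_less(1)[OF d(1) p]] pos_less(2)[OF d(1) p] by simp
   then have "\<bar>f p\<bar> = int (Suc (pos ps p))" using NF_abs[OF assms f(1) True] by simp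
   then show ?thesis using True p by (cases "f p < 0") (simp_all add: sgnface_def)
  next
   case False
   then show ?thesis using NF_outside[OF f(1)] d by (simp add: sgnface_def)
  qed
 qed
 then show "f \<in> (\<lambda>(ps, S). sgnface ps S) ` ({ps. distinct ps \<and> set ps = I} \<times> Pow I)"
  using d by (intro image_eqI[of _ _ "(ps, {p\<in>I. f p < 0})"]) auto
qed

section \<open>Counting faces of a given type\<close>

definition arrangements :: "'i set \<Rightarrow> ('i \<Rightarrow> nat) \<Rightarrow> nat list \<Rightarrow> 'i list set" where
 "arrangements I wt u = {ps. distinct ps \<and> set ps = I \<and> map wt ps = u}"

lemma finite_arrangements: "finite I \<Longrightarrow> finite (arrangements I wt u)"
 by (rule finite_subset[OF _ finite_subset_distinct[of I]]) (auto simp: arrangements_def)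

text \<open>A type with as many letters as there are coordinates is the type of chambers only, i.e.
  of orderings with signs. A summand that does not see the signs is repeated for each of the 2^card
  I sign patterns.\<close>

lemma sum_full:
 fixes h :: "'i list \<Rightarrow> 'k::field"
 assumes fin: "finite I" and len: "length u = card I"
  and g: "\<And>ps S. ps \<in> arrangements I wt u \<Longrightarrow> S \<subseteq> I \<Longrightarrow> g (sgnface ps S) = h ps"
 shows "(\<Sum>f\<in>{f\<in>NF I. ftyp I wt f = u}. g f) = 2 ^ card I * (\<Sum>ps\<in>arrangements I wt u. h ps)"
proof -
 have bij: "bij_betw (\<lambda>(ps, S). sgnface ps S) (arrangements I wt u \<times> Pow I) {f\<in>NF I. ftyp I wt f = u}"
 proof -
  have "(\<lambda>(ps, S). sgnface ps S) ` (arrangements I wt u \<times> Pow I) = {f\<in>NF I. ftyp I wt f = u}"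
  proof (intro equalityI subsetI)
   fix f assume "f \<in> (\<lambda>(ps, S). sgnface ps S) ` (arrangements I wt u \<times> Pow I)"
   then obtain ps S where *: "distinct ps" "set ps = I" "map wt ps = u" "f = sgnface ps S"
    by (auto simp: arrangements_def)
   then show "f \<in> {f\<in>NF I. ftyp I wt f = u}"
    using sgnface_NF[OF *(1), of S] ftyp_sgnface[OF *(1), of wt S] by simp
  next
   fix f assume "f \<in> {f\<in>NF I. ftyp I wt f = u}"
   then have f: "f \<in> NF I" "ftyp I wt f = u" by simp_all
   have "lev I f = card I" using f(2) len length_ftyp[of I wt f] by simp
   then have "f \<in> (\<lambda>(ps, S). sgnface ps S) ` ({ps. distinct ps \<and> set ps = I} \<times> Pow I)"
    using sgnface_bij[OF fin] f(1) by (simp add: bij_betw_def)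
   then obtain ps S where *: "distinct ps" "set ps = I" "S \<subseteq> I" "f = sgnface ps S" by auto
   then have "map wt ps = u" using ftyp_sgnface[OF *(1), of wt S] f(2) by simp
   then show "f \<in> (\<lambda>(ps, S). sgnface ps S) ` (arrangements I wt u \<times> Pow I)"
    using * by (intro image_eqI[of _ _ "(ps, S)"]) (auto simp: arrangements_def)
  qed
  moreover have "inj_on (\<lambda>(ps, S). sgnface ps S) (arrangements I wt u \<times> Pow I)"
   by (rule inj_on_subset[OF bij_betw_imp_inj_on[OF sgnface_bij[OF fin]]])
    (auto simp: arrangements_def)
  ultimately show ?thesis by (simp add: bij_betw_def)
 qed
 have "(\<Sum>f\<in>{f\<in>NF I. ftyp I wt f = u}. g f)
   = (\<Sum>x\<in>arrangements I wt u \<times> Pow I. g (case x of (ps, S) \<Rightarrow> sgnface ps S))"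
  by (rule sum.reindex_bij_betw[OF bij, symmetric])
 also have "\<dots> = (\<Sum>(ps, S)\<in>arrangements I wt u \<times> Pow I. h ps)"
  by (rule sum.cong[OF refl]) (auto simp: g)
 also have "\<dots> = (\<Sum>ps\<in>arrangements I wt u. \<Sum>S\<in>Pow I. h ps)"
  by (rule sum.cartesian_product[symmetric])
 also have "\<dots> = (\<Sum>ps\<in>arrangements I wt u. 2 ^ card I * h ps)"
  by (simp add: card_Pow fin)
 finally show ?thesis by (simp only: sum_distrib_left)
qed

text \<open>The product of the factorials of the multiplicities of the letters, split off letter by
  letter. In this form each factor is visibly at most the length of the word, which is what its
  invertibility rests on.\<close>

fun arrcount :: "nat list \<Rightarrow> nat" where
 "arrcount [] = 1"
| "arrcount (x # u) = Suc (count (mset u) x) * arrcount u"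

lemma card_arrangements:
 assumes "finite I" "image_mset wt (mset_set I) = mset u"
 shows "card (arrangements I wt u) = arrcount u"
 using assms
proof (induction u arbitrary: I)
 case Nil
 then have "I = {}" by (simp add: mset_set_empty_iff)
 then have "arrangements I wt [] = {[]}" by (auto simp: arrangements_def)
 then show ?case by simp
next
 case (Cons x u)
 let ?P = "{p\<in>I. wt p = x}"
 have eq: "arrangements I wt (x # u) = (\<Union>p\<in>?P. (#) p ` arrangements (I - {p}) wt u)"
 proof (intro equalityI subsetI)
  fix ps assume "ps \<in> arrangements I wt (x # u)"
  then obtain p qs where "ps = p # qs" "distinct (p # qs)" "set (p # qs) = I" "wt p = x" "map wt qs = u"
   by (cases ps) (auto simp: arrangements_def)
  then show "ps \<in> (\<Union>p\<in>?P. (#) p ` arrangements (I - {p}) wt u)"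
   by (auto simp: arrangements_def)
 next
  fix ps assume "ps \<in> (\<Union>p\<in>?P. (#) p ` arrangements (I - {p}) wt u)"
  then obtain p qs where "p \<in> I" "wt p = x" "ps = p # qs" "qs \<in> arrangements (I - {p}) wt u" by auto
  then show "ps \<in> arrangements I wt (x # u)" by (auto simp: arrangements_def)
 qed
 have card: "card ((#) p ` arrangements (I - {p}) wt u) = arrcount u" if "p \<in> ?P" for p
 proof -
  have "mset_set I = add_mset p (mset_set (I - {p}))"
   using that Cons.prems(1) by (simp add: mset_set.remove)
  then have "image_mset wt (mset_set (I - {p})) = mset u"
   using Cons.prems(2) that by simp
  then have "card (arrangements (I - {p}) wt u) = arrcount u"
   using Cons.IH[of "I - {p}"] Cons.prems(1) by simp
  then show ?thesis by (simp add: card_image)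
 qed
 have "card (arrangements I wt (x # u)) = (\<Sum>p\<in>?P. card ((#) p ` arrangements (I - {p}) wt u))"
  unfolding eq
  by (rule card_UN_disjoint) (use Cons.prems(1) in \<open>auto simp: finite_arrangements\<close>)
 also have "\<dots> = (\<Sum>p\<in>?P. arrcount u)" by (rule sum.cong[OF refl]) (rule card)
 also have "\<dots> = card ?P * arrcount u" by simp
 also have "card ?P = count (image_mset wt (mset_set I)) x"
  using Cons.prems(1) by (simp add: count_image_mset vimage_def Int_def conj_commute)
 also have "\<dots> = Suc (count (mset u) x)" by (simp add: Cons.prems(2))
 finally show ?case by simp
qed

lemma arrcount_perm:
 assumes "mset u = mset u'"
 shows "arrcount u = arrcount u'"
proof -
 have "arrcount u = (\<Prod>v\<in>set_mset (mset u). fact (count (mset u) v))" for u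
 proof (induction u)
  case (Cons x u)
  let ?p = "\<Prod>v\<in>set u - {x}. fact (count (mset u) v) :: nat"
  have "(\<Prod>v\<in>set (x # u). fact (count (mset (x # u)) v)) = fact (Suc (count (mset u) x)) * ?p"
   by (subst prod.remove[of _ x]) (auto intro!: prod.cong)
  moreover have "(\<Prod>v\<in>set u. fact (count (mset u) v)) = fact (count (mset u) x) * ?p"
  proof (cases "x \<in> set u")
   case True
   then show ?thesis by (simp add: prod.remove)
  next
   case False
   then have *: "count (mset u) x = 0" by (simp add: count_eq_zero_iff)
   show ?thesis unfolding * using False by simp
  qed
  ultimately show ?case using Cons.IH by (simp add: algebra_simps)
 qed simp
 then show ?thesis using assms by (simp only:)
qed

lemma arrcount_nonzero:
 assumes "\<And>i. 1 \<le> i \<Longrightarrow> i \<le> length u \<Longrightarrow> of_nat i \<noteq> (0::'k::field)"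
 shows "of_nat (arrcount u) \<noteq> (0::'k)"
 using assms
proof (induction u)
 case (Cons x u)
 have "count (mset u) x \<le> length u" by (metis count_le_size size_mset)
 then have "of_nat (Suc (count (mset u) x)) \<noteq> (0::'k)" by (intro Cons.prems) simp_all
 moreover have "of_nat (arrcount u) \<noteq> (0::'k)" by (rule Cons.IH) (rule Cons.prems, simp_all)
 ultimately show ?case by (simp only: arrcount.simps of_nat_mult mult_eq_0_iff simp_thms)
qed simp

lemma arrangements_at:
 assumes "finite I" "p \<in> I" "i < length u" "wt p = u ! i"
 shows "card {ps\<in>arrangements I wt u. ps ! i = p}
  = card (arrangements (I - {p}) wt (take i u @ drop (Suc i) u))"
proof -
 let ?f = "\<lambda>ps. take i ps @ drop (Suc i) ps" and ?g = "\<lambda>qs. take i qs @ p # drop i qs"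
 have "bij_betw ?f {ps\<in>arrangements I wt u. ps ! i = p} (arrangements (I - {p}) wt (take i u @ drop (Suc i) u))"
 proof (rule bij_betw_byWitness[where f' = ?g])
 show "\<forall>a\<in>{ps \<in> arrangements I wt u. ps ! i = p}. ?g (?f a) = a"
 proof
  fix ps assume "ps \<in> {ps \<in> arrangements I wt u. ps ! i = p}"
  then have "i < length ps" "ps ! i = p" using assms(3) by (auto simp: arrangements_def)
  then show "?g (?f ps) = ps" using id_take_nth_drop[of i ps] by (simp add: min_def)
 qed
 have len: "length qs = length u - 1" if "map wt qs = take i u @ drop (Suc i) u" for qs
  using arg_cong[OF that, of length] assms(3) by simp
 show "\<forall>a'\<in>arrangements (I - {p}) wt (take i u @ drop (Suc i) u). ?f (?g a') = a'"
  using len assms(3) by (auto simp: arrangements_def min_def)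
 show "?f ` {ps \<in> arrangements I wt u. ps ! i = p} \<subseteq> arrangements (I - {p}) wt (take i u @ drop (Suc i) u)"
 proof
  fix qs assume "qs \<in> ?f ` {ps \<in> arrangements I wt u. ps ! i = p}"
  then obtain ps where ps: "distinct ps" "set ps = I" "map wt ps = u" "ps ! i = p" "qs = ?f ps"
   by (auto simp: arrangements_def)
  have i: "i < length ps" using ps(3) assms(3) by auto
  have split: "ps = take i ps @ p # drop (Suc i) ps" using id_take_nth_drop[OF i] ps(4) by simp
  have "distinct (take i ps @ p # drop (Suc i) ps)" "set (take i ps @ p # drop (Suc i) ps) = I"
   using ps split by metis+
  then have "distinct qs" "set qs = I - {p}" unfolding ps(5) by auto
  then show "qs \<in> arrangements (I - {p}) wt (take i u @ drop (Suc i) u)"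
   using ps by (auto simp: arrangements_def take_map drop_map)
 qed
 show "?g ` arrangements (I - {p}) wt (take i u @ drop (Suc i) u) \<subseteq> {ps \<in> arrangements I wt u. ps ! i = p}"
 proof
  fix ps assume "ps \<in> ?g ` arrangements (I - {p}) wt (take i u @ drop (Suc i) u)"
  then obtain qs where qs: "distinct qs" "set qs = I - {p}" "map wt qs = take i u @ drop (Suc i) u"
   "ps = ?g qs" by (auto simp: arrangements_def)
  have i: "i \<le> length qs" using len[OF qs(3)] assms(3) by simp
  define A B where "A = take i qs" and "B = drop i qs"
  have AB: "qs = A @ B" "length A = i" "ps = A @ p # B"
   using i qs(4) by (simp_all add: A_def B_def)
  have "map wt A @ map wt B = take i u @ drop (Suc i) u" using qs(3) AB(1) by simp
  then have wtAB: "map wt A = take i u" "map wt B = drop (Suc i) u"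
   using AB(2) assms(3) by (simp_all add: append_eq_append_conv)
  have "distinct ps" "set ps = I" using qs(1,2) AB assms(2) by auto
  moreover have "map wt ps = u"
   using id_take_nth_drop[OF assms(3)] assms(4) wtAB AB(3) by simp
  moreover have "ps ! i = p" using AB by (simp add: nth_append)
  ultimately show "ps \<in> {ps \<in> arrangements I wt u. ps ! i = p}" by (simp add: arrangements_def)
 qed
 qed
 then show ?thesis by (rule bij_betw_same_card)
qed

text \<open>Relabelling the levels by a permutation, with signs kept, turns faces of type u into
  faces of type \<open>u'\<close>. This is the source of the radical: orbit sums of rearranged types
  have equal character values.\<close>

lemma card_type_perm_le:
 assumes fin: "finite I" and perm: "mset u = mset u'"
 shows "card {f\<in>NF I. ftyp I wt f = u} \<le> card {f\<in>NF I. ftyp I wt f = u'}"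
proof -
 obtain \<pi> where \<pi>: "\<pi> permutes {..<length u}" "permute_list \<pi> u = u'"
  using mset_eq_permutation[OF perm] by (metis mset_eq_permutation perm mset_eq_length)
 define \<rho> where "\<rho> = inv_into UNIV \<pi>"
 have \<rho>: "\<rho> permutes {..<length u}" unfolding \<rho>_def by (rule permutes_inv[OF \<pi>(1)])
 \<comment> \<open>The relabelling of single entries. Levels are numbered from 1 whereas \<rho> acts
   on positions from 0, hence the shift; the entry 0 is fixed.\<close>
 define s :: "int \<Rightarrow> int" where "s x = sgn x * (int (\<rho> (nat \<bar>x\<bar> - 1)) + 1)" for x
 have s0: "s x = 0 \<longleftrightarrow> x = 0" for x by (cases "x = 0") (simp_all add: s_def sgn_if)
 have abs_s: "nat \<bar>s x\<bar> = Suc (\<rho> (nat \<bar>x\<bar> - 1))" if "x \<noteq> 0" for x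
  using that by (simp add: s_def abs_mult)
 have sgn_s: "sgn (s x) = sgn x" for x by (simp add: s_def sgn_mult)
 have inj_s: "s x = s y \<Longrightarrow> x = y" for x y
 proof (cases "x = 0 \<or> y = 0")
  case True
  then show "s x = s y \<Longrightarrow> x = y" using s0 by metis
 next
  case False
  assume eq: "s x = s y"
  have "\<rho> (nat \<bar>x\<bar> - 1) = \<rho> (nat \<bar>y\<bar> - 1)" using abs_s[of x] abs_s[of y] False eq by simp
  then have "nat \<bar>x\<bar> - 1 = nat \<bar>y\<bar> - 1" by (rule injD[OF permutes_inj[OF \<rho>]])
  moreover have "nat \<bar>x\<bar> \<noteq> 0" "nat \<bar>y\<bar> \<noteq> 0" using False by simp_all
  ultimately have "nat \<bar>x\<bar> = nat \<bar>y\<bar>" by (metis Suc_pred' gr0I)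
  then have "\<bar>x\<bar> = \<bar>y\<bar>" by (simp only: eq_nat_nat_iff abs_ge_zero)
  moreover have "sgn x = sgn y" using sgn_s eq by metis
  ultimately show "x = y" by (metis abs_mult_sgn mult.commute)
 qed
 have "(\<lambda>f. s \<circ> f) ` {f\<in>NF I. ftyp I wt f = u} \<subseteq> {f\<in>NF I. ftyp I wt f = u'}"
 proof
  fix g assume "g \<in> (\<lambda>f. s \<circ> f) ` {f\<in>NF I. ftyp I wt f = u}"
  then obtain f where f: "f \<in> NF I" "ftyp I wt f = u" "g = s \<circ> f" by blast
  have lev: "lev I f = length u" using f(2) length_ftyp[of I wt f] by simp
  have "nabs g ` {i\<in>I. g i \<noteq> 0} = (\<lambda>v. Suc (\<rho> (v - 1))) ` (nabs f ` {i\<in>I. f i \<noteq> 0})"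
   unfolding image_image by (rule image_cong) (simp_all add: f(3) s0 abs_s)
  also have "\<dots> = (\<lambda>v. Suc (\<rho> (v - 1))) ` {1..length u}" by (simp only: NF_image[OF fin f(1)] lev)
  also have "{1..length u} = Suc ` {..<length u}" by (auto simp: image_iff Suc_le_eq gr0_conv_Suc)
  also have "(\<lambda>v. Suc (\<rho> (v - 1))) ` Suc ` {..<length u} = Suc ` (\<rho> ` {..<length u})"
   by (simp add: image_image)
  also have "\<dots> = Suc ` {..<length u}" by (simp only: permutes_image[OF \<rho>])
  also have "\<dots> = {1..length u}" by (auto simp: image_iff Suc_le_eq gr0_conv_Suc)
  finally have im: "nabs g ` {i\<in>I. g i \<noteq> 0} = {1..length u}" .
  have out: "g i = 0" if "i \<notin> I" for i using NF_outside[OF f(1) that] by (simp add: f(3) s0)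
  have g: "g \<in> NF I" "lev I g = length u" "\<And>i. i \<in> I \<Longrightarrow> rk I g i = nat \<bar>g i\<bar>"
   using NF_I[where f=g, OF fin out im] by blast+
  have "ftyp I wt g = u'"
  proof (rule nth_equalityI)
   show "length (ftyp I wt g) = length u'" using g(2) mset_eq_length[OF perm] by simp
   fix l assume "l < length (ftyp I wt g)"
   then have l: "l < length u" "l < lev I g" using g(2) by simp_all
   have \<pi>l: "\<pi> l < lev I f" using permutes_in_image[OF \<pi>(1), of l] l lev by simp
   have "{i\<in>I. rk I g i = Suc l} = {i\<in>I. rk I f i = Suc (\<pi> l)}"
   proof (rule Collect_cong, rule conj_cong[OF refl])
    fix i assume i: "i \<in> I"
    show "rk I g i = Suc l \<longleftrightarrow> rk I f i = Suc (\<pi> l)"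
    proof (cases "f i = 0")
     case True
     then have "g i = 0" by (simp add: f(3) s0)
     then show ?thesis using True rk_eq_0_iff[OF fin i, of f] rk_eq_0_iff[OF fin i, of g] by auto
    next
     case False
     have "rk I g i = Suc (\<rho> (nat \<bar>f i\<bar> - 1))" using g(3)[OF i] abs_s[OF False] by (simp add: f(3))
     moreover have "nat \<bar>f i\<bar> = rk I f i" using NF_abs[OF fin f(1) i] by simp
     ultimately have rk: "rk I g i = Suc (\<rho> (rk I f i - 1))" by simp
     have "rk I f i \<noteq> 0" using rk_eq_0_iff[OF fin i] False by blast
     then obtain m where m: "rk I f i = Suc m" by (metis not0_implies_Suc)
     have "\<rho> m = l \<longleftrightarrow> \<pi> l = m"
      unfolding \<rho>_def by (rule permutes_inv_eq[OF \<pi>(1)])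
     then show ?thesis unfolding rk m by auto
    qed
   qed
   then have "ftyp I wt g ! l = ftyp I wt f ! \<pi> l" by (simp add: nth_ftyp l \<pi>l)
   also have "\<dots> = u' ! l" using \<pi> l f(2) by (auto simp: permute_list_nth)
   finally show "ftyp I wt g ! l = u' ! l" .
  qed
  then show "g \<in> {f\<in>NF I. ftyp I wt f = u'}" using g(1) by simp
 qed
 moreover have "inj_on (\<lambda>f. s \<circ> f) {f\<in>NF I. ftyp I wt f = u}"
 proof (rule inj_onI, rule ext)
  fix f g :: "'a \<Rightarrow> int" and i
  assume "s \<circ> f = s \<circ> g"
  then have "s (f i) = s (g i)" by (metis comp_apply)
  then show "f i = g i" by (rule inj_s)
 qed
 ultimately show ?thesis by (intro card_inj_on_le) (simp_all add: finite_NF[OF fin])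
qed

lemma card_type_perm:
 assumes "finite I" "mset u = mset u'"
 shows "card {f\<in>NF I. ftyp I wt f = u} = card {f\<in>NF I. ftyp I wt f = u'}"
 using card_type_perm_le[OF assms] card_type_perm_le[OF assms(1) sym[OF assms(2)]]
 by (rule order_antisym)

section \<open>Functions on words compatible with the square of the radical\<close>

text \<open>\<open>lastfun T g w\<close> sums \<open>g\<close> of the last letter over the occurrences of \<open>T\<close>, in any order, as a
 subword of \<open>w\<close>. The recursion reads the word backwards to meet the last letter first.\<close>

fun subcount_rev :: "nat multiset \<Rightarrow> nat list \<Rightarrow> 'k::field" where
 "subcount_rev M [] = (if M = {#} then 1 else 0)"
| "subcount_rev M (v # w) =
  subcount_rev M w + (if v \<in># M then subcount_rev (M - {#v#}) w else 0)"

fun lastfun_rev :: "nat multiset \<Rightarrow> (nat \<Rightarrow> 'k::field) \<Rightarrow> nat list \<Rightarrow> 'k" where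
 "lastfun_rev T g [] = 0"
| "lastfun_rev T g (v # w) =
  lastfun_rev T g w + (if v \<in># T then g v * subcount_rev (T - {#v#}) w else 0)"

definition lastfun :: "nat multiset \<Rightarrow> (nat \<Rightarrow> 'k::field) \<Rightarrow> nat list \<Rightarrow> 'k" where
 "lastfun T g w = lastfun_rev T g (rev w)"

lemma subcount_rev_swap: "subcount_rev M (x # y # w) = subcount_rev M (y # x # w)"
 by (cases "x \<in># M"; cases "y \<in># M"; cases "x = y")
  (simp_all add: diff_right_commute in_diff_count algebra_simps)

lemma subcount_rev_swap_append:
 "subcount_rev M (U @ x # y # w) = subcount_rev M (U @ y # x # w)"
proof (induction U arbitrary: M)
 case Nil show ?case unfolding append_Nil by (rule subcount_rev_swap)
qed simp

lemma subcount_rev_empty [simp]: "subcount_rev {#} w = 1"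
 by (induction w) simp_all

lemma subcount_rev_single: "subcount_rev {#z#} w = of_nat (count (mset w) z)"
 by (induction w) simp_all

text \<open>If \<phi> is extended linearly to noncommutative polynomials in the letters, this is its
  value at L [x,y] U.\<close>

definition comm_diff :: "(nat list \<Rightarrow> 'k::field) \<Rightarrow> nat list \<Rightarrow> nat \<Rightarrow> nat \<Rightarrow> nat list \<Rightarrow> 'k" where
 "comm_diff \<phi> L x y U = \<phi> (L @ x # y # U) - \<phi> (L @ y # x # U)"

text \<open>The value of the linear extension at L [p,[q,r]] U, which explains the antisymmetry in q
  and r and the Jacobi identity below.\<close>

definition brack :: "(nat list \<Rightarrow> 'k::field) \<Rightarrow> nat list \<Rightarrow> nat \<Rightarrow> nat \<Rightarrow> nat \<Rightarrow> nat list \<Rightarrow> 'k" where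
 "brack \<phi> L p q r U = comm_diff \<phi> (L @ [p]) q r U - comm_diff \<phi> L q r (p # U)"

abbreviation brack_sum :: "(nat list \<Rightarrow> 'k::field) \<Rightarrow> nat list \<Rightarrow> nat \<Rightarrow> nat \<Rightarrow> nat \<Rightarrow> 'k" where
 "brack_sum \<phi> \<alpha> p q r \<equiv>
  \<Sum>i\<in>{i. i < length \<alpha> \<and> \<alpha> ! i = p + q + r}. brack \<phi> (take i \<alpha>) p q r (drop (Suc i) \<alpha>)"

lemma brack_eq:
 "brack \<phi> L p q r U =
  \<phi> (L @ p # q # r # U) - \<phi> (L @ p # r # q # U) - \<phi> (L @ q # r # p # U) + \<phi> (L @ r # q # p # U)"
 by (simp add: brack_def comm_diff_def)

lemma comm_diff_swap: "comm_diff \<phi> L y x U = - comm_diff \<phi> L x y U"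
 by (simp add: comm_diff_def)

lemma comm_diff_self [simp]: "comm_diff \<phi> L x x U = 0"
 by (simp add: comm_diff_def)

lemma brack_swap: "brack \<phi> L p r q U = - brack \<phi> L p q r U"
 by (simp add: brack_eq)

lemma brack_self [simp]: "brack \<phi> L p q q U = 0"
 by (simp add: brack_eq)

lemma brack_jacobi: "brack \<phi> L z x y U = brack \<phi> L x z y U - brack \<phi> L y z x U"
 by (simp add: brack_eq)

text \<open>Exchanging the neighbours x and y affects only the occurrences of T whose last two
  letters are exactly these two; every other occurrence corresponds to one with the same last
  letter. What remains of T is then found in L.\<close>

lemma comm_diff_lastfun:
 "comm_diff (lastfun T g) L x y U =
  (if {#x, y#} \<subseteq># T then (g y - g x) * subcount_rev (T - {#x, y#}) (rev L) else 0)"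
proof -
 have base: "lastfun_rev T g (y # x # w) - lastfun_rev T g (x # y # w) =
  (if {#x, y#} \<subseteq># T then (g y - g x) * subcount_rev (T - {#x, y#}) w else 0)" for w
 proof (cases "x \<in># T \<and> y \<in># T")
  case True
  show ?thesis
  proof (cases "x = y")
   case False
   with True have "{#x, y#} \<subseteq># T" by (simp add: insert_subset_eq_iff in_diff_count)
   moreover have "x \<in># T - {#y#}" "y \<in># T - {#x#}" using True False by (simp_all add: in_diff_count)
   moreover have "T - {#y#} - {#x#} = T - {#x, y#}" "T - {#x#} - {#y#} = T - {#x, y#}"
    by (rule multiset_eqI, simp)+
   ultimately show ?thesis using True by (simp add: algebra_simps)
  qed simp
 next
  case False
  then have "\<not> {#x, y#} \<subseteq># T" by (auto simp: insert_subset_eq_iff dest: in_diffD)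
  moreover have "x \<notin># T \<Longrightarrow> x \<notin># T - {#y#}" "y \<notin># T \<Longrightarrow> y \<notin># T - {#x#}" by (auto dest: in_diffD)
  ultimately show ?thesis using False by (cases "x \<in># T"; cases "y \<in># T") simp_all
 qed
 have "lastfun_rev T g (V @ y # x # w) - lastfun_rev T g (V @ x # y # w) =
  (if {#x, y#} \<subseteq># T then (g y - g x) * subcount_rev (T - {#x, y#}) w else 0)" for V w
 proof (induction V)
  case Nil show ?case unfolding append_Nil by (rule base)
 next
  case (Cons v V)
  \<comment> \<open>A letter behind the exchanged pair contributes equally to both words, because
    the counts of the rest of T ignore the order of the letters.\<close>
  have "lastfun_rev T g ((v # V) @ y # x # w) - lastfun_rev T g ((v # V) @ x # y # w)
    = lastfun_rev T g (V @ y # x # w) - lastfun_rev T g (V @ x # y # w)"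
   by (simp add: subcount_rev_swap_append[of _ V y x w])
  then show ?case using Cons.IH by simp
 qed
 from this[of "rev U" "rev L"] show ?thesis by (simp add: comm_diff_def lastfun_def)
qed

text \<open>Words of equal content are linked by exchanges of neighbours: the first letter of one
  word is moved to the front of the other, and induction with a growing common prefix settles the
  rest.\<close>

lemma constant_if_comm_diff_zero:
 assumes zero: "\<And>L x y U. mset (L @ x # y # U) = \<mu> \<Longrightarrow> comm_diff \<psi> L x y U = 0"
  and "mset w = \<mu>" "mset w' = \<mu>"
 shows "\<psi> w = \<psi> w'"
proof -
 have move: "\<psi> (L @ A @ x # B) = \<psi> (L @ x # A @ B)" if "mset (L @ x # A @ B) = \<mu>" for L A x B
  using that
 proof (induction A arbitrary: L)
  case (Cons a A)
  have "\<psi> ((L @ [a]) @ A @ x # B) = \<psi> ((L @ [a]) @ x # A @ B)"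
   by (rule Cons.IH) (use Cons.prems in \<open>simp add: ac_simps add_mset_commute\<close>)
  moreover have "comm_diff \<psi> L a x (A @ B) = 0"
   by (rule zero) (use Cons.prems in \<open>simp add: ac_simps add_mset_commute\<close>)
  ultimately show ?case by (simp add: comm_diff_def)
 qed simp
 have "\<psi> (L @ w) = \<psi> (L @ w')" if "mset w = mset w'" "mset (L @ w) = \<mu>" for L
  using that
 proof (induction w arbitrary: L w')
  case (Cons x v)
  then have "x \<in> set w'" by (metis list.set_intros(1) set_mset_mset)
  then obtain A B where w': "w' = A @ x # B" by (meson split_list)
  have v: "mset v = mset (A @ B)" using Cons.prems(1) w' by simp
  have "\<psi> ((L @ [x]) @ v) = \<psi> ((L @ [x]) @ (A @ B))"
   by (rule Cons.IH[OF v]) (use Cons.prems(2) in simp)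
  also have "\<dots> = \<psi> (L @ A @ x # B)"
   using move[of L x A B] Cons.prems(2) v by simp
  finally show ?case by (simp add: w')
 qed simp
 from this[of "[]"] show ?thesis using assms(2,3) by simp
qed

section \<open>Solving the relations\<close>

lemma sum_mset_count_cong:
 fixes f :: "'b \<Rightarrow> 'k::field"
 assumes "finite A" "set_mset M \<subseteq> A"
 shows "(\<Sum>z\<in>#M. f z) = (\<Sum>z\<in>A. of_nat (count M z) * f z)"
 using assms(2)
proof (induction M)
 case (add x M)
 have "(\<Sum>z\<in>A. of_nat (count (add_mset x M) z) * f z)
   = (\<Sum>z\<in>A. of_nat (count M z) * f z + (if z = x then f z else 0))"
  by (rule sum.cong) (simp_all add: algebra_simps)
 also have "\<dots> = (\<Sum>z\<in>A. of_nat (count M z) * f z) + f x"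
  using add.prems assms(1) by (simp add: sum.distrib)
 finally show ?case using add by simp
qed simp

text \<open>Both relations reflect the vanishing on products of two radical elements: a commutator
  at the front does not see the order of the other letters, and neither does the sum of the brackets
  substituted for the single copies of p + q + r. The condition \<open>inv\<close> serves to divide
  by the number of these copies.\<close>

locale word_functional =
 fixes \<phi> :: "nat list \<Rightarrow> 'k::field" and \<mu> :: "nat multiset"
 assumes pos: "0 \<notin># \<mu>"
  and inv: "\<And>i. 1 \<le> i \<Longrightarrow> i \<le> size \<mu> \<Longrightarrow> of_nat i \<noteq> (0::'k)"
  and pair_rel: "\<And>a b u u'. mset (a # b # u) = \<mu> \<Longrightarrow> mset u = mset u' \<Longrightarrow>
    comm_diff \<phi> [] a b u = comm_diff \<phi> [] a b u'"
  and triple_rel: "\<And>p q r R \<alpha> \<alpha>'. mset (p # q # r # R) = \<mu> \<Longrightarrow>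
    mset \<alpha> = mset ((p + q + r) # R) \<Longrightarrow> mset \<alpha>' = mset \<alpha> \<Longrightarrow>
    brack_sum \<phi> \<alpha> p q r =
    brack_sum \<phi> \<alpha>' p q r"
begin

definition movable :: "nat \<Rightarrow> nat \<Rightarrow> nat \<Rightarrow> bool" where
 "movable p q r \<longleftrightarrow> (\<forall>L U L' U'. add_mset p (add_mset q (add_mset r (mset (L @ U)))) = \<mu> \<longrightarrow>
  mset (L' @ U') = mset (L @ U) \<longrightarrow> brack \<phi> L p q r U = brack \<phi> L' p q r U')"

text \<open>By \<open>pair_rel\<close> this is the common value of all commutators of x and y at the
  front; the sorted list is an arbitrary choice of the remaining word.\<close>

definition beta :: "nat \<Rightarrow> nat \<Rightarrow> 'k" where
 "beta x y = comm_diff \<phi> [] x y (sorted_list_of_multiset (\<mu> - {#x, y#}))"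

definition tau :: "nat \<Rightarrow> nat \<Rightarrow> nat \<Rightarrow> 'k" where
 "tau z x y = brack \<phi> [] z x y (sorted_list_of_multiset (\<mu> - {#z, x, y#}))"

lemma brack_tau:
 assumes "movable z x y" "add_mset z (add_mset x (add_mset y (mset (L @ U)))) = \<mu>"
 shows "brack \<phi> L z x y U = tau z x y"
proof -
 have "\<mu> - {#z, x, y#} = mset (L @ U)" unfolding assms(2)[symmetric] by simp
 then show ?thesis
  using assms(1)[unfolded movable_def, rule_format, OF assms(2), of "[]" "sorted_list_of_multiset (\<mu> - {#z, x, y#})"]
  unfolding tau_def by simp
qed

text \<open>A telescoping sum: taking the last letter z of L to the other side of the commutator
  costs the bracket [z,[x,y]], and a commutator that has reached the front has the value
  \<open>beta x y\<close>.\<close>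

lemma comm_diff_formula:
 assumes "\<And>z. {#z, x, y#} \<subseteq># \<mu> \<Longrightarrow> movable z x y"
  and "add_mset x (add_mset y (mset (L @ U))) = \<mu>"
 shows "comm_diff \<phi> L x y U = beta x y + (\<Sum>z\<in>#mset L. tau z x y)"
 using assms(2)
proof (induction L arbitrary: U rule: rev_induct)
 case Nil
 then have "\<mu> - {#x, y#} = mset U" by (auto simp flip: Nil)
 then have "comm_diff \<phi> [] x y U = beta x y"
  unfolding beta_def by (intro pair_rel) (use Nil in \<open>simp_all add: add_mset_commute\<close>)
 then show ?case by simp
next
 case (snoc z L)
 have *: "add_mset z (add_mset x (add_mset y (mset (L @ U)))) = \<mu>"
  using snoc.prems by (simp add: add_mset_commute)
 moreover have "{#z, x, y#} \<subseteq># \<mu>" unfolding *[symmetric] by simp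
 then have "movable z x y" by (rule assms(1))
 ultimately have "brack \<phi> L z x y U = tau z x y" by (intro brack_tau)
 moreover have "comm_diff \<phi> L x y (z # U) = beta x y + (\<Sum>z\<in>#mset L. tau z x y)"
  by (rule snoc.IH) (use snoc.prems in simp)
 ultimately show ?case by (simp add: brack_def algebra_simps)
qed

text \<open>Induction from the largest sums downwards. With d = p + q + r the triples z, d, e have
  larger sums, so the commutators of d with other letters obey \<open>comm_diff_formula\<close>.
  Hence copies of d can be moved freely around the bracket; once all of them are gathered next to
  it, the terms of \<open>triple_rel\<close> coincide and their number can be divided out.\<close>

lemma movable_all: "movable p q r"
proof (induction "sum_mset \<mu> - (p + q + r)" arbitrary: p q r rule: less_induct)
 case less
 show ?case
  unfolding movable_def
 proof (intro allI impI)
  fix L U L' U' :: "nat list"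
  assume mu: "add_mset p (add_mset q (add_mset r (mset (L @ U)))) = \<mu>"
   and perm: "mset (L' @ U') = mset (L @ U)"
  define d where "d = p + q + r"
  let ?nd = "filter (\<lambda>z. z \<noteq> d)"
  define M where "M = mset (L @ U)"
  have muM: "\<mu> = add_mset p (add_mset q (add_mset r M))" using mu by (simp add: M_def)
  have mov: "movable z d e" if sub: "{#z, d, e#} \<subseteq># \<mu>" for z e
  proof (rule less)
   obtain N where N: "\<mu> = {#z, d, e#} + N" using sub by (metis mset_subset_eq_exists_conv)
   have "z \<noteq> 0" "e \<noteq> 0" using pos unfolding N by auto
   moreover have "sum_mset \<mu> = z + d + e + sum_mset N" unfolding N by simp
   ultimately show "sum_mset \<mu> - (z + d + e) < sum_mset \<mu> - (p + q + r)"
    unfolding d_def[symmetric] by linarith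
  qed
  have cd: "comm_diff \<phi> V d e Y = beta d e + (\<Sum>z\<in>#mset V. tau z d e)"
   if "add_mset d (add_mset e (mset (V @ Y))) = \<mu>" for V e Y
   by (rule comm_diff_formula[OF _ that]) (rule mov)
  have cd_cong: "comm_diff \<phi> V d e Y = comm_diff \<phi> V' d e Y'"
   if "add_mset d (add_mset e (mset (V @ Y))) = \<mu>" "mset V' = mset V" "mset Y' = mset Y" for V V' e Y Y'
  proof -
   have "add_mset d (add_mset e (mset (V' @ Y'))) = \<mu>" using that by simp
   from cd[OF this] cd[OF that(1)] that(2) show ?thesis by simp
  qed
  define H where "H V Y = brack \<phi> V p q r Y" for V Y
  \<comment> \<open>The alternating sum that defines the bracket annihilates everything that depends
    only on the multiset of the three letters.\<close>
  have alt: "D [p, q, r] - D [p, r, q] - D [q, r, p] + D [r, q, p] = (0::'k)"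
   if "\<And>S. mset S = mset [p, q, r] \<Longrightarrow> D S = D [p, q, r]" for D
   using that[of "[p, r, q]"] that[of "[q, r, p]"] that[of "[r, q, p]"] by (simp add: add_mset_commute)
  have moveU: "H V (A @ d # e # B) = H V (A @ e # d # B)"
   if *: "add_mset d (add_mset e (mset (V @ A @ B))) = M" for V A B e
  proof -
   have "comm_diff \<phi> (V @ S @ A) d e B = comm_diff \<phi> (V @ [p, q, r] @ A) d e B"
    if "mset S = mset [p, q, r]" for S
    by (rule cd_cong) (use that in \<open>simp_all add: muM *[symmetric] add_mset_commute ac_simps\<close>)
   from alt[of "\<lambda>S. comm_diff \<phi> (V @ S @ A) d e B", OF this] show ?thesis by (simp add: H_def brack_eq comm_diff_def algebra_simps)
  qed
  have moveL: "H (A @ d # e # B) Y = H (A @ e # d # B) Y"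
   if *: "add_mset d (add_mset e (mset (A @ B @ Y))) = M" for Y A B e
  proof -
   have "comm_diff \<phi> A d e (B @ S @ Y) = comm_diff \<phi> A d e (B @ [p, q, r] @ Y)"
    if "mset S = mset [p, q, r]" for S
    by (rule cd_cong) (use that in \<open>simp_all add: muM *[symmetric] add_mset_commute ac_simps\<close>)
   from alt[of "\<lambda>S. comm_diff \<phi> A d e (B @ S @ Y)", OF this] show ?thesis by (simp add: H_def brack_eq comm_diff_def algebra_simps)
  qed
  have moveS: "H (V @ [d]) Y = H V (d # Y)" if *: "add_mset d (mset (V @ Y)) = M" for V Y
  proof -
   \<comment> \<open>The cost of carrying d across three letters. Only the last three terms depend
     on the order of these letters.\<close>
   have slide: "\<phi> (V @ d # s1 # s2 # s3 # Y) - \<phi> (V @ s1 # s2 # s3 # d # Y) =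
     beta d s1 + beta d s2 + beta d s3 + (\<Sum>z\<in>#mset V. tau z d s1) + (\<Sum>z\<in>#mset V. tau z d s2)
     + (\<Sum>z\<in>#mset V. tau z d s3) + tau s1 d s2 + tau s1 d s3 + tau s2 d s3"
    if "mset [s1, s2, s3] = mset [p, q, r]" for s1 s2 s3
   proof -
    have ms: "add_mset d (add_mset s1 (add_mset s2 (add_mset s3 (mset (V @ Y))))) = \<mu>"
     using that by (simp add: muM *[symmetric] add_mset_commute)
    have "comm_diff \<phi> V d s1 (s2 # s3 # Y) = beta d s1 + (\<Sum>z\<in>#mset V. tau z d s1)"
     by (rule cd) (use ms in simp)
    moreover have "comm_diff \<phi> (V @ [s1]) d s2 (s3 # Y) = beta d s2 + (\<Sum>z\<in>#mset (V @ [s1]). tau z d s2)"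
     by (rule cd) (use ms in \<open>simp add: add_mset_commute\<close>)
    moreover have "comm_diff \<phi> (V @ [s1, s2]) d s3 Y = beta d s3 + (\<Sum>z\<in>#mset (V @ [s1, s2]). tau z d s3)"
     by (rule cd) (use ms in \<open>simp add: add_mset_commute\<close>)
    ultimately show ?thesis by (simp add: comm_diff_def algebra_simps)
   qed
   have "H (V @ [d]) Y - H V (d # Y) =
     (\<phi> (V @ d # p # q # r # Y) - \<phi> (V @ p # q # r # d # Y))
     - (\<phi> (V @ d # p # r # q # Y) - \<phi> (V @ p # r # q # d # Y))
     - (\<phi> (V @ d # q # r # p # Y) - \<phi> (V @ q # r # p # d # Y))
     + (\<phi> (V @ d # r # q # p # Y) - \<phi> (V @ r # q # p # d # Y))"
    by (simp add: H_def brack_eq)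
   \<comment> \<open>In the alternating sum every term \<open>tau s d s'\<close> appears once with
     each sign.\<close>
   also have "\<dots> = 0"
    by (subst (1 2 3 4) slide) (simp_all add: add_mset_commute)
   finally show ?thesis by simp
  qed
  have moveU': "H V (A @ d # B) = H V (d # A @ B)" if "add_mset d (mset (V @ A @ B)) = M" for V A B
   using that
  proof (induction A arbitrary: B rule: rev_induct)
   case (snoc a A)
   have "H V (A @ d # a # B) = H V (A @ a # d # B)"
    by (rule moveU) (use snoc.prems in \<open>simp add: add_mset_commute\<close>)
   moreover have "H V (A @ d # a # B) = H V (d # A @ a # B)"
    by (rule snoc.IH) (use snoc.prems in \<open>simp add: add_mset_commute\<close>)
   ultimately show ?case by simp
  qed simp
  have moveL': "H (A @ d # B) Y = H (A @ B) (d # Y)" if "add_mset d (mset (A @ B @ Y)) = M" for Y A B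
   using that
  proof (induction B arbitrary: A)
   case Nil then show ?case using moveS[of A Y] by simp
  next
   case (Cons b B)
   have "H (A @ d # b # B) Y = H (A @ b # d # B) Y"
    by (rule moveL) (use Cons.prems in \<open>simp add: add_mset_commute\<close>)
   moreover have "H ((A @ [b]) @ d # B) Y = H ((A @ [b]) @ B) (d # Y)"
    by (rule Cons.IH) (use Cons.prems in \<open>simp add: add_mset_commute\<close>)
   ultimately show ?case by simp
  qed
  have gatherU: "H V (A @ Y) = H V (replicate (count (mset Y) d) d @ A @ ?nd Y)"
   if "mset (V @ A @ Y) = M" for V A Y
   using that
  proof (induction Y arbitrary: A)
   case (Cons y Y)
   show ?case
   proof (cases "y = d")
    case True
    have "H V (A @ d # Y) = H V (d # A @ Y)" by (rule moveU') (use Cons.prems True in simp)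
    also have "\<dots> = H V ((d # A) @ Y)" by simp
    also have "\<dots> = H V (replicate (count (mset Y) d) d @ (d # A) @ ?nd Y)"
     by (rule Cons.IH) (use Cons.prems True in simp)
    finally show ?thesis using True by (simp add: replicate_app_Cons_same)
   next
    case False
    have "H V ((A @ [y]) @ Y) = H V (replicate (count (mset Y) d) d @ (A @ [y]) @ ?nd Y)"
     by (rule Cons.IH) (use Cons.prems in simp)
    then show ?thesis using False by simp
   qed
  qed simp
  have gatherL: "H (A @ V) Y = H (A @ ?nd V) (replicate (count (mset V) d) d @ Y)"
   if "mset (A @ V @ Y) = M" for V A Y
   using that
  proof (induction V arbitrary: A Y)
   case (Cons x V)
   show ?case
   proof (cases "x = d")
    case True
    have "H (A @ d # V) Y = H (A @ V) (d # Y)" by (rule moveL') (use Cons.prems True in simp)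
    also have "\<dots> = H (A @ ?nd V) (replicate (count (mset V) d) d @ d # Y)"
     by (rule Cons.IH) (use Cons.prems True in simp)
    finally show ?thesis using True by (simp add: replicate_app_Cons_same)
   next
    case False
    have "H ((A @ [x]) @ V) Y = H ((A @ [x]) @ ?nd V) (replicate (count (mset V) d) d @ Y)"
     by (rule Cons.IH) (use Cons.prems in simp)
    then show ?thesis using False by simp
   qed
  qed simp
  \<comment> \<open>The word in which p, q, r are contracted to d contains d exactly t + 1
    times.\<close>
  define t where "t = count M d"
  have gather: "H V Y = H (?nd V) (replicate t d @ ?nd Y)"
   if XY: "mset (V @ Y) = M" for V Y
  proof -
   have "H V Y = H (?nd V) (replicate (count (mset V) d) d @ Y)"
    using gatherL[of "[]" V Y] XY by simp
   also have "\<dots> = H (?nd V)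
     (replicate (count (mset Y) d) d @ replicate (count (mset V) d) d @ ?nd Y)"
   proof (rule gatherU)
    show "mset (?nd V @ replicate (count (mset V) d) d @ Y) = M"
     unfolding XY[symmetric] by (rule multiset_eqI) simp
   qed
   also have "replicate (count (mset Y) d) d @ replicate (count (mset V) d) d @ ?nd Y
     = replicate t d @ ?nd Y"
    unfolding t_def XY[symmetric] by (simp add: replicate_add[symmetric] add.commute)
   finally show ?thesis .
  qed
  have total: "(\<Sum>i\<in>{i. i < length \<alpha> \<and> \<alpha> ! i = d}. brack \<phi> (take i \<alpha>) p q r (drop (Suc i) \<alpha>))
    = of_nat (Suc t) * H V Y"
   if XY: "mset (V @ Y) = M"
    and \<alpha>: "\<alpha> = ?nd V @ replicate (Suc t) d @ ?nd Y" for V Y \<alpha>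
  proof -
   let ?V = "?nd V" and ?Y = "?nd Y"
   have Md: "mset (?V @ ?Y) + replicate_mset t d = M"
    unfolding t_def XY[symmetric] by (rule multiset_eqI) simp
   have "brack \<phi> (take i \<alpha>) p q r (drop (Suc i) \<alpha>) = H V Y"
    if i: "i < length \<alpha>" "\<alpha> ! i = d" for i
   proof -
    have filt: "?nd xs ! k \<noteq> d" if "k < length (?nd xs)" for k xs
     using nth_mem[OF that] by simp
    have "\<not> i < length ?V"
    proof
     assume "i < length ?V"
     then have "\<alpha> ! i = ?V ! i" unfolding \<alpha> by (simp add: nth_append)
     then show False using i(2) filt[OF \<open>i < length ?V\<close>] by simp
    qed
    moreover have "i < length ?V + Suc t"
    proof (rule ccontr)
     assume "\<not> i < length ?V + Suc t"
     define W where "W = ?V @ replicate (Suc t) d"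
     have W: "\<alpha> = W @ ?Y" "\<not> i < length W"
      using \<open>\<not> i < length ?V + Suc t\<close> by (simp_all add: \<alpha> W_def)
     have *: "i - length W < length ?Y" using i(1) W by simp
     have "\<alpha> ! i = ?Y ! (i - length W)" using W by (simp only: nth_append if_False)
     then show False using i(2) filt[OF *] by simp
    qed
    moreover define j where "j = i - length ?V"
    ultimately have j: "i = length ?V + j" "j \<le> t" by simp_all
    \<comment> \<open>Expanding copy number j of the run, counted from 0, leaves j copies of d in
      front of the bracket and t - j behind it; \<open>gather\<close> identifies all these
      cases.\<close>
    have tk: "take i \<alpha> = ?V @ replicate j d" "drop (Suc i) \<alpha> = replicate (t - j) d @ ?Y"
     unfolding \<alpha> using j by (simp_all add: min_def del: replicate.simps)
    have "mset (take i \<alpha> @ drop (Suc i) \<alpha>) = M"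
     unfolding tk Md[symmetric] using j(2) by (intro multiset_eqI) simp
    from gather[OF this] gather[OF XY] show ?thesis
     unfolding tk H_def[symmetric] by simp
   qed
   then have "(\<Sum>i\<in>{i. i < length \<alpha> \<and> \<alpha> ! i = d}. brack \<phi> (take i \<alpha>) p q r (drop (Suc i) \<alpha>))
     = of_nat (card {i. i < length \<alpha> \<and> \<alpha> ! i = d}) * H V Y"
    by simp
   also have "card {i. i < length \<alpha> \<and> \<alpha> ! i = d} = length (filter (\<lambda>z. z = d) \<alpha>)"
    by (rule length_filter_conv_card[symmetric])
   also have "\<dots> = Suc t" unfolding \<alpha> by (simp add: filter_empty_conv)
   finally show ?thesis .
  qed
  \<comment> \<open>Both words keep their copies of d in one run at the place of the bracket, as
    \<open>total\<close> requires.\<close>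
  define \<alpha> \<alpha>' where
   "\<alpha> = ?nd L @ replicate (Suc t) d @ ?nd U" and
   "\<alpha>' = ?nd L' @ replicate (Suc t) d @ ?nd U'"
  have LU: "mset (L @ U) = M" and LU': "mset (L' @ U') = M" using perm by (simp_all add: M_def)
  have "mset \<alpha> = mset ((p + q + r) # (L @ U))"
   unfolding \<alpha>_def d_def[symmetric] mset.simps LU t_def unfolding LU[symmetric]
   by (rule multiset_eqI) simp
  moreover have "mset \<alpha>' = mset ((p + q + r) # (L' @ U'))"
   unfolding \<alpha>'_def d_def[symmetric] mset.simps LU' t_def unfolding LU'[symmetric]
   by (rule multiset_eqI) simp
  ultimately have "brack_sum \<phi> \<alpha> p q r
   = brack_sum \<phi> \<alpha>' p q r"
   by (intro triple_rel[of p q r "L @ U"]) (simp_all add: mu[symmetric] perm[simplified])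
  then have "of_nat (Suc t) * H L U = of_nat (Suc t) * H L' U'"
   using total[OF LU \<alpha>_def] total[OF LU' \<alpha>'_def] by (simp add: d_def)
  moreover have "of_nat (Suc t) \<noteq> (0::'k)"
  proof (rule inv)
   have "t \<le> size M" unfolding t_def by (rule count_le_size)
   then show "Suc t \<le> size \<mu>" by (simp add: muM)
  qed simp
  ultimately show "brack \<phi> L p q r U = brack \<phi> L' p q r U'" unfolding H_def by simp
 qed
qed

lemma comm_diff_beta_tau:
 assumes "add_mset x (add_mset y (mset (L @ U))) = \<mu>"
 shows "comm_diff \<phi> L x y U = beta x y + (\<Sum>z\<in>#mset L. tau z x y)"
 by (rule comm_diff_formula[OF movable_all assms])

lemma beta_swap: "beta y x = - beta x y"
 unfolding beta_def by (simp add: add_mset_commute comm_diff_swap[of \<phi> _ y x])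

lemma tau_swap: "tau z y x = - tau z x y"
 unfolding tau_def by (simp add: add_mset_commute brack_swap[of \<phi> _ z y x])

lemma tau_self [simp]: "tau z x x = 0" and beta_self [simp]: "beta x x = 0"
 by (simp_all add: tau_def beta_def)

lemma tau_jacobi: "tau z x y = tau x z y - tau y z x"
 unfolding tau_def using brack_jacobi[of \<phi> "[]" z x y] by (simp add: add_mset_commute)

text \<open>The weights are determined modulo constants; they are normalised to vanish at the least element
 of \<open>T\<close>.\<close>

definition coeff2 :: "nat multiset \<Rightarrow> nat \<Rightarrow> 'k" where
 "coeff2 T v = beta (Min (set_mset T)) v"

definition coeff3 :: "nat multiset \<Rightarrow> nat \<Rightarrow> 'k" where
 "coeff3 T v = (let m = Min (set_mset T) in
  if v = m then 0 else tau (sum_mset (T - {#m, v#})) m v)"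

lemma coeff2_diff: "coeff2 {#x, y#} y - coeff2 {#x, y#} x = beta x y"
proof -
 have "Min (set_mset {#x, y#}) = x \<or> Min (set_mset {#x, y#}) = y" by (simp add: min_def)
 then show ?thesis unfolding coeff2_def using beta_swap[of x y] by auto
qed

text \<open>If the least element is x or y, the normalisation and the antisymmetry of
  \<open>tau\<close> suffice; if it is z, the claim is the Jacobi identity.\<close>

lemma coeff3_diff: "coeff3 {#z, x, y#} y - coeff3 {#z, x, y#} x = tau z x y"
proof -
 define m where "m = Min (set_mset {#z, x, y#})"
 have "m = x \<or> m = y \<or> m = z" unfolding m_def by (simp add: min_def)
 then consider "m = x" | "m \<noteq> x" "m = y" | "m \<noteq> x" "m \<noteq> y" "m = z" by blast
 then show ?thesis
 proof cases
  case 1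
  have "{#z, x, y#} - {#x, y#} = {#z#}" by (rule multiset_eqI) simp
  with 1 show ?thesis unfolding coeff3_def m_def[symmetric] Let_def by simp
 next
  case 2
  have "{#z, x, y#} - {#y, x#} = {#z#}" by (rule multiset_eqI) simp
  with 2 show ?thesis unfolding coeff3_def m_def[symmetric] Let_def
   using tau_swap[of z x y] by simp
 next
  case 3
  have "{#z, x, y#} - {#z, x#} = {#y#}" "{#z, x, y#} - {#z, y#} = {#x#}"
   by (rule multiset_eqI, simp)+
  with 3 show ?thesis unfolding coeff3_def m_def[symmetric] Let_def
   using tau_jacobi[of z x y] by simp
 qed
qed

definition parts23 :: "nat multiset set" where
 "parts23 = {T. T \<subseteq># \<mu> \<and> (size T = 2 \<or> size T = 3)}"

lemma finite_parts23: "finite parts23"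
proof (rule finite_surj)
 show "finite {l. set l \<subseteq> set_mset \<mu> \<and> length l \<le> 3}" by (rule finite_lists_length_le) simp
 show "parts23 \<subseteq> mset ` {l. set l \<subseteq> set_mset \<mu> \<and> length l \<le> 3}"
 proof
  fix T assume T: "T \<in> parts23"
  obtain l where l: "T = mset l" by (metis ex_mset)
  have "set_mset T \<subseteq> set_mset \<mu>" using T by (intro set_mset_mono) (simp add: parts23_def)
  then show "T \<in> mset ` {l. set l \<subseteq> set_mset \<mu> \<and> length l \<le> 3}"
   using T by (intro image_eqI[of _ _ l]) (auto simp: l parts23_def)
 qed
qed

definition coeff :: "nat multiset \<Rightarrow> nat \<Rightarrow> 'k" where
 "coeff T = (if size T = 2 then coeff2 T else coeff3 T)"

text \<open>An exchange of x and y is seen only by those T that contain both. T = {x, y} returns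
  \<open>beta x y\<close>, and T = {z, x, y} returns \<open>tau z x y\<close> once for every z in L,
  so the sum reproduces the formula for \<phi>.\<close>

lemma comm_diff_sum_lastfun:
 assumes mu: "add_mset x (add_mset y (mset (L @ U))) = \<mu>"
 shows "(\<Sum>T\<in>parts23. comm_diff (lastfun T (coeff T)) L x y U) = comm_diff \<phi> L x y U"
proof -
 let ?g = "\<lambda>T. comm_diff (lastfun T (coeff T)) L x y U"
 let ?t = "\<lambda>z. {#z, x, y#}"
 let ?Z = "{z. ?t z \<subseteq># \<mu>}"
 have xy: "{#x, y#} \<subseteq># \<mu>" unfolding mu[symmetric] by simp
 have sub: "{#x, y#} \<in> parts23" "?t ` ?Z \<subseteq> parts23" using xy by (auto simp: parts23_def)
 have zero: "?g T = 0" if "T \<in> parts23 - insert {#x, y#} (?t ` ?Z)" for T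
 proof (rule ccontr)
  assume "?g T \<noteq> 0"
  then have "{#x, y#} \<subseteq># T" by (auto simp: comm_diff_lastfun split: if_splits)
  then obtain N where N: "T = {#x, y#} + N" by (metis mset_subset_eq_exists_conv)
  have "size N = 0 \<or> size N = 1" using that N by (auto simp: parts23_def)
  then show False
  proof
   assume "size N = 1"
   then obtain z where "N = {#z#}" by (metis size_1_singleton_mset)
   then have "T = ?t z" using N by simp
   then show False using that by (auto simp: parts23_def)
  qed (use that N in simp)
 qed
 have "(\<Sum>T\<in>parts23. ?g T) = (\<Sum>T\<in>insert {#x, y#} (?t ` ?Z). ?g T)"
  by (rule sum.mono_neutral_right[OF finite_parts23]) (use sub zero in auto)
 also have "\<dots> = ?g {#x, y#} + (\<Sum>T\<in>?t ` ?Z. ?g T)"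
 proof (rule sum.insert)
  show "finite (?t ` ?Z)" by (rule finite_subset[OF sub(2) finite_parts23])
  show "{#x, y#} \<notin> ?t ` ?Z" by (auto dest: arg_cong[of _ _ size])
 qed
 also have "?g {#x, y#} = beta x y"
  by (simp add: comm_diff_lastfun coeff_def coeff2_diff)
 also have "(\<Sum>T\<in>?t ` ?Z. ?g T) = (\<Sum>z\<in>?Z. ?g (?t z))"
  by (rule sum.reindex_cong[OF _ refl refl]) (auto simp: inj_on_def)
 also have "\<dots> = (\<Sum>z\<in>?Z. of_nat (count (mset L) z) * tau z x y)"
 proof (rule sum.cong[OF refl])
  fix z
  have "{#x, y#} \<subseteq># ?t z" by simp
  moreover have "?t z - {#x, y#} = {#z#}" by (rule multiset_eqI) simp
  moreover have "coeff (?t z) y - coeff (?t z) x = tau z x y"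
   using coeff3_diff[of z x y] by (simp add: coeff_def)
  ultimately show "?g (?t z) = of_nat (count (mset L) z) * tau z x y"
   by (simp add: comm_diff_lastfun subcount_rev_single)
 qed
 also have "\<dots> = (\<Sum>z\<in>#mset L. tau z x y)"
 proof (rule sum_mset_count_cong[symmetric])
  have "?Z \<subseteq> set_mset \<mu>" by (auto dest: mset_subset_eqD)
  then show "finite ?Z" by (rule finite_subset) simp
  show "set_mset (mset L) \<subseteq> ?Z"
  proof
   fix z assume "z \<in># mset L"
   then obtain N where "mset L = add_mset z N" by (metis mset_add)
   then have "\<mu> = ?t z + (N + mset U)" unfolding mu[symmetric] by simp
   then show "z \<in> ?Z" by simp
  qed
 qed
 finally show ?thesis using comm_diff_beta_tau[OF mu] by simp
qed

text \<open>Once the sum is subtracted, all commutator differences vanish, so what is left of \<phi>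
  is constant on the words of content \<mu>.\<close>

theorem classification:
 obtains c where "\<And>w. mset w = \<mu> \<Longrightarrow> \<phi> w = c + (\<Sum>T\<in>parts23. lastfun T (coeff T) w)"
proof -
 define \<psi> where "\<psi> w = \<phi> w - (\<Sum>T\<in>parts23. lastfun T (coeff T) w)" for w
 have zero: "comm_diff \<psi> L x y U = 0" if "mset (L @ x # y # U) = \<mu>" for L x y U
 proof -
  have *: "add_mset x (add_mset y (mset (L @ U))) = \<mu>" using that by simp
  have "comm_diff \<psi> L x y U =
    comm_diff \<phi> L x y U - (\<Sum>T\<in>parts23. comm_diff (lastfun T (coeff T)) L x y U)"
   by (simp add: \<psi>_def comm_diff_def sum_subtractf)
  then show ?thesis using comm_diff_sum_lastfun[OF *] by simp
 qed
 have const: "\<psi> w = \<psi> w'" if "mset w = \<mu>" "mset w' = \<mu>" for w w'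
  using zero that by (rule constant_if_comm_diff_zero)
 show thesis
 proof (rule that)
  fix w assume "mset w = \<mu>"
  then have "\<psi> w = \<psi> (sorted_list_of_multiset \<mu>)" by (intro const) simp_all
  then have "\<phi> w - (\<Sum>T\<in>parts23. lastfun T (coeff T) w) = \<psi> (sorted_list_of_multiset \<mu>)"
   by (simp only: \<psi>_def[of w])
  then show "\<phi> w = \<psi> (sorted_list_of_multiset \<mu>) + (\<Sum>T\<in>parts23. lastfun T (coeff T) w)"
   by (simp only: diff_eq_eq)
 qed
qed

end

section \<open>The action on words\<close>

definition actI ::
  "'i set \<Rightarrow> ('i \<Rightarrow> nat) \<Rightarrow> ('i \<Rightarrow> int) \<Rightarrow> (nat list \<Rightarrow> 'k::field) \<Rightarrow> (nat list \<Rightarrow> 'k) \<Rightarrow> 'k" where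
 "actI I wt c \<phi> a = (\<Sum>f\<in>NF I. a (ftyp I wt f) * \<phi> (ftyp I wt (comb I f c)))"

text \<open>The coordinates 1, 2, 3, ...; with the letters of w as weights this chamber has type
  w.\<close>

definition idc :: "nat \<Rightarrow> int" where
 "idc i = int (Suc i)"

definition act :: "(nat list \<Rightarrow> 'k::field) \<Rightarrow> (nat list \<Rightarrow> 'k) \<Rightarrow> nat list \<Rightarrow> 'k" where
 "act \<phi> a w = actI {..<length w} ((!) w) idc \<phi> a"

text \<open>The faces in the linear span of C form the arrangement of smaller rank on
  \<open>I\<close>, in which C becomes a chamber. Thus acting at a face is acting on a word, namely
  on its type.\<close>

lemma (in regroup) sum_below:
 fixes \<phi> a :: "nat list \<Rightarrow> 'k::field"
 assumes c: "chamber I c" and C: "same_face J C (pull \<pi> c)"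
  and wt: "\<And>i. i \<in> I \<Longrightarrow> wt' i = (\<Sum>j\<in>{j\<in>J. \<pi> j = Some i}. wt j)"
 shows "(\<Sum>F\<in>{F\<in>NF J. same_face J (comb J C F) C}. a (ftyp J wt F) * \<phi> (ftyp J wt (comb J F C)))
  = actI I wt' c \<phi> a"
proof -
 have "same_face J (comb J C F) C \<longleftrightarrow> same_face J (comb J (pull \<pi> c) F) (pull \<pi> c)" for F
 proof -
  have "same_face J (comb J C F) (comb J (pull \<pi> c) F)"
   by (rule comb_same_face[OF fin C same_face_refl])
  then show ?thesis using C by (meson same_face_sym same_face_trans)
 qed
 then have "{F\<in>NF J. same_face J (comb J C F) C} = pull \<pi> ` NF I"
  using NF_below[of c] c by (simp add: chamber_def)
 then have "(\<Sum>F\<in>{F\<in>NF J. same_face J (comb J C F) C}. a (ftyp J wt F) * \<phi> (ftyp J wt (comb J F C)))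
   = (\<Sum>f\<in>NF I. a (ftyp J wt (pull \<pi> f)) * \<phi> (ftyp J wt (comb J (pull \<pi> f) C)))"
  by (simp add: sum.reindex[OF inj_pull])
 also have "\<dots> = actI I wt' c \<phi> a"
  unfolding actI_def
 proof (rule sum.cong[OF refl])
  fix f assume "f \<in> NF I"
  have "same_face J (comb J (pull \<pi> f) C) (pull \<pi> (comb I f c))"
   using comb_same_face[OF fin same_face_refl C] comb_pull by (rule same_face_trans)
  then have "ftyp J wt (comb J (pull \<pi> f) C) = ftyp I wt' (comb I f c)"
   using ftyp_same_face ftyp_pull[where wt=wt and wt'=wt', OF wt] by metis
  then show "a (ftyp J wt (pull \<pi> f)) * \<phi> (ftyp J wt (comb J (pull \<pi> f) C))
    = a (ftyp I wt' f) * \<phi> (ftyp I wt' (comb I f c))"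
   using ftyp_pull[where wt=wt and wt'=wt', OF wt] by metis
 qed
 finally show ?thesis .
qed

lemma generic_comb_fix:
 assumes "finite I" "generic I c"
 shows "same_face I (comb I c F) c"
 unfolding comb_fix_iff[OF assms(1)] using assms(2) by (auto simp: generic_def inj_on_def)

lemma ordering_idc: "ordering {..<n} idc [0..<n]"
 by (auto simp: ordering_def sorted_wrt_iff_nth_less idc_def)

lemma chamber_idc: "chamber {..<n} idc"
 by (auto simp: chamber_def inj_on_def idc_def)

lemma ftyp_idc: "ftyp {..<length w} ((!) w) idc = w"
 unfolding ftyp_ordering(1)[OF ordering_idc] by (rule map_nth)

text \<open>Naming each coordinate by its place in the ordering of c turns c into
  \<open>idc\<close>. This is a regrouping with singleton fibres, and every face lies in the linear
  span of a chamber.\<close>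

lemma actI_act:
 fixes \<phi> a :: "nat list \<Rightarrow> 'k::field"
 assumes fin: "finite I" and c: "chamber I c"
 shows "actI I wt c \<phi> a = act \<phi> a (ftyp I wt c)"
proof -
 obtain ps where ps: "ordering I c ps" by (rule ordering_exists[OF fin generic_chamber[OF c]])
 have d: "distinct ps" "set ps = I" using ordering_distinct[OF ps] ps by (simp_all add: ordering_def)
 define w where "w = ftyp I wt c"
 have w: "w = map wt ps" unfolding w_def by (rule ftyp_ordering(1)[OF ps])
 define \<pi> where "\<pi> p = (if p \<in> I then Some (pos ps p) else None)" for p
 interpret regroup I "{..<length w}" \<pi>
 proof
  fix j i assume "\<pi> j = Some i"
  then show "j \<in> I \<and> i \<in> {..<length w}"
   using pos_less(1)[OF d(1), of j] d(2) by (simp add: \<pi>_def w split: if_splits)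
 next
  fix i assume "i \<in> {..<length w}"
  then have "i < length ps" by (simp add: w)
  then have "\<pi> (ps ! i) = Some i" using d(2) nth_mem[of i ps] by (simp add: \<pi>_def pos_nth[OF d(1)])
  then show "\<exists>j. \<pi> j = Some i" ..
 qed (rule fin)
 have fiber: "{j \<in> I. \<pi> j = Some i} = {ps ! i}" if "i < length w" for i
 proof (intro equalityI subsetI)
  fix j assume "j \<in> {j \<in> I. \<pi> j = Some i}"
  then have "j \<in> set ps" "pos ps j = i" using d(2) by (simp_all add: \<pi>_def split: if_splits)
  then show "j \<in> {ps ! i}" using pos_less(2)[OF d(1), of j] by simp
 next
  fix j assume "j \<in> {ps ! i}"
  moreover have "i < length ps" using that by (simp add: w)
  ultimately show "j \<in> {j \<in> I. \<pi> j = Some i}"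
   using d(2) nth_mem[of i ps] by (simp add: \<pi>_def pos_nth[OF d(1)])
 qed
 have pc: "pull \<pi> idc p = int (Suc (pos ps p))" if "p \<in> I" for p
  using that by (simp add: pull_def \<pi>_def idc_def)
 have rkc: "rk I c p = Suc (pos ps p)" if "p \<in> I" for p
  using ftyp_ordering(3)[OF ps pos_less(1)[OF d(1), of p]] pos_less(2)[OF d(1), of p] that d(2) by simp
 have "same_face I c (pull \<pi> idc)"
  unfolding same_face_def
 proof (intro conjI ballI)
  fix i j assume i: "i \<in> I" and j: "j \<in> I"
  show "(0 < c i) = (0 < pull \<pi> idc i)" "(c i < 0) = (pull \<pi> idc i < 0)"
   using c i pc[OF i] unfolding chamber_def by (simp_all add: order_less_imp_not_less)
  show "(\<bar>c i\<bar> \<le> \<bar>c j\<bar>) = (\<bar>pull \<pi> idc i\<bar> \<le> \<bar>pull \<pi> idc j\<bar>)"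
   unfolding rk_le_iff[OF fin i j, of c, symmetric] rkc[OF i] rkc[OF j] pc[OF i] pc[OF j] by simp
 qed
 from sum_below[OF chamber_idc this, where wt=wt and wt'="(!) w" and a=a and \<phi>=\<phi>]
 have "(\<Sum>F\<in>{F \<in> NF I. same_face I (comb I c F) c}. a (ftyp I wt F) * \<phi> (ftyp I wt (comb I F c)))
   = act \<phi> a w"
  unfolding act_def using fiber w by simp
 moreover have "{F \<in> NF I. same_face I (comb I c F) c} = NF I"
  using generic_comb_fix[OF fin generic_chamber[OF c]] by blast
 ultimately show ?thesis by (simp add: actI_def w_def)
qed

section \<open>Neighbouring chambers\<close>

lemma tie_chamber: "0 < c p \<Longrightarrow> tie f c p = (if f p < 0 then - c p else c p)"
 by (simp add: tie_def sgn_if)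

lemma rk_abs_cong:
 assumes "\<And>i. \<bar>f i\<bar> = \<bar>g i\<bar>"
 shows "rk I f = rk I (g :: 'i \<Rightarrow> int)" "lev I f = lev I g" "ftyp I wt f = ftyp I wt g"
proof -
 have nz: "f i \<noteq> 0 \<longleftrightarrow> g i \<noteq> 0" for i using assms[of i] by (metis abs_eq_0_iff)
 have cl: "lclass I f = lclass I g" unfolding lclass_def assms ..
 show rk: "rk I f = rk I g" unfolding rk_def assms nz cl ..
 show lev: "lev I f = lev I g" unfolding lev_def nz cl ..
 show "ftyp I wt f = ftyp I wt g" unfolding ftyp_def rk lev ..
qed

lemma NF_abs_cong:
 assumes "finite I" "f \<in> NF I" "\<And>i. \<bar>f i\<bar> = \<bar>g i\<bar>"
 shows "g \<in> NF I"
proof (rule NF_I(1)[OF assms(1)])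
 show "g i = 0" if "i \<notin> I" for i using NF_outside[OF assms(2) that] assms(3)[of i] by simp
 have nz: "f i \<noteq> 0 \<longleftrightarrow> g i \<noteq> 0" for i using assms(3)[of i] by (metis abs_eq_0_iff)
 show "nabs g ` {i \<in> I. g i \<noteq> 0} = {1..lev I f}"
  using NF_image[OF assms(1,2)] unfolding assms(3) nz .
qed

text \<open>Meant for faces f that separate all coordinates except those in V: the chamber c is
  consulted only inside this one level.\<close>

lemma row_ordering:
 assumes fin: "finite I" and c: "chamber I c" and set: "set (A @ V @ B) = I"
  and A: "sorted_wrt (abs_less f) A" and B: "sorted_wrt (abs_less f) B"
  and V: "\<And>x. x \<in> set V \<Longrightarrow> \<bar>f x\<bar> = v" and Av: "\<And>x. x \<in> set A \<Longrightarrow> \<bar>f x\<bar> < v"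
  and Bv: "\<And>x. x \<in> set B \<Longrightarrow> v < \<bar>f x\<bar>" and t: "sorted_wrt (\<lambda>p q. tie f c p < tie f c q) V"
 shows "ordering I (comb I f c) (A @ V @ B)"
 unfolding ordering_def
proof (intro conjI ballI)
 show "set (A @ V @ B) = I" by fact
 show "comb I f c p \<noteq> 0" if "p \<in> I" for p
  using generic_comb[OF fin c] that by (simp add: generic_def)
 have less: "\<bar>comb I f c p\<bar> < \<bar>comb I f c q\<bar>" if "p \<in> I" "q \<in> I" "abs_less f p q" for p q
  using that abs_comb_less[OF fin that(1,2)] by blast
 have I: "set A \<subseteq> I" "set V \<subseteq> I" "set B \<subseteq> I" unfolding set[symmetric] by auto
 have "sorted_wrt (\<lambda>p q. \<bar>comb I f c p\<bar> < \<bar>comb I f c q\<bar>) A"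
  by (rule sorted_wrt_mono_rel[OF _ A]) (use less I in blast)
 moreover have "sorted_wrt (\<lambda>p q. \<bar>comb I f c p\<bar> < \<bar>comb I f c q\<bar>) B"
  by (rule sorted_wrt_mono_rel[OF _ B]) (use less I in blast)
 moreover have "sorted_wrt (\<lambda>p q. \<bar>comb I f c p\<bar> < \<bar>comb I f c q\<bar>) V"
 proof (rule sorted_wrt_mono_rel[OF _ t])
  fix p q assume pq: "p \<in> set V" "q \<in> set V" "tie f c p < tie f c q"
  then have "p \<in> I" "q \<in> I" using I by auto
  then show "\<bar>comb I f c p\<bar> < \<bar>comb I f c q\<bar>"
   using pq V[OF pq(1)] V[OF pq(2)] abs_comb_less[OF fin] by metis
 qed
 moreover have "\<bar>comb I f c p\<bar> < \<bar>comb I f c q\<bar>" if "p \<in> set A" "q \<in> set V \<union> set B" for p q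
 proof (rule less)
  show "p \<in> I" "q \<in> I" using that I by auto
  show "abs_less f p q" using that(2) Av[OF that(1)] V[of q] Bv[of q] by auto
 qed
 moreover have "\<bar>comb I f c p\<bar> < \<bar>comb I f c q\<bar>" if "p \<in> set V" "q \<in> set B" for p q
 proof (rule less)
  show "p \<in> I" "q \<in> I" using that I by auto
  show "abs_less f p q" using V[OF that(1)] Bv[OF that(2)] by simp
 qed
 ultimately show "sorted_wrt (\<lambda>p q. \<bar>comb I f c p\<bar> < \<bar>comb I f c q\<bar>) (A @ V @ B)"
  by (simp add: sorted_wrt_append)
qed

text \<open>As the values of c at q and r are consecutive, c and the chamber \<open>c'\<close>
  obtained by exchanging them are separated only by the wall on which these two coordinates
  agree.\<close>

locale adjacent =
 fixes I :: "'i set" and c :: "'i \<Rightarrow> int" and q r :: 'i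
 assumes fin: "finite I" and c: "chamber I c" and q: "q \<in> I" and r: "r \<in> I" and qr: "c r = c q + 1"
begin

definition c' :: "'i \<Rightarrow> int" where
 "c' = c(q := c r, r := c q)"

definition flip :: "('i \<Rightarrow> int) \<Rightarrow> 'i \<Rightarrow> int" where
 "flip f = f(q := - f q, r := - f r)"

lemma qr_neq: "q \<noteq> r" using qr by auto

lemma c_pos: "p \<in> I \<Longrightarrow> 0 < c p" using c by (simp add: chamber_def)

lemma c_inj: "p \<in> I \<Longrightarrow> s \<in> I \<Longrightarrow> p \<noteq> s \<Longrightarrow> c p \<noteq> c s"
 using c by (auto simp: chamber_def inj_on_def)

lemma c'_simps: "c' q = c r" "c' r = c q" "p \<noteq> q \<Longrightarrow> p \<noteq> r \<Longrightarrow> c' p = c p"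
 using qr_neq by (simp_all add: c'_def)

lemma flip_simps: "flip f q = - f q" "flip f r = - f r" "p \<noteq> q \<Longrightarrow> p \<noteq> r \<Longrightarrow> flip f p = f p"
 using qr_neq by (simp_all add: flip_def)

lemma flip_flip [simp]: "flip (flip f) = f"
 using qr_neq by (auto simp: flip_def fun_eq_iff)

lemma abs_flip: "\<bar>flip f p\<bar> = \<bar>f p\<bar>"
 by (simp add: flip_def)

lemma chamber_c': "chamber I c'"
 unfolding chamber_def
proof (intro conjI ballI inj_onI)
 fix p assume "p \<in> I"
 then show "0 < c' p" using c_pos q r by (simp add: c'_def)
next
 fix p s assume *: "p \<in> I" "s \<in> I" "c' p = c' s"
 show "p = s"
 proof (rule ccontr)
  assume "p \<noteq> s"
  then show False
   using * c_inj[of p s] c_inj[of p q] c_inj[of p r] c_inj[of s q] c_inj[of s r] c_inj[of q r] q r qr_neq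
   by (simp add: c'_def split: if_splits)
 qed
qed

lemma tie_c: "p \<in> I \<Longrightarrow> tie f c p = (if f p < 0 then - c p else c p)"
 by (rule tie_chamber) (rule c_pos)

lemma tie_c': "p \<in> I \<Longrightarrow> tie f c' p = (if f p < 0 then - c' p else c' p)"
 using chamber_c' by (intro tie_chamber) (simp add: chamber_def)

text \<open>A face off the wall decides by itself on which side of the wall the product
  lies.\<close>

lemma ftyp_swap_neutral:
 assumes "f q \<noteq> f r"
 shows "ftyp I wt (comb I f c) = ftyp I wt (comb I f c')"
proof (rule ftyp_order_cong[OF fin generic_comb[OF fin chamber_c']])
 fix p assume "p \<in> I"
 then show "comb I f c p \<noteq> 0" using generic_comb[OF fin c] by (simp add: generic_def)
next
 fix p s assume p: "p \<in> I" and s: "s \<in> I" and less: "\<bar>comb I f c' p\<bar> < \<bar>comb I f c' s\<bar>"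
 have "tie f c p < tie f c s" if eq: "\<bar>f p\<bar> = \<bar>f s\<bar>" and tie: "tie f c' p < tie f c' s"
 proof -
  have pos: "0 < c p" "0 < c s" "0 < c q" using c_pos p s q by blast+
  have ne: "x \<noteq> q \<Longrightarrow> x \<noteq> r \<Longrightarrow> c x \<noteq> c q \<and> c x \<noteq> c q + 1" if "x \<in> I" for x
   using c_inj[OF that q] c_inj[OF that r] qr by simp
  note T = tie[unfolded tie_c'[OF p] tie_c'[OF s]]
  consider "p = s" | "p = q" "s = r" | "p = r" "s = q" | "p = q" "s \<noteq> q" "s \<noteq> r"
   | "p = r" "s \<noteq> q" "s \<noteq> r" | "s = q" "p \<noteq> q" "p \<noteq> r" | "s = r" "p \<noteq> q" "p \<noteq> r"
   | "p \<noteq> q" "p \<noteq> r" "s \<noteq> q" "s \<noteq> r" by blast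
  then show ?thesis
  proof cases
   case 1 then show ?thesis using tie by simp
  next
   case 2
   then have "f q = - f r" using eq assms by (simp add: abs_eq_iff)
   then show ?thesis using T 2 pos qr assms unfolding tie_c[OF p] tie_c[OF s]
    by (simp add: c'_simps split: if_splits)
  next
   case 3
   then have "f r = - f q" using eq assms by (simp add: abs_eq_iff)
   then show ?thesis using T 3 pos qr assms unfolding tie_c[OF p] tie_c[OF s]
    by (simp add: c'_simps split: if_splits)
  next
   case 4
   then show ?thesis using T pos qr ne[OF s] unfolding tie_c[OF p] tie_c[OF s]
    by (simp add: c'_simps split: if_splits)
  next
   case 5
   then show ?thesis using T pos qr ne[OF s] unfolding tie_c[OF p] tie_c[OF s]
    by (simp add: c'_simps split: if_splits)
  next
   case 6
   then show ?thesis using T pos qr ne[OF p] unfolding tie_c[OF p] tie_c[OF s]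
    by (simp add: c'_simps split: if_splits)
  next
   case 7
   then show ?thesis using T pos qr ne[OF p] unfolding tie_c[OF p] tie_c[OF s]
    by (simp add: c'_simps split: if_splits)
  next
   case 8
   then show ?thesis using T unfolding tie_c[OF p] tie_c[OF s] c'_simps(3)[OF 8(1,2)] c'_simps(3)[OF 8(3,4)] by blast
  qed
 qed
 then show "\<bar>comb I f c p\<bar> < \<bar>comb I f c s\<bar>"
  using less unfolding abs_comb_less[OF fin p s] by blast
qed

definition first_in_row :: "('i \<Rightarrow> int) \<Rightarrow> bool" where
 "first_in_row f \<longleftrightarrow> f q = f r \<and> f q \<noteq> 0 \<and> (\<forall>e\<in>I. \<bar>f e\<bar> = \<bar>f q\<bar> \<longrightarrow> e = q \<or> e = r \<or> c r < c e)"

text \<open>In a level whose other members come after q and r in c, these two stand between the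
  negative and the positive members, whatever their own sign. Flipping this sign therefore only
  reverses their order, and so does crossing the wall.\<close>

lemma ftyp_flip:
 assumes "first_in_row f"
 shows "ftyp I wt (comb I (flip f) c) = ftyp I wt (comb I f c')"
proof (rule ftyp_order_cong[OF fin generic_comb[OF fin chamber_c']])
 fix p assume "p \<in> I"
 then show "comb I (flip f) c p \<noteq> 0" using generic_comb[OF fin c] by (simp add: generic_def)
next
 fix p s assume p: "p \<in> I" and s: "s \<in> I" and less: "\<bar>comb I f c' p\<bar> < \<bar>comb I f c' s\<bar>"
 have f: "f q = f r" "f q \<noteq> 0" using assms by (simp_all add: first_in_row_def)
 have "tie (flip f) c p < tie (flip f) c s" if eq: "\<bar>f p\<bar> = \<bar>f s\<bar>" and tie: "tie f c' p < tie f c' s"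
 proof -
  have pos: "0 < c p" "0 < c s" "0 < c q" using c_pos p s q by blast+
  have ge: "c q + 1 < c x" if "x \<in> I" "x \<noteq> q" "x \<noteq> r" "\<bar>f x\<bar> = \<bar>f q\<bar>" for x
   using assms that qr unfolding first_in_row_def by auto
  note T = tie[unfolded tie_c'[OF p] tie_c'[OF s]]
  consider "p = s" | "p = q" "s = r" | "p = r" "s = q" | "p = q" "s \<noteq> q" "s \<noteq> r"
   | "p = r" "s \<noteq> q" "s \<noteq> r" | "s = q" "p \<noteq> q" "p \<noteq> r" | "s = r" "p \<noteq> q" "p \<noteq> r"
   | "p \<noteq> q" "p \<noteq> r" "s \<noteq> q" "s \<noteq> r" by blast
  then show ?thesis
  proof cases
   case 1 then show ?thesis using tie by simp
  next
   case 2
   then show ?thesis using T f pos qr unfolding tie_c[OF p] tie_c[OF s]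
    by (simp add: c'_simps flip_simps split: if_splits)
  next
   case 3
   then show ?thesis using T f pos qr unfolding tie_c[OF p] tie_c[OF s]
    by (simp add: c'_simps flip_simps split: if_splits)
  next
   case 4
   then show ?thesis using T f pos qr ge[OF s] eq unfolding tie_c[OF p] tie_c[OF s]
    by (simp add: c'_simps flip_simps split: if_splits)
  next
   case 5
   then show ?thesis using T f pos qr ge[OF s] eq unfolding tie_c[OF p] tie_c[OF s]
    by (simp add: c'_simps flip_simps split: if_splits)
  next
   case 6
   then show ?thesis using T f pos qr ge[OF p] eq unfolding tie_c[OF p] tie_c[OF s]
    by (simp add: c'_simps flip_simps split: if_splits)
  next
   case 7
   then show ?thesis using T f pos qr ge[OF p] eq unfolding tie_c[OF p] tie_c[OF s]
    by (simp add: c'_simps flip_simps split: if_splits)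
  next
   case 8
   then show ?thesis using T unfolding tie_c[OF p] tie_c[OF s] c'_simps(3)[OF 8(1,2)] c'_simps(3)[OF 8(3,4)]
     flip_simps(3)[OF 8(1,2)] flip_simps(3)[OF 8(3,4)] by blast
  qed
 qed
 then show "\<bar>comb I (flip f) c p\<bar> < \<bar>comb I (flip f) c s\<bar>"
  using less unfolding abs_comb_less[OF fin p s] abs_flip by blast
qed

lemma first_in_row_flip: "first_in_row f \<Longrightarrow> first_in_row (flip f)"
 unfolding first_in_row_def abs_flip by (simp add: flip_simps)

definition swap_diff :: "('i \<Rightarrow> nat) \<Rightarrow> (nat list \<Rightarrow> 'k::field) \<Rightarrow> ('i \<Rightarrow> int) \<Rightarrow> 'k" where
 "swap_diff wt \<phi> f = \<phi> (ftyp I wt (comb I f c)) - \<phi> (ftyp I wt (comb I f c'))"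

lemma swap_diff_flip:
 assumes "first_in_row f"
 shows "swap_diff wt \<phi> (flip f) = - swap_diff wt \<phi> f"
 using ftyp_flip[OF assms] ftyp_flip[OF first_in_row_flip[OF assms]] by (simp add: swap_diff_def)

text \<open>Faces off the wall contribute nothing, and \<open>flip\<close> is a type preserving
  involution that negates the contributions of the faces in which q and r come first in their
  level.\<close>

lemma sum_swap_diff:
 fixes \<phi> :: "nat list \<Rightarrow> 'k::field"
 shows "(\<Sum>f\<in>{f\<in>NF I. ftyp I wt f = \<alpha>}. swap_diff wt \<phi> f) =
  (\<Sum>f\<in>{f\<in>NF I. ftyp I wt f = \<alpha> \<and> f q = f r \<and> \<not> first_in_row f}. swap_diff wt \<phi> f)"
proof -
 define F where "F = {f\<in>NF I. ftyp I wt f = \<alpha>}"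
 have finF: "finite F" unfolding F_def using finite_NF[OF fin] by simp
 have flipF: "flip f \<in> F" if "f \<in> F" for f
  using that NF_abs_cong[OF fin _ abs_flip[symmetric]] rk_abs_cong(3)[OF abs_flip] by (auto simp: F_def)
 define S where "S = {f\<in>F. first_in_row f}"
 have "(\<Sum>f\<in>S. swap_diff wt \<phi> f) =
   (\<Sum>f\<in>{f\<in>S. 0 < f q}. swap_diff wt \<phi> f) + (\<Sum>f\<in>{f\<in>S. f q < 0}. swap_diff wt \<phi> f)"
 proof (subst sum.union_disjoint[symmetric])
  have nz: "f q \<noteq> 0" if "f \<in> S" for f using that by (simp add: S_def first_in_row_def)
  have "S = {f\<in>S. 0 < f q} \<union> {f\<in>S. f q < 0}"
  proof (intro equalityI subsetI)
   fix f assume f: "f \<in> S"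
   then show "f \<in> {f\<in>S. 0 < f q} \<union> {f\<in>S. f q < 0}" using nz[OF f] by auto
  qed auto
  then show "sum (swap_diff wt \<phi>) S = sum (swap_diff wt \<phi>) ({f\<in>S. 0 < f q} \<union> {f\<in>S. f q < 0})" by simp
  show "finite {f\<in>S. 0 < f q}" "finite {f\<in>S. f q < 0}" using finF by (simp_all add: S_def)
  show "{f\<in>S. 0 < f q} \<inter> {f\<in>S. f q < 0} = {}" by auto
 qed
 also have "(\<Sum>f\<in>{f\<in>S. f q < 0}. swap_diff wt \<phi> f) = (\<Sum>f\<in>{f\<in>S. 0 < f q}. - swap_diff wt \<phi> f)"
  by (rule sum.reindex_bij_witness[of _ flip flip])
   (auto simp: S_def flip_simps flipF first_in_row_flip swap_diff_flip)
 finally have S0: "(\<Sum>f\<in>S. swap_diff wt \<phi> f) = 0" by (simp add: sum_negf)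
 have "(\<Sum>f\<in>F. swap_diff wt \<phi> f) = (\<Sum>f\<in>{f\<in>F. f q = f r}. swap_diff wt \<phi> f)"
 proof (rule sum.mono_neutral_right[OF finF])
  show "\<forall>f\<in>F - {f\<in>F. f q = f r}. swap_diff wt \<phi> f = 0"
   using ftyp_swap_neutral by (simp add: swap_diff_def)
 qed simp
 also have "{f\<in>F. f q = f r} = S \<union> {f\<in>F. f q = f r \<and> \<not> first_in_row f}"
  by (auto simp: S_def first_in_row_def)
 also have "(\<Sum>f\<in>S \<union> {f\<in>F. f q = f r \<and> \<not> first_in_row f}. swap_diff wt \<phi> f)
  = (\<Sum>f\<in>{f\<in>F. f q = f r \<and> \<not> first_in_row f}. swap_diff wt \<phi> f)"
  by (subst sum.union_disjoint) (use finF S0 in \<open>auto simp: S_def\<close>)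
 finally show ?thesis by (simp add: F_def)
qed

end

section \<open>Necessary relations\<close>

text \<open>Coordinates on the zero level influence neither the other levels nor their
  weights.\<close>

lemma zero_outside_subset:
 fixes f :: "'i \<Rightarrow> int"
 assumes sub: "I' \<subseteq> I" and zero: "\<And>i. i \<in> I - I' \<Longrightarrow> f i = 0"
 shows "f \<in> NF I \<longleftrightarrow> f \<in> NF I'" "ftyp I wt f = ftyp I' wt f"
proof -
 have eqI: "{j\<in>I. f j \<noteq> 0 \<and> P j} = {j\<in>I'. f j \<noteq> 0 \<and> P j}" for P using sub zero by blast
 have cl: "lclass I f j = lclass I' f j" if "f j \<noteq> 0" for j
  using sub zero that unfolding lclass_def by force
 have rk: "rk I f i = rk I' f i" for i
  unfolding rk_def eqI by (intro arg_cong[where f = card] image_cong refl cl) simp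
 have lev: "lev I f = lev I' f"
  unfolding lev_def using eqI[of "\<lambda>_. True"]
  by (intro arg_cong[where f = card] image_cong cl) simp_all
 have "nrm I f i = nrm I' f i" for i
 proof (cases "i \<in> I \<longleftrightarrow> i \<in> I'")
  case True then show ?thesis by (simp add: nrm_def rk)
 next
  case False
  then have "i \<in> I - I'" using sub by blast
  then show ?thesis using zero[of i] by (simp add: nrm_def)
 qed
 then have "nrm I f = nrm I' f" by (rule ext)
 then show "f \<in> NF I \<longleftrightarrow> f \<in> NF I'" by (simp add: NF_def)
 have nz: "f i \<noteq> 0" if "rk I' f i = Suc l" for i l
 proof
  assume "f i = 0"
  then have emp: "upto_row I' f i = {}" by auto
  have "rk I' f i = 0" unfolding rk_def emp image_empty card.empty ..
  then show False using that by simp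
 qed
 show "ftyp I wt f = ftyp I' wt f"
 proof (rule nth_equalityI)
  fix l assume "l < length (ftyp I wt f)"
  then have l: "l < lev I f" "l < lev I' f" by (simp_all add: lev)
  have "{i\<in>I. rk I f i = Suc l} = {i\<in>I'. rk I' f i = Suc l}"
  proof (intro equalityI subsetI)
   fix i assume i: "i \<in> {i\<in>I. rk I f i = Suc l}"
   then have "f i \<noteq> 0" using nz[of i l] by (simp add: rk)
   then have "i \<in> I'" using i zero[of i] by blast
   then show "i \<in> {i\<in>I'. rk I' f i = Suc l}" using i by (simp add: rk)
  next
   fix i assume "i \<in> {i\<in>I'. rk I' f i = Suc l}"
   then show "i \<in> {i\<in>I. rk I f i = Suc l}" using sub by (auto simp: rk)
  qed
  then show "ftyp I wt f ! l = ftyp I' wt f ! l" using l by (simp add: nth_ftyp)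
 qed (simp add: lev)
qed

definition ind :: "nat list \<Rightarrow> nat list \<Rightarrow> 'k::field" where
 "ind \<alpha> \<beta> = (if \<beta> = \<alpha> then 1 else 0)"

lemma actI_ind:
 assumes "finite I"
 shows "actI I wt c \<phi> (ind \<alpha>) = (\<Sum>f\<in>{f\<in>NF I. ftyp I wt f = \<alpha>}. \<phi> (ftyp I wt (comb I f c)))"
proof -
 have "actI I wt c \<phi> (ind \<alpha>) = (\<Sum>f\<in>NF I. if ftyp I wt f = \<alpha> then \<phi> (ftyp I wt (comb I f c)) else 0)"
  unfolding actI_def ind_def by (rule sum.cong) simp_all
 also have "\<dots> = (\<Sum>f\<in>{f\<in>NF I. ftyp I wt f = \<alpha>}. \<phi> (ftyp I wt (comb I f c)))"
  by (rule sum.inter_filter[symmetric]) (rule finite_NF[OF assms])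
 finally show ?thesis .
qed

lemma adjacent_upt: "Suc k < n \<Longrightarrow> adjacent {..<n} idc k (Suc k)"
 by unfold_locales (rule chamber_idc finite_lessThan | simp add: idc_def)+

lemma ftyp_swapped:
 assumes "w = L @ x # y # U" "k = length L"
 shows "ftyp {..<length w} ((!) w) (adjacent.c' idc k (Suc k)) = L @ y # x # U"
proof -
 interpret adjacent "{..<length w}" idc k "Suc k"
  by (rule adjacent_upt) (simp add: assms)
 let ?ps = "[0..<k] @ [Suc k, k] @ [Suc (Suc k)..<length w]"
 have len: "length w = Suc (Suc (k + length U))" using assms by simp
 have c'v: "c' i = (if i = k then int (Suc (Suc k)) else if i = Suc k then int (Suc k) else int (Suc i))" for i
  by (simp add: c'_def idc_def)
 have "ordering {..<length w} c' ?ps"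
  unfolding ordering_def
 proof (intro conjI ballI)
  show "set ?ps = {..<length w}" using len by auto
  show "c' p \<noteq> 0" for p by (simp add: c'v)
  have "sorted_wrt (abs_less c') [0..<k]"
   "sorted_wrt (abs_less c') [Suc (Suc k)..<length w]"
   by (simp_all add: sorted_wrt_iff_nth_less c'v)
  then show "sorted_wrt (abs_less c') ?ps"
   by (auto simp: sorted_wrt_append c'v)
 qed
 then have "ftyp {..<length w} ((!) w) c' = map ((!) w) ?ps" by (rule ftyp_ordering(1))
 moreover have "map ((!) w) [0..<k] = L"
  by (rule nth_equalityI) (simp_all add: assms nth_append)
 moreover have "map ((!) w) [Suc (Suc k)..<length w] = U"
 proof (rule nth_equalityI)
  fix i assume "i < length (map ((!) w) [Suc (Suc k)..<length w])"
  then have "i < length U" by (simp add: len del: upt_Suc)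
  then have "map ((!) w) [Suc (Suc k)..<length w] ! i = w ! (Suc (Suc k) + i)"
   by (simp add: len del: upt_Suc)
  also have "\<dots> = U ! i" by (simp add: assms nth_append)
  finally show "map ((!) w) [Suc (Suc k)..<length w] ! i = U ! i" .
 qed (simp add: len del: upt_Suc)
 moreover have "w ! Suc k = y" "w ! k = x" by (simp_all add: assms nth_append)
 ultimately show ?thesis by simp
qed

lemma act_swap_diff:
 fixes \<phi> :: "nat list \<Rightarrow> 'k::field"
 assumes "w = L @ x # y # U" "k = length L"
 shows "act \<phi> (ind \<alpha>) (L @ x # y # U) - act \<phi> (ind \<alpha>) (L @ y # x # U) =
  (\<Sum>f\<in>{f\<in>NF {..<length w}. ftyp {..<length w} ((!) w) f = \<alpha> \<and> f k = f (Suc k) \<and>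
    \<not> adjacent.first_in_row {..<length w} idc k (Suc k) f}.
   adjacent.swap_diff {..<length w} idc k (Suc k) ((!) w) \<phi> f)"
proof -
 interpret adjacent "{..<length w}" idc k "Suc k"
  by (rule adjacent_upt) (simp add: assms)
 have "act \<phi> (ind \<alpha>) w = actI {..<length w} ((!) w) idc \<phi> (ind \<alpha>)"
  by (simp only: act_def)
 moreover have "act \<phi> (ind \<alpha>) (L @ y # x # U) = actI {..<length w} ((!) w) c' \<phi> (ind \<alpha>)"
  using actI_act[OF fin chamber_c', of "(!) w" \<phi> "ind \<alpha>"] ftyp_swapped[OF assms] by simp
 ultimately have "act \<phi> (ind \<alpha>) w - act \<phi> (ind \<alpha>) (L @ y # x # U) =
   (\<Sum>f\<in>{f\<in>NF {..<length w}. ftyp {..<length w} ((!) w) f = \<alpha>}. swap_diff ((!) w) \<phi> f)"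
  by (simp only: actI_ind[OF fin] swap_diff_def sum_subtractf)
 then show ?thesis using sum_swap_diff[where wt="(!) w" and \<alpha>=\<alpha> and \<phi>=\<phi>] assms(1) by simp
qed

lemma map_nth_restrict:
 fixes A :: "nat set"
 assumes "I = {..<length w}" "A \<subseteq> I" "finite A"
 shows "image_mset ((!) w) (mset_set (I - A)) = mset w - image_mset ((!) w) (mset_set A)"
proof -
 have "mset w = image_mset ((!) w) (mset_set I)"
  using mset_map[of "(!) w" "[0..<length w]"] by (simp add: map_nth assms(1) lessThan_atLeast0)
 moreover have "mset_set (I - A) = mset_set I - mset_set A"
  using assms by (intro mset_set_Diff) simp_all
 moreover have "mset_set A \<subseteq># mset_set I"
  using assms by (intro subset_imp_msubset_mset_set) simp_all
 ultimately show ?thesis by (simp add: image_mset_Diff)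
qed

text \<open>The exchanged letters are the first two, so their coordinates come first in their level
  unless they vanish. Only the faces with both coordinates at zero remain. On the other coordinates
  the type u has the maximal length, so these faces are orderings with signs, which explains the
  factor.\<close>

lemma act_pair:
 fixes \<phi> :: "nat list \<Rightarrow> 'k::field"
 assumes "mset u = mset v"
 shows "act \<phi> (ind u) (a # b # v) - act \<phi> (ind u) (b # a # v) =
  2 ^ length u * of_nat (arrcount u) * comm_diff \<phi> [] a b u"
proof -
 define w where "w = a # b # v"
 define I where "I = {..<length w}"
 define c where "c = idc"
 interpret adjacent I c 0 "Suc 0" unfolding I_def c_def by (rule adjacent_upt) (simp add: w_def)
 define I' where "I' = I - {0, Suc 0}"
 have len: "length w = Suc (Suc (length u))" using mset_eq_length[OF assms] by (simp add: w_def)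
 have sub: "I' \<subseteq> I" by (auto simp: I'_def)
 \<comment> \<open>The chamber has its two smallest values at 0 and 1, so nothing in their level can
   precede them.\<close>
 have row: "first_in_row f \<longleftrightarrow> f 0 = f (Suc 0) \<and> f 0 \<noteq> 0" for f
  unfolding first_in_row_def by (auto simp: c_def idc_def)
 have set: "{f\<in>NF I. ftyp I ((!) w) f = u \<and> f 0 = f (Suc 0) \<and> \<not> first_in_row f}
   = {f\<in>NF I'. ftyp I' ((!) w) f = u}" (is "?l = ?r")
 proof (intro equalityI subsetI)
  fix f assume f: "f \<in> ?l"
  then have "f i = 0" if "i \<in> I - I'" for i using that by (auto simp: I'_def row)
  from zero_outside_subset[OF sub this] f show "f \<in> ?r" by simp
 next
  fix f assume f: "f \<in> ?r"
  then have zero: "f i = 0" if "i \<notin> I'" for i using that by (auto intro: NF_outside)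
  then have "f i = 0" if "i \<in> I - I'" for i using that by blast
  from zero_outside_subset[OF sub this] f zero[of 0] zero[of "Suc 0"] show "f \<in> ?l"
   by (simp add: row I'_def)
 qed
 have card: "length u = card I'"
 proof -
  have "{0, Suc 0} \<subseteq> I" using q r by simp
  then have "card I' = card I - 2" unfolding I'_def by (subst card_Diff_subset) simp_all
  then show ?thesis by (simp add: I_def len)
 qed
 have val: "swap_diff ((!) w) \<phi> (sgnface ps S) = comm_diff \<phi> [] a b u"
  if "ps \<in> arrangements I' ((!) w) u" for ps S
 proof -
  have ps: "distinct ps" "set ps = I'" "map ((!) w) ps = u" using that by (auto simp: arrangements_def)
  let ?f = "sgnface ps S"
  have o: "sorted_wrt (abs_less ?f) ps" "\<And>p. p \<in> set ps \<Longrightarrow> ?f p \<noteq> 0"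
   using ordering_sgnface[OF ps(1), of S] by (simp_all add: ordering_def)
  have f01: "?f 0 = 0" "?f (Suc 0) = 0" using ps(2) by (simp_all add: sgnface_def I'_def)
  have c01: "c 0 = 1" "c (Suc 0) = 2" by (simp_all add: c_def idc_def)
  have I01: "set ([] @ [0, Suc 0] @ ps) = I" "set ([] @ [Suc 0, 0] @ ps) = I" using ps(2) q r by (auto simp: I'_def)
  have "ordering I (comb I ?f c) ([] @ [0, Suc 0] @ ps)"
   by (rule row_ordering[OF fin c I01(1), where v = 0])
    (use o f01 in \<open>auto simp: tie_c[OF q] tie_c[OF r] c01\<close>)
  then have "ftyp I ((!) w) (comb I ?f c) = a # b # u"
   using ps(3) by (simp add: ftyp_ordering(1) w_def)
  moreover have "ordering I (comb I ?f c') ([] @ [Suc 0, 0] @ ps)"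
   by (rule row_ordering[OF fin chamber_c' I01(2), where v = 0])
    (use o f01 in \<open>auto simp: tie_c'[OF q] tie_c'[OF r] c'_simps c01\<close>)
  then have "ftyp I ((!) w) (comb I ?f c') = b # a # u"
   using ps(3) by (simp add: ftyp_ordering(1) w_def)
  ultimately show ?thesis by (simp add: swap_diff_def comm_diff_def)
 qed
 have img: "image_mset ((!) w) (mset_set I') = mset u"
  unfolding I'_def by (subst map_nth_restrict[OF I_def]) (use q r assms in \<open>auto simp: w_def\<close>)
 have finI': "finite I'" unfolding I'_def using fin by simp
 have "act \<phi> (ind u) (a # b # v) - act \<phi> (ind u) (b # a # v) =
   (\<Sum>f\<in>{f\<in>NF I'. ftyp I' ((!) w) f = u}. swap_diff ((!) w) \<phi> f)"
  unfolding set[symmetric] using act_swap_diff[of w "[]" a b v 0 \<phi> u, folded I_def c_def] by (simp add: w_def)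
 also have "\<dots> = 2 ^ card I' * (\<Sum>ps\<in>arrangements I' ((!) w) u. comm_diff \<phi> [] a b u)"
  by (rule sum_full[OF finI' card]) (rule val)
 also have "\<dots> = 2 ^ length u * of_nat (arrcount u) * comm_diff \<phi> [] a b u"
  by (simp add: card_arrangements[OF finI' img] card)
 finally show ?thesis .
qed

text \<open>The exchanged letters stand behind p. A face survives the cancellation only if the
  coordinate of p shares their level, and then the length of \<alpha> makes all other levels
  singletons. So the three coordinates merge into one of weight p + q + r, and the two signs of p
  relative to the pair together produce the four terms of the bracket.\<close>

lemma act_triple:
 fixes \<phi> :: "nat list \<Rightarrow> 'k::field"
 assumes pos: "0 \<notin> set (p # q # r # R)" and perm: "mset \<alpha> = mset ((p + q + r) # R)"
 shows "act \<phi> (ind \<alpha>) (p # q # r # R) - act \<phi> (ind \<alpha>) (p # r # q # R) =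
  2 ^ Suc (length R) * of_nat (arrcount R) *
   brack_sum \<phi> \<alpha> p q r"
proof -
 define w where "w = p # q # r # R"
 define I where "I = {..<length w}"
 define c where "c = idc"
 interpret adjacent I c "Suc 0" "Suc (Suc 0)"
  unfolding I_def c_def by (rule adjacent_upt) (simp add: w_def)
 have I0: "0 \<in> I" by (simp add: I_def w_def)
 define I' where "I' = I - {Suc 0, Suc (Suc 0)}"
 \<comment> \<open>Coordinate 0 stands for the merged triple.\<close>
 define wt where "wt = ((!) w)(0 := p + q + r)"
 let ?t = "ftyp I ((!) w)" and ?arr = "arrangements I' wt \<alpha>" and ?s = "swap_diff ((!) w) \<phi>"
 define \<pi> :: "nat \<Rightarrow> nat option" where
  "\<pi> i = (if i \<in> {Suc 0, Suc (Suc 0)} then Some 0 else if i \<in> I' then Some i else None)" for i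
 have I0': "0 \<in> I'" using I0 by (simp add: I'_def)
 interpret rg: regroup I I' \<pi>
 proof
  fix j i assume "\<pi> j = Some i"
  then show "j \<in> I \<and> i \<in> I'"
   using I0' q r by (auto simp: \<pi>_def I'_def split: if_splits)
 next
  fix i assume "i \<in> I'"
  then have "\<pi> i = Some i" by (auto simp: \<pi>_def I'_def)
  then show "\<exists>j. \<pi> j = Some i" ..
 qed (rule fin)
 have fiber0: "{j\<in>I. \<pi> j = Some 0} = {0, Suc 0, Suc (Suc 0)}"
  using I0 q r by (auto simp: \<pi>_def I'_def split: if_splits)
 have fiber: "{j\<in>I. \<pi> j = Some i} = {i}" if "i \<in> I'" "i \<noteq> 0" for i
  using that by (auto simp: \<pi>_def I'_def split: if_splits)
 have w012: "w ! 0 = p" "w ! (Suc 0) = q" "w ! (Suc (Suc 0)) = r" by (simp_all add: w_def)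
 have wtsum: "wt i = (\<Sum>j\<in>{j\<in>I. \<pi> j = Some i}. w ! j)" if "i \<in> I'" for i
 proof (cases "i = 0")
  case True
  then show ?thesis using w012 by (simp only: fiber0) (simp add: wt_def)
 next
  case False
  then show ?thesis by (simp only: fiber[OF that False]) (simp add: wt_def)
 qed
 have lenA: "length \<alpha> = Suc (length R)" using mset_eq_length[OF perm] by simp
 have card: "length \<alpha> = card I'"
 proof -
  have "{Suc 0, Suc (Suc 0)} \<subseteq> I" using q r by simp
  then have "card I' = card I - 2" unfolding I'_def by (subst card_Diff_subset) simp_all
  then show ?thesis by (simp add: I_def lenA w_def)
 qed
 define F where "F = {f\<in>NF I. ?t f = \<alpha> \<and> f (Suc 0) = f (Suc (Suc 0)) \<and> \<not> first_in_row f}"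
 have F_iff: "f \<in> F \<longleftrightarrow> f \<in> NF I \<and> ?t f = \<alpha> \<and> f (Suc 0) = f (Suc (Suc 0)) \<and> \<bar>f 0\<bar> = \<bar>f (Suc 0)\<bar>" for f
 proof -
  \<comment> \<open>\<alpha> has the same total as the word, so no coordinate of positive weight can
    be at zero.\<close>
  have nz: "f (Suc 0) \<noteq> 0" if f: "f \<in> NF I" "?t f = \<alpha>"
  proof
   assume "f (Suc 0) = 0"
   have "sum_list \<alpha> = (\<Sum>i\<in>{i\<in>I. f i \<noteq> 0}. w ! i)"
    using sum_list_ftyp[OF fin, of "(!) w" f] f by simp
   also have "\<dots> \<le> (\<Sum>i\<in>I - {Suc 0}. w ! i)"
    using \<open>f (Suc 0) = 0\<close> by (intro sum_mono2) (use fin in auto)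
   also have "\<dots> + w ! (Suc 0) = (\<Sum>i\<in>I. w ! i)" using sum.remove[OF fin q, of "(!) w"] by simp
   also have "\<dots> = sum_list w" by (simp add: I_def sum_list_sum_nth lessThan_atLeast0)
   also have "\<dots> = sum_list \<alpha>"
    using arg_cong[OF perm, of sum_mset] by (simp add: w_def sum_mset_sum_list)
   finally have "w ! (Suc 0) = 0" by simp
   then show False using pos by (simp add: w_def)
  qed
  have row: "first_in_row f \<longleftrightarrow> \<bar>f 0\<bar> \<noteq> \<bar>f (Suc 0)\<bar>" if "f (Suc 0) = f (Suc (Suc 0))" "f (Suc 0) \<noteq> 0"
  proof
   assume "first_in_row f"
   then show "\<bar>f 0\<bar> \<noteq> \<bar>f (Suc 0)\<bar>" using I0 unfolding first_in_row_def by (force simp: c_def idc_def)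
  next
   assume *: "\<bar>f 0\<bar> \<noteq> \<bar>f (Suc 0)\<bar>"
   show "first_in_row f"
    unfolding first_in_row_def
   proof (intro conjI ballI impI)
    fix e assume "e \<in> I" "\<bar>f e\<bar> = \<bar>f (Suc 0)\<bar>"
    then have "e \<noteq> 0" using * by metis
    then show "e = Suc 0 \<or> e = Suc (Suc 0) \<or> c (Suc (Suc 0)) < c e" by (simp add: c_def idc_def) linarith
   qed (use that in simp_all)
  qed
  show ?thesis unfolding F_def using nz row by blast
 qed
 define G where "G = {g\<in>NF I'. ftyp I' wt g = \<alpha>}"
 have F_nz: "f 0 \<noteq> 0" if "g \<in> G" "f = pull \<pi> g" for f g
 proof -
  have g: "g \<in> NF I'" "lev I' g = card I'" using that card by (auto simp: G_def)
  have "generic I' g" by (rule full_level_generic[OF rg.finI g])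
  moreover have "\<pi> 0 = Some 0" using I0' by (simp add: \<pi>_def)
  ultimately show ?thesis using that I0' by (simp add: generic_def rg.pull_Some)
 qed
 have Fplus: "{f\<in>F. f 0 = f (Suc 0)} = pull \<pi> ` G"
 proof (intro equalityI subsetI)
  fix f assume "f \<in> {f\<in>F. f 0 = f (Suc 0)}"
  then have f: "f \<in> NF I" "?t f = \<alpha>" "f (Suc 0) = f (Suc (Suc 0))" "f 0 = f (Suc 0)" by (simp_all add: F_iff)
  define g where "g i = (if i \<in> I' then f i else 0)" for i
  have pg: "pull \<pi> g = f"
  proof
   fix j show "pull \<pi> g j = f j"
    using f(3,4) I0' NF_outside[OF f(1), of j]
    by (auto simp: pull_def \<pi>_def g_def I'_def split: option.splits if_splits)
  qed
  have "g \<in> NF I'" by (rule rg.pull_NF_rev) (simp_all add: pg f(1), simp add: g_def)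
  moreover have "ftyp I' wt g = \<alpha>" using rg.ftyp_pull[where wt="(!) w" and wt'=wt and h=g, OF wtsum] pg f(2) by simp
  ultimately show "f \<in> pull \<pi> ` G" using pg by (auto simp: G_def)
 next
  fix f assume "f \<in> pull \<pi> ` G"
  then obtain g where g: "g \<in> NF I'" "ftyp I' wt g = \<alpha>" "f = pull \<pi> g" by (auto simp: G_def)
  have "f 0 = g 0" "f (Suc 0) = g 0" "f (Suc (Suc 0)) = g 0" using I0' g(3) by (simp_all add: pull_def \<pi>_def)
  then show "f \<in> {f\<in>F. f 0 = f (Suc 0)}"
   using g rg.pull_NF(1)[OF g(1)] rg.ftyp_pull[where wt="(!) w" and wt'=wt and h=g, OF wtsum] by (simp add: F_iff)
 qed
 have flipF: "flip f \<in> F" if "f \<in> F" for f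
  using that NF_abs_cong[where f=f and g="flip f", OF fin _ abs_flip[symmetric]]
   rk_abs_cong(3)[where f="flip f" and g=f, OF abs_flip]
  by (simp add: F_iff abs_flip flip_simps)
 have finF: "finite F" unfolding F_def using finite_NF[OF fin] by simp
 have "(\<Sum>f\<in>F. ?s f) =
   (\<Sum>f\<in>{f\<in>F. f 0 = f (Suc 0)}. ?s f) + (\<Sum>f\<in>{f\<in>F. f 0 \<noteq> f (Suc 0)}. ?s f)"
 proof (subst sum.union_disjoint[symmetric])
  have "F = {f\<in>F. f 0 = f (Suc 0)} \<union> {f\<in>F. f 0 \<noteq> f (Suc 0)}" by blast
  then show "sum (?s) F = sum (?s) ({f\<in>F. f 0 = f (Suc 0)} \<union> {f\<in>F. f 0 \<noteq> f (Suc 0)})" by simp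
  show "finite {f\<in>F. f 0 = f (Suc 0)}" "finite {f\<in>F. f 0 \<noteq> f (Suc 0)}" using finF by simp_all
 qed blast
 \<comment> \<open>Flipping the pair matches the faces in which p has the opposite sign with those
   in which it has the same sign.\<close>
 also have "(\<Sum>f\<in>{f\<in>F. f 0 \<noteq> f (Suc 0)}. ?s f) = (\<Sum>f\<in>{f\<in>F. f 0 = f (Suc 0)}. ?s (flip f))"
 proof (rule sum.reindex_bij_witness[of _ flip flip])
  fix f assume f: "f \<in> {f\<in>F. f 0 \<noteq> f (Suc 0)}"
  then have "f 0 = - f (Suc 0)" by (auto simp: F_iff abs_eq_iff)
  then show "flip f \<in> {f\<in>F. f 0 = f (Suc 0)}" using f flipF by (simp add: flip_simps)
 next
  fix f assume f: "f \<in> {f\<in>F. f 0 = f (Suc 0)}"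
  then obtain g where "g \<in> G" "f = pull \<pi> g" using Fplus by blast
  then have "f 0 \<noteq> 0" by (rule F_nz)
  then show "flip f \<in> {f\<in>F. f 0 \<noteq> f (Suc 0)}" using f flipF by (simp add: flip_simps)
 qed simp_all
 finally have sumF: "(\<Sum>f\<in>F. ?s f) =
   (\<Sum>g\<in>G. ?s (pull \<pi> g) + ?s (flip (pull \<pi> g)))"
  unfolding Fplus using inj_on_subset[OF rg.inj_pull, of G]
  by (simp add: sum.reindex sum.distrib G_def)
 define br where "br i = brack \<phi> (take i \<alpha>) p q r (drop (Suc i) \<alpha>)" for i
 have val: "?s (pull \<pi> (sgnface ps S)) + ?s (flip (pull \<pi> (sgnface ps S)))
   = br (pos ps 0)" if "ps \<in> ?arr" for ps S
 proof -
  have ps: "distinct ps" "set ps = I'" "map wt ps = \<alpha>" using that by (auto simp: arrangements_def)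
  define g where "g = sgnface ps S"
  define f where "f = pull \<pi> g"
  define i where "i = pos ps 0"
  have i: "i < length ps" "ps ! i = 0" unfolding i_def using pos_less[OF ps(1)] I0' ps(2) by auto
  define A B where "A = take i ps" and "B = drop (Suc i) ps"
  have psAB: "ps = A @ 0 # B" unfolding A_def B_def using id_take_nth_drop[OF i(1)] i(2) by simp
  have AB0: "0 \<notin> set A" "0 \<notin> set B" using ps(1) unfolding psAB by auto
  have o: "sorted_wrt (abs_less g) (A @ 0 # B)"
   using ordering_sgnface[OF ps(1), of S] unfolding g_def psAB[symmetric] by (simp add: ordering_def)
  have fI': "f x = g x" if "x \<in> I'" for x
   using that by (auto simp: f_def pull_def \<pi>_def I'_def)
  have f12: "f (Suc 0) = g 0" "f (Suc (Suc 0)) = g 0" by (simp_all add: f_def pull_def \<pi>_def)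
  have f0: "f 0 = g 0" by (rule fI'[OF I0'])
  have ABI: "set A \<subseteq> I'" "set B \<subseteq> I'" using ps(2) unfolding psAB by auto
  have fA: "f x = g x" if "x \<in> set A" for x using that ABI by (intro fI') blast
  have fB: "f x = g x" if "x \<in> set B" for x using that ABI by (intro fI') blast
  have g0: "g 0 \<noteq> 0" using ordering_sgnface[OF ps(1), of S] I0' ps(2) by (simp add: ordering_def g_def)
  have AB12: "x \<noteq> 0 \<and> x \<noteq> Suc 0 \<and> x \<noteq> Suc (Suc 0)" if "x \<in> set A \<union> set B" for x
   using that AB0 ABI by (auto simp: I'_def)
  have row: "?t (comb I f' d) = take i \<alpha> @ map ((!) w) V @ drop (Suc i) \<alpha>"
   if d: "chamber I d" and V: "set V = {0, Suc 0, Suc (Suc 0)}"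
    and t: "sorted_wrt (\<lambda>x y. tie f' d x < tie f' d y) V"
    and f': "f' = f \<or> f' = flip f" for f' d V
  proof -
   have abs: "\<bar>f' x\<bar> = \<bar>f x\<bar>" for x using f' abs_flip by metis
   have "ordering I (comb I f' d) (A @ V @ B)"
   proof (rule row_ordering[OF fin d _ _ _ _ _ _ t, where v = "\<bar>g 0\<bar>"])
    have "set (A @ V @ B) = {Suc 0, Suc (Suc 0)} \<union> set ps" unfolding psAB using V by auto
    also have "\<dots> = I" using ps(2) q r by (auto simp: I'_def)
    finally show "set (A @ V @ B) = I" .
    have oAB: "sorted_wrt (abs_less g) A" "sorted_wrt (abs_less g) B"
     using o by (simp_all add: sorted_wrt_append)
    show "sorted_wrt (abs_less f') A"
     unfolding abs by (rule sorted_wrt_mono_rel[OF _ oAB(1)]) (simp add: fA)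
    show "sorted_wrt (abs_less f') B"
     unfolding abs by (rule sorted_wrt_mono_rel[OF _ oAB(2)]) (simp add: fB)
    show "\<bar>f' x\<bar> = \<bar>g 0\<bar>" if "x \<in> set V" for x using that f12 f0 unfolding abs V by auto
    show "\<bar>f' x\<bar> < \<bar>g 0\<bar>" if "x \<in> set A" for x
     using that o fA[OF that] unfolding abs by (simp add: sorted_wrt_append)
    show "\<bar>g 0\<bar> < \<bar>f' x\<bar>" if "x \<in> set B" for x
     using that o fB[OF that] unfolding abs by (simp add: sorted_wrt_append)
   qed
   then have "?t (comb I f' d) = map ((!) w) A @ map ((!) w) V @ map ((!) w) B"
    by (simp add: ftyp_ordering(1))
   moreover have "map ((!) w) A = map wt A" "map ((!) w) B = map wt B"
    using AB0 by (auto simp: wt_def)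
   moreover have "map wt A = take i \<alpha>" "map wt B = drop (Suc i) \<alpha>"
    unfolding ps(3)[symmetric] A_def B_def by (simp_all add: take_map drop_map)
   ultimately show ?thesis by simp
  qed
  have c012: "c 0 = 1" "c (Suc 0) = 2" "c (Suc (Suc 0)) = 3" by (simp_all add: c_def idc_def)
  have c'012: "c' 0 = 1" "c' (Suc 0) = 3" "c' (Suc (Suc 0)) = 2" by (simp_all add: c'_simps c012)
  note ties = tie_c[OF I0] tie_c[OF q] tie_c[OF r] tie_c'[OF I0] tie_c'[OF q] tie_c'[OF r]
  have ff: "flip f 0 = g 0" "flip f (Suc 0) = - g 0" "flip f (Suc (Suc 0)) = - g 0"
   using f0 f12 by (simp_all add: flip_def)
  note tie_simps = ties f0 f12 ff c012 c'012
  define T where "T V = take i \<alpha> @ map ((!) w) V @ drop (Suc i) \<alpha>" for V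
  \<comment> \<open>Where the pair is positive, the level is read in the order of the chamber with p
    in front; in \<open>down\<close> the pair is negative, and the level is read backwards with p at
    the end.\<close>
  have up: "?t (comb I f' c) = T [0, Suc 0, Suc (Suc 0)]" "?t (comb I f' c') = T [0, Suc (Suc 0), Suc 0]"
   if "f' = f \<and> 0 < g 0 \<or> f' = flip f \<and> g 0 < 0" for f'
   unfolding T_def by (rule row[OF c] row[OF chamber_c']; use that in \<open>auto simp: tie_simps\<close>)+
  have down: "?t (comb I f' c) = T [Suc (Suc 0), Suc 0, 0]" "?t (comb I f' c') = T [Suc 0, Suc (Suc 0), 0]"
   if "f' = f \<and> g 0 < 0 \<or> f' = flip f \<and> 0 < g 0" for f'
   unfolding T_def by (rule row[OF c] row[OF chamber_c']; use that in \<open>auto simp: tie_simps\<close>)+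
  have "br i = \<phi> (T [0, Suc 0, Suc (Suc 0)]) - \<phi> (T [0, Suc (Suc 0), Suc 0])
    - \<phi> (T [Suc 0, Suc (Suc 0), 0]) + \<phi> (T [Suc (Suc 0), Suc 0, 0])"
   by (simp add: br_def brack_eq T_def w012)
  then show ?thesis
   unfolding g_def[symmetric] f_def[symmetric] i_def[symmetric] swap_diff_def
   using g0 up[of f] up[of "flip f"] down[of f] down[of "flip f"] by (cases "0 < g 0") simp_all
 qed
 have finI': "finite I'" by (rule rg.finI)
 have img: "image_mset wt (mset_set I') = mset \<alpha>"
 proof -
  have "image_mset wt (mset_set I') = add_mset (p + q + r) (image_mset wt (mset_set (I' - {0})))"
   using mset_set.remove[OF finI' I0'] by (simp add: wt_def)
  also have "image_mset wt (mset_set (I' - {0})) = image_mset ((!) w) (mset_set (I' - {0}))"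
   by (rule image_mset_cong) (simp add: wt_def finI')
  also have "I' - {0} = I - {0, Suc 0, Suc (Suc 0)}" by (auto simp: I'_def)
  also have "image_mset ((!) w) (mset_set (I - {0, Suc 0, Suc (Suc 0)})) = mset R"
   by (subst map_nth_restrict[OF I_def]) (use I0 q r in \<open>auto simp: w_def\<close>)
  finally show ?thesis using perm by simp
 qed
 \<comment> \<open>The merged coordinate fits position i only if the letter there is p + q + r; the
   other coordinates are then arranged along a rearrangement of R.\<close>
 have count: "card {ps\<in>?arr. ps ! i = 0} = (if \<alpha> ! i = p + q + r then arrcount R else 0)"
  if "i < length \<alpha>" for i
 proof (cases "\<alpha> ! i = p + q + r")
  case True
  then have "wt 0 = \<alpha> ! i" by (simp add: wt_def)
  then have "card {ps\<in>?arr. ps ! i = 0}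
    = card (arrangements (I' - {0}) wt (take i \<alpha> @ drop (Suc i) \<alpha>))"
   by (rule arrangements_at[OF finI' I0' that])
  also have rest: "mset (take i \<alpha> @ drop (Suc i) \<alpha>) = mset R"
  proof -
   have "mset \<alpha> = add_mset (p + q + r) (mset (take i \<alpha> @ drop (Suc i) \<alpha>))"
    using arg_cong[OF id_take_nth_drop[OF that], of mset] True by simp
   then show ?thesis using perm by simp
  qed
  then have "card (arrangements (I' - {0}) wt (take i \<alpha> @ drop (Suc i) \<alpha>)) = arrcount (take i \<alpha> @ drop (Suc i) \<alpha>)"
  proof (intro card_arrangements)
   have "image_mset wt (mset_set I') = add_mset (p + q + r) (image_mset wt (mset_set (I' - {0})))"
    using mset_set.remove[OF finI' I0'] by (simp add: wt_def)
   then show "image_mset wt (mset_set (I' - {0})) = mset (take i \<alpha> @ drop (Suc i) \<alpha>)"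
    unfolding rest using img perm by simp
  qed (use finI' in simp)
  also have "\<dots> = arrcount R" by (rule arrcount_perm[OF rest])
  finally show ?thesis using True by simp
 next
  case False
  have "ps ! i \<noteq> 0" if "ps \<in> ?arr" for ps
  proof
   assume "ps ! i = 0"
   moreover have "map wt ps = \<alpha>" using that by (simp add: arrangements_def)
   then have "\<alpha> ! i = wt (ps ! i)" using \<open>i < length \<alpha>\<close> by auto
   ultimately show False using False by (simp add: wt_def)
  qed
  then have emp: "{ps\<in>?arr. ps ! i = 0} = {}" by blast
  show ?thesis unfolding emp using False by simp
 qed
 have "act \<phi> (ind \<alpha>) (p # q # r # R) - act \<phi> (ind \<alpha>) (p # r # q # R) = (\<Sum>f\<in>F. ?s f)"
  unfolding F_def using act_swap_diff[of w "[p]" q r R "Suc 0" \<phi> \<alpha>, folded I_def c_def] by (simp add: w_def)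
 also have "\<dots> = 2 ^ card I' * (\<Sum>ps\<in>?arr. br (pos ps 0))"
  unfolding sumF G_def by (rule sum_full[OF finI' card]) (rule val)
 also have "(\<Sum>ps\<in>?arr. br (pos ps 0))
   = (\<Sum>i<length \<alpha>. \<Sum>ps\<in>{ps\<in>?arr. pos ps 0 = i}. br (pos ps 0))"
 proof (rule sum.group[symmetric])
  show "(\<lambda>ps. pos ps 0) ` ?arr \<subseteq> {..<length \<alpha>}"
   using pos_less(1) I0' by (auto simp: arrangements_def)
 qed (simp_all add: finite_arrangements finI')
 also have "\<dots> = (\<Sum>i<length \<alpha>. of_nat (if \<alpha> ! i = p + q + r then arrcount R else 0) * br i)"
 proof (rule sum.cong[OF refl])
  fix i assume "i \<in> {..<length \<alpha>}"
  then have i: "i < length \<alpha>" by simp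
  have eq: "{ps\<in>?arr. pos ps 0 = i} = {ps\<in>?arr. ps ! i = 0}"
  proof (rule Collect_cong, rule conj_cong[OF refl])
   fix ps assume "ps \<in> ?arr"
   then have d: "distinct ps" "0 \<in> set ps" "i < length ps" using i I0' by (auto simp: arrangements_def)
   show "pos ps 0 = i \<longleftrightarrow> ps ! i = 0" using pos_less(2)[OF d(1,2)] pos_nth[OF d(1,3)] by auto
  qed
  have "(\<Sum>ps\<in>{ps\<in>?arr. pos ps 0 = i}. br (pos ps 0))
    = (\<Sum>ps\<in>{ps\<in>?arr. pos ps 0 = i}. br i)" by (rule sum.cong) auto
  also have "\<dots> = of_nat (card {ps\<in>?arr. pos ps 0 = i}) * br i" by simp
  finally show "(\<Sum>ps\<in>{ps\<in>?arr. pos ps 0 = i}. br (pos ps 0))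
    = of_nat (if \<alpha> ! i = p + q + r then arrcount R else 0) * br i"
   by (simp only: eq count[OF i])
 qed
 also have "\<dots> = (\<Sum>i\<in>{i. i < length \<alpha> \<and> \<alpha> ! i = p + q + r}. of_nat (arrcount R) * br i)"
  by (rule sum.mono_neutral_cong_right) auto
 finally show ?thesis
  unfolding br_def by (simp add: sum_distrib_left mult.assoc card[symmetric] lenA)
qed

text \<open>The condition \<open>four\<close> expresses that \<phi> kills the product of a
  difference of orbit sums of rearranged types with a difference of two words. For two words that
  differ by one exchange, \<open>act_pair\<close> and \<open>act_triple\<close> evaluate it, and the
  face counts in front can be divided out.\<close>

lemma word_functionalI:
 fixes \<phi> :: "nat list \<Rightarrow> 'k::field"
 assumes pos: "0 \<notin># \<mu>"
  and inv: "\<And>i. 1 \<le> i \<Longrightarrow> i \<le> size \<mu> \<Longrightarrow> of_nat i \<noteq> (0::'k)" and two: "(2::'k) \<noteq> 0"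
  and four: "\<And>w w' \<alpha> \<alpha>'. mset w = \<mu> \<Longrightarrow> mset w' = \<mu> \<Longrightarrow> mset \<alpha> = mset \<alpha>' \<Longrightarrow> 0 \<notin> set \<alpha> \<Longrightarrow>
   sum_list \<alpha> \<le> sum_mset \<mu> \<Longrightarrow>
   act \<phi> (ind \<alpha>) w - act \<phi> (ind \<alpha>') w = act \<phi> (ind \<alpha>) w' - act \<phi> (ind \<alpha>') w'"
 shows "word_functional \<phi> \<mu>"
proof
 fix a b u u'
 assume mu: "mset (a # b # u) = \<mu>" and uu': "mset u = mset u'"
 have "0 \<notin> set u" "length u \<le> size \<mu>" "sum_list u \<le> sum_mset \<mu>"
  using pos unfolding mu[symmetric] by (auto simp: sum_mset_sum_list)
 moreover have "mset (b # a # u) = \<mu>" using mu by (simp add: add_mset_commute)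
 ultimately have "act \<phi> (ind u) (a # b # u) - act \<phi> (ind u') (a # b # u)
   = act \<phi> (ind u) (b # a # u) - act \<phi> (ind u') (b # a # u)"
  by (intro four mu uu')
 then have "act \<phi> (ind u) (a # b # u) - act \<phi> (ind u) (b # a # u)
   = act \<phi> (ind u') (a # b # u) - act \<phi> (ind u') (b # a # u)" by (simp add: algebra_simps)
 then have "2 ^ length u * of_nat (arrcount u) * comm_diff \<phi> [] a b u
   = 2 ^ length u * of_nat (arrcount u) * comm_diff \<phi> [] a b u'"
  unfolding act_pair[OF refl] act_pair[OF sym[OF uu']]
  by (simp only: arrcount_perm[OF uu'] mset_eq_length[OF uu'])
 moreover have "of_nat (arrcount u) \<noteq> (0::'k)"
  by (rule arrcount_nonzero) (use inv \<open>length u \<le> size \<mu>\<close> in simp)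
 ultimately show "comm_diff \<phi> [] a b u = comm_diff \<phi> [] a b u'" using two by simp
next
 fix p q r R \<alpha> \<alpha>'
 assume mu: "mset (p # q # r # R) = \<mu>" and \<alpha>: "mset \<alpha> = mset ((p + q + r) # R)" and \<alpha>': "mset \<alpha>' = mset \<alpha>"
 have zero: "0 \<notin> set (p # q # r # R)" and len: "length R \<le> size \<mu>"
  using pos unfolding mu[symmetric] by auto
 have "0 \<notin># mset \<alpha>" unfolding \<alpha> using zero by auto
 then have 1: "0 \<notin> set \<alpha>" by simp
 have 2: "sum_list \<alpha> \<le> sum_mset \<mu>"
  using arg_cong[OF \<alpha>, of sum_mset] unfolding mu[symmetric] by (simp add: sum_mset_sum_list)
 have "mset (p # r # q # R) = \<mu>" using mu by (simp add: add_mset_commute)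
 then have "act \<phi> (ind \<alpha>) (p # q # r # R) - act \<phi> (ind \<alpha>') (p # q # r # R)
   = act \<phi> (ind \<alpha>) (p # r # q # R) - act \<phi> (ind \<alpha>') (p # r # q # R)"
  using 1 2 by (intro four mu sym[OF \<alpha>'])
 then have "act \<phi> (ind \<alpha>) (p # q # r # R) - act \<phi> (ind \<alpha>) (p # r # q # R)
   = act \<phi> (ind \<alpha>') (p # q # r # R) - act \<phi> (ind \<alpha>') (p # r # q # R)" by (simp add: algebra_simps)
 moreover have "of_nat (arrcount R) \<noteq> (0::'k)"
  by (rule arrcount_nonzero) (use inv len in simp)
 ultimately show "brack_sum \<phi> \<alpha> p q r =
    brack_sum \<phi> \<alpha>' p q r"
  unfolding act_triple[OF zero \<alpha>] act_triple[OF zero trans[OF \<alpha>' \<alpha>]] using two by simp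
qed (use pos inv in simp_all)

section \<open>Functions of the last letter of a subword\<close>

text \<open>Constant functions are eigenvectors of the action; \<open>act_const\<close> shows that
  every word of content \<nu> gives the same value as the sorted one.\<close>

definition chi :: "nat multiset \<Rightarrow> (nat list \<Rightarrow> 'k::field) \<Rightarrow> 'k" where
 "chi \<nu> a = act (\<lambda>_. 1) a (sorted_list_of_multiset \<nu>)"

lemma arrangement_exists:
 fixes wt :: "'i \<Rightarrow> nat"
 assumes "finite I" "image_mset wt (mset_set I) = mset u"
 obtains ps where "distinct ps" "set ps = I" "map wt ps = u"
proof -
 have "arrcount u \<noteq> 0" by (induction u) simp_all
 then have "arrangements I wt u \<noteq> {}" using card_arrangements[OF assms] by force
 then show thesis using that by (auto simp: arrangements_def)
qed

lemma chamber_sgnface: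
 assumes "distinct ps"
 shows "chamber (set ps) (sgnface ps {})"
 unfolding chamber_def
proof (intro conjI ballI inj_onI)
 fix p assume "p \<in> set ps"
 then show "0 < sgnface ps {} p" by (simp add: sgnface_def)
next
 fix p s assume ps: "p \<in> set ps" "s \<in> set ps" "sgnface ps {} p = sgnface ps {} s"
 then have "pos ps p = pos ps s" by (simp add: sgnface_def)
 then show "p = s" using pos_less(2)[OF assms ps(1)] pos_less(2)[OF assms ps(2)] by metis
qed

text \<open>Summing over all faces is acting on the constant 1 at any chamber, and one with sorted
  weights can be chosen.\<close>

lemma sum_NF_chi:
 fixes a :: "nat list \<Rightarrow> 'k::field"
 assumes "finite I" "image_mset wt (mset_set I) = \<nu>"
 shows "(\<Sum>f\<in>NF I. a (ftyp I wt f)) = chi \<nu> a"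
proof -
 obtain ps where ps: "distinct ps" "set ps = I" "map wt ps = sorted_list_of_multiset \<nu>"
  by (rule arrangement_exists[OF assms(1), of wt "sorted_list_of_multiset \<nu>"]) (use assms(2) in simp)
 have "(\<Sum>f\<in>NF I. a (ftyp I wt f)) = actI I wt (sgnface ps {}) (\<lambda>_. 1) a"
  by (simp add: actI_def)
 also have "\<dots> = act (\<lambda>_. 1) a (ftyp I wt (sgnface ps {}))"
  using chamber_sgnface[OF ps(1)] ps(2) by (intro actI_act[OF assms(1)]) simp
 also have "ftyp I wt (sgnface ps {}) = sorted_list_of_multiset \<nu>"
  using ftyp_sgnface[OF ps(1), of wt "{}"] ps by simp
 finally show ?thesis by (simp add: chi_def)
qed

lemma image_mset_upt: "image_mset ((!) w) (mset_set {..<length w}) = mset w"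
 using map_nth_restrict[of "{..<length w}" w "{}"] by simp

lemma act_const: "act (\<lambda>_. c) a w = c * chi (mset w) a"
proof -
 have "act (\<lambda>_. c) a w = (\<Sum>f\<in>NF {..<length w}. a (ftyp {..<length w} ((!) w) f)) * c"
  by (simp add: act_def actI_def sum_distrib_right)
 then show ?thesis by (simp add: sum_NF_chi[OF _ image_mset_upt])
qed

text \<open>Faces that are constant on V are the faces of the flat on which these coordinates are
  identified; there the weights of V are added up.\<close>

lemma sum_merged_chi:
 fixes a :: "nat list \<Rightarrow> 'k::field"
 assumes fin: "finite I" and X: "V \<subseteq> I" "e \<in> V"
 shows "(\<Sum>f\<in>{f\<in>NF I. \<forall>x\<in>V. f x = f e}. a (ftyp I wt f)) =
  chi (image_mset wt (mset_set (I - V)) + {#\<Sum>x\<in>V. wt x#}) a"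
proof -
 define I' where "I' = insert e (I - V)"
 define wt' where "wt' = wt(e := \<Sum>x\<in>V. wt x)"
 define \<pi> where "\<pi> i = (if i \<in> V then Some e else if i \<in> I' then Some i else None)" for i
 interpret rg: regroup I I' \<pi>
 proof
  fix j i assume "\<pi> j = Some i"
  then show "j \<in> I \<and> i \<in> I'" using X by (auto simp: \<pi>_def I'_def split: if_splits)
 next
  fix i assume "i \<in> I'"
  then have "\<pi> i = Some i" using X by (auto simp: \<pi>_def I'_def)
  then show "\<exists>j. \<pi> j = Some i" ..
 qed (rule fin)
 have fiber: "{j\<in>I. \<pi> j = Some i} = (if i = e then V else {i})" if "i \<in> I'" for i
  using that X by (auto simp: \<pi>_def I'_def split: if_splits)
 have wtsum: "wt' i = (\<Sum>j\<in>{j\<in>I. \<pi> j = Some i}. wt j)" if "i \<in> I'" for i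
  unfolding fiber[OF that] by (simp add: wt'_def)
 have set: "{f\<in>NF I. \<forall>x\<in>V. f x = f e} = pull \<pi> ` NF I'"
 proof (intro equalityI subsetI)
  fix f assume "f \<in> {f\<in>NF I. \<forall>x\<in>V. f x = f e}"
  then have f: "f \<in> NF I" "\<And>x. x \<in> V \<Longrightarrow> f x = f e" by blast+
  define g where "g i = (if i \<in> I' then f i else 0)" for i
  have pg: "pull \<pi> g = f"
  proof
   fix j show "pull \<pi> g j = f j"
   proof (cases "j \<in> V")
    case True then show ?thesis using f(2)[OF True] by (simp add: pull_def \<pi>_def g_def I'_def)
   next
    case False
    then show ?thesis using NF_outside[OF f(1), of j] by (auto simp: pull_def \<pi>_def g_def I'_def)
   qed
  qed
  have "g \<in> NF I'" by (rule rg.pull_NF_rev) (simp_all add: pg f(1), simp add: g_def)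
  then show "f \<in> pull \<pi> ` NF I'" using pg by blast
 next
  fix f assume "f \<in> pull \<pi> ` NF I'"
  then obtain g where g: "g \<in> NF I'" "f = pull \<pi> g" by blast
  then show "f \<in> {f\<in>NF I. \<forall>x\<in>V. f x = f e}"
   using rg.pull_NF(1)[OF g(1)] X(2) by (simp add: pull_def \<pi>_def)
 qed
 have "(\<Sum>f\<in>{f\<in>NF I. \<forall>x\<in>V. f x = f e}. a (ftyp I wt f)) = (\<Sum>g\<in>NF I'. a (ftyp I' wt' g))"
 proof -
  have typ': "ftyp I wt (pull \<pi> g) = ftyp I' wt' g" for g
   by (rule rg.ftyp_pull[where wt=wt and wt'=wt', OF wtsum])
  show ?thesis unfolding set by (simp add: sum.reindex[OF rg.inj_pull] typ')
 qed
 also have "\<dots> = chi (image_mset wt (mset_set (I - V)) + {#\<Sum>x\<in>V. wt x#}) a"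
 proof (rule sum_NF_chi[OF rg.finI])
  have "image_mset wt' (mset_set (I - V)) = image_mset wt (mset_set (I - V))"
   using X fin by (intro image_mset_cong) (auto simp: wt'_def)
  moreover have "e \<notin> I - V" using X by simp
  ultimately show "image_mset wt' (mset_set I') = image_mset wt (mset_set (I - V)) + {#\<Sum>x\<in>V. wt x#}"
   using fin by (simp add: I'_def wt'_def)
 qed
 finally show ?thesis .
qed

lemma sum_zero_chi:
 fixes a :: "nat list \<Rightarrow> 'k::field"
 assumes fin: "finite I" and X: "V \<subseteq> I"
 shows "(\<Sum>f\<in>{f\<in>NF I. \<forall>x\<in>V. f x = 0}. a (ftyp I wt f)) = chi (image_mset wt (mset_set (I - V))) a"
proof -
 have sub: "I - V \<subseteq> I" by blast
 have iff: "f \<in> NF I \<and> (\<forall>x\<in>V. f x = 0) \<longleftrightarrow> f \<in> NF (I - V)" for f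
 proof
  assume f: "f \<in> NF I \<and> (\<forall>x\<in>V. f x = 0)"
  then have "f i = 0" if "i \<in> I - (I - V)" for i using that by blast
  then have "f \<in> NF I \<longleftrightarrow> f \<in> NF (I - V)" by (rule zero_outside_subset(1)[OF sub])
  then show "f \<in> NF (I - V)" using f by blast
 next
  assume f: "f \<in> NF (I - V)"
  then have z: "f i = 0" if "i \<in> I - (I - V)" for i using that NF_outside[OF f] by blast
  have "\<forall>x\<in>V. f x = 0" using NF_outside[OF f] by simp
  moreover have "f \<in> NF I \<longleftrightarrow> f \<in> NF (I - V)" by (rule zero_outside_subset(1)[OF sub]) (rule z)
  ultimately show "f \<in> NF I \<and> (\<forall>x\<in>V. f x = 0)" using f by blast
 qed
 have ft: "ftyp I wt f = ftyp (I - V) wt f" if f: "f \<in> NF (I - V)" for f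
 proof -
  have z: "f i = 0" if "i \<in> I - (I - V)" for i using that NF_outside[OF f] by blast
  show ?thesis by (rule zero_outside_subset(2)[OF sub]) (rule z)
 qed
 have "(\<Sum>f\<in>{f\<in>NF I. \<forall>x\<in>V. f x = 0}. a (ftyp I wt f)) = (\<Sum>f\<in>NF (I - V). a (ftyp (I - V) wt f))"
 proof -
  have "{f\<in>NF I. \<forall>x\<in>V. f x = 0} = NF (I - V)" using iff by blast
  then show ?thesis by (simp add: ft)
 qed
 also have "\<dots> = chi (image_mset wt (mset_set (I - V))) a"
  by (rule sum_NF_chi) (use fin in simp_all)
 finally show ?thesis .
qed

section \<open>Summation with sign changes\<close>

definition negate :: "'i set \<Rightarrow> ('i \<Rightarrow> int) \<Rightarrow> 'i \<Rightarrow> int" where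
 "negate V f i = (if i \<in> V then - f i else f i)"

lemma negate_negate [simp]: "negate V (negate V f) = f"
 by (rule ext) (simp add: negate_def)

lemma abs_negate: "\<bar>negate V f i\<bar> = \<bar>f i\<bar>"
 by (simp add: negate_def)

lemma negate_NF: "finite I \<Longrightarrow> f \<in> NF I \<Longrightarrow> negate V f \<in> NF I"
 by (rule NF_abs_cong[where f=f]) (simp_all add: abs_negate)

lemma ftyp_negate: "ftyp I wt (negate V f) = ftyp I wt f"
 by (rule rk_abs_cong(3)) (rule abs_negate)

text \<open>Sign changes preserve normal forms and types, so they may be performed inside any sum
  whose coefficients depend on types.\<close>

lemma sum_negate:
 fixes h :: "('i \<Rightarrow> int) \<Rightarrow> 'k::field"
 assumes "finite I"
 shows "(\<Sum>f\<in>NF I. a (ftyp I wt f) * h (negate V f)) = (\<Sum>f\<in>NF I. a (ftyp I wt f) * h f)"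
 by (rule sum.reindex_bij_witness[of _ "negate V" "negate V"])
  (simp_all add: negate_NF[OF assms] ftyp_negate)

context adjacent
begin

definition before :: "('i \<Rightarrow> int) \<Rightarrow> 'i \<Rightarrow> bool" where
 "before f e \<longleftrightarrow> \<bar>comb I f c e\<bar> < \<bar>comb I f c q\<bar>"

text \<open>For a face on the wall, q and r are neighbours in both products, which differ by the
  exchange of these two; on a negative level the order of the chamber is reversed.\<close>

lemma swap_orderings:
 assumes f: "f q = f r"
 obtains A B where "distinct A" "set A = {e \<in> I - {q, r}. before f e}"
  and "ftyp I wt (comb I f c) = map wt A @ (if f q < 0 then [wt r, wt q] else [wt q, wt r]) @ map wt B"
  and "ftyp I wt (comb I f c') = map wt A @ (if f q < 0 then [wt q, wt r] else [wt r, wt q]) @ map wt B"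
proof -
 let ?z = "comb I f c" and ?z' = "comb I f c'"
 have gen: "generic I (comb I f d)" if "d = c \<or> d = c'" for d
  using generic_comb[OF fin c] generic_comb[OF fin chamber_c'] that by auto
 have ne: "c x \<noteq> c q \<and> c x \<noteq> c q + 1" if "x \<in> I - {q, r}" for x
  using c_inj[of x q] c_inj[of x r] q r that qr by auto
 have os_ex: "generic (I - {q, r}) ?z" using gen[of c] by (auto simp: generic_def intro: inj_on_subset)
 have finI': "finite (I - {q, r})" using fin by simp
 obtain os where os: "ordering (I - {q, r}) ?z os" by (rule ordering_exists[OF finI' os_ex])
 have dos: "distinct os" "set os = I - {q, r}"
  using ordering_distinct[OF os] os by (simp_all add: ordering_def)
 have tq: "tie f c q = (if f q < 0 then - c q else c q)" "tie f c r = (if f q < 0 then - c q - 1 else c q + 1)"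
  using tie_c[OF q] tie_c[OF r] f qr by simp_all
 have tq': "tie f c' q = (if f q < 0 then - c q - 1 else c q + 1)" "tie f c' r = (if f q < 0 then - c q else c q)"
  using tie_c'[OF q] tie_c'[OF r] f qr by (simp_all add: c'_simps)
 have te: "tie f c e = (if f e < 0 then - c e else c e)" "tie f c' e = tie f c e" if "e \<in> I - {q, r}" for e
  using that tie_c[of e] tie_c'[of e] c'_simps(3)[of e] by auto
 have pos: "0 < c q" by (rule c_pos[OF q])
 have less: "abs_less (comb I f d) e p \<longleftrightarrow> before f e" "before f e \<or> abs_less (comb I f d) p e"
  if e: "e \<in> I - {q, r}" and d: "d = c \<or> d = c'" and p: "p = q \<or> p = r" for d e p
 proof -
  have eI: "e \<in> I" "p \<in> I" using e p q r by auto
  have t: "tie f d e < tie f d p \<longleftrightarrow> tie f c e < tie f c q" "tie f d e \<noteq> tie f d p"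
   using ne[OF e] te[OF e] tq tq' c_pos[OF eI(1)] d p pos by (auto split: if_splits)
  show 1: "abs_less (comb I f d) e p \<longleftrightarrow> before f e"
   unfolding before_def abs_comb_less[OF fin eI] abs_comb_less[OF fin eI(1) q] t(1) using p f by auto
  show "before f e \<or> abs_less (comb I f d) p e"
   using 1 t(2) abs_comb_eq[OF fin eI, of f d] by linarith
 qed
 have zd: "abs_less (comb I f d) x y \<longleftrightarrow> abs_less ?z x y"
  if "x \<in> I - {q, r}" "y \<in> I - {q, r}" "d = c \<or> d = c'" for x y d
  using that te(2)[OF that(1)] te(2)[OF that(2)] by (auto simp: abs_comb_less[OF fin])
 define A B where "A = filter (before f) os" and "B = filter (\<lambda>e. \<not> before f e) os"
 have setA: "set A = {e \<in> I - {q, r}. before f e}" and setB: "set B = {e \<in> I - {q, r}. \<not> before f e}"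
  by (simp_all add: A_def B_def dos)
 have ord: "ordering I (comb I f d) (A @ [x, y] @ B)"
  if d: "d = c \<or> d = c'" and xy: "{x, y} = {q, r}" "abs_less (comb I f d) x y" for x y d
  unfolding ordering_def
 proof (intro conjI)
  show "set (A @ [x, y] @ B) = I" using xy(1) q r by (auto simp: setA setB)
  show "\<forall>p\<in>I. comb I f d p \<noteq> 0" using gen[OF d] by (simp add: generic_def)
  have "x = q \<or> x = r" "y = q \<or> y = r" using xy(1) by auto
  then have A: "abs_less (comb I f d) e x \<and> abs_less (comb I f d) e y" if "e \<in> set A" for e
   using less(1)[OF _ d, of e] that by (auto simp: setA)
  have B: "abs_less (comb I f d) x e \<and> abs_less (comb I f d) y e" if "e \<in> set B" for e
   using less(2)[OF _ d, of e] that \<open>x = q \<or> x = r\<close> \<open>y = q \<or> y = r\<close> by (auto simp: setB)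
  have AB: "abs_less (comb I f d) e e'" if "e \<in> set A" "e' \<in> set B" for e e'
   using A[OF that(1)] B[OF that(2)] by linarith
  have "sorted_wrt (abs_less ?z) os" using os by (simp add: ordering_def)
  then have "sorted_wrt (abs_less (comb I f d)) os"
   by (rule sorted_wrt_mono_rel[rotated]) (use zd[OF _ _ d] dos(2) in blast)
  then have "sorted_wrt (abs_less (comb I f d)) A" "sorted_wrt (abs_less (comb I f d)) B"
   unfolding A_def B_def by (rule sorted_wrt_filter)+
  then show "sorted_wrt (abs_less (comb I f d)) (A @ [x, y] @ B)"
   using A B AB xy(2) by (simp add: sorted_wrt_append)
 qed
 have o1: "ordering I ?z (A @ (if f q < 0 then [r, q] else [q, r]) @ B)"
  using ord[of c r q] ord[of c q r] abs_comb_less[OF fin r q, of f c] abs_comb_less[OF fin q r, of f c] f tq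
  by (auto simp: insert_commute)
 have o2: "ordering I ?z' (A @ (if f q < 0 then [q, r] else [r, q]) @ B)"
  using ord[of c' r q] ord[of c' q r] abs_comb_less[OF fin r q, of f c'] abs_comb_less[OF fin q r, of f c'] f tq'
  by (auto simp: insert_commute)
 show thesis
 proof (rule that)
  show "distinct A" unfolding A_def using dos by simp
  show "set A = {e \<in> I - {q, r}. before f e}" by (rule setA)
  show "ftyp I wt ?z = map wt A @ (if f q < 0 then [wt r, wt q] else [wt q, wt r]) @ map wt B"
   unfolding ftyp_ordering(1)[OF o1] by simp
  show "ftyp I wt ?z' = map wt A @ (if f q < 0 then [wt q, wt r] else [wt r, wt q]) @ map wt B"
   unfolding ftyp_ordering(1)[OF o2] by simp
 qed
qed

lemma swap_diff_lastfun:
 fixes g :: "nat \<Rightarrow> 'k::field"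
 assumes "f q = f r"
 obtains A where "distinct A" "set A = {e \<in> I - {q, r}. before f e}"
  "swap_diff wt (lastfun T g) f = (if f q < 0 then - 1 else 1) *
   (if {#wt q, wt r#} \<subseteq># T then (g (wt r) - g (wt q)) * subcount_rev (T - {#wt q, wt r#}) (rev (map wt A)) else 0)"
proof -
 obtain A B where AB: "distinct A" "set A = {e \<in> I - {q, r}. before f e}"
  "ftyp I wt (comb I f c) = map wt A @ (if f q < 0 then [wt r, wt q] else [wt q, wt r]) @ map wt B"
  "ftyp I wt (comb I f c') = map wt A @ (if f q < 0 then [wt q, wt r] else [wt r, wt q]) @ map wt B"
  by (rule swap_orderings[OF assms, of wt])
 have "swap_diff wt (lastfun T g) f = (if f q < 0 then - 1 else 1) * comm_diff (lastfun T g) (map wt A) (wt q) (wt r) (map wt B)"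
  unfolding swap_diff_def AB(3,4) comm_diff_def by simp
 then show thesis unfolding comm_diff_lastfun by (rule that[OF AB(1,2)])
qed

lemma swap_diff_lastfun_pair:
 fixes g :: "nat \<Rightarrow> 'k::field"
 assumes "f q = f r"
 shows "swap_diff wt (lastfun {#wt q, wt r#} g) f = (if f q < 0 then - 1 else 1) * (g (wt r) - g (wt q))"
 by (rule swap_diff_lastfun[OF assms, of wt "{#wt q, wt r#}" g]) simp

text \<open>Only occurrences with z in front of the pair count. They are indexed by single
  coordinates e, so that the sum over faces can later be evaluated for each e on its own.\<close>

lemma swap_diff_lastfun_triple:
 fixes g :: "nat \<Rightarrow> 'k::field"
 assumes "f q = f r"
 shows "swap_diff wt (lastfun {#z, wt q, wt r#} g) f = (if f q < 0 then - 1 else 1) * (g (wt r) - g (wt q)) *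
  (\<Sum>e\<in>{e\<in>I - {q, r}. wt e = z}. if before f e then 1 else 0)"
proof -
 obtain A where A: "distinct A" "set A = {e \<in> I - {q, r}. before f e}"
  "swap_diff wt (lastfun {#z, wt q, wt r#} g) f = (if f q < 0 then - 1 else 1) *
   (if {#wt q, wt r#} \<subseteq># {#z, wt q, wt r#}
   then (g (wt r) - g (wt q)) * subcount_rev ({#z, wt q, wt r#} - {#wt q, wt r#}) (rev (map wt A)) else 0)"
  by (rule swap_diff_lastfun[OF assms, of wt "{#z, wt q, wt r#}" g])
 have z: "{#z, wt q, wt r#} - {#wt q, wt r#} = {#z#}" by (rule multiset_eqI) simp
 have "count (mset (map wt A)) z = card {e\<in>set A. wt e = z}"
  using A(1) by (simp add: count_image_mset vimage_def Int_def conj_commute flip: mset_set_set)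
 also have "{e\<in>set A. wt e = z} = {e\<in>{e\<in>I - {q, r}. wt e = z}. before f e}" unfolding A(2) by blast
 finally have "(of_nat (count (mset (map wt A)) z) :: 'k) = (\<Sum>e\<in>{e\<in>I - {q, r}. wt e = z}. if before f e then 1 else 0)"
  using fin by (simp add: sum.inter_filter[symmetric])
 then show ?thesis using A(3) unfolding z by (simp add: subcount_rev_single)
qed

text \<open>Faces with e on a lower level cancel when the pair q, r changes sign. On a common level
  let b be 1 or 0 according to whether e precedes q in c. The contributions are b if all three
  vanish, b if all are positive, 1 if e is negative and the pair positive, 0 if e is positive and
  the pair negative, and -(1 - b) if all are negative. All nonzero patterns have the same weighted
  sum, so the total is b times the sum over the flat on which e, q and r agree.\<close>

lemma sum_before:
 fixes a :: "nat list \<Rightarrow> 'k::field"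
 assumes e: "e \<in> I - {q, r}"
 shows "(\<Sum>f\<in>NF I. a (ftyp I wt f) *
   (if f q = f r then (if f q < 0 then - 1 else 1) * (if before f e then 1 else 0) else 0)) =
  (if c e < c q then \<Sum>f\<in>{f\<in>NF I. \<forall>x\<in>{e, q, r}. f x = f e}. a (ftyp I wt f) else 0)"
 (is "?lhs = _")
proof -
 let ?E = "\<lambda>f. f e = f q \<and> f q = f r"
 define S where "S P = (\<Sum>f\<in>NF I. a (ftyp I wt f) * (if P f then 1 else 0))" for P
 define b :: 'k where "b = (if c e < c q then 1 else 0)"
 have eI: "e \<in> I" "e \<noteq> q" "e \<noteq> r" using e by auto
 have ne: "c e \<noteq> c q" "c e \<noteq> c q + 1" using c_inj[OF eI(1) q eI(2)] c_inj[OF eI(1) r eI(3)] qr by auto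
 have pos: "0 < c e" "0 < c q" using c_pos eI(1) q by blast+
 have flip: "S (\<lambda>f. P (negate V f)) = S P" for P V
  unfolding S_def using sum_negate[OF fin, of a wt "\<lambda>f. if P f then 1 else 0" V] .
 have bef: "before f e \<longleftrightarrow> abs_less f e q \<or>
  \<bar>f e\<bar> = \<bar>f q\<bar> \<and> (if f e < 0 then - c e else c e) < (if f q < 0 then - c q else c q)" for f
  unfolding before_def abs_comb_less[OF fin eI(1) q] tie_c[OF eI(1)] tie_c[OF q] ..
 have pointwise: "(if f q = f r then (if f q < 0 then - 1 else 1) * (if before f e then 1 else 0) else 0) =
   (if f q = f r \<and> 0 < f q \<and> abs_less f e q then 1 else 0)
   - (if f q = f r \<and> f q < 0 \<and> abs_less f e q then 1 else 0)
   + b * (if ?E f \<and> f q = 0 then 1 else 0)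
   + b * (if ?E f \<and> 0 < f q then 1 else 0)
   + (if f e = - f q \<and> f q = f r \<and> 0 < f q then 1 else 0)
   - (1 - b) * (if ?E f \<and> f q < 0 then 1 else 0)" for f
 proof (cases "f q = f r")
  case True
  consider "f q = 0" | "0 < f q" "abs_less f e q" | "f q < 0" "abs_less f e q" | "abs_less f q e"
   | "0 < f q" "f e = f q" | "0 < f q" "f e = - f q" | "f q < 0" "f e = f q" | "f q < 0" "f e = - f q"
   by linarith
  then show ?thesis
   using True ne pos by cases (auto simp: bef b_def)
 qed simp
 have split: "?lhs =
   S (\<lambda>f. f q = f r \<and> 0 < f q \<and> abs_less f e q) - S (\<lambda>f. f q = f r \<and> f q < 0 \<and> abs_less f e q)
   + b * S (\<lambda>f. ?E f \<and> f q = 0) + b * S (\<lambda>f. ?E f \<and> 0 < f q)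
   + S (\<lambda>f. f e = - f q \<and> f q = f r \<and> 0 < f q) - (1 - b) * S (\<lambda>f. ?E f \<and> f q < 0)"
  unfolding pointwise S_def sum_distrib_left sum.distrib[symmetric] sum_subtractf[symmetric]
  by (rule sum.cong[OF refl]) (simp only: algebra_simps)
 have "S (\<lambda>f. f q = f r \<and> f q < 0 \<and> abs_less f e q) = S (\<lambda>f. f q = f r \<and> 0 < f q \<and> abs_less f e q)"
  using flip[of "\<lambda>f. f q = f r \<and> 0 < f q \<and> abs_less f e q" "{q, r}"] eI by (simp add: negate_def)
 moreover have "S (\<lambda>f. f e = - f q \<and> f q = f r \<and> 0 < f q) = S (\<lambda>f. ?E f \<and> 0 < f q)"
  using flip[of "\<lambda>f. ?E f \<and> 0 < f q" "{e}"] eI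
  by (simp add: negate_def equation_minus_iff minus_equation_iff[of "_ e"] eq_commute[of "- _ q"])
 moreover have "S (\<lambda>f. ?E f \<and> f q < 0) = S (\<lambda>f. ?E f \<and> 0 < f q)"
  using flip[of "\<lambda>f. ?E f \<and> 0 < f q" "{e, q, r}"] by (simp add: negate_def)
 moreover have "(\<Sum>f\<in>{f\<in>NF I. \<forall>x\<in>{e, q, r}. f x = f e}. a (ftyp I wt f)) =
   S (\<lambda>f. ?E f \<and> f q = 0) + S (\<lambda>f. ?E f \<and> 0 < f q)
   + S (\<lambda>f. ?E f \<and> f q < 0)"
  unfolding S_def sum.distrib[symmetric] sum.inter_filter[OF finite_NF[OF fin]]
  by (rule sum.cong[OF refl]) auto
 ultimately show ?thesis unfolding split by (simp add: b_def algebra_simps)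
qed

text \<open>Positive and negative values of the pair cancel, which leaves the flat on which both
  coordinates vanish.\<close>

lemma sum_pair_sign:
 fixes a :: "nat list \<Rightarrow> 'k::field"
 shows "(\<Sum>f\<in>NF I. a (ftyp I wt f) * (if f q = f r then (if f q < 0 then - 1 else 1) else 0)) =
  (\<Sum>f\<in>{f\<in>NF I. \<forall>x\<in>{q, r}. f x = 0}. a (ftyp I wt f))"
proof -
 define S where "S P = (\<Sum>f\<in>NF I. a (ftyp I wt f) * (if P f then 1 else 0))" for P
 have flip: "S (\<lambda>f. P (negate V f)) = S P" for P V
  unfolding S_def using sum_negate[OF fin, of a wt "\<lambda>f. if P f then 1 else 0" V] .
 have "(\<Sum>f\<in>NF I. a (ftyp I wt f) * (if f q = f r then (if f q < 0 then - 1 else 1) else 0)) =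
   S (\<lambda>f. f q = 0 \<and> f r = 0) + S (\<lambda>f. f q = f r \<and> 0 < f q) - S (\<lambda>f. f q = f r \<and> f q < 0)"
  unfolding S_def sum.distrib[symmetric] sum_subtractf[symmetric]
  by (rule sum.cong[OF refl]) auto
 moreover have "S (\<lambda>f. f q = f r \<and> f q < 0) = S (\<lambda>f. f q = f r \<and> 0 < f q)"
  using flip[of "\<lambda>f. f q = f r \<and> 0 < f q" "{q, r}"] by (simp add: negate_def)
 moreover have "(\<Sum>f\<in>{f\<in>NF I. \<forall>x\<in>{q, r}. f x = 0}. a (ftyp I wt f)) = S (\<lambda>f. f q = 0 \<and> f r = 0)"
  unfolding S_def sum.inter_filter[OF finite_NF[OF fin]]
  by (rule sum.cong[OF refl]) auto
 ultimately show ?thesis by simp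
qed

end

text \<open>The weights of the flat attached to T: two letters are set to zero, three are
  identified.\<close>

definition reduce :: "nat multiset \<Rightarrow> nat multiset \<Rightarrow> nat multiset" where
 "reduce \<mu> T = \<mu> - T + (if size T = 3 then {#sum_mset T#} else {#})"

lemma act_swap:
 fixes \<phi> a :: "nat list \<Rightarrow> 'k::field"
 assumes "w = L @ x # y # U" "k = length L"
 shows "act \<phi> a (L @ x # y # U) - act \<phi> a (L @ y # x # U) =
  (\<Sum>f\<in>NF {..<length w}. a (ftyp {..<length w} ((!) w) f) *
   (if f k = f (Suc k) then adjacent.swap_diff {..<length w} idc k (Suc k) ((!) w) \<phi> f else 0))"
proof -
 interpret adjacent "{..<length w}" idc k "Suc k"
  by (rule adjacent_upt) (simp add: assms)
 have "act \<phi> a w = actI {..<length w} ((!) w) idc \<phi> a" by (simp only: act_def)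
 moreover have "act \<phi> a (L @ y # x # U) = actI {..<length w} ((!) w) c' \<phi> a"
  using actI_act[OF fin chamber_c', of "(!) w" \<phi> a] ftyp_swapped[OF assms] by simp
 ultimately have "act \<phi> a w - act \<phi> a (L @ y # x # U) =
   (\<Sum>f\<in>NF {..<length w}. a (ftyp {..<length w} ((!) w) f) * swap_diff ((!) w) \<phi> f)"
  by (simp only: actI_def swap_diff_def sum_subtractf right_diff_distrib)
 also have "\<dots> = (\<Sum>f\<in>NF {..<length w}. a (ftyp {..<length w} ((!) w) f) *
   (if f k = f (Suc k) then swap_diff ((!) w) \<phi> f else 0))"
  by (rule sum.cong[OF refl]) (use ftyp_swap_neutral in \<open>simp add: swap_diff_def\<close>)
 finally show ?thesis using assms(1) by simp
qed

text \<open>Both exchanged letters must belong to T. For a pair, the sum over faces collapses to the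
  flat on which both vanish. For a triple, it is taken separately for every coordinate e carrying
  the third letter; only those in front of the pair survive, and \<open>comm_diff_lastfun\<close>
  counts exactly these.\<close>

lemma comm_diff_act_lastfun:
 fixes g :: "nat \<Rightarrow> 'k::field"
 assumes T: "size T = 2 \<or> size T = 3"
 shows "comm_diff (act (lastfun T g) a) L x y U =
  chi (reduce (mset (L @ x # y # U)) T) a * comm_diff (lastfun T g) L x y U"
proof -
 define w where "w = L @ x # y # U"
 define k where "k = length L"
 define I where "I = {..<length w}"
 interpret adjacent I idc k "Suc k"
  unfolding I_def by (rule adjacent_upt) (simp add: w_def k_def)
 have wk: "w ! k = x" "w ! Suc k = y" by (simp_all add: w_def k_def nth_append)
 let ?a = "\<lambda>f. a (ftyp I ((!) w) f)"
 let ?h = "\<lambda>f e. ?a f * (if f k = f (Suc k) then (if f k < 0 then - 1 else 1) * (if before f e then 1 else 0) else 0)"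
 have diff: "comm_diff (act (lastfun T g) a) L x y U =
   (\<Sum>f\<in>NF I. ?a f * (if f k = f (Suc k) then swap_diff ((!) w) (lastfun T g) f else 0))"
  unfolding comm_diff_def I_def by (rule act_swap[OF w_def k_def])
 have sub: "{k, Suc k} \<subseteq> I" using q r by simp
 show ?thesis
 proof (cases "{#x, y#} \<subseteq># T")
  case False
  have "swap_diff ((!) w) (lastfun T g) f = 0" if f: "f k = f (Suc k)" for f
   by (rule swap_diff_lastfun[OF f, of "(!) w" T g]) (use False wk in simp)
  then have "comm_diff (act (lastfun T g) a) L x y U = 0" unfolding diff by (intro sum.neutral) simp
  then show ?thesis using False by (simp add: comm_diff_lastfun)
 next
  case True
  then obtain N where N: "T = {#x, y#} + N" by (metis mset_subset_eq_exists_conv)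
  show ?thesis
  proof (cases "size T = 2")
   case True
   then have Txy: "T = {#x, y#}" using N by simp
   have "comm_diff (act (lastfun T g) a) L x y U = (\<Sum>f\<in>NF I. (g y - g x) *
     (?a f * (if f k = f (Suc k) then (if f k < 0 then - 1 else 1) else 0)))"
    unfolding diff unfolding Txy
    by (rule sum.cong[OF refl])
     (simp add: swap_diff_lastfun_pair[where wt="(!) w" and g=g, unfolded wk] mult.left_commute)
   also have "\<dots> = (g y - g x) * chi (image_mset ((!) w) (mset_set (I - {k, Suc k}))) a"
    unfolding sum_distrib_left[symmetric] sum_pair_sign sum_zero_chi[OF fin sub] ..
   also have "image_mset ((!) w) (mset_set (I - {k, Suc k})) = reduce (mset w) T"
    unfolding map_nth_restrict[OF I_def sub finite.insertI[OF finite.insertI[OF finite.emptyI]]]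
    using wk by (simp add: reduce_def Txy)
   finally show ?thesis by (simp add: comm_diff_lastfun Txy w_def mult.commute)
  next
   case False
   then have "size N = 1" using T N by simp
   then obtain z where z: "N = {#z#}" by (metis size_1_singleton_mset)
   have Tz: "T = {#z, x, y#}" using N z by simp
   define E where "E = {e\<in>I - {k, Suc k}. w ! e = z}"
   have finE: "finite E" using fin by (simp add: E_def)
   have "comm_diff (act (lastfun T g) a) L x y U = (\<Sum>f\<in>NF I. (g y - g x) * (\<Sum>e\<in>E. ?h f e))"
    unfolding diff unfolding Tz
   proof (rule sum.cong[OF refl])
    fix f
    show "?a f * (if f k = f (Suc k) then swap_diff ((!) w) (lastfun {#z, x, y#} g) f else 0) =
     (g y - g x) * (\<Sum>e\<in>E. ?h f e)"
    proof (cases "f k = f (Suc k)")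
     case True
     show ?thesis
      unfolding if_P[OF True] swap_diff_lastfun_triple[OF True, where wt="(!) w" and g=g and z=z, unfolded wk] E_def
      by (simp only: sum_distrib_left mult.assoc mult.left_commute)
    qed simp
   qed
   \<comment> \<open>With the sums exchanged, each e is treated by \<open>sum_before\<close>, which
     identifies it with the pair.\<close>
   also have "\<dots> = (g y - g x) * (\<Sum>e\<in>E. \<Sum>f\<in>NF I. ?h f e)"
    unfolding sum.swap[of _ "NF I" E] by (rule sum_distrib_left[symmetric])
   also have "(\<Sum>e\<in>E. \<Sum>f\<in>NF I. ?h f e)
    = (\<Sum>e\<in>E. if e < k then chi (reduce (mset w) T) a else 0)"
   proof (rule sum.cong[OF refl])
    fix e assume e: "e \<in> E"
    then have eI: "e \<in> I - {k, Suc k}" and we: "w ! e = z" by (simp_all add: E_def)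
    have V: "{e, k, Suc k} \<subseteq> I" "e \<in> {e, k, Suc k}" using eI sub by simp_all
    have red: "image_mset ((!) w) (mset_set (I - {e, k, Suc k})) + {#\<Sum>x\<in>{e, k, Suc k}. w ! x#} = reduce (mset w) T"
     unfolding map_nth_restrict[OF I_def V(1) finite.insertI[OF finite.insertI[OF finite.insertI[OF finite.emptyI]]]]
     using wk we eI by (simp add: reduce_def Tz)
    show "(\<Sum>f\<in>NF I. ?h f e)
     = (if e < k then chi (reduce (mset w) T) a else 0)"
     unfolding sum_before[OF eI] sum_merged_chi[OF fin V] red by (simp add: idc_def)
   qed
   also have "\<dots> = of_nat (card {e\<in>E. e < k}) * chi (reduce (mset w) T) a"
    using finE by (simp add: sum.inter_filter[symmetric])
   also have "card {e\<in>E. e < k} = count (mset L) z"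
   proof -
    have "{e\<in>E. e < k} = {e. e < length L \<and> L ! e = z}"
     by (auto simp: E_def I_def w_def k_def nth_append)
    moreover have "card {e. e < length L \<and> L ! e = z} = length (filter (\<lambda>v. v = z) L)"
     by (rule length_filter_conv_card[symmetric])
    moreover have "length (filter (\<lambda>v. v = z) L) = count (mset L) z"
     by (induction L) simp_all
    ultimately show ?thesis by simp
   qed
   finally have "comm_diff (act (lastfun T g) a) L x y U =
     chi (reduce (mset w) T) a * ((g y - g x) * of_nat (count (mset L) z))"
    by (simp add: mult.assoc mult.left_commute)
   moreover have "{#z, x, y#} - {#x, y#} = {#z#}" by (rule multiset_eqI) simp
   then have "comm_diff (lastfun T g) L x y U = (g y - g x) * of_nat (count (mset L) z)"
    by (simp add: comm_diff_lastfun Tz subcount_rev_single)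
   ultimately show ?thesis by (simp add: w_def)
  qed
 qed
qed

text \<open>The action multiplies the commutator differences by a character, hence it multiplies the
  function itself by this character up to an additive constant, and radical elements annihilate
  constants.\<close>

theorem lastfun_derivation:
 fixes g :: "nat \<Rightarrow> 'k::field"
 assumes "size T = 2 \<or> size T = 3" "mset w = mset w'"
 shows "act (lastfun T g) a w - chi (reduce (mset w) T) a * lastfun T g w =
  act (lastfun T g) a w' - chi (reduce (mset w) T) a * lastfun T g w'"
proof (rule constant_if_comm_diff_zero[where \<mu> = "mset w"])
 fix L x y U assume mu: "mset (L @ x # y # U) = mset w"
 show "comm_diff (\<lambda>w'. act (lastfun T g) a w' - chi (reduce (mset w) T) a * lastfun T g w') L x y U = 0"
  using comm_diff_act_lastfun[OF assms(1), of g a L x y U] unfolding mu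
  by (simp add: comm_diff_def algebra_simps)
qed (use assms(2) in simp_all)

section \<open>Invariants of the face algebra\<close>

text \<open>As a type, the normal forms become an instance of \<open>monoid_add\<close>, and
  \<open>poly_mapping\<close> then provides their convolution ring. This is why the product of faces
  is written as a sum.\<close>

typedef 'n face = "NF (UNIV :: 'n::finite set)"
 morphisms code Face
proof
 show "nrm UNIV (\<lambda>_. 0 :: int) \<in> NF (UNIV :: 'n set)" by (rule nrm_in_NF) simp
qed

abbreviation "to_face f \<equiv> Face (nrm UNIV f)"

lemma same_face_code_to_face: "same_face UNIV (code (to_face f)) f"
 by (metis Face_inverse finite nrm_in_NF same_face_nrm same_face_sym)

lemma face_eq_iff: "x = y \<longleftrightarrow> same_face UNIV (code x) (code y)"
 by (metis NF_eqI code code_inject same_face_refl)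

lemma to_face_eqI: "same_face UNIV f g \<Longrightarrow> to_face f = to_face g"
 by (simp add: nrm_same_face)

lemma to_face_code [simp]: "to_face (code x) = x"
 by (meson face_eq_iff same_face_code_to_face)

lemma zero_NF: "(\<lambda>_. 0 :: int) \<in> NF I"
 by (simp add: NF_def nrm_def fun_eq_iff)

instantiation face :: (finite) monoid_add
begin

definition zero_face :: "'a face" where "zero_face = Face (\<lambda>_. 0)"

definition plus_face :: "'a face \<Rightarrow> 'a face \<Rightarrow> 'a face" where
 "plus_face x y = to_face (comb UNIV (code x) (code y))"

lemma code_zero [simp]: "code 0 = (\<lambda>_. 0)"
 by (simp add: zero_face_def Face_inverse zero_NF)

lemma code_plus: "same_face UNIV (code (x + y)) (comb UNIV (code x) (code y))"
 unfolding plus_face_def by (rule same_face_code_to_face)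

instance
proof
 fix x y z :: "'a face"
 have "same_face UNIV (code (x + y + z)) (comb UNIV (comb UNIV (code x) (code y)) (code z))"
  by (rule same_face_trans[OF code_plus comb_same_face[OF finite code_plus same_face_refl]])
 moreover have "same_face UNIV (code (x + (y + z))) (comb UNIV (code x) (comb UNIV (code y) (code z)))"
  by (rule same_face_trans[OF code_plus comb_same_face[OF finite same_face_refl code_plus]])
 moreover note comb_assoc[of UNIV "code x" "code y" "code z", OF finite]
 ultimately show "x + y + z = x + (y + z)"
  unfolding face_eq_iff by (meson same_face_sym same_face_trans)
 show "0 + x = x" "x + 0 = x" unfolding plus_face_def code_zero by simp_all
qed

end

instance face :: (finite) finite
proof
 have "(UNIV :: 'a face set) = Face ` NF UNIV" by (metis type_definition.Abs_image type_definition_face)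
 then show "finite (UNIV :: 'a face set)" by (metis finite_imageI finite_NF finite)
qed

lemma plus_eq_iff: "x + y = z \<longleftrightarrow> same_face UNIV (comb UNIV (code x) (code y)) (code z)"
 unfolding face_eq_iff by (meson code_plus same_face_sym same_face_trans)

lemma face_idem: "x + x = (x :: 'n::finite face)"
 unfolding plus_eq_iff by (rule comb_idem)

lemma face_regular: "x + y + x = x + (y :: 'n::finite face)"
proof -
 have "same_face UNIV (code (x + y + x)) (comb UNIV (comb UNIV (code x) (code y)) (code x))"
  by (rule same_face_trans[OF code_plus comb_same_face[OF finite code_plus same_face_refl]])
 moreover note comb_regular[of UNIV "code x" "code y", OF finite]
 ultimately show ?thesis
  unfolding face_eq_iff by (meson code_plus same_face_sym same_face_trans)
qed

text \<open>Here z + x = z means that x lies in the linear span of z. Left regularity splits the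
  condition on x + y at z into one on y at z and one on x at y + z, which is what composing two
  actions requires.\<close>

lemma face_below_iff:
 fixes x y z :: "'n::finite face"
 shows "z + (x + y) = z \<longleftrightarrow> z + y = z \<and> y + z + x = y + z"
proof
 assume *: "z + (x + y) = z"
 have "z + x = z + (x + y) + x" using * by simp
 also have "\<dots> = z + (x + y + x)" by (simp only: add.assoc)
 also have "\<dots> = z" using * by (simp only: face_regular)
 finally have zx: "z + x = z" .
 then have "z + y = z" using * by (metis add.assoc)
 moreover have "y + z + x = y + z" using zx by (simp only: add.assoc)
 ultimately show "z + y = z \<and> y + z + x = y + z" ..
next
 assume *: "z + y = z \<and> y + z + x = y + z"
 then have "z + (y + z + x) = z + (y + z)" by simp
 then have "z + y + z + x = z + y + z" by (simp only: add.assoc)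
 then have "z + x = z" using * by (simp only: face_idem)
 then show "z + (x + y) = z" using * by (metis add.assoc)
qed

definition ftype :: "'n::finite face \<Rightarrow> nat list" where
 "ftype x = ftyp UNIV (\<lambda>_. 1) (code x)"

lemma ftype_to_face: "ftype (to_face f) = ftyp UNIV (\<lambda>_. 1) f"
 unfolding ftype_def by (rule ftyp_same_face[OF same_face_code_to_face])

lemma ftype_plus: "ftype (x + y) = ftyp UNIV (\<lambda>_. 1) (comb UNIV (code x) (code y))"
 unfolding plus_face_def by (rule ftype_to_face)

definition words :: "nat \<Rightarrow> nat list set" where
 "words n = {w. 0 \<notin> set w \<and> sum_list w \<le> n}"

lemma finite_words: "finite (words n)"
proof (rule finite_subset)
 show "finite {w. set w \<subseteq> {0..n} \<and> length w \<le> n}" by (rule finite_lists_length_le) simp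
 have "length w \<le> sum_list w \<and> (\<forall>x\<in>set w. x \<le> sum_list w)" if "0 \<notin> set w" for w :: "nat list"
  using that by (induction w) (auto intro: trans_le_add2)
 then show "words n \<subseteq> {w. set w \<subseteq> {0..n} \<and> length w \<le> n}"
  unfolding words_def by fastforce
qed

lemma ftype_words: "ftype (x :: 'n::finite face) \<in> words CARD('n)"
proof -
 have "sum_list (ftype x) = (\<Sum>i\<in>{i\<in>UNIV. code x i \<noteq> 0}. 1)"
  unfolding ftype_def by (rule sum_list_ftyp) simp
 also have "\<dots> \<le> CARD('n)" by (simp add: card_mono)
 finally show ?thesis using ftyp_pos[of "UNIV :: 'n set" "\<lambda>_. 1" "code x"] by (simp add: words_def ftype_def)
qed

lemma fibers_exist:
 assumes "finite J" "sum_list w \<le> card J"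
 obtains \<pi> where "\<And>j i. \<pi> j = Some i \<Longrightarrow> j \<in> J \<and> i < length w"
  "\<And>i. i < length w \<Longrightarrow> card {j\<in>J. \<pi> j = Some i} = w ! i"
 using assms
proof (induction w arbitrary: J thesis rule: rev_induct)
 case Nil
 show ?case by (rule Nil.prems(1)[of "\<lambda>_. None"]) simp_all
next
 case (snoc x w)
 obtain K where K: "K \<subseteq> J" "card K = x"
  using snoc.prems(3) by (metis add_leD2 obtain_subset_with_card_n sum_list.Cons sum_list.Nil sum_list_append add_0_right)
 have finK: "finite K" using K(1) snoc.prems(2) by (rule finite_subset)
 have "sum_list w \<le> card (J - K)" using snoc.prems K finK by (simp add: card_Diff_subset)
 then obtain \<pi> where \<pi>: "\<And>j i. \<pi> j = Some i \<Longrightarrow> j \<in> J - K \<and> i < length w"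
  "\<And>i. i < length w \<Longrightarrow> card {j\<in>J - K. \<pi> j = Some i} = w ! i"
  using snoc.IH[of "J - K"] snoc.prems(2) by auto
 show ?case
 proof (rule snoc.prems(1))
  let ?\<pi> = "\<lambda>j. if j \<in> K then Some (length w) else \<pi> j"
  show "j \<in> J \<and> i < length (w @ [x])" if "?\<pi> j = Some i" for j i
   using that K(1) \<pi>(1)[of j i] by (auto split: if_splits)
  fix i assume i: "i < length (w @ [x])"
  show "card {j\<in>J. ?\<pi> j = Some i} = (w @ [x]) ! i"
  proof (cases "i = length w")
   case True
   have "{j\<in>J. ?\<pi> j = Some i} = K" using True K(1) \<pi>(1) by (auto split: if_splits)
   then show ?thesis using True K by simp
  next
   case False
   then have "{j\<in>J. ?\<pi> j = Some i} = {j\<in>J - K. \<pi> j = Some i}" by auto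
   then show ?thesis using False i \<pi>(2)[of i] by (simp add: nth_append)
  qed
 qed
qed

text \<open>Disjoint blocks of coordinates with the sizes prescribed by w are put on the levels 1,
  2, ..., and the remaining coordinates on the zero level.\<close>

lemma ftype_surj:
 assumes "w \<in> words CARD('n::finite)"
 obtains x :: "'n::finite face" where "ftype x = w"
proof -
 have "sum_list w \<le> card (UNIV :: 'n set)" using assms by (simp add: words_def)
 from fibers_exist[OF finite this] obtain \<pi> where
  \<pi>: "\<And>j i. \<pi> j = Some i \<Longrightarrow> j \<in> (UNIV :: 'n set) \<and> i < length w"
   "\<And>i. i < length w \<Longrightarrow> card {j\<in>UNIV. \<pi> j = Some i} = w ! i" by blast
 have fib: "{j. \<pi> j = Some i} \<noteq> {}" if "i < length w" for i :: nat
 proof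
  assume "{j. \<pi> j = Some i} = {}"
  then have "w ! i = 0" using \<pi>(2)[OF that] by simp
  then show False using assms that nth_mem[OF that] by (simp add: words_def)
 qed
 interpret regroup UNIV "{..<length w}" \<pi>
  using \<pi>(1) fib by unfold_locales auto
 have "ftyp UNIV (\<lambda>_. 1) (pull \<pi> idc) = ftyp {..<length w} ((!) w) idc"
  by (rule ftyp_pull) (simp add: \<pi>(2)[symmetric])
 then have "ftype (to_face (pull \<pi> idc)) = w" by (simp add: ftype_to_face ftyp_idc)
 then show thesis by (rule that)
qed

section \<open>Signed permutations acting on faces\<close>

definition gact :: "('n \<Rightarrow> 'n) \<Rightarrow> 'n set \<Rightarrow> ('n \<Rightarrow> int) \<Rightarrow> 'n \<Rightarrow> int" where
 "gact \<sigma> V f = negate V (f \<circ> \<sigma>)"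

lemma abs_gact: "\<bar>gact \<sigma> V f i\<bar> = \<bar>f (\<sigma> i)\<bar>"
 by (simp add: gact_def abs_negate)

lemma gact_sign: "0 < gact \<sigma> V f i \<longleftrightarrow> (if i \<in> V then f (\<sigma> i) < 0 else 0 < f (\<sigma> i))"
 "gact \<sigma> V f i < 0 \<longleftrightarrow> (if i \<in> V then 0 < f (\<sigma> i) else f (\<sigma> i) < 0)"
 by (simp_all add: gact_def negate_def)

lemma gact_same_face: "same_face UNIV f g \<Longrightarrow> same_face UNIV (gact \<sigma> V f) (gact \<sigma> V g)"
 by (simp add: same_face_def abs_gact gact_sign)

lemma gact_comb:
 fixes \<sigma> :: "'n::finite \<Rightarrow> 'n"
 assumes "bij \<sigma>"
 shows "comb UNIV (gact \<sigma> V f) (gact \<sigma> V g) = gact \<sigma> V (comb UNIV f g)"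
proof -
 have "(\<Sum>j\<in>UNIV. \<bar>gact \<sigma> V g j\<bar>) = (\<Sum>j\<in>UNIV. \<bar>g j\<bar>)"
  unfolding abs_gact by (rule sum.reindex_bij_betw[OF assms])
 then show ?thesis by (auto simp: comb_def gact_def negate_def fun_eq_iff)
qed

definition fgact :: "('n::finite \<Rightarrow> 'n) \<Rightarrow> 'n set \<Rightarrow> 'n face \<Rightarrow> 'n face" where
 "fgact \<sigma> V x = to_face (gact \<sigma> V (code x))"

lemma fgact_to_face: "fgact \<sigma> V (to_face f) = to_face (gact \<sigma> V f)"
 unfolding fgact_def by (rule to_face_eqI gact_same_face same_face_code_to_face)+

lemma fgact_plus:
 assumes "bij \<sigma>"
 shows "fgact \<sigma> V (x + y) = fgact \<sigma> V x + fgact \<sigma> V y"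
proof -
 have "fgact \<sigma> V x + fgact \<sigma> V y = to_face (comb UNIV (gact \<sigma> V (code x)) (gact \<sigma> V (code y)))"
  unfolding plus_face_def fgact_def
  by (rule to_face_eqI comb_same_face same_face_code_to_face finite)+
 then show ?thesis unfolding plus_face_def fgact_to_face gact_comb[OF assms] by simp
qed

text \<open>A signed permutation merely permutes the absolute values, so the code stays in normal
  form and is not renumbered.\<close>

lemma code_fgact:
 assumes "bij \<sigma>"
 shows "code (fgact \<sigma> V x) = gact \<sigma> V (code (x :: 'n::finite face))"
proof -
 have "gact \<sigma> V (code x) \<in> NF UNIV"
 proof (rule NF_I(1))
  have img: "\<sigma> ` {i. code x (\<sigma> i) \<noteq> 0} = {i\<in>UNIV. code x i \<noteq> 0}"
  proof (rule subset_antisym; rule subsetI)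
   fix i assume "i \<in> {i\<in>UNIV. code x i \<noteq> 0}"
   moreover obtain j where "i = \<sigma> j" using bij_is_surj[OF assms] by (meson surjD)
   ultimately show "i \<in> \<sigma> ` {i. code x (\<sigma> i) \<noteq> 0}" by blast
  qed blast
  have "(\<lambda>i. nat \<bar>gact \<sigma> V (code x) i\<bar>) ` {i\<in>UNIV. gact \<sigma> V (code x) i \<noteq> 0}
    = nabs (code x) ` (\<sigma> ` {i. code x (\<sigma> i) \<noteq> 0})"
   unfolding image_image abs_gact by (rule image_cong) (auto simp: gact_def negate_def)
  also have "\<sigma> ` {i. code x (\<sigma> i) \<noteq> 0} = {i\<in>UNIV. code x i \<noteq> 0}" by (fact img)
  finally show "(\<lambda>i. nat \<bar>gact \<sigma> V (code x) i\<bar>) ` {i\<in>UNIV. gact \<sigma> V (code x) i \<noteq> 0} = {1..lev UNIV (code x)}"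
   by (simp only: NF_image[OF finite code])
 qed simp_all
 then show ?thesis unfolding fgact_def by (simp add: NF_def Face_inverse)
qed

lemma bij_fgact:
 assumes "bij \<sigma>"
 shows "bij (fgact \<sigma> V :: 'n::finite face \<Rightarrow> _)"
proof -
 have "inj (fgact \<sigma> V :: 'n face \<Rightarrow> _)"
 proof (rule injI)
  fix x y :: "'n face"
  assume "fgact \<sigma> V x = fgact \<sigma> V y"
  then have "gact \<sigma> V (code x) i = gact \<sigma> V (code y) i" for i by (metis code_fgact[OF assms])
  then have *: "code x (\<sigma> i) = code y (\<sigma> i)" for i
   by (auto simp: gact_def negate_def dest!: meta_spec[of _ i] split: if_splits)
  have "code x = code y"
  proof
   fix i
   obtain j where "i = \<sigma> j" using bij_is_surj[OF assms] by (meson surjD)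
   then show "code x i = code y i" using *[of j] by simp
  qed
  then show "x = y" by (simp add: code_inject)
 qed
 then show ?thesis by (simp add: bij_def finite_UNIV_inj_surj)
qed

text \<open>Equal types mean equal sizes of all nonzero levels, and the size of the zero level
  follows from the total. So a permutation matches the absolute values and a sign change does the
  rest: types classify the orbits.\<close>

lemma ftype_eq_imp_fgact:
 fixes x y :: "'n::finite face"
 assumes "ftype x = ftype y"
 obtains \<sigma> V where "bij \<sigma>" "x = fgact \<sigma> V y"
proof -
 let ?X = "\<lambda>i. nat \<bar>code x i\<bar>" and ?Y = "\<lambda>i. nat \<bar>code y i\<bar>"
 have cnt: "card {i. nat \<bar>code z i\<bar> = Suc l} = (if l < length (ftype z) then ftype z ! l else 0)" for z :: "'n face" and l
 proof -
  have rk: "nat \<bar>code z i\<bar> = rk UNIV (code z) i" for i using NF_abs[OF finite code, of i z] by simp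
  show ?thesis
  proof (cases "l < lev UNIV (code z)")
   case True
   then show ?thesis by (simp add: ftype_def nth_ftyp rk)
  next
   case False
   have "rk UNIV (code z) i \<noteq> Suc l" for i
    using rk_le_lev[of UNIV "code z" i] False by simp
   then show ?thesis using False by (simp add: ftype_def rk)
  qed
 qed
 have "image_mset ?X (mset_set UNIV) = image_mset ?Y (mset_set UNIV)"
 proof (rule multiset_eqI)
  fix v
  have c: "count (image_mset (nabs (code z)) (mset_set UNIV)) v = card {i. nat \<bar>code z i\<bar> = v}" for z :: "'n face"
   by (simp add: count_image_mset vimage_def)
  show "count (image_mset ?X (mset_set UNIV)) v = count (image_mset ?Y (mset_set UNIV)) v"
  proof (cases v)
   case (Suc l)
   show ?thesis unfolding c unfolding Suc cnt assms ..
  next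
   case 0
   have zero: "{i. nat \<bar>code z i\<bar> = 0} = - {i\<in>UNIV. code z i \<noteq> 0}" for z :: "'n face" by auto
   have "card {i\<in>UNIV. code z i \<noteq> 0} = sum_list (ftype z)" for z :: "'n face"
    unfolding ftype_def sum_list_ftyp[OF finite] by simp
   then have "card {i\<in>UNIV. code x i \<noteq> 0} = card {i\<in>UNIV. code y i \<noteq> 0}" by (simp only: assms)
   then show ?thesis unfolding c unfolding 0 zero by (simp only: Compl_eq_Diff_UNIV card_Diff_subset finite subset_UNIV)
  qed
 qed
 from image_mset_eq_implies_permutes[OF finite this]
 obtain p where p: "p permutes UNIV" "\<forall>i\<in>UNIV. ?X i = ?Y (p i)" by blast
 have bij: "bij p" by (rule permutes_bij[OF p(1)])
 have abs: "\<bar>code x i\<bar> = \<bar>code y (p i)\<bar>" for i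
  using p(2) by (simp add: eq_nat_nat_iff)
 have "code x = gact p {i. sgn (code x i) \<noteq> sgn (code y (p i))} (code y)"
 proof
  fix i
  show "code x i = gact p {i. sgn (code x i) \<noteq> sgn (code y (p i))} (code y) i"
   using abs[of i] by (auto simp: gact_def negate_def abs_eq_iff sgn_if)
 qed
 then have "x = fgact p {i. sgn (code x i) \<noteq> sgn (code y (p i))} y"
  by (metis code_fgact[OF bij] code_inject)
 then show thesis using bij that by blast
qed

lemma ftype_fgact:
 assumes "bij \<sigma>"
 shows "ftype (fgact \<sigma> V x) = ftype (x :: 'n::finite face)"
proof -
 interpret regroup UNIV UNIV "\<lambda>i. Some (\<sigma> i)"
  using bij_is_surj[OF assms] by unfold_locales (auto simp: surj_def, metis)
 have "ftype (fgact \<sigma> V x) = ftyp UNIV (\<lambda>_. 1) (pull (\<lambda>i. Some (\<sigma> i)) (code x))"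
  unfolding ftype_def code_fgact[OF assms]
  by (rule rk_abs_cong(3)) (simp add: abs_gact pull_def)
 also have "\<dots> = ftyp UNIV (\<lambda>_. 1) (code x)"
 proof (rule ftyp_pull)
  fix i
  have "{j \<in> UNIV. Some (\<sigma> j) = Some i} = {inv_into UNIV \<sigma> i}"
   using bij_is_surj[OF assms] bij_is_inj[OF assms] by (auto simp: surj_f_inv_f inv_f_f)
  then show "1 = (\<Sum>j\<in>{j \<in> UNIV. Some (\<sigma> j) = Some i}. 1)" by simp
 qed
 finally show ?thesis by (simp add: ftype_def)
qed

lemma ftype_Nil: "ftype x = [] \<longleftrightarrow> x = (0 :: 'n::finite face)"
proof
 assume "ftype x = []"
 then have "sum_list (ftype x) = 0" by simp
 then have "(\<Sum>i\<in>{i\<in>UNIV. code x i \<noteq> 0}. 1) = (0::nat)"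
  unfolding ftype_def sum_list_ftyp[OF finite] .
 then have "code x = code 0" by (auto simp: fun_eq_iff)
 then show "x = 0" by (simp only: code_inject)
next
 assume "x = 0"
 then have "lev UNIV (code x) = 0" by (simp add: lev_def)
 then have "length (ftype x) = 0" unfolding ftype_def length_ftyp .
 then show "ftype x = []" by simp
qed

text \<open>After a sign change the code of z is nonnegative, and its positive values index the
  blocks of a regrouping whose weights are the letters of the type. Then \<open>sum_below\<close>
  carries the sum over the faces in the linear span of z to the chamber \<open>idc\<close>.\<close>

lemma sum_below_face:
 fixes \<phi> a :: "nat list \<Rightarrow> 'k::field" and z :: "'n::finite face"
 shows "(\<Sum>x\<in>{x. z + x = z}. a (ftype x) * \<phi> (ftype (x + z))) = act \<phi> a (ftype z)"
proof -
 define V where "V = {i. code z i < 0}"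
 define y where "y = fgact id V z"
 have bid: "bij (id :: 'n \<Rightarrow> 'n)" by simp
 have cy: "code y i = \<bar>code z i\<bar>" for i
  unfolding y_def code_fgact[OF bid] by (simp add: gact_def negate_def V_def)
 have ty: "ftype y = ftype z" unfolding y_def by (rule ftype_fgact[OF bid])
 define w where "w = ftype z"
 have len: "length w = lev UNIV (code y)" unfolding w_def ty[symmetric] by (simp add: ftype_def)
 have "bij_betw (fgact id V) {x. z + x = z} {x. y + x = y}"
 proof (rule bij_betwI')
  fix x x' :: "'n face"
  show "(fgact id V x = fgact id V x') = (x = x')"
   using bij_is_inj[OF bij_fgact[OF bid]] by (rule inj_eq)
 next
  fix x assume "x \<in> {x. z + x = z}"
  then show "fgact id V x \<in> {x. y + x = y}" by (simp add: y_def fgact_plus[OF bid, symmetric])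
 next
  fix x' assume x': "x' \<in> {x. y + x = y}"
  obtain x where x: "x' = fgact id V x" using bij_is_surj[OF bij_fgact[OF bid]] by (meson surjD)
  have "z + x = z"
   using x' bij_is_inj[OF bij_fgact[OF bid, of V]]
   by (simp add: x y_def fgact_plus[OF bid, symmetric] inj_eq)
  then show "\<exists>x\<in>{x. z + x = z}. x' = fgact id V x" using x by blast
 qed
 from sum.reindex_bij_betw[OF this, where g = "\<lambda>x. a (ftype x) * \<phi> (ftype (x + y))"]
 have "(\<Sum>x\<in>{x. z + x = z}. a (ftype x) * \<phi> (ftype (x + z)))
   = (\<Sum>x\<in>{x. y + x = y}. a (ftype x) * \<phi> (ftype (x + y)))"
  by (simp add: y_def fgact_plus[OF bid, symmetric] ftype_fgact[OF bid])
 also have "\<dots> = (\<Sum>F\<in>{F\<in>NF UNIV. same_face UNIV (comb UNIV (code y) F) (code y)}.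
   a (ftyp UNIV (\<lambda>_. 1) F) * \<phi> (ftyp UNIV (\<lambda>_. 1) (comb UNIV F (code y))))"
 proof (rule sum.reindex_cong[where l = Face])
  show "inj_on Face {F\<in>NF UNIV. same_face UNIV (comb UNIV (code y) F) (code y)}"
   by (auto simp: inj_on_def Face_inject)
  show "{x. y + x = y} = Face ` {F\<in>NF UNIV. same_face UNIV (comb UNIV (code y) F) (code y)}"
  proof (rule subset_antisym; rule subsetI)
   fix x assume "x \<in> {x. y + x = y}"
   then show "x \<in> Face ` {F\<in>NF UNIV. same_face UNIV (comb UNIV (code y) F) (code y)}"
    by (intro image_eqI[of _ _ "code x"]) (simp_all add: plus_eq_iff code code_inverse)
  qed (auto simp: plus_eq_iff Face_inverse)
  fix x assume "x \<in> {F\<in>NF UNIV. same_face UNIV (comb UNIV (code y) F) (code y)}"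
  then have "code (Face x) = x" by (simp add: Face_inverse)
  then show "a (ftype (Face x)) * \<phi> (ftype (Face x + y))
    = a (ftyp UNIV (\<lambda>_. 1) x) * \<phi> (ftyp UNIV (\<lambda>_. 1) (comb UNIV x (code y)))"
   unfolding ftype_plus by (simp only: ftype_def)
 qed
 also have "\<dots> = act \<phi> a (ftype z)"
 proof -
  \<comment> \<open>Level l + 1 of y becomes coordinate l of the smaller arrangement; the zero level
    is dropped.\<close>
  define \<pi> where "\<pi> i = (if code y i = 0 then None else Some (nat (code y i) - 1))" for i
  have im: "nabs (code y) ` {i\<in>UNIV. code y i \<noteq> 0} = {1..length w}"
   unfolding len by (rule NF_image[OF finite code])
  have \<pi>: "\<pi> i = Some l \<longleftrightarrow> code y i = int (Suc l)" for i l
   using cy[of i] by (auto simp: \<pi>_def)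
  interpret regroup UNIV "{..<length w}" \<pi>
  proof
   show "finite (UNIV :: 'n set)" by simp
  next
   fix j i assume "\<pi> j = Some i"
   then have c: "code y j = int (Suc i)" by (simp only: \<pi>)
   then have "nat \<bar>code y j\<bar> \<in> {1..length w}" unfolding im[symmetric] by (intro imageI) simp
   moreover have "nat \<bar>code y j\<bar> = Suc i" unfolding c by simp
   ultimately show "j \<in> UNIV \<and> i \<in> {..<length w}" by simp
  next
   fix i assume "i \<in> {..<length w}"
   then have "Suc i \<in> nabs (code y) ` {i\<in>UNIV. code y i \<noteq> 0}" unfolding im by simp
   then obtain j where "Suc i = nat \<bar>code y j\<bar>" by blast
   then have "code y j = int (Suc i)" using cy[of j] by simp
   then show "\<exists>j. \<pi> j = Some i" unfolding \<pi>[symmetric] ..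
  qed
  have pull: "pull \<pi> idc = code y"
  proof
   fix i
   show "pull \<pi> idc i = code y i"
    using cy[of i] by (auto simp: pull_def \<pi>_def idc_def)
  qed
  have "w ! i = (\<Sum>j\<in>{j\<in>UNIV. \<pi> j = Some i}. 1)" if i: "i \<in> {..<length w}" for i
  proof -
   have "rk UNIV (code y) j = Suc i \<longleftrightarrow> \<pi> j = Some i" for j
    using NF_abs[OF finite code, of j y] cy[of j] by (auto simp: \<pi>)
   then show ?thesis
    using i unfolding w_def ty[symmetric] by (simp add: ftype_def nth_ftyp)
  qed
  from sum_below[OF chamber_idc _ this, of "code y" a \<phi>]
  show ?thesis unfolding act_def w_def[symmetric] by (simp add: pull same_face_refl)
 qed
 finally show ?thesis .
qed

lemma act_add: "act (\<lambda>u. \<phi> u + \<psi> u) a w = act \<phi> a w + act \<psi> a w"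
 by (simp add: act_def actI_def distrib_left sum.distrib)

lemma act_scale: "act (\<lambda>u. c * \<phi> u) a w = c * act \<phi> a w"
 by (simp add: act_def actI_def sum_distrib_left mult.left_commute)

lemma act_sum: "act (\<lambda>u. \<Sum>t\<in>T. \<phi> t u) a w = (\<Sum>t\<in>T. act (\<phi> t) a w)"
 by (induction T rule: infinite_finite_induct) (simp_all add: act_add act_const)

lemma act_add_right: "act \<phi> (\<lambda>u. a u + b u) w = act \<phi> a w + act \<phi> b w"
 by (simp add: act_def actI_def distrib_right sum.distrib)

lemma act_diff_right: "act \<phi> (\<lambda>u. a u - b u) w = act \<phi> a w - act \<phi> b w"
 by (simp add: act_def actI_def left_diff_distrib sum_subtractf)

lemma act_scale_right: "act \<phi> (\<lambda>u. c * a u) w = c * act \<phi> a w"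
 by (simp add: act_def actI_def sum_distrib_left mult.assoc)

lemma mset_ftyp_generic:
 assumes "finite I" "generic I z"
 shows "mset (ftyp I wt z) = image_mset wt (mset_set I)"
proof -
 obtain ps where ps: "ordering I z ps" using ordering_exists[OF assms] .
 then have "mset ps = mset_set I" using ordering_distinct[OF ps] by (simp add: ordering_def mset_set_set[symmetric])
 then show ?thesis by (simp add: ftyp_ordering(1)[OF ps])
qed

text \<open>A face times a chamber is a chamber, so only words with the content of w are
  evaluated.\<close>

lemma act_cong:
 assumes "\<And>u. mset u = mset w \<Longrightarrow> \<phi> u = \<psi> u"
 shows "act \<phi> a w = act \<psi> a w"
 unfolding act_def actI_def
proof (rule sum.cong[OF refl])
 fix f
 have "mset (ftyp {..<length w} ((!) w) (comb {..<length w} f idc)) = mset w"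
  by (subst mset_ftyp_generic) (simp_all add: generic_comb chamber_idc image_mset_upt)
 then show "a (ftyp {..<length w} ((!) w) f) * \<phi> (ftyp {..<length w} ((!) w) (comb {..<length w} f idc))
   = a (ftyp {..<length w} ((!) w) f) * \<psi> (ftyp {..<length w} ((!) w) (comb {..<length w} f idc))"
  using assms by simp
qed

lemma finite_mset_eq: "finite {u. mset u = M}"
proof -
 have "{u. mset u = M} \<subseteq> {u. set u \<subseteq> set_mset M \<and> length u \<le> size M}" by auto
 then show ?thesis by (rule finite_subset) (rule finite_lists_length_le, simp)
qed

lemma sum_type_full:
 assumes "mset u = mset w"
 shows "(\<Sum>f\<in>{f\<in>NF {..<length w}. ftyp {..<length w} ((!) w) f = u}. 1 :: 'k::field)
  = 2 ^ length w * of_nat (arrcount w)"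
proof -
 have "length u = card {..<length w}" using mset_eq_length[OF assms] by simp
 from sum_full[OF finite_lessThan this, where g = "\<lambda>_. 1" and h = "\<lambda>_. 1 :: 'k" and wt = "(!) w"]
 have "(\<Sum>f\<in>{f\<in>NF {..<length w}. ftyp {..<length w} ((!) w) f = u}. 1 :: 'k)
   = 2 ^ length w * of_nat (card (arrangements {..<length w} ((!) w) u))" by simp
 moreover have "card (arrangements {..<length w} ((!) w) u) = arrcount w"
  using card_arrangements[of "{..<length w}" "(!) w" u] arrcount_perm[OF assms]
  by (simp add: image_mset_upt assms)
 ultimately show ?thesis by (simp only:)
qed

text \<open>If \<open>a\<close> has no support on words shorter than \<open>w\<close>, only faces with all levels distinct
 contribute, and these absorb every chamber.\<close>

lemma act_full:
 fixes a :: "nat list \<Rightarrow> 'k::field"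
 assumes "\<And>u. length u < length w \<Longrightarrow> a u = 0"
 shows "act \<phi> a w = 2 ^ length w * of_nat (arrcount w) * (\<Sum>u\<in>{u. mset u = mset w}. a u * \<phi> u)"
proof -
 let ?I = "{..<length w}" and ?t = "ftyp {..<length w} ((!) w)"
 let ?S = "{f\<in>NF ?I. lev ?I f = card ?I}"
 have gen: "generic ?I f" if "f \<in> ?S" for f using that full_level_generic[of ?I f] by simp
 have "act \<phi> a w = (\<Sum>f\<in>?S. a (?t f) * \<phi> (?t (comb ?I f idc)))"
  unfolding act_def actI_def
 proof (rule sum.mono_neutral_right)
  show "\<forall>f\<in>NF ?I - ?S. a (?t f) * \<phi> (?t (comb ?I f idc)) = 0"
  proof
   fix f assume "f \<in> NF ?I - ?S"
   then have "lev ?I f \<noteq> card ?I" by blast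
   then have "lev ?I f < length w" using lev_le_card[of ?I f] by simp
   then show "a (?t f) * \<phi> (?t (comb ?I f idc)) = 0" using assms[of "?t f"] by simp
  qed
 qed (auto simp: finite_NF)
 also have "\<dots> = (\<Sum>f\<in>?S. a (?t f) * \<phi> (?t f))"
  by (rule sum.cong[OF refl]) (use ftyp_comb_full[OF _ gen chamber_idc] in simp)
 also have "\<dots> = (\<Sum>u\<in>{u. mset u = mset w}. \<Sum>f\<in>{f\<in>?S. ?t f = u}. a (?t f) * \<phi> (?t f))"
 proof (rule sum.group[symmetric])
  show "finite ?S" by (simp add: finite_NF)
  show "?t ` ?S \<subseteq> {u. mset u = mset w}"
  proof
   fix u assume "u \<in> ?t ` ?S"
   then obtain f where f: "f \<in> ?S" "u = ?t f" by blast
   show "u \<in> {u. mset u = mset w}"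
    using mset_ftyp_generic[OF finite_lessThan gen[OF f(1)], of "(!) w"] f(2) by (simp only: image_mset_upt mem_Collect_eq)
  qed
 qed (rule finite_mset_eq)
 also have "\<dots> = (\<Sum>u\<in>{u. mset u = mset w}. 2 ^ length w * of_nat (arrcount w) * (a u * \<phi> u))"
 proof (rule sum.cong[OF refl])
  fix u assume "u \<in> {u. mset u = mset w}"
  then have u: "mset u = mset w" by simp
  have eq: "{f\<in>?S. ?t f = u} = {f\<in>NF ?I. ?t f = u}"
  proof (rule Collect_cong)
   fix f
   show "f \<in> ?S \<and> ?t f = u \<longleftrightarrow> f \<in> NF ?I \<and> ?t f = u"
    using mset_eq_length[OF u] length_ftyp[of ?I "(!) w" f] by auto
  qed
  have "(\<Sum>f\<in>{f\<in>?S. ?t f = u}. a (?t f) * \<phi> (?t f)) = (\<Sum>f\<in>{f\<in>?S. ?t f = u}. 1) * (a u * \<phi> u)"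
   unfolding sum_distrib_right by (rule sum.cong[OF refl]) simp
  then show "(\<Sum>f\<in>{f\<in>?S. ?t f = u}. a (?t f) * \<phi> (?t f)) = 2 ^ length w * of_nat (arrcount w) * (a u * \<phi> u)"
   unfolding eq by (simp only: sum_type_full[OF u])
 qed
 finally show ?thesis by (simp only: sum_distrib_left)
qed

lemma act_ind:
 assumes "mset u = mset w"
 shows "act \<phi> (ind u) w = 2 ^ length w * of_nat (arrcount w) * \<phi> u"
proof -
 have "ind u v * \<phi> v = (if v = u then \<phi> u else 0)" for v by (simp add: ind_def)
 then have "(\<Sum>v\<in>{v. mset v = mset w}. ind u v * \<phi> v) = \<phi> u"
  using assms by (simp add: sum.delta[OF finite_mset_eq])
 moreover have "ind u v = 0" if "length v < length w" for v
  using that mset_eq_length[OF assms] by (auto simp: ind_def)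
 ultimately show ?thesis by (subst act_full) simp_all
qed

lemma chi_ind_perm:
 assumes "mset \<alpha> = mset \<alpha>'"
 shows "chi \<nu> (ind \<alpha> :: nat list \<Rightarrow> 'k::field) = chi \<nu> (ind \<alpha>')"
proof -
 have len: "length (sorted_list_of_multiset \<nu>) = size \<nu>" by (simp flip: size_mset)
 have "chi \<nu> (ind \<beta> :: nat list \<Rightarrow> 'k) = of_nat (card {f\<in>NF {..<size \<nu>}.
   ftyp {..<size \<nu>} ((!) (sorted_list_of_multiset \<nu>)) f = \<beta>})" for \<beta>
  unfolding chi_def act_def len by (simp add: actI_ind)
 then show ?thesis using card_type_perm[OF _ assms, of "{..<size \<nu>}"] by simp
qed

text \<open>A face has at most as many levels as there are coordinates, and if it has that many, its
  type rearranges the weights. The character table is therefore triangular when partitions are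
  ordered by their number of parts.\<close>

lemma chi_ind_triangular:
 assumes "size \<nu> < length u \<or> size \<nu> = length u \<and> mset u \<noteq> \<nu>"
 shows "chi \<nu> (ind u :: nat list \<Rightarrow> 'k::field) = 0"
proof -
 let ?w = "sorted_list_of_multiset \<nu>"
 let ?I = "{..<length ?w}"
 have lw: "length ?w = size \<nu>" by (simp flip: size_mset)
 have "ftyp ?I ((!) ?w) f \<noteq> u" if f: "f \<in> NF ?I" for f
 proof
  assume u: "ftyp ?I ((!) ?w) f = u"
  then have len: "length u = lev ?I f" by auto
  then have *: "lev ?I f = card ?I" "mset u \<noteq> \<nu>" using assms lev_le_card[of ?I f] lw by auto
  have "mset u = mset ?w"
   using mset_ftyp_generic[OF _ full_level_generic[OF _ f *(1)], of "(!) ?w"] u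
   by (simp only: image_mset_upt finite_lessThan)
  then show False using *(2) by simp
 qed
 then have none: "{f\<in>NF ?I. ftyp ?I ((!) ?w) f = u} = {}" by blast
 show ?thesis unfolding chi_def act_def actI_ind[OF finite_lessThan] none by simp
qed

section \<open>The face algebra as a convolution ring\<close>

type_synonym ('n, 'k) falg = "'n face \<Rightarrow>\<^sub>0 'k"

abbreviation "lookup \<equiv> poly_mapping.lookup"

definition of_fun :: "('a::finite \<Rightarrow> 'k::zero) \<Rightarrow> 'a \<Rightarrow>\<^sub>0 'k" where
 "of_fun f = Abs_poly_mapping f"

lemma lookup_of_fun [simp]: "lookup (of_fun f) = (f :: 'a::finite \<Rightarrow> 'k::zero)"
 unfolding of_fun_def by (rule Abs_poly_mapping_inverse) simp

definition pair :: "('a::finite \<Rightarrow>\<^sub>0 'k::field) \<Rightarrow> ('a \<Rightarrow> 'k) \<Rightarrow> 'k" where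
 "pair a f = (\<Sum>x\<in>UNIV. lookup a x * f x)"

lemma Sum_any_finite: "Sum_any f = sum f (UNIV :: 'a::finite set)"
 by (rule Sum_any.expand_superset) simp_all

lemma lookup_times:
 fixes a b :: "'a::{finite, monoid_add} \<Rightarrow>\<^sub>0 'k::field"
 shows "lookup (a * b) z = pair a (\<lambda>x. pair b (\<lambda>y. if x + y = z then 1 else 0))"
 unfolding lookup_mult Sum_any_finite pair_def
 by (intro sum.cong refl arg_cong2[where f = "(*)"]) (simp add: when_def eq_commute)

lemma pair_swap: "pair a (\<lambda>x. pair b (f x)) = pair b (\<lambda>y. pair a (\<lambda>x. f x y))"
 unfolding pair_def sum_distrib_left by (subst sum.swap) (simp only: mult.left_commute)

lemma pair_delta: "pair a (\<lambda>x. if x = z then c x else 0) = lookup a z * c z"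
 unfolding pair_def by (simp add: if_distrib[of "(*) _"] cong: if_cong)

lemma pair_times:
 fixes a b :: "'a::{finite, monoid_add} \<Rightarrow>\<^sub>0 'k::field"
 shows "pair (a * b) f = pair a (\<lambda>x. pair b (\<lambda>y. f (x + y)))"
proof -
 have "pair (a * b) f = (\<Sum>z\<in>UNIV. \<Sum>x\<in>UNIV. \<Sum>y\<in>UNIV.
   lookup a x * (lookup b y * ((if x + y = z then 1 else 0) * f z)))"
  unfolding pair_def[of "a * b"] lookup_times pair_def sum_distrib_left sum_distrib_right by (simp only: mult.assoc)
 also have "\<dots> = (\<Sum>x\<in>UNIV. \<Sum>y\<in>UNIV. \<Sum>z\<in>UNIV.
   lookup a x * (lookup b y * ((if x + y = z then 1 else 0) * f z)))"
  by (subst sum.swap, rule sum.cong[OF refl], rule sum.swap)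
 also have "\<dots> = pair a (\<lambda>x. pair b (\<lambda>y. f (x + y)))"
  unfolding pair_def sum_distrib_left[symmetric]
  by (simp add: if_distrib[of "\<lambda>t. t * _"] cong: if_cong)
 finally show ?thesis .
qed

definition sc :: "'k::field \<Rightarrow> ('a::finite \<Rightarrow>\<^sub>0 'k) \<Rightarrow> 'a \<Rightarrow>\<^sub>0 'k" where
 "sc c a = of_fun (\<lambda>x. c * lookup a x)"

lemma lookup_sc [simp]: "lookup (sc c a) x = c * lookup a x"
 by (simp add: sc_def)

lemma pair_sc: "pair (sc c a) f = c * pair a f"
 by (simp add: pair_def sum_distrib_left mult.assoc)

lemma pair_scale: "pair a (\<lambda>x. c * f x) = c * pair a f"
 by (simp add: pair_def sum_distrib_left mult.left_commute)

lemma sc_times_left: "sc c a * b = sc c (a * (b :: 'a::{finite, monoid_add} \<Rightarrow>\<^sub>0 'k::field))"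
 by (rule poly_mapping_eqI) (simp add: lookup_times pair_sc)

lemma sc_times_right: "a * sc c b = sc c (a * (b :: 'a::{finite, monoid_add} \<Rightarrow>\<^sub>0 'k::field))"
 by (rule poly_mapping_eqI) (simp add: lookup_times pair_sc pair_scale)

lemma vector_space_sc: "vector_space (sc :: 'k::field \<Rightarrow> ('a::finite \<Rightarrow>\<^sub>0 'k) \<Rightarrow> _)"
 by unfold_locales (auto intro!: poly_mapping_eqI simp: lookup_add distrib_left distrib_right mult.assoc)

interpretation sc: vector_space "sc :: 'k::field \<Rightarrow> ('a::finite \<Rightarrow>\<^sub>0 'k) \<Rightarrow> _"
 by (rule vector_space_sc)

text \<open>The sum runs over the faces x in the linear span of z, for which x + z spans the same
  flat as z; on invariants this becomes \<open>act\<close> on types.\<close>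

definition actF :: "('n::finite face \<Rightarrow> 'k::field) \<Rightarrow> ('n, 'k) falg \<Rightarrow> 'n face \<Rightarrow> 'k" where
 "actF \<phi> a z = pair a (\<lambda>x. if z + x = z then \<phi> (x + z) else 0)"

text \<open>Both sides sum \<phi> (x + y + z); \<open>face_below_iff\<close> splits the condition on
  x + y so that the inner sum is the action at y + z.\<close>

lemma actF_times:
 "actF \<phi> (a * b) z = actF (actF \<phi> a) b (z :: 'n::finite face)"
proof -
 have "(if z + (x + y) = z then \<phi> (x + y + z) else 0) =
   (if z + y = z then if y + z + x = y + z then \<phi> (x + (y + z)) else 0 else 0)" for x y
  by (simp add: face_below_iff add.assoc)
 then have "actF \<phi> (a * b) z = pair a (\<lambda>x. pair b (\<lambda>y.
   if z + y = z then if y + z + x = y + z then \<phi> (x + (y + z)) else 0 else 0))"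
  unfolding actF_def pair_times by presburger
 also have "\<dots> = pair b (\<lambda>y. pair a (\<lambda>x.
   if z + y = z then if y + z + x = y + z then \<phi> (x + (y + z)) else 0 else 0))"
  by (rule pair_swap)
 also have "\<dots> = pair b (\<lambda>y. if z + y = z then pair a (\<lambda>x.
   if y + z + x = y + z then \<phi> (x + (y + z)) else 0) else 0)"
  by (intro arg_cong[of _ _ "pair b"] ext) (simp add: pair_def)
 finally show ?thesis unfolding actF_def .
qed


text \<open>Invariance is expressed by types, which classify the orbits; the connection with the
  reflection group is made in \<open>invariant_iff\<close>.\<close>

definition Inv :: "('n::finite, 'k::field) falg set" where
 "Inv = {a. \<forall>x y. ftype x = ftype y \<longrightarrow> lookup a x = lookup a y}"

lemma InvD: "a \<in> Inv \<Longrightarrow> ftype x = ftype y \<Longrightarrow> lookup a x = lookup a y"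
 unfolding Inv_def by blast

lemma pair_fgact:
 assumes "a \<in> Inv" "bij \<sigma>"
 shows "pair a (\<lambda>x. f (fgact \<sigma> V x)) = pair a f"
proof -
 have "(\<Sum>x\<in>UNIV. lookup a (fgact \<sigma> V x) * f (fgact \<sigma> V x)) = pair a f"
  unfolding pair_def by (rule sum.reindex_bij_betw[OF bij_fgact[OF assms(2)]])
 moreover have "lookup a (fgact \<sigma> V x) = lookup a x" for x
  by (rule InvD[OF assms(1) ftype_fgact[OF assms(2)]])
 ultimately show ?thesis by (simp add: pair_def)
qed

lemma Inv_I:
 assumes "\<And>\<sigma> V x. bij \<sigma> \<Longrightarrow> lookup a (fgact \<sigma> V x) = lookup a x"
 shows "a \<in> Inv"
 unfolding Inv_def
proof (intro CollectI allI impI)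
 fix x y :: "'a face" assume "ftype x = ftype y"
 from ftype_eq_imp_fgact[OF this] obtain \<sigma> V where "bij \<sigma>" "x = fgact \<sigma> V y" .
 then show "lookup a x = lookup a y" using assms by simp
qed

lemma Inv_times: "a * b \<in> Inv" if "a \<in> Inv" "b \<in> Inv"
proof (rule Inv_I)
 fix \<sigma> :: "'a \<Rightarrow> 'a" and V z assume \<sigma>: "bij \<sigma>"
 let ?g = "fgact \<sigma> V"
 have "lookup (a * b) (?g z) = pair a (\<lambda>x. pair b (\<lambda>y. if ?g x + y = ?g z then 1 else 0))"
  unfolding lookup_times by (rule pair_fgact[OF that(1) \<sigma>, symmetric])
 also have "\<dots> = pair a (\<lambda>x. pair b (\<lambda>y. if ?g x + ?g y = ?g z then 1 else 0))"
 proof (rule arg_cong[of _ _ "pair a"], rule ext)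
  fix x
  show "pair b (\<lambda>y. if ?g x + y = ?g z then 1 else 0) = pair b (\<lambda>y. if ?g x + ?g y = ?g z then 1 else 0)"
   by (rule pair_fgact[OF that(2) \<sigma>, symmetric])
 qed
 also have "\<dots> = lookup (a * b) z"
  unfolding lookup_times fgact_plus[OF \<sigma>, symmetric] inj_eq[OF bij_is_inj[OF bij_fgact[OF \<sigma>]]] ..
 finally show "lookup (a * b) (?g z) = lookup (a * b) z" .
qed

lemma Inv_add: "a + b \<in> Inv" if "a \<in> Inv" "b \<in> Inv"
 unfolding Inv_def
proof (intro CollectI allI impI)
 fix x y :: "'a face" assume h: "ftype x = ftype y"
 show "lookup (a + b) x = lookup (a + b) y"
  unfolding lookup_add InvD[OF that(1) h] InvD[OF that(2) h] ..
qed

lemma Inv_sc: "sc c a \<in> Inv" if "a \<in> Inv"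
 unfolding Inv_def
proof (intro CollectI allI impI)
 fix x y :: "'a face" assume h: "ftype x = ftype y"
 show "lookup (sc c a) x = lookup (sc c a) y" unfolding lookup_sc InvD[OF that h] ..
qed

lemma Inv_0: "0 \<in> Inv"
 unfolding Inv_def by simp

lemma Inv_diff: "a - b \<in> Inv" if "a \<in> Inv" "b \<in> Inv"
 unfolding Inv_def
proof (intro CollectI allI impI)
 fix x y :: "'a face" assume h: "ftype x = ftype y"
 show "lookup (a - b) x = lookup (a - b) y"
  unfolding lookup_minus InvD[OF that(1) h] InvD[OF that(2) h] ..
qed

lemma Inv_1: "1 \<in> Inv"
 unfolding Inv_def
proof (intro CollectI allI impI)
 fix x y :: "'a face" assume h: "ftype x = ftype y"
 show "lookup 1 x = lookup 1 y"
  unfolding lookup_one ftype_Nil[symmetric] h ..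
qed

text \<open>The value 0 outside \<open>words\<close> makes the coefficient function of an invariant
  unique and \<open>tc\<close> linear.\<close>

definition tc :: "('n::finite, 'k::field) falg \<Rightarrow> nat list \<Rightarrow> 'k" where
 "tc a w = (if w \<in> words CARD('n) then lookup a (SOME x. ftype x = w) else 0)"

lemma tc_ftype: "a \<in> Inv \<Longrightarrow> tc a (ftype x) = lookup a (x :: 'n::finite face)"
 unfolding tc_def using ftype_words[of x] InvD[of a, OF _ someI[of "\<lambda>y. ftype y = ftype x" x]] by simp

lemma tc_outside: "w \<notin> words CARD('n) \<Longrightarrow> tc (a :: ('n::finite, 'k::field) falg) w = 0"
 by (simp add: tc_def)

lemma tc_add: "tc (a + b) = (\<lambda>w. tc a w + tc b w)"
 by (simp add: tc_def fun_eq_iff lookup_add)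

lemma tc_diff: "tc (a - b) = (\<lambda>w. tc a w - tc b w)"
 by (simp add: tc_def fun_eq_iff lookup_minus)

lemma tc_sc: "tc (sc c a) = (\<lambda>w. c * tc a w)"
 by (simp add: tc_def fun_eq_iff)

lemma tc_0: "tc 0 = (\<lambda>w. 0)"
 by (simp add: tc_def fun_eq_iff)

definition of_type :: "(nat list \<Rightarrow> 'k) \<Rightarrow> ('n::finite, 'k::field) falg" where
 "of_type f = of_fun (\<lambda>x. f (ftype x))"

lemma of_type_Inv: "of_type f \<in> Inv"
 by (simp add: Inv_def of_type_def)

lemma tc_of_type:
 assumes "\<And>w. w \<notin> words CARD('n) \<Longrightarrow> f w = 0"
 shows "tc (of_type f :: ('n::finite, 'k::field) falg) = f"
proof
 fix w
 show "tc (of_type f :: ('n, 'k) falg) w = f w"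
 proof (cases "w \<in> words CARD('n)")
  case True
  then obtain x :: "'n face" where "w = ftype x" by (metis ftype_surj)
  then show ?thesis using tc_ftype[OF of_type_Inv, of f x] by (simp add: of_type_def)
 qed (simp add: assms tc_def)
qed

lemma of_type_tc: "a \<in> Inv \<Longrightarrow> of_type (tc a) = a"
 by (rule poly_mapping_eqI) (simp add: of_type_def tc_ftype)

lemma actF_act:
 assumes "a \<in> Inv"
 shows "actF (\<lambda>x. \<phi> (ftype x)) a z = act \<phi> (tc a) (ftype (z :: 'n::finite face))"
proof -
 have "actF (\<lambda>x. \<phi> (ftype x)) a z = (\<Sum>x\<in>UNIV. if z + x = z then tc a (ftype x) * \<phi> (ftype (x + z)) else 0)"
  unfolding actF_def pair_def by (rule sum.cong) (simp_all add: tc_ftype assms)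
 also have "\<dots> = (\<Sum>x\<in>{x. z + x = z}. tc a (ftype x) * \<phi> (ftype (x + z)))"
  by (simp add: sum.If_cases)
 finally show ?thesis by (simp only: sum_below_face)
qed

lemma act_tc_times:
 fixes a b :: "('n::finite, 'k::field) falg"
 assumes "a \<in> Inv" "b \<in> Inv" "w \<in> words CARD('n)"
 shows "act \<phi> (tc (a * b)) w = act (act \<phi> (tc a)) (tc b) w"
proof -
 obtain z :: "'n face" where z: "ftype z = w" using ftype_surj[OF assms(3)] .
 have "act \<phi> (tc (a * b)) w = actF (\<lambda>x. \<phi> (ftype x)) (a * b) z"
  by (simp add: actF_act Inv_times assms z)
 also have "\<dots> = actF (\<lambda>x. act \<phi> (tc a) (ftype x)) b z"
  unfolding actF_times actF_act[OF assms(1)] ..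
 finally show ?thesis by (simp add: actF_act assms z)
qed

lemma act_tc_1:
 assumes "w \<in> words CARD('n)"
 shows "act \<phi> (tc (1 :: ('n::finite, 'k::field) falg)) w = \<phi> w"
proof -
 obtain z :: "'n face" where z: "ftype z = w" using ftype_surj[OF assms] .
 have "act \<phi> (tc (1 :: ('n, 'k) falg)) w = pair (1 :: ('n, 'k) falg) (\<lambda>x. if z + x = z then \<phi> (ftype (x + z)) else 0)"
  using actF_act[OF Inv_1, of \<phi> z] by (simp add: z actF_def)
 also have "\<dots> = pair (1 :: ('n, 'k) falg) (\<lambda>x. if x = 0 then \<phi> w else 0)"
  unfolding pair_def by (rule sum.cong) (simp_all add: lookup_one when_def z)
 finally show ?thesis by (simp add: pair_delta)
qed

section \<open>Characters and the radical\<close>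

definition partitions_upto :: "nat \<Rightarrow> nat multiset set" where
 "partitions_upto n = (\<Union>m\<le>n. integer_partitions m)"

lemma partitions_upto_iff: "\<nu> \<in> partitions_upto n \<longleftrightarrow> 0 \<notin># \<nu> \<and> sum_mset \<nu> \<le> n"
 by (auto simp: partitions_upto_def integer_partitions_def)

lemma words_iff: "w \<in> words n \<longleftrightarrow> mset w \<in> partitions_upto n"
 by (simp add: words_def partitions_upto_iff sum_mset_sum_list)

lemma finite_partitions_upto: "finite (partitions_upto n)"
proof -
 have "partitions_upto n \<subseteq> mset ` words n"
 proof
  fix \<nu> assume "\<nu> \<in> partitions_upto n"
  then show "\<nu> \<in> mset ` words n"
   by (intro image_eqI[of _ _ "sorted_list_of_multiset \<nu>"]) (simp_all add: words_iff)
 qed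
 then show ?thesis by (rule finite_surj[OF finite_words])
qed

lemma length_word: "w \<in> words n \<Longrightarrow> length w \<le> n"
proof -
 have "length w \<le> sum_list w" if "0 \<notin> set w" for w :: "nat list"
  using that by (induction w) (auto simp: Suc_le_eq add_less_le_mono)
 then show "w \<in> words n \<Longrightarrow> length w \<le> n" unfolding words_def by fastforce
qed

definition ch :: "nat multiset \<Rightarrow> ('n::finite, 'k::field) falg \<Rightarrow> 'k" where
 "ch \<nu> a = chi \<nu> (tc a)"

lemma act_one: "act (\<lambda>_. 1) (tc a) w = ch (mset w) a"
 by (simp add: ch_def act_const)

lemma act_const_tc: "act (\<lambda>_. c) (tc a) w = c * ch (mset w) a"
 by (simp add: ch_def act_const)

lemma ch_add: "ch \<nu> (a + b) = ch \<nu> a + ch \<nu> b"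
 by (simp add: ch_def chi_def tc_add act_add_right)

lemma ch_diff: "ch \<nu> (a - b) = ch \<nu> a - ch \<nu> b"
 by (simp add: ch_def chi_def tc_diff act_diff_right)

lemma ch_sc: "ch \<nu> (sc c a) = c * ch \<nu> a"
 by (simp add: ch_def chi_def tc_sc act_scale_right)

lemma ch_0: "ch \<nu> 0 = 0"
 using ch_diff[of \<nu> 0 0] by simp

text \<open>Acting with a on the constant 1 gives a function that is constant on words of equal
  content, so the second factor acts on a constant again.\<close>

lemma ch_times:
 fixes a b :: "('n::finite, 'k::field) falg"
 assumes "a \<in> Inv" "b \<in> Inv" "\<nu> \<in> partitions_upto CARD('n)"
 shows "ch \<nu> (a * b) = ch \<nu> a * ch \<nu> b"
proof -
 let ?w = "sorted_list_of_multiset \<nu>"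
 have w: "?w \<in> words CARD('n)" using assms(3) by (simp add: words_iff)
 have "ch \<nu> (a * b) = act (\<lambda>_. 1) (tc (a * b)) ?w" by (simp add: act_one)
 also have "\<dots> = act (act (\<lambda>_. 1) (tc a)) (tc b) ?w" by (rule act_tc_times[OF assms(1,2) w])
 also have "\<dots> = act (\<lambda>_. ch \<nu> a) (tc b) ?w" by (rule act_cong) (simp add: act_one)
 finally show ?thesis by (simp add: act_const_tc)
qed

lemma ch_1:
 assumes "\<nu> \<in> partitions_upto CARD('n)"
 shows "ch \<nu> (1 :: ('n::finite, 'k::field) falg) = 1"
proof -
 have "sorted_list_of_multiset \<nu> \<in> words CARD('n)" using assms by (simp add: words_iff)
 from act_tc_1[OF this, of "\<lambda>_. 1 :: 'k"] show ?thesis by (simp add: act_one)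
qed

definition radJ :: "('n::finite, 'k::field) falg set" where
 "radJ = {a \<in> Inv. \<forall>\<nu>\<in>partitions_upto CARD('n). ch \<nu> a = 0}"

lemma radJ_I: "a \<in> Inv \<Longrightarrow> (\<And>\<nu>. \<nu> \<in> partitions_upto CARD('n) \<Longrightarrow> ch \<nu> a = 0) \<Longrightarrow>
  (a :: ('n::finite, 'k::field) falg) \<in> radJ"
 by (simp add: radJ_def)

lemma radJ_D:
 assumes "(a :: ('n::finite, 'k::field) falg) \<in> radJ"
 shows "a \<in> Inv" "\<nu> \<in> partitions_upto CARD('n) \<Longrightarrow> ch \<nu> a = 0"
 using assms by (simp_all add: radJ_def)

lemma radJ_times_right: "a \<in> radJ \<Longrightarrow> b \<in> Inv \<Longrightarrow> a * b \<in> radJ"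
 by (intro radJ_I) (simp_all add: radJ_D Inv_times ch_times)

lemma radJ_times_left: "a \<in> Inv \<Longrightarrow> b \<in> radJ \<Longrightarrow> a * b \<in> radJ"
 by (intro radJ_I) (simp_all add: radJ_D Inv_times ch_times)

text \<open>A height on the face order: strictly increasing and bounded by the number of
  faces.\<close>

definition below_count :: "'n::finite face \<Rightarrow> nat" where
 "below_count x = card {g. g + x = x}"

lemma below_count_less:
 assumes "x + z = z" "x \<noteq> z"
 shows "below_count x < below_count (z :: 'n::finite face)"
 unfolding below_count_def
proof (rule psubset_card_mono)
 have "g + z = z" if "g + x = x" for g using that assms(1) by (metis add.assoc)
 moreover have "z + x \<noteq> x"
 proof
  assume "z + x = x"
  then have "x + z + x = x + x" by (simp add: add.assoc)
  then show False using face_regular[of x z] face_idem[of x] assms by simp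
 qed
 moreover have "z + z = z" by (rule face_idem)
 ultimately show "{g. g + x = x} \<subset> {g. g + z = z}" by blast
qed simp

text \<open>Multiplying by an element of \<open>radJ\<close> from the right pushes the support strictly up in the
 face order, because the coefficient on the diagonal is a character value.\<close>

lemma radJ_raises_support:
 fixes a b :: "('n::finite, 'k::field) falg"
 assumes a: "\<And>x. lookup a x \<noteq> 0 \<Longrightarrow> k \<le> below_count x" and b: "b \<in> radJ"
  and z: "lookup (a * b) z \<noteq> 0"
 shows "Suc k \<le> below_count z"
proof (rule ccontr)
 assume small: "\<not> Suc k \<le> below_count z"
 have "lookup a x * pair b (\<lambda>y. if x + y = z then 1 else 0) = 0" for x
 proof (cases "lookup a x = 0 \<or> x + z \<noteq> z")
  case True
  moreover have "pair b (\<lambda>y. if x + y = z then 1 else 0) = 0" if "x + z \<noteq> z"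
  proof -
   have "x + y \<noteq> z" for y using that by (metis face_idem add.assoc)
   then show ?thesis by (simp add: pair_def)
  qed
  ultimately show ?thesis by auto
 next
  case False
  then have "x = z" using below_count_less[of x z] a[of x] small by auto
  have "ch (mset (ftype z)) b = 0"
   by (rule radJ_D(2)[OF b]) (simp add: words_iff[symmetric] ftype_words)
  then have "actF (\<lambda>_. 1) b z = 0"
   using actF_act[OF radJ_D(1)[OF b], of "\<lambda>_. 1" z] by (simp add: act_one)
  then show ?thesis unfolding \<open>x = z\<close> actF_def by simp
 qed
 then have "lookup (a * b) z = 0" unfolding lookup_times pair_def[of a] by (rule sum.neutral[OF ballI])
 then show False using z by (rule notE[rotated])
qed

text \<open>The support of the k-th power has height at least k, and heights are bounded.\<close>

lemma radJ_nilpotent: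
 fixes a :: "('n::finite, 'k::field) falg"
 assumes "a \<in> radJ"
 shows "a ^ Suc CARD('n face) = 0"
proof (rule poly_mapping_eqI)
 fix x :: "'n face"
 have *: "k \<le> below_count x" if "lookup (a ^ k) x \<noteq> 0" for k x
  using that
 proof (induction k arbitrary: x)
  case (Suc k)
  show ?case by (rule radJ_raises_support[OF Suc.IH assms]) (use Suc.prems in \<open>simp_all add: power_Suc2 del: power_Suc\<close>)
 qed simp
 have "below_count x \<le> CARD('n face)" unfolding below_count_def by (rule card_mono) simp_all
 then have "\<not> Suc CARD('n face) \<le> below_count x" by simp
 then have "lookup (a ^ Suc CARD('n face)) x = 0" using *[of "Suc CARD('n face)" x] by argo
 then show "lookup (a ^ Suc CARD('n face)) x = lookup 0 x" by simp
qed

lemma tc_of_type_ind: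
 assumes "w \<in> words CARD('n)"
 shows "tc (of_type (ind w) :: ('n::finite, 'k::field) falg) = ind w"
 by (rule tc_of_type) (use assms in \<open>auto simp: ind_def\<close>)

text \<open>Normalised by the number of chambers of type w in the arrangement weighted by the
  letters of w, so that it acts on words of the same content as evaluation at w.\<close>

definition xi :: "nat list \<Rightarrow> ('n::finite, 'k::field) falg" where
 "xi w = sc (inverse (2 ^ length w * of_nat (arrcount w))) (of_type (ind w))"

lemma xi_Inv: "xi w \<in> Inv"
 by (simp add: xi_def Inv_sc of_type_Inv)

lemma ch_xi:
 assumes "w \<in> words CARD('n)"
 shows "ch \<nu> (xi w :: ('n::finite, 'k::field) falg) = inverse (2 ^ length w * of_nat (arrcount w)) * chi \<nu> (ind w)"
 by (simp add: xi_def ch_sc) (simp add: ch_def tc_of_type_ind[OF assms])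

text \<open>Rearranged types have equally many faces in every weighted arrangement, so no character
  tells them apart.\<close>

lemma of_type_ind_perm_radJ:
 assumes "mset w = mset w'" "w \<in> words CARD('n)"
 shows "of_type (ind w) - of_type (ind w') \<in> (radJ :: ('n::finite, 'k::field) falg set)"
proof (rule radJ_I)
 fix \<nu>
 have "w' \<in> words CARD('n)" using assms by (simp add: words_iff)
 then show "ch \<nu> (of_type (ind w) - of_type (ind w') :: ('n, 'k) falg) = 0"
  unfolding ch_diff unfolding ch_def tc_of_type_ind[OF assms(2)] using chi_ind_perm[OF assms(1), of \<nu>, where 'k='k]
  by (simp add: tc_of_type_ind)
qed (simp add: Inv_diff of_type_Inv)

lemma xi_perm_radJ:
 assumes "mset w = mset w'" "w \<in> words CARD('n)"
 shows "xi w - xi w' \<in> (radJ :: ('n::finite, 'k::field) falg set)"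
proof (rule radJ_I)
 fix \<nu>
 have w': "w' \<in> words CARD('n)" using assms by (simp add: words_iff)
 show "ch \<nu> (xi w - xi w' :: ('n, 'k) falg) = 0"
  unfolding ch_diff ch_xi[OF assms(2)] ch_xi[OF w'] chi_ind_perm[OF assms(1)]
   arrcount_perm[OF assms(1)] mset_eq_length[OF assms(1)] by simp
qed (simp add: Inv_diff xi_Inv)

locale good_characteristic =
 fixes tyn :: "'n::finite itself" and tyk :: "'k::field itself"
 assumes of_nat_nonzero: "\<And>i. 1 \<le> i \<Longrightarrow> i \<le> CARD('n) \<Longrightarrow> of_nat i \<noteq> (0 :: 'k)"
  and two_nonzero: "(2 :: 'k) \<noteq> 0"
begin

lemma count_nonzero:
 assumes "w \<in> words CARD('n)"
 shows "2 ^ length w * of_nat (arrcount w) \<noteq> (0 :: 'k)"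
 using arrcount_nonzero[of w, where 'k='k] of_nat_nonzero length_word[OF assms] two_nonzero by simp

lemma act_xi:
 assumes "w \<in> words CARD('n)" "mset w = mset v"
 shows "act \<phi> (tc (xi w :: ('n, 'k) falg)) v = \<phi> w"
proof -
 let ?N = "2 ^ length w * of_nat (arrcount w) :: 'k"
 have "act \<phi> (tc (xi w :: ('n, 'k) falg)) v = inverse ?N * (?N * \<phi> w)"
  unfolding xi_def tc_sc act_scale_right tc_of_type_ind[OF assms(1)] act_ind[OF assms(2)]
   arrcount_perm[OF assms(2)] mset_eq_length[OF assms(2)] ..
 also have "\<dots> = \<phi> w"
 proof -
  have "inverse N * (N * t) = t" if "N \<noteq> 0" for N t :: 'k using that by (simp add: field_simps)
  then show ?thesis using count_nonzero[OF assms(1)] .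
 qed
 finally show ?thesis .
qed

text \<open>By triangularity, the normalised orbit sum of the partition with at least as many parts
  has value 1 at its own character and 0 at the other one. If this is \<nu>, its complement to 1 is
  used.\<close>

lemma separate_characters:
 assumes "\<mu> \<in> partitions_upto CARD('n)" "\<nu> \<in> partitions_upto CARD('n)" "\<mu> \<noteq> \<nu>"
 obtains z :: "('n, 'k) falg" where "z \<in> Inv" "ch \<mu> z = 1" "ch \<nu> z = 0"
proof -
 have len: "length (sorted_list_of_multiset \<rho>) = size \<rho>" for \<rho> :: "nat multiset" by (simp flip: size_mset)
 have own: "ch \<rho> (xi (sorted_list_of_multiset \<rho>) :: ('n, 'k) falg) = 1" if "\<rho> \<in> partitions_upto CARD('n)" for \<rho>
  using act_xi[of "sorted_list_of_multiset \<rho>" "sorted_list_of_multiset \<rho>" "\<lambda>_. 1"] that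
  by (simp add: words_iff act_one)
 have other: "ch \<sigma> (xi (sorted_list_of_multiset \<rho>) :: ('n, 'k) falg) = 0"
  if "\<rho> \<in> partitions_upto CARD('n)" "size \<sigma> \<le> size \<rho>" "\<rho> \<noteq> \<sigma>" for \<rho> \<sigma>
 proof -
  have "chi \<sigma> (ind (sorted_list_of_multiset \<rho>) :: nat list \<Rightarrow> 'k) = 0"
   by (rule chi_ind_triangular) (use that in \<open>auto simp: len\<close>)
  then show ?thesis using that(1) by (simp add: ch_xi words_iff)
 qed
 show thesis
 proof (cases "size \<nu> \<le> size \<mu>")
  case True
  show thesis by (rule that[OF xi_Inv own[OF assms(1)] other[OF assms(1) True assms(3)]])
 next
  case False
  have "ch \<mu> (1 - xi (sorted_list_of_multiset \<nu>) :: ('n, 'k) falg) = 1"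
   using False assms by (simp add: ch_diff ch_1 other)
  moreover have "ch \<nu> (1 - xi (sorted_list_of_multiset \<nu>) :: ('n, 'k) falg) = 0"
   using assms by (simp add: ch_diff ch_1 own)
  ultimately show thesis by (intro that[of "1 - xi (sorted_list_of_multiset \<nu>)"]) (simp_all add: Inv_diff Inv_1 xi_Inv)
 qed
qed

text \<open>The action on the words of content \<open>\<mu>\<close> is faithful on \<open>A x\<close>: the types of minimal length
 in the support of \<open>a\<close> act by a functional that does not depend on the word.\<close>

lemma faithful:
 fixes a x :: "('n, 'k) falg"
 assumes a: "a \<in> Inv" and x: "x \<in> Inv" and ax: "a * x = a"
  and chx: "\<And>\<nu>. \<nu> \<in> partitions_upto CARD('n) \<Longrightarrow> ch \<nu> x = (if \<nu> = \<mu> then 1 else 0)"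
  and w0: "mset w0 = \<mu>" and zero: "\<And>u. mset u = \<mu> \<Longrightarrow> act (ind u) (tc a) w0 = 0"
 shows "a = 0"
proof (rule ccontr)
 assume "a \<noteq> 0"
 have "\<exists>\<alpha>. tc a \<alpha> \<noteq> 0"
 proof (rule ccontr)
  assume "\<nexists>\<alpha>. tc a \<alpha> \<noteq> 0"
  then have "tc a = tc 0" by (simp add: tc_0 fun_eq_iff)
  then have "a = 0" by (metis of_type_tc Inv_0 a)
  then show False using \<open>a \<noteq> 0\<close> by simp
 qed
 then obtain \<alpha> where \<alpha>: "tc a \<alpha> \<noteq> 0" "\<And>\<beta>. tc a \<beta> \<noteq> 0 \<Longrightarrow> length \<alpha> \<le> length \<beta>"
  using ex_has_least_nat[of "\<lambda>\<alpha>. tc a \<alpha> \<noteq> 0" _ length] by blast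
 have w: "\<alpha> \<in> words CARD('n)" using \<alpha>(1) tc_outside by blast
 define C :: 'k where "C = 2 ^ length \<alpha> * of_nat (arrcount \<alpha>) * tc a \<alpha>"
 have C: "C \<noteq> 0" using \<alpha>(1) count_nonzero[OF w] by (simp add: C_def)
 have act: "act (ind \<alpha>) (tc a) v = C" if v: "mset v = mset \<alpha>" for v
 proof -
  have "tc a u = 0" if "length u < length v" for u
   using \<alpha>(2)[of u] that mset_eq_length[OF v] by auto
  then have "act (ind \<alpha>) (tc a) v
    = 2 ^ length v * of_nat (arrcount v) * (\<Sum>u\<in>{u. mset u = mset v}. tc a u * ind \<alpha> u)"
   by (rule act_full)
  also have "(\<Sum>u\<in>{u. mset u = mset v}. tc a u * ind \<alpha> u)
    = (\<Sum>u\<in>{u. mset u = mset v}. if u = \<alpha> then tc a \<alpha> else 0)"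
   by (rule sum.cong[OF refl]) (simp add: ind_def)
  also have "\<dots> = tc a \<alpha>" using v by (simp add: sum.delta[OF finite_mset_eq])
  finally show ?thesis unfolding C_def arrcount_perm[OF v] mset_eq_length[OF v] .
 qed
 have "C = act (ind \<alpha>) (tc (a * x)) \<alpha>" unfolding ax by (rule act[symmetric]) simp
 also have "\<dots> = act (act (ind \<alpha>) (tc a)) (tc x) \<alpha>" by (rule act_tc_times[OF a x w])
 also have "\<dots> = act (\<lambda>_. C) (tc x) \<alpha>" by (rule act_cong) (rule act)
 also have "\<dots> = C * ch (mset \<alpha>) x" by (rule act_const_tc)
 finally have "ch (mset \<alpha>) x \<noteq> 0" using C by auto
 then have "mset \<alpha> = \<mu>" using chx[of "mset \<alpha>"] w by (auto simp: words_iff split: if_splits)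
 then show False using act[of w0] w0 zero[of \<alpha>] C by simp
qed

end

section \<open>Arrows\<close>

definition point :: "nat \<Rightarrow> nat \<Rightarrow> 'k::field" where
 "point s v = (if v = s then 1 else 0)"

lemma lastfun_add: "lastfun T (\<lambda>v. g v + h v) w = lastfun T g w + lastfun T h w"
proof -
 have "lastfun_rev T (\<lambda>v. g v + h v) w = lastfun_rev T g w + lastfun_rev T h w" for w
  by (induction w) (simp_all add: distrib_right add_ac)
 then show ?thesis by (simp add: lastfun_def)
qed

lemma lastfun_scale: "lastfun T (\<lambda>v. c * g v) w = c * lastfun T g w"
proof -
 have "lastfun_rev T (\<lambda>v. c * g v) w = c * lastfun_rev T g w" for w
  by (induction w) (simp_all add: distrib_left mult.assoc)
 then show ?thesis by (simp add: lastfun_def)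
qed

lemma lastfun_cong: "(\<And>v. v \<in># T \<Longrightarrow> g v = h v) \<Longrightarrow> lastfun T g w = lastfun T h w"
proof -
 assume eq: "\<And>v. v \<in># T \<Longrightarrow> g v = h v"
 have "lastfun_rev T g w = lastfun_rev T h w" for w
  by (induction w) (simp_all add: eq)
 then show ?thesis by (simp add: lastfun_def)
qed

lemma lastfun_sum: "lastfun T (\<lambda>v. \<Sum>s\<in>S. c s * g s v) w = (\<Sum>s\<in>S. c s * lastfun T (g s) w)"
proof (induction S rule: infinite_finite_induct)
 case empty
 show ?case using lastfun_scale[of T 0 "\<lambda>_. 0" w] by simp
next
 case (infinite A)
 then show ?case using lastfun_scale[of T 0 "\<lambda>_. 0" w] by simp
qed (simp add: lastfun_add lastfun_scale)

lemma lastfun_const_perm: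
 assumes "mset w = mset w'"
 shows "lastfun T (\<lambda>_. c) w = lastfun T (\<lambda>_. c) w'"
 by (rule constant_if_comm_diff_zero[of "mset w"]) (simp_all add: comm_diff_lastfun assms)

text \<open>Up to the constant g m, the weight is a combination of point weights at the elements of
  T other than m.\<close>

lemma lastfun_expand:
 fixes g :: "nat \<Rightarrow> 'k::field"
 shows "lastfun T g w = (\<Sum>s\<in>set_mset T - {m}. (g s - g m) * lastfun T (point s) w) + lastfun T (\<lambda>_. g m) w"
proof -
 have "lastfun T g w = lastfun T (\<lambda>v. (\<Sum>s\<in>set_mset T - {m}. (g s - g m) * point s v) + g m) w"
 proof (rule lastfun_cong)
  fix v assume v: "v \<in># T"
  have "(\<Sum>s\<in>set_mset T - {m}. (g s - g m) * point s v)
    = (\<Sum>s\<in>set_mset T - {m}. if s = v then g v - g m else 0)"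
   by (rule sum.cong[OF refl]) (simp add: point_def)
  also have "\<dots> = g v - g m" using v by (simp add: sum.delta)
  finally show "g v = (\<Sum>s\<in>set_mset T - {m}. (g s - g m) * point s v) + g m" by simp
 qed
 then show ?thesis by (simp only: lastfun_add lastfun_sum)
qed

lemma size_3_mset:
 assumes "size T = 3"
 obtains a b c where "T = {#a, b, c#}"
proof -
 obtain l where l: "mset l = T" by (metis ex_mset)
 then have "length l = 3" using assms by auto
 then obtain a b c where "l = [a, b, c]" by (auto simp: numeral_3_eq_3 length_Suc_conv)
 then show thesis using that[of a b c] l by simp
qed

lemma size_2_mset:
 assumes "size T = 2"
 obtains a b where "T = {#a, b#}"
proof -
 obtain l where l: "mset l = T" by (metis ex_mset)
 then have "length l = 2" using assms by auto
 then obtain a b where "l = [a, b]" by (auto simp: numeral_2_eq_2 length_Suc_conv)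
 then show thesis using that[of a b] l by simp
qed

text \<open>The sum of three positive parts differs from each of them, so the new part does not
  cancel against T when the two partitions are subtracted.\<close>

lemma reduce_determines:
 assumes "T \<subseteq># \<mu>" "size T = 2 \<or> size T = 3" "0 \<notin># \<mu>"
 shows "\<mu> - reduce \<mu> T = T"
proof (cases "size T = 3")
 case True
 obtain R where R: "\<mu> = T + R" using assms(1) by (metis mset_subset_eq_exists_conv)
 have "sum_mset T \<notin># T"
 proof -
  obtain a b c where abc: "T = {#a, b, c#}" using size_3_mset[OF True] .
  then show ?thesis using R assms(3) by auto
 qed
 then have "T - {#sum_mset T#} = T" by (rule diff_single_trivial)
 moreover have "\<mu> - reduce \<mu> T = T - {#sum_mset T#}" by (simp add: reduce_def R True)
 ultimately show ?thesis by simp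
next
 case False
 obtain R where R: "\<mu> = T + R" using assms(1) by (metis mset_subset_eq_exists_conv)
 show ?thesis by (simp add: reduce_def R False)
qed

lemma reduce_partitions_upto:
 assumes "T \<subseteq># \<mu>" "\<mu> \<in> partitions_upto n"
 shows "reduce \<mu> T \<in> partitions_upto n"
proof -
 obtain R where R: "\<mu> = T + R" using assms(1) by (metis mset_subset_eq_exists_conv)
 have "sum_mset T \<noteq> 0" if sz: "size T = 3"
 proof -
  obtain a b c where "T = {#a, b, c#}" using size_3_mset[OF sz] .
  then show ?thesis using assms(2) R by (auto simp: partitions_upto_iff)
 qed
 then show ?thesis using assms(2) by (auto simp: reduce_def R partitions_upto_iff)
qed

text \<open>A basis of the functions on the distinct elements of \<open>T\<close> modulo constants is indexed by all of
 these elements but one.\<close>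

definition arrow_values :: "nat multiset \<Rightarrow> nat multiset \<Rightarrow> nat set" where
 "arrow_values p q = (let T = p - q in
  if (size T = 2 \<or> size T = 3) \<and> reduce p T = q then set_mset T - {Max (set_mset T)} else {})"

lemma finite_arrow_values: "finite (arrow_values p q)"
 by (simp add: arrow_values_def Let_def)

lemma card_minus_Max: "finite A \<Longrightarrow> A \<noteq> {} \<Longrightarrow> card (A - {Max A}) = card (A :: nat set) - 1"
 by (simp add: card_Diff_singleton)

text \<open>As p - q recovers T, the count depends only on the number of distinct values in T, and
  the alternatives of \<open>partition_arrows\<close> exclude each other. A T with a single value
  yields no arrow.\<close>

lemma card_arrow_values:
 assumes "0 \<notin># p"
 shows "card (arrow_values p q) = partition_arrows p q"
proof -
 have val: "card (arrow_values p q) = card (set_mset T) - 1"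
  if "T \<subseteq># p" "size T = 2 \<or> size T = 3" "q = reduce p T" for T
 proof -
  have "p - q = T" unfolding that(3) by (rule reduce_determines[OF that(1,2) assms])
  moreover have "set_mset T \<noteq> {}" using that(2) by auto
  ultimately show ?thesis using that by (simp add: arrow_values_def card_minus_Max)
 qed
 have three: "adds_three_parts p q a b c \<longleftrightarrow> {#a, b, c#} \<subseteq># p \<and> q = reduce p {#a, b, c#}" for a b c
  by (simp add: adds_three_parts_def reduce_def add.assoc)
 have two: "deletes_two_parts p q a b \<longleftrightarrow> {#a, b#} \<subseteq># p \<and> q = reduce p {#a, b#}" for a b
  by (simp add: deletes_two_parts_def reduce_def)
 show ?thesis
 proof (cases "\<exists>a b c. a \<noteq> b \<and> a \<noteq> c \<and> b \<noteq> c \<and> adds_three_parts p q a b c")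
  case True
  then obtain a b c where abc: "a \<noteq> b" "a \<noteq> c" "b \<noteq> c" "adds_three_parts p q a b c" by blast
  have "card (arrow_values p q) = 2" using val[of "{#a, b, c#}"] abc by (simp add: three)
  then show ?thesis using True by (simp add: partition_arrows_def)
 next
  case no3: False
  show ?thesis
  proof (cases "\<exists>a b. a \<noteq> b \<and> adds_three_parts p q a b b")
   case True
   then obtain a b where ab: "a \<noteq> b" "adds_three_parts p q a b b" by blast
   have "card (arrow_values p q) = 1" using val[of "{#a, b, b#}"] ab by (simp add: three)
   moreover have "partition_arrows p q = 1" unfolding partition_arrows_def using no3 True by argo
   ultimately show ?thesis by simp
  next
   case no21: False
   show ?thesis
   proof (cases "\<exists>a b. a \<noteq> b \<and> deletes_two_parts p q a b")
    case True
    then obtain a b where ab: "a \<noteq> b" "deletes_two_parts p q a b" by blast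
    have "card (arrow_values p q) = 1" using val[of "{#a, b#}"] ab by (simp add: two)
    moreover have "partition_arrows p q = 1" unfolding partition_arrows_def using no3 no21 True by argo
    ultimately show ?thesis by simp
   next
    case no2: False
    have "arrow_values p q = {}"
    proof (rule ccontr)
     assume ne: "arrow_values p q \<noteq> {}"
     let ?T = "p - q"
     from ne have T: "size ?T = 2 \<or> size ?T = 3" "reduce p ?T = q" "set_mset ?T - {Max (set_mset ?T)} \<noteq> {}"
      by (auto simp: arrow_values_def Let_def split: if_splits)
     have sub: "?T \<subseteq># p" by simp
     show False
     proof (cases "size ?T = 2")
      case True
      then obtain a b where ab: "?T = {#a, b#}" using size_2_mset by blast
      then have "deletes_two_parts p q a b" using sub T(2) by (simp add: two)
      then have "a = b" using no2 by blast
      then show False using T(3) ab by simp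
     next
      case False
      then have "size ?T = 3" using T(1) by simp
      then obtain a b c where abc: "?T = {#a, b, c#}" using size_3_mset by blast
      have adds: "adds_three_parts p q a' b' c'" if "{#a', b', c'#} = {#a, b, c#}" for a' b' c'
       using sub T(2) unfolding three that abc by simp
      have "a = b \<or> a = c \<or> b = c" using no3 adds[of a b c] by blast
      moreover have "\<not> (a \<noteq> c \<and> b = c)" using no21 adds[of a b c] by blast
      moreover have "\<not> (b \<noteq> c \<and> a = c)" using no21 adds[of b a c] by (auto simp: add_mset_commute)
      moreover have "\<not> (c \<noteq> b \<and> a = b)" using no21 adds[of c a b] by (auto simp: add_mset_commute)
      ultimately have "a = b" "b = c" by auto
      then show False using T(3) abc by simp
     qed
    qed
    moreover have "partition_arrows p q = 0" unfolding partition_arrows_def using no3 no21 no2 by argo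
    ultimately show ?thesis by simp
   qed
  qed
 qed
qed

section \<open>Dual elements and the upper bound for arrows\<close>

definition radJ2 :: "('n::finite, 'k::field) falg set" where
 "radJ2 = sc.span {a * b | a b. a \<in> radJ \<and> b \<in> radJ}"

lemma radJ2_times_right:
 fixes x :: "('n::finite, 'k::field) falg"
 assumes "s \<in> radJ2" "x \<in> Inv"
 shows "s * x \<in> radJ2"
 using assms(1) unfolding radJ2_def
proof (induction rule: sc.span_induct_alt)
 case base
 show ?case by (simp add: sc.span_zero)
next
 case (step c p s)
 then obtain a b where p: "p = a * b" "a \<in> radJ" "b \<in> radJ" by blast
 have "p * x \<in> {a * b | a b. a \<in> radJ \<and> b \<in> radJ}"
  using p radJ_times_right[OF p(3) assms(2)] by (auto simp: mult.assoc)
 then have "sc c (p * x) + s * x \<in> sc.span {a * b | a b. a \<in> radJ \<and> b \<in> radJ}"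
  by (intro sc.span_add sc.span_scale sc.span_base step.IH)
 then show ?case by (simp add: distrib_right sc_times_left)
qed

text \<open>A basis of the span stays independent when s is added, so the values 1 at s and 0 on the
  basis extend to a linear form.\<close>

lemma linear_functional_separating:
 fixes s :: "'a::finite \<Rightarrow>\<^sub>0 'k::field"
 assumes "s \<notin> sc.span M"
 obtains f where "\<And>a b. f (a + b) = f a + f b" "\<And>c a. f (sc c a) = c * f a"
  "\<And>a. a \<in> sc.span M \<Longrightarrow> f a = 0" "f s = 1"
proof -
 interpret vector_space_pair "sc :: 'k \<Rightarrow> ('a \<Rightarrow>\<^sub>0 'k) \<Rightarrow> _" "(*) :: 'k \<Rightarrow> 'k \<Rightarrow> 'k"
  by unfold_locales (simp_all add: algebra_simps)
 obtain B where B: "B \<subseteq> sc.span M" "sc.independent B" "sc.span M \<subseteq> sc.span B"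
  using sc.maximal_independent_subset by blast
 have "sc.span B \<subseteq> sc.span M" using B(1) by (metis sc.span_mono sc.span_span)
 then have "s \<notin> sc.span B" using assms by blast
 then have ind: "sc.independent (insert s B)" using B(2) by (simp add: sc.independent_insert)
 from linear_independent_extend[OF ind, of "\<lambda>b. if b = s then 1 else 0"]
 obtain f where f: "Vector_Spaces.linear sc (*) f" "\<forall>b\<in>insert s B. f b = (if b = s then 1 else 0)" by blast
 have "s \<notin> B" using \<open>s \<notin> sc.span B\<close> sc.span_base by blast
 then have zB: "f b = 0" if "b \<in> B" for b using f(2) that by auto
 show thesis
 proof (rule that)
  show "f (a + b) = f a + f b" for a b by (rule linear_add[OF f(1)])
  show "f (sc c a) = c * f a" for c a by (rule linear_scale[OF f(1)])
  show "f a = 0" if "a \<in> sc.span M" for a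
   by (rule linear_eq_0_on_span[where b = B, OF f(1) zB subsetD[OF B(3) that]])
  show "f s = 1" using f(2) by simp
 qed
qed

lemma act_zero_right: "act \<phi> (\<lambda>_. 0) w = 0"
 by (simp add: act_def actI_def)

locale arrow = good_characteristic tyn tyk
 for tyn :: "'n::finite itself" and tyk :: "'k::field itself" +
 fixes x y :: "('n, 'k) falg" and \<mu> \<nu> :: "nat multiset"
 assumes x: "x \<in> Inv" "x * x = x" and y: "y \<in> Inv"
  and mu: "\<mu> \<in> partitions_upto CARD('n)" and nu: "\<nu> \<in> partitions_upto CARD('n)"
  and chx: "\<And>\<rho>. \<rho> \<in> partitions_upto CARD('n) \<Longrightarrow> ch \<rho> x = (if \<rho> = \<mu> then 1 else 0)"
  and chy: "\<And>\<rho>. \<rho> \<in> partitions_upto CARD('n) \<Longrightarrow> ch \<rho> y = (if \<rho> = \<nu> then 1 else 0)"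
begin

definition w0 :: "nat list" where "w0 = sorted_list_of_multiset \<mu>"

lemma mset_w0: "mset w0 = \<mu>" by (simp add: w0_def)

lemma content_words: "mset w = \<mu> \<Longrightarrow> w \<in> words CARD('n)" using mu by (simp add: words_iff)

lemma w0_word: "w0 \<in> words CARD('n)" by (rule content_words[OF mset_w0])

text \<open>Multiplication by x brings r into A x, where the action on the words of content \<mu> is
  faithful; \<mu> - \<nu> is the multiset T of the arrow.\<close>

definition arrow_functional :: "nat \<Rightarrow> ('n, 'k) falg \<Rightarrow> 'k" where
 "arrow_functional v r = act (lastfun (\<mu> - \<nu>) (point v)) (tc (r * x)) w0"

lemma arrow_functional_diff: "arrow_functional v (a - b) = arrow_functional v a - arrow_functional v b"
 by (simp add: arrow_functional_def left_diff_distrib tc_diff act_diff_right)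

text \<open>By \<open>lastfun_derivation\<close>, acting with a gives a multiple of
  \<open>lastfun T g\<close> plus a constant K, and b annihilates K because its character value at
  \<mu> is 0.\<close>

lemma act_lastfun_times:
 fixes a b :: "('n, 'k) falg"
 assumes T: "size T = 2 \<or> size T = 3" and a: "a \<in> Inv" and b: "b \<in> radJ"
 shows "act (lastfun T g) (tc (a * b)) w0 = ch (reduce \<mu> T) a * act (lastfun T g) (tc b) w0"
proof -
 let ?c = "ch (reduce \<mu> T) a"
 define K where "K = act (lastfun T g) (tc a) w0 - ?c * lastfun T g w0"
 have "act (lastfun T g) (tc (a * b)) w0 = act (act (lastfun T g) (tc a)) (tc b) w0"
  by (rule act_tc_times[OF a radJ_D(1)[OF b] w0_word])
 also have "\<dots> = act (\<lambda>w. ?c * lastfun T g w + K) (tc b) w0"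
 proof (rule act_cong)
  fix w assume "mset w = mset w0"
  from lastfun_derivation[OF T this, of g "tc a"] this
  have "act (lastfun T g) (tc a) w - ?c * lastfun T g w = K"
   by (simp only: K_def ch_def mset_w0)
  then show "act (lastfun T g) (tc a) w = ?c * lastfun T g w + K" by (simp add: algebra_simps)
 qed
 also have "\<dots> = ?c * act (lastfun T g) (tc b) w0 + K * ch \<mu> b"
  by (simp only: act_add act_scale act_const_tc mset_w0)
 finally show ?thesis using radJ_D(2)[OF b mu] by simp
qed

lemma arrow_functional_times:
 assumes "v \<in> arrow_values \<mu> \<nu>" "a \<in> Inv" "r \<in> radJ"
 shows "arrow_functional v (a * r) = ch \<nu> a * arrow_functional v r"
proof -
 have "size (\<mu> - \<nu>) = 2 \<or> size (\<mu> - \<nu>) = 3" "reduce \<mu> (\<mu> - \<nu>) = \<nu>"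
  using assms(1) by (auto simp: arrow_values_def Let_def split: if_splits)
 then show ?thesis
  using act_lastfun_times[OF _ assms(2) radJ_times_right[OF assms(3) x(1)], of "\<mu> - \<nu>" "point v"]
  by (simp add: arrow_functional_def mult.assoc)
qed

lemma act_const_x: "act (\<lambda>_. c) (tc x) w0 = c"
 by (simp add: act_const_tc mset_w0 chx mu)

lemma act_xi_x:
 assumes "mset w = \<mu>"
 shows "act \<phi> (tc (xi w * x)) w0 = \<phi> w"
proof -
 have "act \<phi> (tc (xi w * x)) w0 = act (act \<phi> (tc (xi w :: ('n, 'k) falg))) (tc x) w0"
  by (rule act_tc_times[OF xi_Inv x(1) w0_word])
 also have "\<dots> = act (\<lambda>_. \<phi> w) (tc x) w0"
  by (rule act_cong) (simp add: act_xi content_words assms mset_w0)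
 finally show ?thesis by (simp only: act_const_x)
qed

text \<open>Two words that differ by exchanging m and v, with the rest of T in front, give a radical
  element on which \<open>lastfun T g\<close> takes the value g v - g m. Since the reference element
  m is left out of \<open>arrow_values\<close>, these elements are dual to the point
  weights.\<close>

lemma arrow_dual:
 assumes v: "v \<in> arrow_values \<mu> \<nu>"
 obtains r where "r \<in> radJ" "\<And>v'. v' \<in> arrow_values \<mu> \<nu> \<Longrightarrow> arrow_functional v' r = (if v' = v then 1 else 0)"
proof -
 define T where "T = \<mu> - \<nu>"
 define m where "m = Max (set_mset T)"
 have cond: "(size T = 2 \<or> size T = 3) \<and> reduce \<mu> T = \<nu>"
 proof (rule ccontr)
  assume "\<not> ?thesis"
  then have "arrow_values \<mu> \<nu> = {}" unfolding arrow_values_def Let_def T_def[symmetric] by (rule if_not_P)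
  then show False using v by blast
 qed
 have T: "size T = 2 \<or> size T = 3" "arrow_values \<mu> \<nu> = set_mset T - {m}"
  unfolding arrow_values_def Let_def T_def[symmetric] m_def using cond by simp_all
 have "v \<in> set_mset T - {m}" using v unfolding T(2) .
 then have v: "v \<in># T" "v \<noteq> m" by simp_all
 have "m \<in># T" unfolding m_def by (rule Max_in[OF finite_set_mset]) (rule ex_in_conv[THEN iffD1, OF exI, OF v(1)])
 have "v \<in># T - {#m#}" unfolding in_diff_count using v by (simp add: count_greater_zero_iff)
 then have sub: "{#m, v#} \<subseteq># T"
  unfolding insert_subset_eq_iff[of m "{#v#}"] using \<open>m \<in># T\<close> by (simp only: mset_subset_eq_single conj_absorb)
 then obtain Z where Z: "T = {#m, v#} + Z" by (metis mset_subset_eq_exists_conv)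
 have Tmu: "T \<subseteq># \<mu>" by (simp add: T_def)
 define L where "L = sorted_list_of_multiset Z"
 define R where "R = sorted_list_of_multiset (\<mu> - T)"
 have content: "mset (L @ m # v # R) = \<mu>" "mset (L @ v # m # R) = \<mu>"
  using subset_mset.add_diff_inverse[OF Tmu] by (simp_all add: L_def R_def Z add_mset_commute add_ac)
 have "subcount_rev Z (rev L) = (1::'k)"
 proof (cases "Z = {#}")
  case False
  then have "size Z = 1" using T(1) by (auto simp: Z)
  then obtain z where "Z = {#z#}" by (metis size_1_singleton_mset)
  then show ?thesis by (simp add: subcount_rev_single L_def)
 qed simp
 then have swap: "lastfun T g (L @ m # v # R) - lastfun T g (L @ v # m # R) = g v - (g m :: 'k)" for g
  using comm_diff_lastfun[of T g L m v R] sub by (simp add: comm_diff_def Z)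
 show thesis
 proof (rule that)
  show "xi (L @ m # v # R) - xi (L @ v # m # R) \<in> (radJ :: ('n, 'k) falg set)"
   by (rule xi_perm_radJ[OF trans[OF content(1) content(2)[symmetric]] content_words[OF content(1)]])
  fix v' assume v': "v' \<in> arrow_values \<mu> \<nu>"
  have "arrow_functional v' (xi (L @ m # v # R) - xi (L @ v # m # R)) = point v' v - point v' m"
   unfolding arrow_functional_diff unfolding arrow_functional_def act_xi_x[OF content(1)] act_xi_x[OF content(2)]
    T_def[symmetric] by (rule swap)
  then show "arrow_functional v' (xi (L @ m # v # R) - xi (L @ v # m # R)) = (if v' = v then 1 else 0)"
   using v' T(2) by (auto simp: point_def)
 qed
qed

text \<open>Each \<open>xi u\<close> acts as evaluation at u. So, up to an element that acts as
  zero, a is the combination of the \<open>xi u\<close> whose coefficients are the values through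
  which a x acts at \<open>w0\<close>.\<close>

lemma linear_sum_xi:
 fixes f :: "('n, 'k) falg \<Rightarrow> 'k"
 assumes add: "\<And>a b. f (a + b) = f a + f b" and sc: "\<And>c a. f (sc c a) = c * f a"
  and zero: "\<And>a. a \<in> Inv \<Longrightarrow> (\<And>u. mset u = \<mu> \<Longrightarrow> act (ind u) (tc (a * x)) w0 = 0) \<Longrightarrow> f a = 0"
  and a: "a \<in> Inv"
 shows "f a = act (\<lambda>u. f (xi u)) (tc (a * x)) w0"
proof -
 let ?U = "{u. mset u = \<mu>}"
 let ?c = "\<lambda>u. act (ind u) (tc (a * x)) w0"
 define b where "b = (\<Sum>u\<in>?U. sc (?c u) (xi u :: ('n, 'k) falg))"
 have fin: "finite ?U" by (rule finite_mset_eq)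
 have lin: "L b = (\<Sum>u\<in>?U. ?c u * L (xi u))"
  if "\<And>a b. L (a + b) = L a + L b" "\<And>c a. L (sc c a) = c * L a" for L :: "('n, 'k) falg \<Rightarrow> 'k"
 proof -
  have L0: "L 0 = 0" using that(2)[of 0 0] by simp
  have "L (\<Sum>u\<in>V. sc (?c u) (xi u)) = (\<Sum>u\<in>V. ?c u * L (xi u))" for V
   by (induction V rule: infinite_finite_induct) (simp_all add: L0 that)
  then show ?thesis unfolding b_def .
 qed
 have bI: "b \<in> Inv"
 proof -
  have "(\<Sum>u\<in>V. sc (?c u) (xi u :: ('n, 'k) falg)) \<in> Inv" for V
   by (induction V rule: infinite_finite_induct) (simp_all add: Inv_0 Inv_add Inv_sc xi_Inv)
  then show ?thesis unfolding b_def .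
 qed
 have "f (a - b) = 0"
 proof (rule zero)
  show "a - b \<in> Inv" by (rule Inv_diff[OF a bI])
  fix u assume u: "mset u = \<mu>"
  let ?L = "\<lambda>a. act (ind u) (tc (a * x)) w0"
  have "?L b = (\<Sum>v\<in>?U. ?c v * ?L (xi v))"
   by (rule lin) (simp_all add: distrib_right tc_add act_add_right sc_times_left tc_sc act_scale_right)
  also have "\<dots> = (\<Sum>v\<in>?U. if v = u then ?c u else 0)"
   by (rule sum.cong[OF refl]) (simp add: act_xi_x ind_def)
  also have "\<dots> = ?c u" using u by (simp add: sum.delta[OF fin])
  finally show "?L (a - b) = 0" by (simp add: left_diff_distrib tc_diff act_diff_right)
 qed
 moreover have "f a = f (a - b) + f b" using add[of "a - b" b] by simp
 moreover have "f b = (\<Sum>u\<in>?U. ?c u * f (xi u))" by (rule lin[OF add sc])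
 moreover have "(\<Sum>u\<in>?U. ?c u * f (xi u)) = act (\<lambda>u. f (xi u)) (tc (a * x)) w0"
 proof -
  have "(\<Sum>u\<in>?U. ?c u * f (xi u)) = (\<Sum>u\<in>?U. act (\<lambda>v. f (xi u) * ind u v) (tc (a * x)) w0)"
   unfolding act_scale by (simp add: mult.commute)
  also have "\<dots> = act (\<lambda>v. \<Sum>u\<in>?U. f (xi u) * ind u v) (tc (a * x)) w0" by (rule act_sum[symmetric])
  also have "\<dots> = act (\<lambda>u. f (xi u)) (tc (a * x)) w0"
  proof (rule act_cong)
   fix v assume v: "mset v = mset w0"
   have "(\<Sum>u\<in>?U. f (xi u) * ind u v) = (\<Sum>u\<in>?U. if u = v then f (xi v) else 0)"
    by (rule sum.cong[OF refl]) (simp add: ind_def)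
   then show "(\<Sum>u\<in>?U. f (xi u) * ind u v) = f (xi v)"
    using v by (simp add: sum.delta[OF fin] mset_w0)
  qed
  finally show ?thesis .
 qed
 ultimately show ?thesis by simp
qed

text \<open>If y r x were not in the span of the products, a linear form f would separate it from
  them and from the elements that act as zero; such an f is given by a function \<phi> on words.
  Vanishing on products makes \<phi> a \<open>word_functional\<close>, hence a constant plus
  functions \<open>lastfun T g\<close>. At y r x every term is 0: y kills each T that leads to a
  vertex other than \<nu>, the hypothesis kills T = \<mu> - \<nu>, and constants are annihilated by
  radical elements.\<close>

theorem arrow_upper_bound:
 assumes r: "r \<in> radJ" and zero: "\<And>v. v \<in> arrow_values \<mu> \<nu> \<Longrightarrow> arrow_functional v r = 0"
 shows "y * r * x \<in> radJ2"
proof (rule ccontr)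
 assume notin: "y * r * x \<notin> radJ2"
 define s where "s = y * r * x"
 define P where "P = {a * b | a b. a \<in> (radJ :: ('n, 'k) falg set) \<and> b \<in> radJ}"
 \<comment> \<open>The elements whose multiples by x act as zero at \<open>w0\<close>; requiring f
   to vanish on them makes it factor through the faithful action.\<close>
 define N where "N = {a \<in> Inv. \<forall>u. mset u = \<mu> \<longrightarrow> act (ind u) (tc (a * x)) w0 = 0}"
 have rI: "r \<in> Inv" by (rule radJ_D(1)[OF r])
 have sI: "s \<in> Inv" and sx: "s * x = s" by (simp_all add: s_def Inv_times rI x y mult.assoc)
 have subN: "sc.subspace N"
  by (rule sc.subspaceI)
   (auto simp: N_def Inv_0 Inv_add Inv_sc tc_0 act_zero_right distrib_right tc_add act_add_right sc_times_left tc_sc act_scale_right)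
 \<comment> \<open>By \<open>faithful\<close>, a component in N disappears after multiplication by
   x, whereas s is unchanged by it and the span of the products is stable.\<close>
 have "s \<notin> sc.span (P \<union> N)"
 proof
  assume "s \<in> sc.span (P \<union> N)"
  then obtain p k where pk: "s = p + k" "p \<in> sc.span P" "k \<in> sc.span N" unfolding sc.span_Un by blast
  have k: "k \<in> N" using pk(3) subN by (simp add: sc.span_eq_iff[THEN iffD2])
  then have kI: "k \<in> Inv" by (simp add: N_def)
  have "k * x = 0"
  proof (rule faithful[OF Inv_times[OF kI x(1)] x(1) _ chx mset_w0])
   show "k * x * x = k * x" by (simp add: mult.assoc x)
   show "act (ind u) (tc (k * x)) w0 = 0" if "mset u = \<mu>" for u using k that by (simp add: N_def)
  qed simp_all
  then have "s = p * x" using sx pk(1) by (simp add: distrib_right)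
  moreover have "p * x \<in> radJ2" by (rule radJ2_times_right[OF _ x(1)]) (use pk(2) in \<open>simp add: radJ2_def P_def\<close>)
  ultimately show False using notin by (simp add: s_def)
 qed
 then obtain f where f: "\<And>a b. f (a + b) = f a + f b" "\<And>c a. f (sc c a) = c * f a"
   "\<And>a. a \<in> sc.span (P \<union> N) \<Longrightarrow> f a = 0" "f s = (1::'k)"
  using linear_functional_separating by blast
 define \<phi> where "\<phi> u = f (xi u)" for u
 have eval: "f a = act \<phi> (tc (a * x)) w0" if "a \<in> Inv" for a
  unfolding \<phi>_def
 proof (rule linear_sum_xi[OF f(1,2) _ that])
  fix b assume "b \<in> Inv" "\<And>u. mset u = \<mu> \<Longrightarrow> act (ind u) (tc (b * x)) w0 = 0"
  then have "b \<in> P \<union> N" by (simp add: N_def)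
  then show "f b = 0" by (intro f(3) sc.span_base)
 qed
 have "word_functional \<phi> \<mu>"
 proof (rule word_functionalI)
  show "0 \<notin># \<mu>" using mu by (simp add: partitions_upto_iff)
  show "of_nat i \<noteq> (0::'k)" if "1 \<le> i" "i \<le> size \<mu>" for i
   using that length_word[OF w0_word] by (intro of_nat_nonzero) (simp_all add: mset_w0 flip: size_mset)
  show "(2::'k) \<noteq> 0" by (rule two_nonzero)
  fix w w' \<alpha> \<alpha>' :: "nat list"
  assume h: "mset w = \<mu>" "mset w' = \<mu>" "mset \<alpha> = mset \<alpha>'" "0 \<notin> set \<alpha>" "sum_list \<alpha> \<le> sum_mset \<mu>"
  have \<alpha>: "\<alpha> \<in> words CARD('n)" using h(4,5) mu by (simp add: words_def partitions_upto_iff)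
  have \<alpha>': "\<alpha>' \<in> words CARD('n)" using \<alpha> h(3) by (simp add: words_iff)
  define a :: "('n, 'k) falg" where "a = of_type (ind \<alpha>) - of_type (ind \<alpha>')"
  define b :: "('n, 'k) falg" where "b = xi w - xi w'"
  have a: "a \<in> radJ" unfolding a_def by (rule of_type_ind_perm_radJ[OF h(3) \<alpha>])
  have b: "b \<in> radJ" unfolding b_def by (rule xi_perm_radJ) (simp_all add: h content_words)
  note aI = radJ_D(1)[OF a] and bI = radJ_D(1)[OF b]
  let ?\<psi> = "act \<phi> (tc a)"
  \<comment> \<open>Evaluated through \<phi>, the vanishing on this product is the condition
    \<open>four\<close> of \<open>word_functionalI\<close>.\<close>
  have "f (a * b) = 0" by (intro f(3) sc.span_base) (use a b in \<open>auto simp: P_def\<close>)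
  then have "0 = act \<phi> (tc (a * b * x)) w0" using eval[OF Inv_times[OF aI bI]] by simp
  also have "\<dots> = act (act \<phi> (tc (a * b))) (tc x) w0"
   by (rule act_tc_times[OF Inv_times[OF aI bI] x(1) w0_word])
  also have "\<dots> = act (\<lambda>_. ?\<psi> w - ?\<psi> w') (tc x) w0"
  proof (rule act_cong)
   fix v assume v: "mset v = mset w0"
   have "act \<phi> (tc (a * b)) v = act ?\<psi> (tc b) v"
    by (rule act_tc_times[OF aI bI content_words]) (simp add: v mset_w0)
   also have "\<dots> = ?\<psi> w - ?\<psi> w'"
    unfolding b_def tc_diff act_diff_right using v h by (simp add: act_xi content_words mset_w0)
   finally show "act \<phi> (tc (a * b)) v = ?\<psi> w - ?\<psi> w'" .
  qed
  also have "\<dots> = ?\<psi> w - ?\<psi> w'" by (rule act_const_x)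
  finally have "?\<psi> w = ?\<psi> w'" by simp
  then show "act \<phi> (ind \<alpha>) w - act \<phi> (ind \<alpha>') w = act \<phi> (ind \<alpha>) w' - act \<phi> (ind \<alpha>') w'"
   unfolding a_def tc_diff act_diff_right tc_of_type_ind[OF \<alpha>] tc_of_type_ind[OF \<alpha>'] .
 qed
 then interpret word_functional \<phi> \<mu> .
 obtain c where c: "\<And>w. mset w = \<mu> \<Longrightarrow> \<phi> w = c + (\<Sum>T\<in>parts23. lastfun T (coeff T) w)"
  using classification by blast
 define b where "b = r * x"
 have b: "b \<in> radJ" unfolding b_def by (rule radJ_times_right[OF r x(1)])
 have s: "s = y * b" by (simp add: s_def b_def mult.assoc)
 have term0: "act (lastfun T g) (tc s) w0 = 0" if "T \<in> parts23" for T g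
 proof -
  have T: "T \<subseteq># \<mu>" "size T = 2 \<or> size T = 3" using that by (auto simp: parts23_def)
  have eq: "act (lastfun T g) (tc s) w0 = ch (reduce \<mu> T) y * act (lastfun T g) (tc b) w0"
   unfolding s by (rule act_lastfun_times[OF T(2) y b])
  show ?thesis
  proof (cases "reduce \<mu> T = \<nu>")
   case False
   then have "ch (reduce \<mu> T) y = 0" using chy[OF reduce_partitions_upto[OF T(1) mu]] by simp
   then show ?thesis using eq by simp
  next
   case True
   have T\<nu>: "T = \<mu> - \<nu>" using reduce_determines[OF T] mu True by (simp add: partitions_upto_iff)
   define m where "m = Max (set_mset T)"
   have vals: "arrow_values \<mu> \<nu> = set_mset T - {m}"
    using T(2) True unfolding arrow_values_def Let_def T\<nu>[symmetric] m_def by simp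
   have "act (lastfun T g) (tc b) w0
     = act (\<lambda>w. (\<Sum>s\<in>set_mset T - {m}. (g s - g m) * lastfun T (point s) w) + lastfun T (\<lambda>_. g m) w) (tc b) w0"
    by (rule arg_cong[of _ _ "\<lambda>\<phi>. act \<phi> (tc b) w0"], rule ext, rule lastfun_expand)
   also have "\<dots> = (\<Sum>s\<in>set_mset T - {m}. (g s - g m) * act (lastfun T (point s)) (tc b) w0)
     + act (lastfun T (\<lambda>_. g m)) (tc b) w0"
    by (simp only: act_add act_sum act_scale)
   also have "act (lastfun T (\<lambda>_. g m)) (tc b) w0 = act (\<lambda>_. lastfun T (\<lambda>_. g m) w0) (tc b) w0"
    by (rule act_cong) (rule lastfun_const_perm)
   also have "\<dots> = 0" using radJ_D(2)[OF b mu] by (simp add: act_const_tc mset_w0)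
   also have "(\<Sum>s\<in>set_mset T - {m}. (g s - g m) * act (lastfun T (point s)) (tc b) w0) = 0"
   proof (rule sum.neutral, rule ballI)
    fix v assume "v \<in> set_mset T - {m}"
    then have "arrow_functional v r = 0" using zero[of v] by (simp only: vals)
    then show "(g v - g m) * act (lastfun T (point v)) (tc b) w0 = 0"
     by (simp add: arrow_functional_def T\<nu>[symmetric] b_def)
   qed
   finally show ?thesis using eq by simp
  qed
 qed
 have "f s = act \<phi> (tc s) w0" using eval[OF sI] by (simp add: sx)
 also have "\<dots> = act (\<lambda>w. c + (\<Sum>T\<in>parts23. lastfun T (coeff T) w)) (tc s) w0"
  by (rule act_cong) (rule c, simp add: mset_w0)
 also have "\<dots> = c * ch \<mu> s + (\<Sum>T\<in>parts23. act (lastfun T (coeff T)) (tc s) w0)"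
  by (simp only: act_add act_sum act_const_tc mset_w0)
 also have "\<dots> = 0"
  using radJ_D(2)[OF radJ_times_left[OF y b] mu] by (simp add: s term0[unfolded s])
 finally show False using f(4) by simp
qed

end

section \<open>The reflection arrangement and its group\<close>

text \<open>Integral normal vectors for all hyperplanes; the arbitrary normals of a labelling are
  nonzero multiples of them.\<close>

definition roots :: "(real ^ 'n) set" where
 "roots = {axis i 1 | i. True} \<union> {axis i 1 - axis j 1 | i j. i \<noteq> j} \<union> {axis i 1 + axis j 1 | i j. i \<noteq> j}"

lemma roots_I:
 "axis i 1 \<in> roots" "i \<noteq> j \<Longrightarrow> axis i 1 - axis j 1 \<in> roots" "i \<noteq> j \<Longrightarrow> axis i 1 + axis j 1 \<in> roots"
proof -
 show "axis i 1 \<in> roots" unfolding roots_def by (rule UnI1[OF UnI1]) (intro CollectI exI[of _ i] conjI TrueI refl)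
 assume ij: "i \<noteq> j"
 show "axis i 1 - axis j 1 \<in> roots"
  unfolding roots_def by (rule UnI1[OF UnI2]) (intro CollectI exI[of _ i] exI[of _ j] conjI refl ij)
 show "axis i 1 + axis j 1 \<in> roots"
  unfolding roots_def by (rule UnI2) (intro CollectI exI[of _ i] exI[of _ j] conjI refl ij)
qed

lemma root_forms:
 assumes "a \<in> (roots :: (real ^ 'n) set)"
 obtains i where "a = axis i 1" "\<And>v. a \<bullet> v = v $ i"
 | i j where "i \<noteq> j" "a = axis i 1 - axis j 1" "\<And>v. a \<bullet> v = v $ i - v $ j"
 | i j where "i \<noteq> j" "a = axis i 1 + axis j 1" "\<And>v. a \<bullet> v = v $ i + v $ j"
 using assms unfolding roots_def
 by (auto simp: inner_axis' inner_diff_left inner_add_left)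

lemma root_nonzero: "a \<in> (roots :: (real ^ 'n) set) \<Longrightarrow> a \<noteq> 0"
proof (elim root_forms)
 fix i assume "a = axis i 1"
 then show "a \<noteq> 0" by (simp add: axis_eq_0_iff)
next
 fix i j assume ij: "i \<noteq> j" and "\<And>v. a \<bullet> v = v $ i - v $ j"
 then have "a \<bullet> axis i 1 = 1" by (simp add: axis_def)
 then show "a \<noteq> 0" by auto
next
 fix i j assume ij: "i \<noteq> j" and "\<And>v. a \<bullet> v = v $ i + v $ j"
 then have "a \<bullet> axis i 1 = 1" by (simp add: axis_def)
 then show "a \<noteq> 0" by auto
qed

lemma B_arrangement_roots: "H \<in> B_arrangement \<longleftrightarrow> (\<exists>a\<in>roots. H = {v :: real ^ 'n. a \<bullet> v = 0})"
proof -
 have diff: "{v :: real ^ 'n. v $ i = v $ j} = {v. (axis i 1 - axis j 1) \<bullet> v = 0}" for i j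
  by (simp add: inner_axis' inner_diff_left)
 have add: "{v :: real ^ 'n. v $ i = - (v $ j)} = {v. (axis i 1 + axis j 1) \<bullet> v = 0}" for i j
  by (auto simp: inner_axis' inner_add_left)
 have one: "{v :: real ^ 'n. v $ i = 0} = {v. axis i 1 \<bullet> v = 0}" for i
  by (simp add: inner_axis')
 show ?thesis
 proof
  assume "H \<in> B_arrangement"
  then consider i where "H = {v. v $ i = 0}" | i j where "i \<noteq> j" "H = {v. v $ i = v $ j}"
   | i j where "i \<noteq> j" "H = {v. v $ i = - (v $ j)}"
   unfolding B_arrangement_def by (elim UnE CollectE exE conjE) simp_all
  then show "\<exists>a\<in>roots. H = {v. a \<bullet> v = 0}"
  proof cases
   case (1 i)
   show ?thesis by (rule bexI[OF _ roots_I(1)]) (unfold 1 one, rule refl)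
  next
   case (2 i j)
   show ?thesis by (rule bexI[OF _ roots_I(2)[OF 2(1)]]) (unfold 2 diff, rule refl)
  next
   case (3 i j)
   show ?thesis by (rule bexI[OF _ roots_I(3)[OF 3(1)]]) (unfold 3 add, rule refl)
  qed
 next
  assume "\<exists>a\<in>roots. H = {v. a \<bullet> v = 0}"
  then obtain a where a: "a \<in> roots" "H = {v. a \<bullet> v = 0}" ..
  from a(1) show "H \<in> B_arrangement"
  proof (cases rule: root_forms)
   case (1 i)
   then have "H = {v. v $ i = 0}" using a(2) by simp
   then show ?thesis unfolding B_arrangement_def by (intro UnI1) (intro CollectI exI conjI TrueI)
  next
   case (2 i j)
   then have "H = {v. v $ i = v $ j}" using a(2) by simp
   then show ?thesis unfolding B_arrangement_def
    by (intro UnI1[OF UnI2]) (intro CollectI exI[of _ i] exI[of _ j] conjI 2(1))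
  next
   case (3 i j)
   then have "H = {v. v $ i = - (v $ j)}" using a(2) by (auto simp: eq_neg_iff_add_eq_0)
   then show ?thesis unfolding B_arrangement_def
    by (intro UnI2) (intro CollectI exI[of _ i] exI[of _ j] conjI 3(1))
  qed
 qed
qed

lemma parallel_normals:
 fixes a b :: "'v::real_inner"
 assumes "a \<noteq> 0" "b \<noteq> 0" "\<And>v. a \<bullet> v = 0 \<longleftrightarrow> b \<bullet> v = 0"
 obtains c where "c \<noteq> 0" "a = c *\<^sub>R b"
proof -
 define c where "c = (a \<bullet> b) / (b \<bullet> b)"
 define v where "v = a - c *\<^sub>R b"
 have "b \<bullet> v = 0" using assms(2) by (simp add: v_def c_def inner_diff_right inner_commute)
 then have "a \<bullet> v = 0" using assms(3) by simp
 then have "v \<bullet> v = 0" using \<open>b \<bullet> v = 0\<close> by (simp add: v_def inner_diff_left)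
 then have "a = c *\<^sub>R b" by (simp add: v_def)
 moreover from this have "c \<noteq> 0" using assms(1) by auto
 ultimately show thesis using that by blast
qed

text \<open>Normalisation applies to real vectors too, so every point of the space receives the
  integer code of its face.\<close>

definition face_at :: "real ^ 'n::finite \<Rightarrow> 'n face" where
 "face_at v = to_face (\<lambda>i. v $ i)"

definition vec_of :: "('n \<Rightarrow> int) \<Rightarrow> real ^ 'n" where
 "vec_of f = (\<chi> i. of_int (f i))"

definition face_cone :: "'n::finite face \<Rightarrow> (real ^ 'n) set" where
 "face_cone x = {v. face_at v = x}"

lemma to_face_eq_iff: "to_face f = to_face g \<longleftrightarrow> same_face UNIV f g"
 by (metis nrm_same_face same_face_code_to_face same_face_sym same_face_trans)

lemma same_face_vec_of: "same_face UNIV (\<lambda>i. vec_of f $ i) f"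
 by (simp add: same_face_def vec_of_def flip: of_int_abs)

lemma face_at_vec_of: "face_at (vec_of f) = to_face (f :: 'n::finite \<Rightarrow> int)"
 unfolding face_at_def by (rule nrm_same_face[THEN arg_cong]) (simp_all add: same_face_vec_of)

lemma face_at_code: "face_at (vec_of (code x)) = x"
 by (simp add: face_at_vec_of)

lemma face_cone_nonempty: "vec_of (code x) \<in> face_cone x"
 by (simp add: face_cone_def face_at_code)

lemma inj_face_cone: "inj face_cone"
proof (rule injI)
 fix x y :: "'n::finite face" assume "face_cone x = face_cone y"
 then have "vec_of (code x) \<in> face_cone y" using face_cone_nonempty[of x] by simp
 then show "x = y" by (simp add: face_cone_def face_at_code)
qed

lemma compare_by_face:
 fixes p q :: "'a::linordered_idom" and p' q' :: "'b::linordered_idom"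
 assumes "0 < p \<longleftrightarrow> 0 < p'" "p < 0 \<longleftrightarrow> p' < 0" "0 < q \<longleftrightarrow> 0 < q'" "q < 0 \<longleftrightarrow> q' < 0"
  and "\<bar>p\<bar> \<le> \<bar>q\<bar> \<longleftrightarrow> \<bar>p'\<bar> \<le> \<bar>q'\<bar>" "\<bar>q\<bar> \<le> \<bar>p\<bar> \<longleftrightarrow> \<bar>q'\<bar> \<le> \<bar>p'\<bar>"
 shows "p < q \<longleftrightarrow> p' < q'" "p + q < 0 \<longleftrightarrow> p' + q' < 0" "0 < p + q \<longleftrightarrow> 0 < p' + q'"
 using assms by (auto simp: abs_if not_less split: if_splits)

lemma sgn_root_same_face:
 fixes u v :: "real ^ 'n"
 assumes same: "same_face UNIV (\<lambda>i. u $ i) (\<lambda>i. v $ i)" and a: "a \<in> roots"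
 shows "sgn (a \<bullet> u) = sgn (a \<bullet> v)"
proof -
 have D: "0 < u $ i \<longleftrightarrow> 0 < v $ i" "u $ i < 0 \<longleftrightarrow> v $ i < 0" "\<bar>u $ i\<bar> \<le> \<bar>u $ j\<bar> \<longleftrightarrow> \<bar>v $ i\<bar> \<le> \<bar>v $ j\<bar>" for i j
  using same by (simp_all add: same_face_def)
 note cmp = compare_by_face[OF D(1,2) D(1,2) D(3) D(3)]
 from a show ?thesis
 proof (cases rule: root_forms)
  case (1 i)
  show ?thesis unfolding 1(2) sgn_if using D(1,2)[of i] by auto
 next
  case (2 i j)
  show ?thesis unfolding 2(3) sgn_if using cmp(1)[of i j] cmp(1)[of j i] by auto
 next
  case (3 i j)
  show ?thesis unfolding 3(3) sgn_if using cmp(2,3)[of i j] by auto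
 qed
qed

text \<open>The relation |p| \<le> |q| holds exactly if (q - p) (q + p) is nonnegative, and both
  factors are values of roots.\<close>

lemma same_face_sgn_roots:
 fixes u v :: "real ^ 'n"
 assumes sg: "\<And>a. a \<in> roots \<Longrightarrow> sgn (a \<bullet> u) = sgn (a \<bullet> v)"
 shows "same_face UNIV (\<lambda>i. u $ i) (\<lambda>i. v $ i)"
proof -
 have one: "sgn (u $ i) = sgn (v $ i)" for i using sg[OF roots_I(1)[of i]] by (simp add: inner_axis')
 have le: "\<bar>u $ i\<bar> \<le> \<bar>u $ j\<bar> \<longleftrightarrow> \<bar>v $ i\<bar> \<le> \<bar>v $ j\<bar>" for i j
 proof (cases "i = j")
  case False
  have "sgn (u $ j - u $ i) = sgn (v $ j - v $ i)" "sgn (u $ j + u $ i) = sgn (v $ j + v $ i)"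
   using sg[OF roots_I(2)[of j i]] sg[OF roots_I(3)[of j i]] False
   by (simp_all add: inner_axis' inner_diff_left inner_add_left)
  then have "sgn ((u $ j - u $ i) * (u $ j + u $ i)) = sgn ((v $ j - v $ i) * (v $ j + v $ i))"
   by (simp only: sgn_mult)
  then have "0 \<le> (u $ j - u $ i) * (u $ j + u $ i) \<longleftrightarrow> 0 \<le> (v $ j - v $ i) * (v $ j + v $ i)"
   by (metis sgn_less not_less)
  moreover have "\<bar>p\<bar> \<le> \<bar>q\<bar> \<longleftrightarrow> 0 \<le> (q - p) * (q + p)" for p q :: real
   using abs_le_square_iff[of p q] by (simp add: algebra_simps power2_eq_square)
  ultimately show ?thesis by simp
 qed simp
 show ?thesis unfolding same_face_def
 proof (intro conjI ballI)
  fix i j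
  show "0 < u $ i \<longleftrightarrow> 0 < v $ i" "u $ i < 0 \<longleftrightarrow> v $ i < 0" by (metis one sgn_greater, metis one sgn_less)
  show "\<bar>u $ i\<bar> \<le> \<bar>u $ j\<bar> \<longleftrightarrow> \<bar>v $ i\<bar> \<le> \<bar>v $ j\<bar>" by (rule le)
 qed
qed

lemma face_at_eq_iff: "face_at u = face_at v \<longleftrightarrow> (\<forall>a\<in>roots. sgn (a \<bullet> u) = sgn (a \<bullet> v))"
 unfolding face_at_def to_face_eq_iff using sgn_root_same_face same_face_sgn_roots by blast

lemma sgn_comb:
 fixes s t K :: int
 assumes "\<bar>t\<bar> < K"
 shows "sgn (K * s + t) = (if s \<noteq> 0 then sgn s else sgn t)"
proof (cases "s = 0")
 case False
 have "K * \<bar>s\<bar> \<ge> K * 1" using False assms by (intro mult_left_mono) auto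
 then show ?thesis using False assms by (cases "s > 0") (auto simp: sgn_if)
qed simp

text \<open>A root is an integer linear form with at most two coefficients 1 or -1, so its value at
  the code of y is smaller than the factor used in \<open>comb\<close>; the sign at x decides unless
  it is 0.\<close>

lemma sgn_root_plus:
 fixes x y :: "'n::finite face"
 assumes a: "a \<in> roots"
 shows "sgn (a \<bullet> vec_of (code (x + y)))
  = (if sgn (a \<bullet> vec_of (code x)) \<noteq> 0 then sgn (a \<bullet> vec_of (code x)) else sgn (a \<bullet> vec_of (code y)))"
proof -
 define f where "f = code x"
 define g where "g = code y"
 define S where "S = (\<Sum>j\<in>UNIV. \<bar>g j\<bar>)"
 have "face_at (vec_of (code (x + y))) = face_at (vec_of (comb UNIV f g))"
  by (simp add: face_at_vec_of plus_face_def f_def g_def)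
 then have eq: "sgn (a \<bullet> vec_of (code (x + y))) = sgn (a \<bullet> vec_of (comb UNIV f g))"
  using a by (simp only: face_at_eq_iff)
 have le: "\<bar>g i\<bar> \<le> S" for i unfolding S_def by (rule member_le_sum) simp_all
 have S0: "0 \<le> S" unfolding S_def by (rule sum_nonneg) simp
 have main: "\<exists>L. (\<forall>h. a \<bullet> vec_of h = of_int (L h)) \<and> \<bar>L g\<bar> < 2 * S + 1
   \<and> L (comb UNIV f g) = (2 * S + 1) * L f + L g"
  using a
 proof (cases rule: root_forms)
  case (1 i)
  show ?thesis using le[of i] S0
   by (intro exI[of _ "\<lambda>h. h i"]) (simp add: 1(2) vec_of_def comb_def S_def)
 next
  case (2 i j)
  show ?thesis using le[of i] le[of j]
   by (intro exI[of _ "\<lambda>h. h i - h j"]) (simp add: 2(3) vec_of_def comb_def S_def algebra_simps)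
 next
  case (3 i j)
  show ?thesis using le[of i] le[of j]
   by (intro exI[of _ "\<lambda>h. h i + h j"]) (simp add: 3(3) vec_of_def comb_def S_def algebra_simps)
 qed
 then obtain L where L: "\<And>h. a \<bullet> vec_of h = of_int (L h)" "\<bar>L g\<bar> < 2 * S + 1"
  "L (comb UNIV f g) = (2 * S + 1) * L f + L g" by blast
 have sgi: "sgn (real_of_int k) = real_of_int (sgn k)" for k by (simp add: sgn_if)
 show ?thesis
  unfolding eq unfolding f_def[symmetric] g_def[symmetric] L(1) L(3) sgi sgn_comb[OF L(2)] by (simp add: sgn_if)
qed

definition sign_of :: "real \<Rightarrow> sign" where
 "sign_of t = (if 0 < t then Pos else if t < 0 then Neg else Zero)"

lemma in_side: "v \<in> side a s \<longleftrightarrow> sign_of (a \<bullet> v) = s"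
 by (cases s) (auto simp: sign_of_def)

lemma sign_of_eq_iff: "sign_of t = sign_of t' \<longleftrightarrow> sgn t = sgn t'"
 by (auto simp: sign_of_def sgn_if)

lemma sign_of_Zero: "sign_of t = Zero \<longleftrightarrow> sgn t = 0"
 by (auto simp: sign_of_def sgn_if)

definition cone_coeffs :: "((real ^ 'n) set \<Rightarrow> 'k) \<Rightarrow> ('n::finite, 'k::field) falg" where
 "cone_coeffs f = of_fun (\<lambda>x. f (face_cone x))"

lemma lookup_cone_coeffs [simp]: "lookup (cone_coeffs f) x = f (face_cone x)"
 by (simp add: cone_coeffs_def)

context
 fixes \<eta> :: "(real ^ 'n::finite) set \<Rightarrow> real ^ 'n"
 assumes lab: "labelling B_arrangement \<eta>"
begin

text \<open>The factor may be negative, which exchanges the labels of the two half spaces. The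
  product rule tolerates this because it only distinguishes zero from nonzero signs.\<close>

lemma normal_parallel:
 assumes "a \<in> roots"
 obtains c where "c \<noteq> 0" "\<eta> {v. a \<bullet> v = 0} = c *\<^sub>R a"
proof -
 let ?H = "{v. a \<bullet> v = 0}"
 have "?H \<in> B_arrangement" unfolding B_arrangement_roots by (rule bexI[OF refl assms])
 note \<eta>' = bspec[OF lab[unfolded labelling_def] this]
 note \<eta> = conjunct1[OF \<eta>'] conjunct2[OF \<eta>']
 have "\<eta> ?H \<bullet> v = 0 \<longleftrightarrow> a \<bullet> v = 0" for v
  using arg_cong[OF \<eta>(2), of "\<lambda>S. v \<in> S"] unfolding mem_Collect_eq by (rule sym)
 from parallel_normals[OF \<eta>(1) root_nonzero[OF assms] this]
 obtain c where c: "c \<noteq> 0" "\<eta> ?H = c *\<^sub>R a" .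
 show thesis by (rule that[OF c])
qed

lemma face_at_normals:
 "face_at u = face_at v \<longleftrightarrow> (\<forall>H\<in>B_arrangement. sign_of (\<eta> H \<bullet> u) = sign_of (\<eta> H \<bullet> v))"
proof
 assume eq: "face_at u = face_at v"
 show "\<forall>H\<in>B_arrangement. sign_of (\<eta> H \<bullet> u) = sign_of (\<eta> H \<bullet> v)"
 proof
  fix H :: "(real ^ 'n) set" assume "H \<in> B_arrangement"
  then obtain a where a: "a \<in> roots" "H = {v. a \<bullet> v = 0}" unfolding B_arrangement_roots ..
  obtain c where "c \<noteq> 0" and c: "\<eta> H = c *\<^sub>R a" unfolding a(2) by (rule normal_parallel[OF a(1)])
  have "sgn (a \<bullet> u) = sgn (a \<bullet> v)" using bspec[OF eq[unfolded face_at_eq_iff] a(1)] .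
  then show "sign_of (\<eta> H \<bullet> u) = sign_of (\<eta> H \<bullet> v)" by (simp add: c sign_of_eq_iff sgn_mult)
 qed
next
 assume eq: "\<forall>H\<in>B_arrangement. sign_of (\<eta> H \<bullet> u) = sign_of (\<eta> H \<bullet> v)"
 show "face_at u = face_at v"
  unfolding face_at_eq_iff
 proof
  fix a :: "real ^ 'n" assume a: "a \<in> roots"
  obtain c where c: "c \<noteq> 0" "\<eta> {v. a \<bullet> v = 0} = c *\<^sub>R a" by (rule normal_parallel[OF a])
  have "{v. a \<bullet> v = 0} \<in> B_arrangement" unfolding B_arrangement_roots by (rule bexI[OF refl a])
  from bspec[OF eq this] have "sgn c * sgn (a \<bullet> u) = sgn c * sgn (a \<bullet> v)"
   by (simp add: c(2) sign_of_eq_iff sgn_mult)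
  then show "sgn (a \<bullet> u) = sgn (a \<bullet> v)" using c(1) by (simp add: sgn_zero_iff)
 qed
qed

lemma face_of_signs_eq:
 "face_of_signs B_arrangement \<eta> \<sigma> = {u. \<forall>H\<in>B_arrangement. sign_of (\<eta> H \<bullet> u) = \<sigma> H}"
 unfolding face_of_signs_def by (auto simp: in_side)

lemma cone_eq_face_of_signs: "face_cone (face_at v) = face_of_signs B_arrangement \<eta> (\<lambda>H. sign_of (\<eta> H \<bullet> v))"
 unfolding face_of_signs_eq face_cone_def face_at_normals ..

lemma faces_eq: "faces B_arrangement \<eta> = range face_cone"
proof (rule equalityI; rule subsetI)
 fix z assume "z \<in> faces B_arrangement \<eta>"
 then obtain \<sigma> v where z: "z = face_of_signs B_arrangement \<eta> \<sigma>" "v \<in> z" unfolding faces_def by blast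
 then have v: "sign_of (\<eta> H \<bullet> v) = \<sigma> H" if "H \<in> B_arrangement" for H using that by (simp add: face_of_signs_eq)
 have "z = face_cone (face_at v)" unfolding cone_eq_face_of_signs z(1) face_of_signs_eq using v by auto
 then show "z \<in> range face_cone" by simp
next
 fix z :: "(real ^ 'n) set" assume "z \<in> range face_cone"
 then obtain x :: "'n face" where x: "z = face_cone x" by blast
 have "z = face_of_signs B_arrangement \<eta> (\<lambda>H. sign_of (\<eta> H \<bullet> vec_of (code x)))"
  using cone_eq_face_of_signs[of "vec_of (code x)"] by (simp add: x face_at_code)
 then show "z \<in> faces B_arrangement \<eta>" unfolding faces_def using face_cone_nonempty[of x] x by blast
qed

lemma face_sign_cone:
 assumes "H \<in> B_arrangement"
 shows "face_sign \<eta> (face_cone x) H = sign_of (\<eta> H \<bullet> vec_of (code x))"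
 unfolding face_sign_def
proof (rule the_equality)
 show "face_cone x \<subseteq> side (\<eta> H) (sign_of (\<eta> H \<bullet> vec_of (code x)))"
 proof
  fix u assume "u \<in> face_cone x"
  then have "face_at u = face_at (vec_of (code x))" by (simp add: face_cone_def face_at_code)
  then show "u \<in> side (\<eta> H) (sign_of (\<eta> H \<bullet> vec_of (code x)))"
   using assms unfolding face_at_normals in_side by blast
 qed
next
 fix s assume "face_cone x \<subseteq> side (\<eta> H) s"
 then have "vec_of (code x) \<in> side (\<eta> H) s" using face_cone_nonempty by blast
 then show "s = sign_of (\<eta> H \<bullet> vec_of (code x))" by (simp add: in_side)
qed

lemma face_mult_cone: "face_mult B_arrangement \<eta> (face_cone x) (face_cone y) = face_cone (x + y)"
proof -
 let ?s = "\<lambda>x H. sign_of (\<eta> H \<bullet> vec_of (code x))"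
 \<comment> \<open>Passing from the root to the labelled normal multiplies all three values by the
   same nonzero scalar.\<close>
 have prod: "(if ?s x H \<noteq> Zero then ?s x H else ?s y H) = ?s (x + y) H" if H: "H \<in> B_arrangement" for H
 proof -
  obtain a where a: "a \<in> roots" "H = {v. a \<bullet> v = 0}" using H unfolding B_arrangement_roots ..
  obtain c where c: "c \<noteq> 0" "\<eta> H = c *\<^sub>R a" unfolding a(2) by (rule normal_parallel[OF a(1)])
  show ?thesis
   using sgn_root_plus[OF a(1), of x y] c(1)
   by (auto simp: c(2) sign_of_Zero sign_of_eq_iff sgn_mult sgn_zero_iff split: if_splits)
 qed
 have "face_mult B_arrangement \<eta> (face_cone x) (face_cone y) = {u. \<forall>H\<in>B_arrangement. sign_of (\<eta> H \<bullet> u) = ?s (x + y) H}"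
  unfolding face_mult_def face_of_signs_eq
  by (intro Collect_cong ball_cong refl) (simp only: face_sign_cone prod)
 also have "\<dots> = face_cone (face_at (vec_of (code (x + y))))"
  unfolding cone_eq_face_of_signs face_of_signs_eq ..
 finally show ?thesis by (simp add: face_at_code)
qed

lemma one_cone: "face_of_signs B_arrangement \<eta> (\<lambda>_. Zero) = face_cone 0"
proof -
 have "vec_of (code (0 :: 'n face)) = 0" by (simp add: vec_of_def vec_eq_iff)
 then have "face_cone (0 :: 'n face) = face_cone (face_at 0)" by (metis face_at_code)
 also have "\<dots> = face_of_signs B_arrangement \<eta> (\<lambda>_. Zero)"
  unfolding cone_eq_face_of_signs by (simp add: sign_of_def)
 finally show ?thesis ..
qed

abbreviation BF :: "('k::field, (real ^ 'n) set \<Rightarrow> 'k) module" where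
 "BF \<equiv> B_face_algebra \<eta>"

lemma BF_simps:
 "carrier BF = {f. \<forall>z. z \<notin> range face_cone \<longrightarrow> f z = 0}"
 "\<one>\<^bsub>BF\<^esub> = (\<lambda>z. if z = face_cone 0 then 1 else 0)"
 "\<zero>\<^bsub>BF\<^esub> = (\<lambda>_. 0)" "f \<oplus>\<^bsub>BF\<^esub> g = (\<lambda>z. f z + g z)" "c \<odot>\<^bsub>BF\<^esub> f = (\<lambda>z. c * f z)"
proof -
 have "finite (range (face_cone :: 'n face \<Rightarrow> _))" by simp
 then have "finite (supp f) \<and> supp f \<subseteq> range (face_cone :: 'n face \<Rightarrow> _) \<longleftrightarrow> supp f \<subseteq> range (face_cone :: 'n face \<Rightarrow> _)"
  for f :: "(real ^ 'n) set \<Rightarrow> 'a"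
  by (metis finite_subset)
 moreover have "supp f \<subseteq> range (face_cone :: 'n face \<Rightarrow> _) \<longleftrightarrow> (\<forall>z. z \<notin> range (face_cone :: 'n face \<Rightarrow> _) \<longrightarrow> f z = 0)"
  for f :: "(real ^ 'n) set \<Rightarrow> 'a"
  unfolding supp_def subset_iff mem_Collect_eq by metis
 ultimately have "finite (supp f) \<and> supp f \<subseteq> range (face_cone :: 'n face \<Rightarrow> _) \<longleftrightarrow> (\<forall>z. z \<notin> range (face_cone :: 'n face \<Rightarrow> _) \<longrightarrow> f z = 0)"
  for f :: "(real ^ 'n) set \<Rightarrow> 'a" by (simp only:)
 then show "carrier BF = {f :: (real ^ 'n) set \<Rightarrow> 'a. \<forall>z. z \<notin> range face_cone \<longrightarrow> f z = 0}"
  by (simp add: B_face_algebra_def semigroup_algebra_def face_semigroup_def faces_eq)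
qed (simp_all add: B_face_algebra_def semigroup_algebra_def face_semigroup_def one_cone)

text \<open>Reindexing the supports along the injection \<open>face_cone\<close> turns the sum over
  pairs of cones into convolution over pairs of face codes.\<close>

lemma BF_mult:
 fixes f g :: "(real ^ 'n) set \<Rightarrow> 'k::field"
 assumes "f \<in> carrier BF" "g \<in> carrier BF"
 shows "f \<otimes>\<^bsub>BF\<^esub> g \<in> carrier BF" "cone_coeffs (f \<otimes>\<^bsub>BF\<^esub> g) = cone_coeffs f * cone_coeffs g"
proof -
 have outside: "f z = 0" "g z = 0" if "z \<notin> range face_cone" for z using that assms unfolding BF_simps by simp_all
 let ?pairs = "\<lambda>z. {(x, y). (x, y) \<in> supp f \<times> supp g \<and> face_mult B_arrangement \<eta> x y = z}"
 have val: "(f \<otimes>\<^bsub>BF\<^esub> g) z = (\<Sum>(x, y)\<in>?pairs z. f x * g y)" for z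
  by (simp add: B_face_algebra_def semigroup_algebra_def face_semigroup_def)
 let ?Q = "\<lambda>z. {(x, y). f (face_cone x) \<noteq> 0 \<and> g (face_cone y) \<noteq> 0 \<and> face_cone (x + y) = z}"
 have pairs: "?pairs z = map_prod face_cone face_cone ` ?Q z" for z
 proof (rule equalityI; rule subsetI)
  fix p assume "p \<in> ?pairs z"
  moreover obtain S T where p: "p = (S, T)" by (cases p)
  ultimately have ST: "f S \<noteq> 0" "g T \<noteq> 0" "face_mult B_arrangement \<eta> S T = z" by (simp_all add: supp_def)
  have "S \<in> range face_cone" by (rule ccontr) (use outside(1)[of S] ST(1) in simp)
  then obtain x where x: "S = face_cone x" ..
  have "T \<in> range face_cone" by (rule ccontr) (use outside(2)[of T] ST(2) in simp)
  then obtain y where y: "T = face_cone y" ..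
  have "(x, y) \<in> ?Q z" using ST by (simp add: x y face_mult_cone)
  then show "p \<in> map_prod face_cone face_cone ` ?Q z" by (rule rev_image_eqI) (simp add: p x y)
 qed (auto simp: supp_def face_mult_cone)
 show "f \<otimes>\<^bsub>BF\<^esub> g \<in> carrier BF"
  unfolding BF_simps
 proof (intro CollectI allI impI)
  fix z :: "(real ^ 'n) set" assume "z \<notin> range face_cone"
  then have "?Q z = {}" by blast
  then have none: "?pairs z = {}" unfolding pairs by blast
  show "(f \<otimes>\<^bsub>BF\<^esub> g) z = 0" unfolding val none by (rule sum.empty)
 qed
 show "cone_coeffs (f \<otimes>\<^bsub>BF\<^esub> g) = cone_coeffs f * cone_coeffs g"
 proof (rule poly_mapping_eqI)
  fix c :: "'n face"
  have inj: "inj_on (map_prod face_cone face_cone) (?Q (face_cone c))"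
   using inj_face_cone by (auto simp: inj_on_def)
  have "lookup (cone_coeffs (f \<otimes>\<^bsub>BF\<^esub> g)) c = (\<Sum>(x, y)\<in>?Q (face_cone c). f (face_cone x) * g (face_cone y))"
   unfolding lookup_cone_coeffs val pairs sum.reindex[OF inj] by (simp add: case_prod_unfold comp_def)
  also have "\<dots> = (\<Sum>(x, y)\<in>UNIV. f (face_cone x) * (g (face_cone y) * (if x + y = c then 1 else 0)))"
  proof (rule sum.mono_neutral_cong_left)
   show "\<forall>p\<in>UNIV - ?Q (face_cone c). (case p of (x, y) \<Rightarrow> f (face_cone x) * (g (face_cone y) * (if x + y = c then 1 else 0))) = 0"
   proof
    fix p assume p: "p \<in> UNIV - ?Q (face_cone c)"
    obtain x y where xy: "p = (x, y)" by (cases p)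
    show "(case p of (x, y) \<Rightarrow> f (face_cone x) * (g (face_cone y) * (if x + y = c then 1 else 0))) = 0"
     using p by (cases "x + y = c") (simp_all add: xy)
   qed
   show "\<And>p. p \<in> ?Q (face_cone c) \<Longrightarrow> (case p of (x, y) \<Rightarrow> f (face_cone x) * g (face_cone y))
     = (case p of (x, y) \<Rightarrow> f (face_cone x) * (g (face_cone y) * (if x + y = c then 1 else 0)))"
    by (auto simp: inj_eq[OF inj_face_cone])
  qed simp_all
  also have "\<dots> = lookup (cone_coeffs f * cone_coeffs g) c"
   unfolding lookup_times pair_def lookup_cone_coeffs sum_distrib_left
   by (simp only: UNIV_Times_UNIV[symmetric] sum.cartesian_product)
  finally show "lookup (cone_coeffs (f \<otimes>\<^bsub>BF\<^esub> g)) c = lookup (cone_coeffs f * cone_coeffs g) c" .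
 qed
qed

end

section \<open>The hyperoctahedral group as the group of signed permutations\<close>

type_synonym 'n endo = "real ^ 'n \<Rightarrow> real ^ 'n"

definition signed_perm :: "('n \<Rightarrow> 'n) \<Rightarrow> 'n set \<Rightarrow> 'n::finite endo" where
 "signed_perm \<sigma> V v = (\<chi> i. if i \<in> V then - v $ \<sigma> i else v $ \<sigma> i)"

lemma signed_perm_nth: "signed_perm \<sigma> V v $ i = (if i \<in> V then - v $ \<sigma> i else v $ \<sigma> i)"
 by (simp add: signed_perm_def)

lemma signed_perm_id: "signed_perm id {} = (\<lambda>v. v)"
 by (simp add: signed_perm_def fun_eq_iff)

text \<open>Entry i is read at place \<sigma> i of the argument, so the permutations compose in the
  opposite order.\<close>

lemma signed_perm_compose:
 "signed_perm \<sigma> V (signed_perm \<tau> U v) = signed_perm (\<tau> \<circ> \<sigma>) {i. (i \<in> V) \<noteq> (\<sigma> i \<in> U)} v"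
 by (simp add: signed_perm_def vec_eq_iff)

lemma signed_perm_inj:
 assumes eq: "signed_perm \<sigma> V = signed_perm \<tau> (U :: 'n::finite set)"
 shows "\<sigma> = \<tau> \<and> V = U"
proof -
 have *: "signed_perm \<sigma> V (axis j 1) $ i = signed_perm \<tau> U (axis j 1) $ i" for i j by (simp only: eq)
 have st: "\<sigma> i = \<tau> i" for i using *[of "\<sigma> i" i] by (auto simp: signed_perm_nth axis_def split: if_splits)
 have "i \<in> V \<longleftrightarrow> i \<in> U" for i using *[of "\<sigma> i" i] st[of i] by (auto simp: signed_perm_nth axis_def split: if_splits)
 then show ?thesis using st by blast
qed

lemma signed_perm_inverse:
 assumes "bij \<sigma>"
 shows "signed_perm \<sigma> V (signed_perm (inv_into UNIV \<sigma>) {j. inv_into UNIV \<sigma> j \<in> V} v) = v"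
  "signed_perm (inv_into UNIV \<sigma>) {j. inv_into UNIV \<sigma> j \<in> V} (signed_perm \<sigma> V v) = v"
 using bij_is_surj[OF assms] bij_is_inj[OF assms]
 by (simp_all add: signed_perm_def vec_eq_iff inv_f_f surj_f_inv_f)

lemma bij_signed_perm: "bij \<sigma> \<Longrightarrow> bij (signed_perm \<sigma> V)"
 by (rule o_bij[of "signed_perm (inv_into UNIV \<sigma>) {j. inv_into UNIV \<sigma> j \<in> V}"])
  (simp_all add: fun_eq_iff signed_perm_inverse)

lemma reflection_scale: "c \<noteq> 0 \<Longrightarrow> reflection (c *\<^sub>R a) = reflection a"
 by (simp add: reflection_def fun_eq_iff)

lemma root_reflections:
 fixes i j :: "'n::finite"
 shows "reflection (axis i 1 :: real ^ 'n) = signed_perm id {i}"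
  and "i \<noteq> j \<Longrightarrow> reflection (axis i 1 - axis j 1 :: real ^ 'n) = signed_perm (Transposition.transpose i j) {}"
  and "i \<noteq> j \<Longrightarrow> reflection (axis i 1 + axis j 1 :: real ^ 'n) = signed_perm (Transposition.transpose i j) {i, j}"
proof -
 have nth: "axis k 1 $ l = (if l = k then 1 else 0 :: real)" for k l :: 'n by (simp add: axis_def)
 show "reflection (axis i 1 :: real ^ 'n) = signed_perm id {i}"
  by (rule ext, unfold vec_eq_iff, rule allI) (simp add: reflection_def signed_perm_nth inner_axis' nth)
 assume ij: "i \<noteq> j"
 have norm: "(axis i 1 - axis j 1 :: real ^ 'n) \<bullet> (axis i 1 - axis j 1) = 2"
  "(axis i 1 + axis j 1 :: real ^ 'n) \<bullet> (axis i 1 + axis j 1) = 2"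
  using ij by (simp_all add: inner_diff_left inner_add_left inner_axis' nth)
 show "reflection (axis i 1 - axis j 1 :: real ^ 'n) = signed_perm (Transposition.transpose i j) {}"
 proof (rule ext, unfold vec_eq_iff, rule allI)
  fix v :: "real ^ 'n" and k
  show "reflection (axis i 1 - axis j 1) v $ k = signed_perm (Transposition.transpose i j) {} v $ k"
   using ij unfolding reflection_def norm
   by (cases "k = i"; cases "k = j") (simp_all add: signed_perm_nth inner_diff_left inner_axis' nth)
 qed
 show "reflection (axis i 1 + axis j 1 :: real ^ 'n) = signed_perm (Transposition.transpose i j) {i, j}"
 proof (rule ext, unfold vec_eq_iff, rule allI)
  fix v :: "real ^ 'n" and k
  show "reflection (axis i 1 + axis j 1) v $ k = signed_perm (Transposition.transpose i j) {i, j} v $ k"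
   using ij unfolding reflection_def norm
   by (cases "k = i"; cases "k = j") (simp_all add: signed_perm_nth inner_add_left inner_axis' nth)
 qed
qed

lemma root_reflection:
 assumes "a \<in> (roots :: (real ^ 'n::finite) set)"
 obtains \<sigma> V where "bij \<sigma>" "reflection a = signed_perm \<sigma> V"
 using assms
proof (cases rule: root_forms)
 case (1 i)
 show thesis by (rule that[OF bij_id]) (unfold 1(1), rule root_reflections(1))
next
 case (2 i j)
 show thesis by (rule that[of "Transposition.transpose i j"]) (simp, unfold 2(2), rule root_reflections(2)[OF 2(1)])
next
 case (3 i j)
 show thesis by (rule that[of "Transposition.transpose i j"]) (simp, unfold 3(2), rule root_reflections(3)[OF 3(1)])
qed

abbreviation reflections :: "'n::finite endo set" where
 "reflections \<equiv> {reflection a | a. a \<noteq> 0 \<and> {v. a \<bullet> v = 0} \<in> B_arrangement}"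

lemma reflections_roots: "reflections = reflection ` (roots :: (real ^ 'n::finite) set)"
proof (rule equalityI; rule subsetI)
 fix w :: "'n endo" assume "w \<in> reflections"
 then obtain a where a: "w = reflection a" "a \<noteq> 0" "{v. a \<bullet> v = 0} \<in> B_arrangement" by blast
 obtain b where b: "b \<in> roots" "{v. a \<bullet> v = 0} = {v. b \<bullet> v = 0}" using a(3) unfolding B_arrangement_roots ..
 have "a \<bullet> v = 0 \<longleftrightarrow> b \<bullet> v = 0" for v
  using arg_cong[OF b(2), of "\<lambda>S. v \<in> S"] unfolding mem_Collect_eq .
 from parallel_normals[OF a(2) root_nonzero[OF b(1)] this] obtain c where "c \<noteq> 0" "a = c *\<^sub>R b" .
 then show "w \<in> reflection ` roots" using b(1) by (simp add: a(1) reflection_scale)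
next
 fix w :: "'n endo" assume "w \<in> reflection ` roots"
 then obtain a where a: "w = reflection a" "a \<in> roots" by blast
 have "{v. a \<bullet> v = 0} \<in> B_arrangement" unfolding B_arrangement_roots by (rule bexI[OF refl a(2)])
 then show "w \<in> reflections" using a(1) root_nonzero[OF a(2)] by blast
qed

lemma BijGroup_UNIV:
 assumes "bij f" "bij g"
 shows "f \<otimes>\<^bsub>BijGroup UNIV\<^esub> g = f \<circ> g" "f \<in> carrier (BijGroup UNIV)"
 using assms by (auto simp: BijGroup_def Bij_def compose_def fun_eq_iff extensional_def)

lemma BijGroup_one: "\<one>\<^bsub>BijGroup UNIV\<^esub> = (\<lambda>v. v)"
 by (simp add: BijGroup_def restrict_UNIV)

lemma hyperoctahedral_subset:
 assumes "w \<in> (hyperoctahedral_group :: 'n::finite endo set)"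
 shows "\<exists>\<sigma> V. bij \<sigma> \<and> w = signed_perm \<sigma> V"
 using assms unfolding hyperoctahedral_group_def reflections_roots
proof (induction rule: generate.induct)
 case one
 have "\<one>\<^bsub>BijGroup UNIV\<^esub> = signed_perm id ({} :: 'n set)"
  by (simp add: BijGroup_one signed_perm_id)
 then show ?case using bij_id by blast
next
 case (incl w)
 then show ?case using root_reflection by blast
next
 case (inv w)
 then obtain \<sigma> V where w: "bij \<sigma>" "w = signed_perm \<sigma> V" using root_reflection by blast
 let ?u = "signed_perm (inv_into UNIV \<sigma>) {j. inv_into UNIV \<sigma> j \<in> V}"
 have u: "bij ?u" by (rule bij_signed_perm[OF bij_imp_bij_inv[OF w(1)]])
 have wb: "bij w" unfolding w(2) by (rule bij_signed_perm[OF w(1)])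
 interpret group "BijGroup (UNIV :: (real ^ 'n) set)" by (rule group_BijGroup)
 have "?u \<otimes>\<^bsub>BijGroup UNIV\<^esub> w = \<one>\<^bsub>BijGroup UNIV\<^esub>"
  unfolding BijGroup_UNIV(1)[OF u wb] BijGroup_one by (rule ext) (simp add: w(2) signed_perm_inverse[OF w(1)])
 then have "inv\<^bsub>BijGroup UNIV\<^esub> w = ?u"
  by (rule inv_equality) (rule BijGroup_UNIV(2)[OF wb wb], rule BijGroup_UNIV(2)[OF u u])
 then show ?case using bij_imp_bij_inv[OF w(1)] by blast
next
 case (eng w u)
 then obtain \<sigma> V \<tau> U where wu: "bij \<sigma>" "w = signed_perm \<sigma> V" "bij \<tau>" "u = signed_perm \<tau> U" by blast
 have "w \<otimes>\<^bsub>BijGroup UNIV\<^esub> u = w \<circ> u"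
  by (rule BijGroup_UNIV(1)) (simp_all add: wu bij_signed_perm)
 also have "\<dots> = signed_perm (\<tau> \<circ> \<sigma>) {i. (i \<in> V) \<noteq> (\<sigma> i \<in> U)}"
  by (simp add: fun_eq_iff wu signed_perm_compose)
 finally show ?case using bij_comp[OF wu(1,3)] by blast
qed

lemma signed_perm_product_mem:
 assumes "bij \<sigma>" "bij \<tau>" "signed_perm \<sigma> V \<in> hyperoctahedral_group" "signed_perm \<tau> U \<in> hyperoctahedral_group"
 shows "signed_perm (\<tau> \<circ> \<sigma>) {i. (i \<in> V) \<noteq> (\<sigma> i \<in> (U :: 'n::finite set))} \<in> hyperoctahedral_group"
proof -
 have "signed_perm (\<tau> \<circ> \<sigma>) {i. (i \<in> V) \<noteq> (\<sigma> i \<in> U)} = signed_perm \<sigma> V \<circ> signed_perm \<tau> U"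
  by (simp add: fun_eq_iff signed_perm_compose)
 also have "\<dots> = signed_perm \<sigma> V \<otimes>\<^bsub>BijGroup UNIV\<^esub> signed_perm \<tau> U"
  by (rule BijGroup_UNIV(1)[symmetric]) (simp_all add: assms bij_signed_perm)
 finally show ?thesis using assms(3,4) unfolding hyperoctahedral_group_def by (simp add: generate.eng)
qed

lemma reflection_mem: "a \<in> roots \<Longrightarrow> reflection a \<in> (hyperoctahedral_group :: 'n::finite endo set)"
 unfolding hyperoctahedral_group_def reflections_roots by (intro generate.incl imageI)

lemma id_mem: "signed_perm id {} \<in> (hyperoctahedral_group :: 'n::finite endo set)"
 unfolding hyperoctahedral_group_def signed_perm_id BijGroup_one[symmetric] by (rule generate.one)

lemma signs_mem: "finite V \<Longrightarrow> signed_perm id V \<in> (hyperoctahedral_group :: 'n::finite endo set)"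
proof (induction V rule: finite_induct)
 case (insert i V)
 have "signed_perm id {i} \<in> (hyperoctahedral_group :: 'n endo set)"
  using reflection_mem[OF roots_I(1)[of i]] unfolding root_reflections(1) .
 from signed_perm_product_mem[OF bij_id bij_id this insert.IH]
 have "signed_perm (id \<circ> id) {k. (k \<in> {i}) \<noteq> (id k \<in> V)} \<in> hyperoctahedral_group" .
 moreover have "{k. (k \<in> {i}) \<noteq> (id k \<in> V)} = insert i V" using insert.hyps by auto
 ultimately show ?case by (simp only: comp_id)
qed (rule id_mem)

lemma perms_mem:
 assumes "\<sigma> permutes (UNIV :: 'n::finite set)"
 shows "signed_perm \<sigma> {} \<in> (hyperoctahedral_group :: 'n endo set)"
 using assms finite
proof (induction rule: permutes_induct)
 case id
 show ?case by (rule id_mem)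
next
 case (swap i j \<tau>)
 have \<tau>: "bij \<tau>" using swap.hyps by (simp add: permutes_bij)
 have "signed_perm (Transposition.transpose i j) {} \<in> (hyperoctahedral_group :: 'n endo set)"
 proof (cases "i = j")
  case True
  then show ?thesis using id_mem by simp
 next
  case False
  show ?thesis using reflection_mem[OF roots_I(2)[OF False]] unfolding root_reflections(2)[OF False] .
 qed
 from signed_perm_product_mem[OF \<tau> bij_transpose swap.IH this]
 have "signed_perm (Transposition.transpose i j \<circ> \<tau>) {k. (k \<in> {}) \<noteq> (\<tau> k \<in> {})} \<in> (hyperoctahedral_group :: 'n endo set)" .
 moreover have "{k. (k \<in> {}) \<noteq> (\<tau> k \<in> {})} = {}" by simp
 ultimately show ?case by (simp only:)
qed

text \<open>Reflections in roots are signed permutations; conversely, sign changes of one coordinate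
  and transpositions are such reflections and generate all signed permutations.\<close>

lemma hyperoctahedral_group_eq:
 "(hyperoctahedral_group :: 'n::finite endo set) = (\<lambda>(\<sigma>, V). signed_perm \<sigma> V) ` ({\<sigma>. \<sigma> permutes UNIV} \<times> UNIV)"
proof (rule equalityI; rule subsetI)
 fix w :: "'n endo" assume "w \<in> hyperoctahedral_group"
 then obtain \<sigma> V where w: "bij \<sigma>" "w = signed_perm \<sigma> V" using hyperoctahedral_subset by blast
 have "\<sigma> permutes UNIV" by (rule bij_imp_permutes[OF w(1)]) simp
 then show "w \<in> (\<lambda>(\<sigma>, V). signed_perm \<sigma> V) ` ({\<sigma>. \<sigma> permutes UNIV} \<times> UNIV)"
  by (intro image_eqI[of _ _ "(\<sigma>, V)"]) (simp_all add: w(2))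
next
 fix w :: "'n endo" assume "w \<in> (\<lambda>(\<sigma>, V). signed_perm \<sigma> V) ` ({\<sigma>. \<sigma> permutes UNIV} \<times> UNIV)"
 then obtain \<sigma> V where w: "w = signed_perm \<sigma> V" "\<sigma> permutes UNIV" by auto
 from signed_perm_product_mem[OF bij_id permutes_bij[OF w(2)] signs_mem[OF finite] perms_mem[OF w(2)], of V]
 have "signed_perm (\<sigma> \<circ> id) {i. (i \<in> V) \<noteq> (id i \<in> {})} \<in> hyperoctahedral_group" .
 moreover have "{i. (i \<in> V) \<noteq> (id i \<in> {})} = V" by simp
 ultimately show "w \<in> hyperoctahedral_group" by (simp only: comp_id w(1))
qed

lemma card_hyperoctahedral_group:
 "card (hyperoctahedral_group :: 'n::finite endo set) = fact CARD('n) * 2 ^ CARD('n)"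
proof -
 have "inj_on (\<lambda>(\<sigma>, V). signed_perm \<sigma> V) ({\<sigma>. \<sigma> permutes (UNIV :: 'n set)} \<times> UNIV)"
  by (rule inj_onI) (auto dest: signed_perm_inj)
 then have "card (hyperoctahedral_group :: 'n endo set)
   = card ({\<sigma>. \<sigma> permutes (UNIV :: 'n set)} \<times> (UNIV :: 'n set set))"
  unfolding hyperoctahedral_group_eq by (rule card_image)
 also have "\<dots> = fact CARD('n) * 2 ^ CARD('n)"
  by (simp add: card_cartesian_product card_permutations card_Pow flip: Pow_UNIV)
 finally show ?thesis .
qed

text \<open>The group has order n! 2^n with n at least 1, so 2 and every i from 1 to n divide this
  order.\<close>

lemma good_characteristic_if:
 assumes "\<not> CHAR('k::field) dvd card (hyperoctahedral_group :: 'n::finite endo set)"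
 shows "good_characteristic TYPE('k) TYPE('n)"
proof
 show "of_nat i \<noteq> (0 :: 'k)" if "1 \<le> i" "i \<le> CARD('n)" for i
 proof
  assume "of_nat i = (0 :: 'k)"
  then have "CHAR('k) dvd i" by (simp add: of_nat_eq_0_iff_char_dvd)
  moreover have "i dvd fact CARD('n)" using that by (intro dvd_fact)
  ultimately have "CHAR('k) dvd fact CARD('n) * 2 ^ CARD('n)" by (intro dvd_mult2) (rule dvd_trans)
  then show False using assms by (simp add: card_hyperoctahedral_group)
 qed
 show "(2 :: 'k) \<noteq> 0"
 proof
  assume "(2 :: 'k) = 0"
  then have "of_nat 2 = (0 :: 'k)" by simp
  then have "CHAR('k) dvd 2" by (simp only: of_nat_eq_0_iff_char_dvd)
  moreover have "(2 :: nat) dvd 2 ^ CARD('n)" by (rule dvd_power) simp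
  ultimately have "CHAR('k) dvd fact CARD('n) * 2 ^ CARD('n)" by (intro dvd_mult) (rule dvd_trans)
  then show False using assms by (simp add: card_hyperoctahedral_group)
 qed
qed

lemma face_at_signed_perm:
 assumes "bij \<sigma>"
 shows "face_at (signed_perm \<sigma> V v) = fgact \<sigma> V (face_at (v :: real ^ 'n::finite))"
proof -
 let ?f = "code (face_at v)"
 have same: "same_face UNIV (\<lambda>i. v $ i) ?f"
  unfolding face_at_def by (rule same_face_sym[OF same_face_code_to_face])
 have "same_face UNIV (\<lambda>i. signed_perm \<sigma> V v $ i) (gact \<sigma> V ?f)"
  using same by (simp add: same_face_def signed_perm_nth abs_gact gact_sign)
 then show ?thesis unfolding fgact_def face_at_def[of "signed_perm \<sigma> V v"] by (simp add: nrm_same_face)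
qed

lemma vimage_signed_perm:
 assumes "bij \<sigma>"
 shows "signed_perm \<sigma> V -` face_cone (fgact \<sigma> V x) = face_cone x"
 using bij_is_inj[OF bij_fgact[OF assms, of V]]
 by (auto simp: face_cone_def face_at_signed_perm[OF assms] inj_eq)

section \<open>The face algebra as a quiver model\<close>

context good_characteristic
begin

sublocale sr: split_ring "Inv :: ('n, 'k) falg set" "partitions_upto CARD('n)" ch
proof
 show "partitions_upto CARD('n) \<noteq> {}"
 proof -
  have "{#} \<in> partitions_upto CARD('n)" by (simp add: partitions_upto_iff)
  then show ?thesis by blast
 qed
 fix p q assume "p \<in> partitions_upto CARD('n)" "q \<in> partitions_upto CARD('n)" "p \<noteq> q"
 from separate_characters[OF this]
 obtain z :: "('n, 'k) falg" where z: "z \<in> Inv" "ch p z = 1" "ch q z = 0" .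
 show "\<exists>z\<in>(Inv :: ('n, 'k) falg set). ch p z = 1 \<and> ch q z = 0" by (rule bexI[OF _ z(1)]) (simp add: z)
next
 fix a :: "('n, 'k) falg"
 assume "a \<in> Inv" "\<And>p. p \<in> partitions_upto CARD('n) \<Longrightarrow> ch p a = 0"
 then have "a \<in> radJ" by (rule radJ_I)
 then show "\<exists>N. a ^ N = 0" using radJ_nilpotent by blast
qed (simp_all add: Inv_1 Inv_add Inv_diff Inv_times finite_partitions_upto ch_add ch_times ch_1)

lemma J_eq: "sr.J = radJ"
 by (simp add: sr.J_def radJ_def)

text \<open>The arrow functional written without a target idempotent: only the label of the target
  enters.\<close>

definition functional :: "('n, 'k) falg \<Rightarrow> nat multiset \<Rightarrow> nat \<Rightarrow> ('n, 'k) falg \<Rightarrow> 'k" where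
 "functional x q v r = act (lastfun (sr.label x - q) (point v)) (tc (r * x)) (sorted_list_of_multiset (sr.label x))"

lemma arrow_primitive:
 assumes "sr.primitive x" "q \<in> partitions_upto CARD('n)" "y \<in> Inv"
  and "\<And>p. p \<in> partitions_upto CARD('n) \<Longrightarrow> ch p y = (if p = q then 1 else 0)"
 shows "arrow x y (sr.label x) q"
proof unfold_locales
 show "x \<in> Inv" "x * x = x" using assms(1) by (simp_all add: sr.primitive_def)
 show "sr.label x \<in> partitions_upto CARD('n)" by (rule sr.label(1)[OF assms(1)])
 show "ch p x = (if p = sr.label x then 1 else 0)" if "p \<in> partitions_upto CARD('n)" for p
  by (rule sr.label(2)[OF assms(1) that])
qed (use assms in simp_all)

lemma functional_arrow:
 assumes "arrow x y (sr.label x) q"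
 shows "arrow.arrow_functional x (sr.label x) q = functional x q"
proof -
 interpret a: arrow tyn tyk x y "sr.label x" q by (rule assms)
 show ?thesis by (simp add: fun_eq_iff functional_def a.arrow_functional_def a.w0_def)
qed

text \<open>To apply the results on arrows, any invariant with the character values of the vertex q
  is taken as the target.\<close>

lemma functional_left:
 assumes x: "sr.primitive x" and q: "q \<in> partitions_upto CARD('n)" and v: "v \<in> arrow_values (sr.label x) q"
  and a: "a \<in> Inv" and r: "r \<in> radJ"
 shows "functional x q v (a * r) = ch q a * functional x q v r"
proof -
 obtain y :: "('n, 'k) falg"
  where y: "y \<in> Inv" "\<And>p. p \<in> partitions_upto CARD('n) \<Longrightarrow> ch p y = (if p = q then 1 else 0)"
  using sr.character_delta[OF q] by blast
 have ar: "arrow x y (sr.label x) q" by (rule arrow_primitive[OF x q y(1)]) (rule y(2))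
 show ?thesis using arrow.arrow_functional_times[OF ar v a r] unfolding functional_arrow[OF ar] .
qed

lemma functional_dual:
 assumes x: "sr.primitive x" and q: "q \<in> partitions_upto CARD('n)" and v: "v \<in> arrow_values (sr.label x) q"
 shows "\<exists>r\<in>radJ. \<forall>v'\<in>arrow_values (sr.label x) q. functional x q v' r = (if v' = v then 1 else 0)"
proof -
 obtain y :: "('n, 'k) falg"
  where y: "y \<in> Inv" "\<And>p. p \<in> partitions_upto CARD('n) \<Longrightarrow> ch p y = (if p = q then 1 else 0)"
  using sr.character_delta[OF q] by blast
 have ar: "arrow x y (sr.label x) q" by (rule arrow_primitive[OF x q y(1)]) (rule y(2))
 obtain r where "r \<in> radJ" "\<And>v'. v' \<in> arrow_values (sr.label x) q \<Longrightarrow> functional x q v' r = (if v' = v then 1 else 0)"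
  using arrow.arrow_dual[OF ar v] unfolding functional_arrow[OF ar] by blast
 then show ?thesis by (intro bexI[of _ r] ballI)
qed

text \<open>The linear span of the products lies in Q, because a scalar is absorbed by the first
  factor, which stays in the radical.\<close>

lemma functional_upper:
 assumes x: "sr.primitive x" and y: "sr.primitive y" and r: "r \<in> radJ"
  and zero: "\<And>v. v \<in> arrow_values (sr.label x) (sr.label y) \<Longrightarrow> functional x (sr.label y) v r = 0"
  and Q: "0 \<in> Q" "\<And>a b. a \<in> Q \<Longrightarrow> b \<in> Q \<Longrightarrow> a + b \<in> Q" "\<And>a b. a \<in> radJ \<Longrightarrow> b \<in> radJ \<Longrightarrow> a * b \<in> Q"
 shows "y * r * x \<in> Q"
proof -
 have yI: "y \<in> Inv" using y by (simp add: sr.primitive_def)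
 have ar: "arrow x y (sr.label x) (sr.label y)"
  by (rule arrow_primitive[OF x sr.label(1)[OF y] yI]) (rule sr.label(2)[OF y])
 have mem: "y * r * x \<in> radJ2"
 proof (rule arrow.arrow_upper_bound[OF ar r])
  fix v assume "v \<in> arrow_values (sr.label x) (sr.label y)"
  then show "arrow.arrow_functional x (sr.label x) (sr.label y) v r = 0"
   unfolding functional_arrow[OF ar] by (rule zero)
 qed
 have sub: "s \<in> Q" if "s \<in> radJ2" for s
  using that unfolding radJ2_def
 proof (induction rule: sc.span_induct_alt)
  case base
  show ?case by (rule Q(1))
 next
  case (step c p s)
  then obtain a b where p: "p = a * b" "a \<in> radJ" "b \<in> radJ" by blast
  have "sc c a \<in> radJ" using p(2) by (intro radJ_I) (simp_all add: radJ_D Inv_sc ch_sc)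
  then have "sc c p \<in> Q" using Q(3)[OF _ p(3)] by (simp add: p(1) flip: sc_times_left)
  then show ?case using Q(2) step.IH by blast
 qed
 show ?thesis by (rule sub[OF mem])
qed

end

lemma signed_perm_mem: "bij \<sigma> \<Longrightarrow> signed_perm \<sigma> V \<in> (hyperoctahedral_group :: 'n::finite endo set)"
 unfolding hyperoctahedral_group_eq
 by (rule image_eqI[of _ _ "(\<sigma>, V)"]) (auto intro: bij_imp_permutes)

lemma tc_bij:
 "bij_betw tc (Inv :: ('n::finite, 'k::field) falg set) {g. \<forall>w. w \<notin> words CARD('n) \<longrightarrow> g w = 0}"
proof (rule bij_betw_imageI)
 show "inj_on tc (Inv :: ('n, 'k) falg set)" by (rule inj_on_inverseI) (rule of_type_tc)
 show "tc ` (Inv :: ('n, 'k) falg set) = {g. \<forall>w. w \<notin> words CARD('n) \<longrightarrow> g w = 0}"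
 proof (rule equalityI; rule subsetI)
  fix g :: "nat list \<Rightarrow> 'k" assume "g \<in> {g. \<forall>w. w \<notin> words CARD('n) \<longrightarrow> g w = 0}"
  then have "tc (of_type g :: ('n, 'k) falg) = g" by (intro tc_of_type) simp
  then show "g \<in> tc ` (Inv :: ('n, 'k) falg set)" using of_type_Inv by (metis imageI)
 qed (auto simp: tc_outside)
qed

context
 fixes \<eta> :: "(real ^ 'n::finite) set \<Rightarrow> real ^ 'n"
 assumes lab: "labelling B_arrangement \<eta>"
begin

text \<open>Signed permutations act on cones as they do on face codes, and types classify the
  orbits. Outside the cones the functions vanish, and the preimage of a set that is no cone is again
  no cone.\<close>

lemma invariant_iff:
 fixes f :: "(real ^ 'n) set \<Rightarrow> 'k::field"
 assumes f: "f \<in> carrier (B_face_algebra \<eta>)"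
 shows "(\<forall>w\<in>hyperoctahedral_group. face_action w f = f) \<longleftrightarrow> cone_coeffs f \<in> Inv"
proof
 assume W: "\<forall>w\<in>hyperoctahedral_group. face_action w f = f"
 show "cone_coeffs f \<in> Inv"
 proof (rule Inv_I)
  fix \<sigma> :: "'n \<Rightarrow> 'n" and V x assume \<sigma>: "bij \<sigma>"
  have "f (signed_perm \<sigma> V -` face_cone (fgact \<sigma> V x)) = f (face_cone (fgact \<sigma> V x))"
   using bspec[OF W signed_perm_mem[OF \<sigma>, of V]] unfolding face_action_def by (rule fun_cong)
  then show "lookup (cone_coeffs f) (fgact \<sigma> V x) = lookup (cone_coeffs f) x"
   by (simp add: vimage_signed_perm[OF \<sigma>])
 qed
next
 assume inv: "cone_coeffs f \<in> Inv"
 show "\<forall>w\<in>hyperoctahedral_group. face_action w f = f"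
 proof
  fix w :: "'n endo" assume "w \<in> hyperoctahedral_group"
  then obtain \<sigma> V where w: "bij \<sigma>" "w = signed_perm \<sigma> V" using hyperoctahedral_subset by blast
  have surj: "surj w" unfolding w(2) using bij_signed_perm[OF w(1)] by (rule bij_is_surj)
  have pre: "w -` face_cone (fgact \<sigma> V x) = face_cone x" for x unfolding w(2) by (rule vimage_signed_perm[OF w(1)])
  have zero: "f z = 0" if "z \<notin> range face_cone" for z using f that by (simp add: BF_simps[OF lab])
  show "face_action w f = f"
   unfolding face_action_def
  proof
   fix z
   show "f (w -` z) = f z"
   proof (cases "z \<in> range face_cone")
    case True
    then obtain y where y: "z = face_cone y" by blast
    obtain x where x: "y = fgact \<sigma> V x" using bij_is_surj[OF bij_fgact[OF w(1)]] by (rule surjE)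
    have "f (face_cone x) = f (face_cone y)"
     using InvD[OF inv ftype_fgact[OF w(1), of V x]] by (simp add: x)
    then show ?thesis by (simp add: y x pre)
   next
    case False
    have "w -` z \<notin> range face_cone"
    proof
     assume "w -` z \<in> range face_cone"
     then obtain x where "w -` z = face_cone x" by blast
     then have "w -` z = w -` face_cone (fgact \<sigma> V x)" by (simp add: pre)
     then have "z = face_cone (fgact \<sigma> V x)" by (metis surj surj_image_vimage_eq)
     then show False using False by blast
    qed
    then show ?thesis using zero False by simp
   qed
  qed
 qed
qed

lemma invariant_simps:
 "carrier (B_invariant_algebra \<eta> :: ('k::field, (real ^ 'n) set \<Rightarrow> 'k) module)
  = {f \<in> carrier (B_face_algebra \<eta>). cone_coeffs f \<in> Inv}"
 "f \<otimes>\<^bsub>B_invariant_algebra \<eta>\<^esub> g = f \<otimes>\<^bsub>B_face_algebra \<eta>\<^esub> g"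
 "\<one>\<^bsub>B_invariant_algebra \<eta>\<^esub> = \<one>\<^bsub>B_face_algebra \<eta>\<^esub>"
 "\<zero>\<^bsub>B_invariant_algebra \<eta>\<^esub> = \<zero>\<^bsub>B_face_algebra \<eta>\<^esub>"
 "f \<oplus>\<^bsub>B_invariant_algebra \<eta>\<^esub> g = f \<oplus>\<^bsub>B_face_algebra \<eta>\<^esub> g"
 "c \<odot>\<^bsub>B_invariant_algebra \<eta>\<^esub> f = c \<odot>\<^bsub>B_face_algebra \<eta>\<^esub> f"
 unfolding B_invariant_algebra_def using invariant_iff by auto

lemma cone_coeffs_simps:
 fixes f g :: "(real ^ 'n) set \<Rightarrow> 'k::field"
 shows "cone_coeffs (\<zero>\<^bsub>B_face_algebra \<eta>\<^esub> :: (real ^ 'n) set \<Rightarrow> 'k) = 0"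
  and "cone_coeffs (\<one>\<^bsub>B_face_algebra \<eta>\<^esub> :: (real ^ 'n) set \<Rightarrow> 'k) = 1"
  and "cone_coeffs (f \<oplus>\<^bsub>B_face_algebra \<eta>\<^esub> g) = cone_coeffs f + cone_coeffs g"
  and "cone_coeffs (c \<odot>\<^bsub>B_face_algebra \<eta>\<^esub> f) = sc c (cone_coeffs f)"
 by (rule poly_mapping_eqI,
   simp add: BF_simps[OF lab] lookup_add lookup_one inj_eq[OF inj_face_cone] when_def)+

lemma cone_coeffs_bij:
 "bij_betw cone_coeffs (carrier (B_invariant_algebra \<eta> :: ('k::field, (real ^ 'n) set \<Rightarrow> 'k) module)) Inv"
proof (rule bij_betw_imageI)
 show "inj_on cone_coeffs (carrier (B_invariant_algebra \<eta> :: ('k, (real ^ 'n) set \<Rightarrow> 'k) module))"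
 proof (rule inj_onI)
  fix f g :: "(real ^ 'n) set \<Rightarrow> 'k"
  assume fg: "f \<in> carrier (B_invariant_algebra \<eta>)" "g \<in> carrier (B_invariant_algebra \<eta>)" "cone_coeffs f = cone_coeffs g"
  show "f = g"
  proof
   fix z
   show "f z = g z"
   proof (cases "z \<in> range face_cone")
    case True
    then obtain x where "z = face_cone x" by blast
    then show ?thesis using arg_cong[OF fg(3), of "\<lambda>a. lookup a x"] by simp
   next
    case False
    then show ?thesis using fg(1,2) by (simp add: invariant_simps BF_simps[OF lab])
   qed
  qed
 qed
 have "a \<in> cone_coeffs ` carrier (B_invariant_algebra \<eta>)" if a: "a \<in> Inv" for a :: "('n, 'k) falg"
 proof -
  define f :: "(real ^ 'n) set \<Rightarrow> 'k" where "f z = (if z \<in> range face_cone then lookup a (the_inv face_cone z) else 0)" for z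
  have fa: "cone_coeffs f = a"
   by (rule poly_mapping_eqI) (simp add: f_def the_inv_f_f[OF inj_face_cone])
  have "f \<in> carrier (B_invariant_algebra \<eta>)"
   using a by (simp add: invariant_simps fa) (simp add: BF_simps[OF lab] f_def)
  then show ?thesis by (rule rev_image_eqI) (simp add: fa)
 qed
 then show "cone_coeffs ` carrier (B_invariant_algebra \<eta> :: ('k, (real ^ 'n) set \<Rightarrow> 'k) module) = Inv"
  by (auto simp: invariant_simps)
qed

end

theorem theorem9p1:
 fixes \<eta> :: "(real ^ 'n) set \<Rightarrow> real ^ 'n"
 assumes "labelling B_arrangement \<eta>"
  and "\<not> CHAR('k::field) dvd card (hyperoctahedral_group :: (real ^ 'n \<Rightarrow> real ^ 'n) set)"
 shows "is_quiver_of (partition_quiver CARD('n)) (ring_of_type_algebra :: 'k ring)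
     (B_invariant_algebra \<eta>)"
proof -
 note lab = assms(1)
 interpret good_characteristic "TYPE('n)" "TYPE('k)" by (rule good_characteristic_if[OF assms(2)])
 let ?A = "B_invariant_algebra \<eta> :: ('k, (real ^ 'n) set \<Rightarrow> 'k) module"
 note simps = invariant_simps[OF lab] cone_coeffs_simps[OF lab] BF_mult[OF lab]
 interpret q: quiver_model "Inv :: ('n, 'k) falg set" "partitions_upto CARD('n)" ch ?A cone_coeffs sc
  "words CARD('n)" tc arrow_values functional
 proof
  show "bij_betw cone_coeffs (carrier ?A) Inv" by (rule cone_coeffs_bij[OF lab])
  show "\<zero>\<^bsub>?A\<^esub> \<in> carrier ?A" by (simp add: simps Inv_0) (simp add: BF_simps[OF lab])
  show "\<one>\<^bsub>?A\<^esub> \<in> carrier ?A" by (simp add: simps Inv_1) (simp add: BF_simps[OF lab])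
  show "cone_coeffs \<zero>\<^bsub>?A\<^esub> = 0" "cone_coeffs \<one>\<^bsub>?A\<^esub> = 1" by (simp_all add: simps)
  show "c \<odot>\<^bsub>?A\<^esub> f \<in> carrier ?A" "cone_coeffs (c \<odot>\<^bsub>?A\<^esub> f) = sc c (cone_coeffs f)" if "f \<in> carrier ?A" for c f
   using that by (simp_all add: simps Inv_sc) (simp add: BF_simps[OF lab])
  fix f g assume fg: "f \<in> carrier ?A" "g \<in> carrier ?A"
  then show "f \<oplus>\<^bsub>?A\<^esub> g \<in> carrier ?A" by (simp add: simps Inv_add) (simp add: BF_simps[OF lab])
  show "cone_coeffs (f \<oplus>\<^bsub>?A\<^esub> g) = cone_coeffs f + cone_coeffs g" by (simp add: simps)
  show "f \<otimes>\<^bsub>?A\<^esub> g \<in> carrier ?A" "cone_coeffs (f \<otimes>\<^bsub>?A\<^esub> g) = cone_coeffs f * cone_coeffs g"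
   using fg by (simp_all add: simps Inv_times)
 next
  show "bij_betw tc (Inv :: ('n, 'k) falg set) {g. \<forall>w. w \<notin> words CARD('n) \<longrightarrow> g w = 0}"
   by (rule tc_bij)
  show "finite (words CARD('n))" by (rule finite_words)
 next
  fix x a r :: "('n, 'k) falg" and q v
  assume "sr.primitive x" "q \<in> partitions_upto CARD('n)" "v \<in> arrow_values (sr.label x) q" "a \<in> Inv" "r \<in> sr.J"
  then show "functional x q v (a * r) = ch q a * functional x q v r" unfolding J_eq by (rule functional_left)
 next
  fix x :: "('n, 'k) falg" and q v
  assume "sr.primitive x" "q \<in> partitions_upto CARD('n)" "v \<in> arrow_values (sr.label x) q"
  then show "\<exists>r\<in>sr.J. \<forall>v'\<in>arrow_values (sr.label x) q. functional x q v' r = (if v' = v then 1 else 0)"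
   unfolding J_eq by (rule functional_dual)
 next
  fix x y r :: "('n, 'k) falg" and Q
  assume "sr.primitive x" "sr.primitive y" "r \<in> sr.J"
   "\<And>v. v \<in> arrow_values (sr.label x) (sr.label y) \<Longrightarrow> functional x (sr.label y) v r = 0"
   "0 \<in> Q" "\<And>a b. a \<in> Q \<Longrightarrow> b \<in> Q \<Longrightarrow> a + b \<in> Q" "\<And>a b. a \<in> sr.J \<Longrightarrow> b \<in> sr.J \<Longrightarrow> a * b \<in> Q"
  then show "y * r * x \<in> Q" unfolding J_eq by (rule functional_upper)
 next
  fix x r :: "('n, 'k) falg" and q v
  assume "sr.primitive x"
  then have "x * x = x" by (simp add: sr.primitive_def)
  then show "functional x q v (r * x) = functional x q v r" by (simp add: functional_def mult.assoc)
 qed (simp_all add: sc_times_left sc_times_right ch_sc tc_0 tc_add tc_sc finite_arrow_values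
   functional_def distrib_right act_add_right act_scale_right)
 \<comment> \<open>The partitions in question have no part 0, as \<open>card_arrow_values\<close>
   demands.\<close>
 have "partition_quiver CARD('n) = multigraph (partitions_upto CARD('n)) (\<lambda>p q. card (arrow_values p q))"
  unfolding partition_quiver_def partitions_upto_def[symmetric] multigraph_def
  by (auto simp: card_arrow_values partitions_upto_iff)
 then show ?thesis using q.is_quiver by simp
qed

end
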